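(* Let $0<\mu\le\frac12$, $N\ge12$, $0\le\tilde\gamma\le\gamma\le1$, $r>0$, and let $A$, $m$ be the time-dependent Fourier multipliers defined in the context (built with these $\mu,N,\gamma,r$ and a $\gamma$-admissible weight $M_L$). Let $t>1$, let $d\in\mathbb N$, and let $f_1,f_2$ be time-dependent functions $\mathbb T\times\mathbb R\to\mathbb R^d$ and $q$ a time-dependent function $\mathbb T\times\mathbb R\to\mathbb R$, satisfying, for some constants $c_1,C>0$ and parameters $\varepsilon_f,\varepsilon_q>0$, the bounds $$\sup_{1\le\tau\le t}\|Af\|_{L^2}^2+c_1\int_1^t\Big(\mu\|\nabla_\tau Af\|_{L^2}^2+\Big\|\sqrt{\tfrac{\partial_tm}{m}}\,Af\Big\|_{L^2}^2\Big)d\tau\le C\varepsilon_f^2\qquad\text{for } f=f_1 \text{ and } f=f_2,$$ $$\sup_{1\le\tau\le t}\|Aq\|_{L^2}^2+c_1\int_1^t\Big(\mu\|\nabla_\tau Aq\|_{L^2}^2+\Big\|\sqrt{\tfrac{\partial_tm}{m}}\,Aq\Big\|_{L^2}^2\Big)d\tau\le C\varepsilon_q^2 .$$ Define the main nonlinearity, at each time $t$, $$NL^\gamma_{f_1,f_2,q}=\Big|\big\langle Af_1,\ [A\Lambda_t^{\tilde\gamma},\ \nabla^\perp\Lambda_t^{-(1+\gamma)}q]\cdot\nabla\Lambda_t^{-\tilde\gamma}f_2\big\rangle\Big| .$$ Then there exists a constant $\tilde C_\gamma>0$, depending on $\gamma,\tilde\gamma,N,r$, the constants $c,c_1,C$ and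 the admissibility constants of the weights, but independent of $\varepsilon_f,\varepsilon_q,\mu$ (and $t$), such that $$\int_1^tNL^\gamma_{f_1,f_2,q}\,d\tau\le\tilde C_\gamma\,\mu^{-\frac13}\varepsilon_f^2\varepsilon_q\quad\text{if }\gamma>0,$$ $$\int_1^tNL^0_{f_1,f_2,q}\,d\tau\le\tilde C_0\,|\ln\mu|^{1+r}\mu^{-\frac13}\varepsilon_f^2\varepsilon_q\quad\text{if }\gamma=0 .$$
   Context: Notation. $\mathbb T=\mathbb R/2\pi\mathbb Z$; $k,l\in\mathbb Z$ and $\eta,\xi\in\mathbb R$ are the Fourier variables in $x$ and $y$; $|k,\eta|=\sqrt{k^2+\eta^2}$; $\langle v\rangle=\sqrt{1+|v|^2}$, $\langle k,\eta\rangle=\sqrt{1+k^2+\eta^2}$. $\partial_y^t=\partial_y-t\partial_x$, $\nabla_t=(\partial_x,\partial_y^t)^T$, $\Delta_t=\partial_x^2+(\partial_y^t)^2$, $\Lambda_t=(-\Delta_t)^{1/2}$ (Fourier symbol $|k,\eta-kt|$), $\nabla^\perp=(\partial_y,-\partial_x)^T$. $\langle\cdot,\cdot\rangle$ between functions is the $L^2(\mathbb T\times\mathbb R)$ inner product. For a Fourier multiplier $T$ and vector field $a$, $[T,a]\cdot\nabla g=T(a\cdot\nabla g)-a\cdot\nabla Tg$. Functions of $(t,k,\eta)$ such as $A$, $m$ act as Fourier multipliers; the argument $t$ is often suppressed. All norms are taken at the integration time. Weights. Fix a constant $c>0$. Let $$A(k,\eta)=\langle k,\eta\rangle^N e^{c\mu^{1/3}t\mathbf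 1_{k\ne0}}m^{-1}(k,\eta),\qquad m=m_\gamma\,M_L\,M_\mu .$$ Main resonance weight: $g_\gamma(s)=c\,\langle s\rangle^{-(1+\gamma)}$ for $\gamma>0$, $g_0(s)=c\,\langle s\rangle^{-1}|\ln(1+\langle s\rangle)|^{-(1+r)}$, and $$m_\gamma(t,k,\eta)=\exp\Big(\min(1,t\mu^{1/3})\int_{-\infty}^t\sum_{n\in\mathbb Z\setminus\{0\}}g_\gamma\big(\tau-\tfrac\eta n\big)\langle k-n\rangle^{-3}\,d\tau\Big).$$ Enhanced dissipation weight: for $k\neq0$, $\frac{\partial_tM_\mu}{M_\mu}(t,k,\eta)=c^{-1}\frac{\mu^{1/3}}{1+\mu^{2/3}|t-\eta/k|^2}$, $M_\mu(0,k,\eta)=1$; and $M_\mu(t,0,\eta)=M_\mu(t,1,\eta)$. $\gamma$-admissible weight: $M_L=M_L(t,k,\eta)$ is $\gamma$-admissible if there is a uniform constant $C>0$ (independent of $\mu$) such that (i) $\partial_tM_L(t,k,\eta)\ge0$ for almost all $t>0$; (ii) $C^{-1}\le M_L\le C$; (iii) for $t\ge1$ and $|l,\xi|\ge8|k-l,\eta-\xi|$, $$\frac{|l,\xi|}{t^{1+\gamma}}|M_L(k,\eta)-M_L(l,\xi)|\le R(t,k,l,\eta,\xi)\cdot\begin{cases}1,&\gamma>0,\\|\ln\mu|^{1+r},&\gamma=0,\end{cases}$$ where $$R=C\Big(1+h(t)\mu^{-\frac13}+(t+\mu^{-\frac13})\sqrt{\tfrac{\partial_tm_\gamma}{m_\gamma}(k,\eta)}\sqrt{\tfrac{\partial_tm_\gamma}{m_\gamma}(l,\xi)}+\mu^{\frac13}(|l,\xi-lt|+|k,\eta-kt|)\Big)\langle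 t\mu^{\frac13}\rangle^n\langle k-l,\eta-\xi\rangle^{N-5}$$ for some $h(t)\ge0$ with $\|h\|_{L^1_t}\le C$ and some $n\in\mathbb N$; (iv) for $t\ge1$, $k\ne0$ and $|k,\xi|\ge8|\eta-\xi|$, $|M_L(k,\eta)-M_L(k,\xi)|\le C\frac1{|k|}|\eta-\xi|\langle\eta-\xi\rangle^{N-5}$. *)

theory Defs
  imports "HOL-Analysis.Analysis"
begin

section \<open>Functions on the cylinder and their Fourier transform\<close>

text \<open>
  A function on \<open>\<T> \<times> \<real>\<close> is a function on the plane which is \<open>2\<pi>\<close>-periodic in the first
  variable; integrals over the torus are taken over the fundamental domain \<open>[0, 2\<pi>)\<close>.
\<close>

definition cyl :: "(real \<times> real) measure" where
  "cyl = restrict_space lborel ({0..<2 * pi} \<times> UNIV)"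

definition freq :: "(int \<times> real) measure" where
  "freq = count_space UNIV \<Otimes>\<^sub>M lborel"

text \<open>
  The Fourier transform on \<open>L\<^sup>2\<close>, in the unitary normalisation
  \<open>f\<^sup>^(k,\<eta>) = (2\<pi>)\<^sup>-\<^sup>1 \<integral> e\<^sup>-\<^sup>i\<^sup>(\<^sup>k\<^sup>x\<^sup>+\<^sup>\<eta>\<^sup>y\<^sup>) f(x,y) dx dy\<close>.  A function in \<open>L\<^sup>2\<close> need not be integrable in
  \<open>y\<close>, so the integral is taken as a limit of Gauss means.  For \<open>f\<close> in \<open>L\<^sup>2\<close> these are, for each
  \<open>k\<close>, the convolutions of the Plancherel transform with an approximate identity in \<open>\<eta>\<close>; they
  converge to it at each of its Lebesgue points, hence for almost all \<open>\<eta>\<close>.  For integrable \<open>f\<close>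
  the limit is the integral itself, see \<open>fourier_integrable\<close> below.
\<close>

definition fourier :: "(real \<times> real \<Rightarrow> real) \<Rightarrow> int \<Rightarrow> real \<Rightarrow> complex" where
  "fourier f k \<eta> = lim (\<lambda>n. 1 / (2 * pi) *
     (\<integral>z. complex_of_real (exp (- (snd z / real (Suc n))\<^sup>2) * f z)
            * cis (- (real_of_int k * fst z + \<eta> * snd z)) \<partial>cyl))"

lemma fourier_integrable:
  assumes "integrable cyl f"
  shows "fourier f k \<eta> =
    1 / (2 * pi) * (\<integral>z. complex_of_real (f z) * cis (- (real_of_int k * fst z + \<eta> * snd z)) \<partial>cyl)"
proof -
  have f_meas: "f \<in> borel_measurable cyl"
    using assms by auto
  have meas_lborel: "g \<in> borel_measurable cyl" if "continuous_on UNIV g"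
    for g :: "real \<times> real \<Rightarrow> 'b::topological_space"
    unfolding cyl_def
    by (rule measurable_restrict_space1) (use that borel_measurable_continuous_onI in auto)
  have exp_meas: "(\<lambda>z. exp (- (snd z / real (Suc n))\<^sup>2)) \<in> borel_measurable cyl" for n
    by (intro meas_lborel continuous_intros) auto
  have cis_meas: "(\<lambda>z. cis (- (real_of_int k * fst z + \<eta> * snd z))) \<in> borel_measurable cyl"
    by (intro meas_lborel continuous_intros)
  have lim_exp: "(\<lambda>n. exp (- (y / real (Suc n))\<^sup>2)) \<longlonglongrightarrow> 1" for y :: real
  proof -
    have "(\<lambda>n. y / real (Suc n)) \<longlonglongrightarrow> 0"
      by (rule LIMSEQ_Suc[OF lim_const_over_n])
    then have "(\<lambda>n. exp (- (y / real (Suc n))\<^sup>2)) \<longlonglongrightarrow> exp (- 0\<^sup>2)"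
      by (intro tendsto_intros)
    then show ?thesis by simp
  qed
  have "(\<lambda>n. \<integral>z. complex_of_real (exp (- (snd z / real (Suc n))\<^sup>2) * f z)
            * cis (- (real_of_int k * fst z + \<eta> * snd z)) \<partial>cyl)
        \<longlonglongrightarrow> (\<integral>z. complex_of_real (f z) * cis (- (real_of_int k * fst z + \<eta> * snd z)) \<partial>cyl)"
  proof (rule integral_dominated_convergence[where w = "\<lambda>z. \<bar>f z\<bar>"])
    show "AE z in cyl. (\<lambda>n. complex_of_real (exp (- (snd z / real (Suc n))\<^sup>2) * f z)
            * cis (- (real_of_int k * fst z + \<eta> * snd z)))
          \<longlonglongrightarrow> complex_of_real (f z) * cis (- (real_of_int k * fst z + \<eta> * snd z))"
    proof (rule AE_I2)
      fix z :: "real \<times> real"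
      have "(\<lambda>n. complex_of_real (exp (- (snd z / real (Suc n))\<^sup>2) * f z)
            * cis (- (real_of_int k * fst z + \<eta> * snd z)))
          \<longlonglongrightarrow> complex_of_real (1 * f z) * cis (- (real_of_int k * fst z + \<eta> * snd z))"
        by (intro tendsto_intros lim_exp)
      then show "(\<lambda>n. complex_of_real (exp (- (snd z / real (Suc n))\<^sup>2) * f z)
            * cis (- (real_of_int k * fst z + \<eta> * snd z)))
          \<longlonglongrightarrow> complex_of_real (f z) * cis (- (real_of_int k * fst z + \<eta> * snd z))"
        by simp
    qed
  next
    fix n
    show "AE z in cyl. norm (complex_of_real (exp (- (snd z / real (Suc n))\<^sup>2) * f z)
            * cis (- (real_of_int k * fst z + \<eta> * snd z))) \<le> \<bar>f z\<bar>"
      by (rule AE_I2) (simp add: norm_mult abs_mult mult_left_le_one_le)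
  next
    fix n
    show "(\<lambda>z. complex_of_real (exp (- (snd z / real (Suc n))\<^sup>2) * f z)
            * cis (- (real_of_int k * fst z + \<eta> * snd z))) \<in> borel_measurable cyl"
      by (intro borel_measurable_times measurable_compose[OF _ borel_measurable_of_real]
           f_meas exp_meas cis_meas)
  next
    show "(\<lambda>z. complex_of_real (f z) * cis (- (real_of_int k * fst z + \<eta> * snd z)))
        \<in> borel_measurable cyl"
      by (intro borel_measurable_times measurable_compose[OF _ borel_measurable_of_real] f_meas cis_meas)
  next
    show "integrable cyl (\<lambda>z. \<bar>f z\<bar>)"
      using assms by (rule integrable_abs)
  qed
  then show ?thesis
    unfolding fourier_def by (intro limI tendsto_mult_left)
qed

text \<open>A time-dependent \<open>L\<^sup>2\<close> function on the time interval \<open>[1, t]\<close>.\<close>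

definition L2_function :: "real \<Rightarrow> (real \<Rightarrow> real \<times> real \<Rightarrow> real) \<Rightarrow> bool" where
  "L2_function t f \<longleftrightarrow>
     (\<lambda>p. f (fst p) (snd p)) \<in> borel_measurable borel \<and>
     (\<forall>\<tau> x y. f \<tau> (x + 2 * pi, y) = f \<tau> (x, y)) \<and>
     (\<forall>\<tau>\<in>{1..t}. integrable cyl (\<lambda>z. (f \<tau> z)\<^sup>2))"

text \<open>
  Vectors in \<open>\<real>\<^sup>d\<close> are functions on \<open>nat\<close> of which only the components below \<open>d\<close> matter.
  \<open>L2_sq d \<sigma> f\<close> is \<open>\<parallel>\<sigma>(D) f\<parallel>\<^sup>2\<close> in \<open>L\<^sup>2\<close> for the Fourier multiplier with symbol \<open>\<sigma>\<close>, with value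
  \<open>\<infinity>\<close> if \<open>\<sigma>(D) f\<close> is not in \<open>L\<^sup>2\<close>.
\<close>

definition L2_sq ::
  "nat \<Rightarrow> (int \<Rightarrow> real \<Rightarrow> complex) \<Rightarrow> (real \<times> real \<Rightarrow> nat \<Rightarrow> real) \<Rightarrow> ennreal" where
  "L2_sq d \<sigma> f =
     (\<Sum>i<d. \<integral>\<^sup>+(k, \<eta>). ennreal ((cmod (\<sigma> k \<eta> * fourier (\<lambda>z. f z i) k \<eta>))\<^sup>2) \<partial>freq)"

definition inner_hat ::
  "(int \<Rightarrow> real \<Rightarrow> complex) \<Rightarrow> (int \<Rightarrow> real \<Rightarrow> complex) \<Rightarrow> complex" where
  "inner_hat F G = (\<integral>(k, \<eta>). F k \<eta> * cnj (G k \<eta>) \<partial>freq)"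

text \<open>
  Fourier transforms of \<open>a \<cdot> \<nabla>g\<close> and of \<open>[T, a] \<cdot> \<nabla>g = T(a \<cdot> \<nabla>g) - a \<cdot> \<nabla>Tg\<close>, in terms of the
  transforms of the vector field \<open>a = (a1, a2)\<close> and of \<open>g\<close> and of the symbol \<open>\<sigma>\<close> of \<open>T\<close>.  In
  the commutator the two convolutions are kept under one integral: the average in \<open>x\<close> of
  \<open>\<nabla>\<^sup>\<bottom>\<Lambda>\<^sub>t\<^sup>-\<^sup>(\<^sup>1\<^sup>+\<^sup>\<gamma>\<^sup>) q\<close> has a transform of size \<open>|\<eta>|\<^sup>-\<^sup>\<gamma> |q\<^sup>^|\<close> near \<open>\<eta> = 0\<close>, which for \<open>\<gamma> \<ge> 1/2\<close> need
  not be locally integrable, so that the two products need not exist separately, while the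
  difference of the symbols cancels the singularity.
\<close>

definition transport_hat ::
  "(int \<Rightarrow> real \<Rightarrow> complex \<times> complex) \<Rightarrow> (int \<Rightarrow> real \<Rightarrow> complex) \<Rightarrow> int \<Rightarrow> real \<Rightarrow> complex" where
  "transport_hat a g k \<eta> = 1 / (2 * pi) *
     (\<integral>(l, \<xi>). (fst (a (k - l) (\<eta> - \<xi>)) * (\<i> * of_int l)
              + snd (a (k - l) (\<eta> - \<xi>)) * (\<i> * of_real \<xi>)) * g l \<xi> \<partial>freq)"

definition commutator_hat ::
  "(int \<Rightarrow> real \<Rightarrow> complex) \<Rightarrow> (int \<Rightarrow> real \<Rightarrow> complex \<times> complex) \<Rightarrow>
   (int \<Rightarrow> real \<Rightarrow> complex) \<Rightarrow> int \<Rightarrow> real \<Rightarrow> complex" where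
  "commutator_hat \<sigma> a g k \<eta> = 1 / (2 * pi) *
     (\<integral>(l, \<xi>). (\<sigma> k \<eta> - \<sigma> l \<xi>) *
              ((fst (a (k - l) (\<eta> - \<xi>)) * (\<i> * of_int l)
              + snd (a (k - l) (\<eta> - \<xi>)) * (\<i> * of_real \<xi>)) * g l \<xi>) \<partial>freq)"

lemma commutator_hat_eq:
  assumes "integrable freq (\<lambda>(l, \<xi>). (fst (a (k - l) (\<eta> - \<xi>)) * (\<i> * of_int l)
              + snd (a (k - l) (\<eta> - \<xi>)) * (\<i> * of_real \<xi>)) * g l \<xi>)"
    and "integrable freq (\<lambda>(l, \<xi>). (fst (a (k - l) (\<eta> - \<xi>)) * (\<i> * of_int l)
              + snd (a (k - l) (\<eta> - \<xi>)) * (\<i> * of_real \<xi>)) * (\<sigma> l \<xi> * g l \<xi>))"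
  shows "commutator_hat \<sigma> a g k \<eta> =
    \<sigma> k \<eta> * transport_hat a g k \<eta> - transport_hat a (\<lambda>l \<xi>. \<sigma> l \<xi> * g l \<xi>) k \<eta>"
proof -
  define P where "P = (\<lambda>(l, \<xi>). (fst (a (k - l) (\<eta> - \<xi>)) * (\<i> * of_int l)
              + snd (a (k - l) (\<eta> - \<xi>)) * (\<i> * of_real \<xi>)) * g l \<xi>)"
  define Q where "Q = (\<lambda>(l, \<xi>). (fst (a (k - l) (\<eta> - \<xi>)) * (\<i> * of_int l)
              + snd (a (k - l) (\<eta> - \<xi>)) * (\<i> * of_real \<xi>)) * (\<sigma> l \<xi> * g l \<xi>))"
  have PQ: "integrable freq P" "integrable freq Q"
    using assms by (simp_all add: P_def Q_def)
  have "commutator_hat \<sigma> a g k \<eta> = 1 / (2 * pi) * (\<integral>p. \<sigma> k \<eta> * P p - Q p \<partial>freq)"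
    unfolding commutator_hat_def P_def Q_def
    by (intro arg_cong2[where f = "(*)"] refl Bochner_Integration.integral_cong)
       (auto simp: algebra_simps)
  also have "\<dots> = 1 / (2 * pi) * (\<sigma> k \<eta> * integral\<^sup>L freq P - integral\<^sup>L freq Q)"
    using PQ by simp
  also have "\<dots> = \<sigma> k \<eta> * transport_hat a g k \<eta> - transport_hat a (\<lambda>l \<xi>. \<sigma> l \<xi> * g l \<xi>) k \<eta>"
    by (simp add: transport_hat_def P_def Q_def algebra_simps)
  finally show ?thesis .
qed


section \<open>The weights\<close>

definition jap :: "real \<Rightarrow> real" where
  "jap v = sqrt (1 + v\<^sup>2)"

definition jap2 :: "int \<Rightarrow> real \<Rightarrow> real" where
  "jap2 k \<eta> = sqrt (1 + (real_of_int k)\<^sup>2 + \<eta>\<^sup>2)"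

definition abs2 :: "int \<Rightarrow> real \<Rightarrow> real" where
  "abs2 k \<eta> = sqrt ((real_of_int k)\<^sup>2 + \<eta>\<^sup>2)"

definition Lam :: "real \<Rightarrow> int \<Rightarrow> real \<Rightarrow> real" where
  "Lam t k \<eta> = abs2 k (\<eta> - real_of_int k * t)"

definition dlog :: "(real \<Rightarrow> int \<Rightarrow> real \<Rightarrow> real) \<Rightarrow> real \<Rightarrow> int \<Rightarrow> real \<Rightarrow> real" where
  "dlog w t k \<eta> = deriv (\<lambda>s. w s k \<eta>) t / w t k \<eta>"

definition g_res :: "real \<Rightarrow> real \<Rightarrow> real \<Rightarrow> real \<Rightarrow> real" where
  "g_res c r \<gamma> s =
     (if \<gamma> = 0 then c * inverse (jap s) * \<bar>ln (1 + jap s)\<bar> powr (- (1 + r))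
      else c * jap s powr (- (1 + \<gamma>)))"

definition m_res ::
  "real \<Rightarrow> real \<Rightarrow> real \<Rightarrow> real \<Rightarrow> real \<Rightarrow> int \<Rightarrow> real \<Rightarrow> real" where
  "m_res c r \<gamma> \<mu> t k \<eta> = exp (min 1 (t * \<mu> powr (1/3)) *
     (LINT \<tau>:{..t}|lborel.
        (\<Sum>\<^sub>\<infinity>n\<in>UNIV - {0::int}.
           g_res c r \<gamma> (\<tau> - \<eta> / of_int n) * inverse (jap (of_int (k - n)) ^ 3))))"

text \<open>
  The solution of the equation defining the enhanced dissipation weight, see
  \<open>M_diss_deriv\<close>, \<open>M_diss_0\<close> and \<open>M_diss_unique\<close>.
\<close>

definition M_diss :: "real \<Rightarrow> real \<Rightarrow> real \<Rightarrow> int \<Rightarrow> real \<Rightarrow> real" where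
  "M_diss c \<mu> t k \<eta> =
     (let k' = (if k = 0 then 1 else real_of_int k)
      in exp (inverse c * (arctan (\<mu> powr (1/3) * (t - \<eta> / k'))
                          - arctan (\<mu> powr (1/3) * (- \<eta> / k')))))"

lemma M_diss_deriv:
  assumes "\<mu> > 0" "k \<noteq> 0"
  shows "((\<lambda>s. M_diss c \<mu> s k \<eta>) has_real_derivative
    inverse c * (\<mu> powr (1/3) / (1 + \<mu> powr (2/3) * \<bar>t - \<eta> / of_int k\<bar>\<^sup>2)) * M_diss c \<mu> t k \<eta>) (at t)"
proof -
  define b where "b = \<mu> powr (1/3)"
  have sq: "b\<^sup>2 = \<mu> powr (2/3)"
    using assms by (simp add: b_def power2_eq_square flip: powr_add)
  define x where "x = \<eta> / of_int k"
  define a where "a = arctan (b * (- \<eta> / of_int k))"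
  define E where "E = (\<lambda>s. exp (inverse c * (arctan (b * (s - x)) - a)))"
  define D where "D = inverse c * (inverse (1 + (b * (t - x))\<^sup>2) * b)"
  have "((\<lambda>s. b * (s - x)) has_real_derivative b) (at t)"
    by (auto intro!: derivative_eq_intros)
  then have "((\<lambda>s. arctan (b * (s - x))) has_real_derivative
      inverse (1 + (b * (t - x))\<^sup>2) * b) (at t)"
    by (rule DERIV_chain2[OF DERIV_arctan])
  then have "((\<lambda>s. inverse c * (arctan (b * (s - x)) - a)) has_real_derivative
      inverse c * (inverse (1 + (b * (t - x))\<^sup>2) * b - 0)) (at t)"
    by (intro DERIV_cmult DERIV_diff DERIV_const)
  then have "((\<lambda>s. inverse c * (arctan (b * (s - x)) - a)) has_real_derivative D) (at t)"
    unfolding D_def diff_0_right .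
  then have "(E has_real_derivative E t * D) (at t)"
    unfolding E_def by (rule DERIV_chain2[OF DERIV_exp])
  moreover have "E t * D = inverse c * (b / (1 + \<mu> powr (2/3) * \<bar>t - x\<bar>\<^sup>2)) * E t"
    unfolding D_def power_mult_distrib sq power2_abs divide_inverse by (simp only: ac_simps)
  moreover have "(\<lambda>s. M_diss c \<mu> s k \<eta>) = E"
    using assms by (simp add: M_diss_def E_def a_def b_def x_def Let_def)
  ultimately show ?thesis
    unfolding b_def x_def by metis
qed

lemma M_diss_0: "M_diss c \<mu> 0 k \<eta> = 1"
  by (simp add: M_diss_def Let_def)

lemma M_diss_zero_mode: "M_diss c \<mu> t 0 \<eta> = M_diss c \<mu> t 1 \<eta>"
  by (simp add: M_diss_def Let_def)

lemma M_diss_unique: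
  assumes "\<mu> > 0" "k \<noteq> 0"
    and M: "\<And>t. (M has_real_derivative
      inverse c * (\<mu> powr (1/3) / (1 + \<mu> powr (2/3) * \<bar>t - \<eta> / of_int k\<bar>\<^sup>2)) * M t) (at t)"
    and "M 0 = 1"
  shows "M t = M_diss c \<mu> t k \<eta>"
proof -
  have pos: "M_diss c \<mu> s k \<eta> > 0" for s
    by (simp add: M_diss_def Let_def)
  have "((\<lambda>s. M s / M_diss c \<mu> s k \<eta>) has_real_derivative 0) (at s)" for s
    using pos[of s]
    by (auto intro!: derivative_eq_intros M M_diss_deriv[OF assms(1,2)])
  then have "M t / M_diss c \<mu> t k \<eta> = M 0 / M_diss c \<mu> 0 k \<eta>"
    by (metis DERIV_isconst_all)
  then show ?thesis
    using pos[of t] assms(4) by (simp add: M_diss_0 field_simps)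
qed

definition R_adm ::
  "real \<Rightarrow> real \<Rightarrow> real \<Rightarrow> real \<Rightarrow> real \<Rightarrow> real \<Rightarrow> nat \<Rightarrow> (real \<Rightarrow> real) \<Rightarrow>
   real \<Rightarrow> int \<Rightarrow> int \<Rightarrow> real \<Rightarrow> real \<Rightarrow> real" where
  "R_adm c r \<gamma> N \<mu> C n h t k l \<eta> \<xi> =
     C * (1 + h t * \<mu> powr (- 1/3)
          + (t + \<mu> powr (- 1/3)) * sqrt (dlog (m_res c r \<gamma> \<mu>) t k \<eta>)
                                * sqrt (dlog (m_res c r \<gamma> \<mu>) t l \<xi>)
          + \<mu> powr (1/3) * (Lam t l \<xi> + Lam t k \<eta>))
       * jap (t * \<mu> powr (1/3)) ^ n * jap2 (k - l) (\<eta> - \<xi>) powr (N - 5)"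

text \<open>
  Admissibility at viscosity \<open>\<mu>\<close> with constants \<open>C\<close> and \<open>n\<close>.  Measurability of the symbol is
  implicit in its use as a Fourier multiplier, and the sign condition on the time derivative
  is required for almost all \<open>(t, \<eta>)\<close>, as the derivative may fail to exist at times
  depending on the frequency.  At \<open>t \<mu>\<^sup>1\<^sup>/\<^sup>3 = 1\<close> the weight \<open>m_res\<close> has a kink and its
  derivative, hence the bound \<open>R_adm\<close>, is undefined.
\<close>

definition admissible ::
  "real \<Rightarrow> real \<Rightarrow> real \<Rightarrow> real \<Rightarrow> real \<Rightarrow> real \<Rightarrow> nat \<Rightarrow>
   (real \<Rightarrow> int \<Rightarrow> real \<Rightarrow> real) \<Rightarrow> bool" where
  "admissible c r \<gamma> N \<mu> C n M \<longleftrightarrow>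
     (\<forall>k. (\<lambda>p. M (fst p) k (snd p)) \<in> borel_measurable borel) \<and>
     (\<forall>k. AE p in lborel. 0 < fst p \<longrightarrow>
        (\<lambda>s. M s k (snd p)) differentiable (at (fst p)) \<and>
        0 \<le> deriv (\<lambda>s. M s k (snd p)) (fst p)) \<and>
     (\<forall>t>0. \<forall>k \<eta>. inverse C \<le> M t k \<eta> \<and> M t k \<eta> \<le> C) \<and>
     (\<exists>h. h \<in> borel_measurable borel \<and> (\<forall>t. 0 \<le> h t) \<and>
        (\<integral>\<^sup>+t. ennreal (h t) \<partial>lborel) \<le> ennreal C \<and>
        (\<forall>t\<ge>1. t * \<mu> powr (1/3) \<noteq> 1 \<longrightarrow>
          (\<forall>k l \<eta> \<xi>. abs2 l \<xi> \<ge> 8 * abs2 (k - l) (\<eta> - \<xi>) \<longrightarrow>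
            abs2 l \<xi> / t powr (1 + \<gamma>) * \<bar>M t k \<eta> - M t l \<xi>\<bar>
              \<le> R_adm c r \<gamma> N \<mu> C n h t k l \<eta> \<xi>
                 * (if \<gamma> > 0 then 1 else \<bar>ln \<mu>\<bar> powr (1 + r))))) \<and>
     (\<forall>t\<ge>1. \<forall>k \<eta> \<xi>. k \<noteq> 0 \<and> abs2 k \<xi> \<ge> 8 * \<bar>\<eta> - \<xi>\<bar> \<longrightarrow>
        \<bar>M t k \<eta> - M t k \<xi>\<bar>
          \<le> C * (1 / \<bar>real_of_int k\<bar>) * \<bar>\<eta> - \<xi>\<bar> * jap (\<eta> - \<xi>) powr (N - 5))"

definition m_total ::
  "real \<Rightarrow> real \<Rightarrow> real \<Rightarrow> real \<Rightarrow> (real \<Rightarrow> int \<Rightarrow> real \<Rightarrow> real) \<Rightarrow>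
   real \<Rightarrow> int \<Rightarrow> real \<Rightarrow> real" where
  "m_total c r \<gamma> \<mu> M t k \<eta> = m_res c r \<gamma> \<mu> t k \<eta> * M t k \<eta> * M_diss c \<mu> t k \<eta>"

definition A_weight ::
  "real \<Rightarrow> real \<Rightarrow> real \<Rightarrow> real \<Rightarrow> real \<Rightarrow> (real \<Rightarrow> int \<Rightarrow> real \<Rightarrow> real) \<Rightarrow>
   real \<Rightarrow> int \<Rightarrow> real \<Rightarrow> real" where
  "A_weight c r \<gamma> N \<mu> M t k \<eta> =
     jap2 k \<eta> powr N * exp (c * \<mu> powr (1/3) * t * (if k \<noteq> 0 then 1 else 0))
       * inverse (m_total c r \<gamma> \<mu> M t k \<eta>)"


section \<open>Energy bounds and the main nonlinearity\<close>

text \<open>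
  In the following two definitions \<open>m\<close> and \<open>A\<close> are time-dependent symbols.  The symbols of
  \<open>\<partial>\<^sub>x\<close> and \<open>\<partial>\<^sub>y - \<tau> \<partial>\<^sub>x\<close> are \<open>i k\<close> and \<open>i (\<eta> - k \<tau>)\<close>.
\<close>

definition energy_bound ::
  "real \<Rightarrow> real \<Rightarrow> real \<Rightarrow> (real \<Rightarrow> int \<Rightarrow> real \<Rightarrow> real) \<Rightarrow> (real \<Rightarrow> int \<Rightarrow> real \<Rightarrow> real) \<Rightarrow>
   real \<Rightarrow> nat \<Rightarrow> (real \<Rightarrow> real \<times> real \<Rightarrow> nat \<Rightarrow> real) \<Rightarrow> real \<Rightarrow> bool" where
  "energy_bound c1 C \<mu> m A t d f \<epsilon> \<longleftrightarrow>
     (SUP \<tau>\<in>{1..t}. L2_sq d (\<lambda>k \<eta>. of_real (A \<tau> k \<eta>)) (f \<tau>))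
     + ennreal c1 * (\<integral>\<^sup>+\<tau>\<in>{1..t}.
         (ennreal \<mu> *
            (L2_sq d (\<lambda>k \<eta>. \<i> * of_int k * of_real (A \<tau> k \<eta>)) (f \<tau>)
             + L2_sq d (\<lambda>k \<eta>. \<i> * of_real (\<eta> - of_int k * \<tau>) * of_real (A \<tau> k \<eta>)) (f \<tau>))
          + L2_sq d (\<lambda>k \<eta>. of_real (sqrt (dlog m \<tau> k \<eta>) * A \<tau> k \<eta>)) (f \<tau>)) \<partial>lborel)
     \<le> ennreal (C * \<epsilon>\<^sup>2)"

definition NL ::
  "real \<Rightarrow> real \<Rightarrow> (real \<Rightarrow> int \<Rightarrow> real \<Rightarrow> real) \<Rightarrow> nat \<Rightarrow>
   (real \<Rightarrow> real \<times> real \<Rightarrow> nat \<Rightarrow> real) \<Rightarrow> (real \<Rightarrow> real \<times> real \<Rightarrow> nat \<Rightarrow> real) \<Rightarrow>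
   (real \<Rightarrow> real \<times> real \<Rightarrow> real) \<Rightarrow> real \<Rightarrow> real" where
  "NL \<gamma> \<gamma>' A d f1 f2 q t = cmod (\<Sum>i<d.
     inner_hat
       (\<lambda>k \<eta>. of_real (A t k \<eta>) * fourier (\<lambda>z. f1 t z i) k \<eta>)
       (commutator_hat
          (\<lambda>k \<eta>. of_real (A t k \<eta> * Lam t k \<eta> powr \<gamma>'))
          (\<lambda>k \<eta>. (\<i> * of_real \<eta> * of_real (Lam t k \<eta> powr (- (1 + \<gamma>))) * fourier (q t) k \<eta>,
                  - (\<i> * of_int k) * of_real (Lam t k \<eta> powr (- (1 + \<gamma>))) * fourier (q t) k \<eta>))
          (\<lambda>k \<eta>. of_real (Lam t k \<eta> powr (- \<gamma>')) * fourier (\<lambda>z. f2 t z i) k \<eta>)))"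

end

theory Submission
  imports Defs
begin

text \<open>
  Write \<open>(j, \<zeta>) = (k - l, \<eta> - \<xi>)\<close> for the frequency of \<open>q\<close>, and let the subscripts \<open>k\<close>, \<open>l\<close>, \<open>j\<close> stand
  for the frequencies \<open>(k, \<eta>)\<close>, \<open>(l, \<xi>)\<close>, \<open>(j, \<zeta>)\<close>.  In Fourier variables the nonlinearity is a
  trilinear form in \<open>f\<^sub>1\<close> at \<open>k\<close>, \<open>q\<close> at \<open>j\<close> and \<open>f\<^sub>2\<close> at \<open>l\<close> with the symbol
  \<open>S = V |A\<^sub>k \<Lambda>\<^sub>k\<^sup>p - A\<^sub>l \<Lambda>\<^sub>l\<^sup>p| \<Lambda>\<^sub>l\<^sup>-\<^sup>p\<close>, where \<open>p\<close> stands for \<open>\<gamma>'\<close> and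
  \<open>V = |\<zeta> l - j \<xi>| \<Lambda>\<^sub>j\<^sup>-\<^sup>(\<^sup>1\<^sup>+\<^sup>\<gamma>\<^sup>)\<close> is the symbol of the velocity times the gradient.  The theorem
  follows from the pointwise estimate \<open>symbol_bound\<close>,
  \<open>S \<le> K L \<mu>\<^sup>-\<^sup>1\<^sup>/\<^sup>3 A\<^sub>j A\<^sub>l (\<langle>j, \<zeta>\<rangle>\<^sup>-\<^sup>2 + \<langle>l, \<xi>\<rangle>\<^sup>-\<^sup>2) (h + w\<^sub>k w\<^sub>l + w\<^sub>k w\<^sub>j + w\<^sub>l w\<^sub>j)\<close>,
  with \<open>L = 1\<close> or \<open>L = |ln \<mu>|\<^sup>1\<^sup>+\<^sup>r\<close>.  The weight \<open>w\<close> collects everything that the energy inequality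
  dissipates: \<open>w\<^sup>2\<close> is at most a constant times \<open>\<mu> k\<^sup>2 + \<mu> (\<eta> - k t)\<^sup>2 + \<partial>\<^sub>t m / m\<close> (\<open>w_square_le\<close>,
  \<open>dlog_m_total_ge\<close>).  Since
  \<open>\<langle>l, \<xi>\<rangle>\<^sup>-\<^sup>2\<close> is square integrable in frequency, Young's inequality turns the form into a product of three
  \<open>L\<^sup>2\<close> norms (\<open>Tri_bound\<close>).  In each term with two factors \<open>w\<close>, two of these norms are square
  integrable in time and the third is bounded; in the term with \<open>h\<close> all three are bounded and \<open>h\<close>
  is integrable.  This gives the time integral (\<open>time_integrated_bound\<close>).

  The symbol bound distinguishes which of the two inputs has the high frequency.

  \<^item> Transport, \<open>|l, \<xi>| \<ge> 8 |j, \<zeta>|\<close>.  The commutator leaves only the variation between \<open>(k, \<eta>)\<close> and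
    \<open>(l, \<xi>)\<close> of each factor of \<open>A\<close> and of \<open>\<Lambda>\<^sup>p\<close> (the lemmas \<open>transport_...\<close>).  Shearing moves a low
    frequency with \<open>j \<noteq> 0\<close> to size \<open>t\<close>, so that \<open>V\<close> is at most \<open>\<langle>j, \<zeta>\<rangle>\<^sup>3 |l, \<xi>| t\<^sup>-\<^sup>(\<^sup>1\<^sup>+\<^sup>\<gamma>\<^sup>)\<close>.  If
    \<open>|l, \<xi>| \<le> 2 (\<Lambda>\<^sub>l + \<Lambda>\<^sub>k)\<close>, the dissipation absorbs every variation of size \<open>min 1 (t \<mu>\<^sup>1\<^sup>/\<^sup>3)\<close>.
    Otherwise \<open>|l, \<xi>| \<le> 2 |l| t\<close>, and the loss is at most \<open>t \<ell>(t) G\<close>, where \<open>G\<close> is the resonance sum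
    which \<open>m_res\<close> integrates and \<open>\<ell>\<close> is its logarithmic factor (\<open>E_shift\<close>).
  \<^item> Reaction, \<open>|l, \<xi>| \<le> 8 |j, \<zeta>|\<close>.  No cancellation is used.  The symbol \<open>V\<close> itself is bounded apart
    from the resonant factor \<open>t \<langle>t - \<zeta> / j\<rangle>\<^sup>-\<^sup>(\<^sup>1\<^sup>+\<^sup>\<gamma>\<^sup>)\<close>, which is again one term of such a sum
    (\<open>reaction_V\<close>).

  In both cases the factor \<open>t\<close> is paid for by the exponential weights: when both inputs are
  nonzero modes, their weights exceed the one of the output by \<open>exp (c t \<mu>\<^sup>1\<^sup>/\<^sup>3)\<close>, and
  \<open>exp (- c t \<mu>\<^sup>1\<^sup>/\<^sup>3) t \<ell>(t)\<close> is of order \<open>L \<mu>\<^sup>-\<^sup>1\<^sup>/\<^sup>3\<close>.  This is the origin of the power of \<open>\<mu>\<close> and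
  of the logarithm.  If one of the inputs is an average in \<open>x\<close>, no resonance occurs; if it is \<open>q\<close>,
  there is no decay of \<open>V\<close> in time either, but \<open>k = l\<close>, and between \<open>\<eta>\<close> and \<open>\<xi>\<close> all weights vary by a
  fraction \<open>|\<eta> - \<xi>| / |k|\<close> at most, up to constants and powers of \<open>\<langle>\<eta> - \<xi>\<rangle>\<close>.
\<close>

section \<open>Japanese brackets and the logarithmic factor\<close>

lemma jap_ge_1 [simp]: "1 \<le> jap v"
  by (simp add: jap_def)

lemma jap_pos [simp]: "0 < jap v"
  using jap_ge_1[of v] by linarith

lemma jap_nonneg [simp]: "0 \<le> jap v"
  by (rule less_imp_le) simp

lemma jap_neq_0 [simp]: "jap v \<noteq> 0"
  using jap_pos[of v] by linarith

lemma jap_sq: "(jap v)\<^sup>2 = 1 + v\<^sup>2"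
  by (simp add: jap_def)

lemma abs_le_jap: "\<bar>v\<bar> \<le> jap v"
  unfolding jap_def by (rule real_le_rsqrt) simp

lemma jap_le: "jap v \<le> 1 + \<bar>v\<bar>"
  unfolding jap_def by (rule real_le_lsqrt) (auto simp: power2_eq_square algebra_simps abs_mult_self_eq)

lemma jap_mono: "\<bar>a\<bar> \<le> \<bar>b\<bar> \<Longrightarrow> jap a \<le> jap b"
  unfolding jap_def by (simp add: abs_le_square_iff)

lemma jap_minus [simp]: "jap (- v) = jap v"
  by (simp add: jap_def)

lemma jap_add: "jap (a + b) \<le> 2 * jap a * jap b"
proof -
  have "(a + b)\<^sup>2 \<le> 2 * a\<^sup>2 + 2 * b\<^sup>2"
    using zero_le_power2[of "a - b"] by (simp add: power2_eq_square algebra_simps)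
  moreover have "0 \<le> a\<^sup>2 * b\<^sup>2" by simp
  ultimately have "1 + (a + b)\<^sup>2 \<le> 4 * (1 + a\<^sup>2) * (1 + b\<^sup>2)"
    using zero_le_power2[of a] zero_le_power2[of b] by (simp only: algebra_simps)
  then have "(jap (a + b))\<^sup>2 \<le> (2 * jap a * jap b)\<^sup>2"
    unfolding power_mult_distrib jap_sq by simp
  then show ?thesis by (rule power2_le_imp_le) simp
qed

lemma jap_double: "jap (2 * x) \<le> 2 * jap x"
proof -
  have "(jap (2 * x))\<^sup>2 \<le> (2 * jap x)\<^sup>2"
    unfolding power_mult_distrib jap_sq by simp
  then show ?thesis by (rule power2_le_imp_le) simp
qed

lemma jap_scale: "1 \<le> w \<Longrightarrow> jap (w * x) \<le> w * jap x"
proof -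
  assume w: "1 \<le> w"
  then have "1 \<le> w\<^sup>2" by simp
  then have "(jap (w * x))\<^sup>2 \<le> (w * jap x)\<^sup>2"
    unfolding power_mult_distrib jap_sq by (simp add: algebra_simps)
  then show ?thesis by (rule power2_le_imp_le) (use w in simp)
qed

lemma continuous_on_jap [continuous_intros]:
  "continuous_on S f \<Longrightarrow> continuous_on S (\<lambda>x. jap (f x))"
  unfolding jap_def by (intro continuous_intros)

text \<open>
  The profile of the resonance weight is \<open>c \<langle>s\<rangle>\<^sup>-\<^sup>(\<^sup>1\<^sup>+\<^sup>\<gamma>\<^sup>) / \<ell>(s)\<close>; writing its logarithm for \<open>\<gamma> = 0\<close> as a
  separate factor \<open>\<ell>\<close> allows both cases to be treated together.
\<close>

definition ell :: "real \<Rightarrow> real \<Rightarrow> real \<Rightarrow> real" where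
  "ell r \<gamma> s = (if \<gamma> = 0 then ln (1 + jap s) powr (1 + r) else 1)"

lemma ln_jap_pos: "0 < ln (1 + jap s)"
  by (rule ln_gt_zero) (simp add: add_pos_pos)

lemma ell_pos [simp]: "0 < ell r \<gamma> s"
  using ln_jap_pos[of s] by (simp add: ell_def)

lemma ell_nonneg [simp]: "0 \<le> ell r \<gamma> s"
  by (rule less_imp_le) simp

lemma g_res_eq: "g_res c r \<gamma> s = c * jap s powr (- (1 + \<gamma>)) / ell r \<gamma> s"
proof -
  have "ln (1 + jap s) powr (- (1 + r)) = inverse (ln (1 + jap s) powr (1 + r))"
    by (rule powr_minus)
  moreover have "jap s powr (- 1) = inverse (jap s)" by (simp add: powr_minus)
  ultimately show ?thesis
    using ln_jap_pos[of s] by (simp add: g_res_def ell_def divide_inverse)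
qed

text \<open>
  A power of a logarithm grows more slowly than any power, so enlarging the argument by a factor
  \<open>w\<close> costs at most a factor \<open>w\<close>.  This is the only property of the logarithm that is used to
  compare values of the profile.
\<close>

lemma ell_submult:
  assumes "0 < r"
  shows "\<exists>C\<ge>1. \<forall>x y w. 1 \<le> w \<longrightarrow> jap x \<le> 2 * jap y * w \<longrightarrow> ell r \<gamma> x \<le> C * ell r \<gamma> y * w"
proof -
  define a where "a = 1 + r"
  (* From ln (1 + jap x) \<le> Y + ln 2 + ln w with Y \<ge> ln 2 and ln w \<le> a w^(1/a), all
     raised to the power a. *)
  define C where "C = (2 + a / ln 2) powr a"
  have a: "a > 1" using assms by (simp add: a_def)
  have l2: "0 < ln (2::real)" by simp
  have C1: "1 \<le> C"
    unfolding C_def using a by (intro ge_one_powr_ge_zero) (auto intro: order_trans[of _ 2])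
  have "ell r \<gamma> x \<le> C * ell r \<gamma> y * w" if w: "1 \<le> w" and xy: "jap x \<le> 2 * jap y * w" for x y w
  proof (cases "\<gamma> = 0")
    case True
    define Y where "Y = ln (1 + jap y)"
    have Y2: "ln 2 \<le> Y" unfolding Y_def by (simp add: add_pos_pos)
    have "1 + jap x \<le> (1 + jap y) * (2 * w)"
      using xy w by (simp add: algebra_simps)
    then have "ln (1 + jap x) \<le> ln ((1 + jap y) * (2 * w))"
      using w by (simp add: add_pos_pos)
    also have "\<dots> = Y + ln 2 + ln w"
      using w unfolding Y_def by (subst ln_mult_pos) (auto simp: add_pos_pos ln_mult)
    also have "ln w \<le> a * w powr (1 / a)"
    proof -
      have "ln w = a * ln (w powr (1 / a))" using w a by (simp add: ln_powr)
      also have "\<dots> \<le> a * (w powr (1 / a))" using w a ln_bound[of "w powr (1 / a)"] by (intro mult_left_mono) auto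
      finally show ?thesis .
    qed
    also have "Y + ln 2 + a * w powr (1 / a) \<le> Y * ((2 + a / ln 2) * w powr (1 / a))"
    proof -
      have p1: "1 \<le> w powr (1 / a)" using w a by (intro ge_one_powr_ge_zero) auto
      have "a * w powr (1/a) \<le> Y * (a / ln 2) * w powr (1/a)"
        using Y2 a l2 by (intro mult_right_mono) (auto simp: field_simps)
      moreover have "Y + ln 2 \<le> Y * 2 * w powr (1/a)"
      proof -
        have "Y * 2 * 1 \<le> Y * 2 * w powr (1/a)" using p1 order_trans[OF less_imp_le[OF l2] Y2] by (intro mult_left_mono) auto
        then show ?thesis using Y2 by linarith
      qed
      ultimately show ?thesis by (simp add: algebra_simps)
    qed
    finally have "ln (1 + jap x) \<le> Y * ((2 + a / ln 2) * w powr (1 / a))" by simp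
    then have "ln (1 + jap x) powr a \<le> (Y * ((2 + a / ln 2) * w powr (1 / a))) powr a"
      using ln_jap_pos[of x] a by (intro powr_mono2) auto
    also have "\<dots> = Y powr a * (C * w)"
      using a Y2 l2 w by (simp add: powr_mult powr_powr C_def add_nonneg_nonneg)
    finally show ?thesis using True by (simp add: ell_def a_def Y_def mult_ac)
  next
    case False
    then show ?thesis using w C1 mult_mono[of 1 C 1 w] by (simp add: ell_def)
  qed
  then show ?thesis using C1 by blast
qed

lemma continuous_on_ell [continuous_intros]:
  "continuous_on S f \<Longrightarrow> continuous_on S (\<lambda>x. ell r \<gamma> (f x))"
proof -
  have ne: "1 + jap u \<noteq> 0" "ln (1 + jap u) \<noteq> 0" "\<not> ln (1 + jap u) < 0" for u
    using ln_jap_pos[of u] jap_pos[of u] by linarith+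
  show "continuous_on S f \<Longrightarrow> continuous_on S (\<lambda>x. ell r \<gamma> (f x))"
    unfolding ell_def by (cases "\<gamma> = 0"; simp) (intro continuous_intros; simp add: ne)
qed

lemma summable_jap_int: "(\<lambda>n::int. inverse (jap (of_int n) ^ 2)) summable_on UNIV"
proof -
  let ?f = "\<lambda>n::int. inverse (jap (of_int n) ^ 2)"
  have nat: "(\<lambda>n::nat. inverse (1 + (real n)\<^sup>2)) summable_on UNIV"
    unfolding summable_on_UNIV_nonneg_real_iff[of "\<lambda>n::nat. inverse (1 + (real n)\<^sup>2)", simplified]
  proof (rule summable_comparison_test'[of _ 1])
    show "summable (\<lambda>n. inverse ((real n)\<^sup>2))" by (rule inverse_power_summable) simp
    show "norm (inverse (1 + (real n)\<^sup>2)) \<le> inverse ((real n)\<^sup>2)" if "1 \<le> n" for n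
      using that by (auto intro!: le_imp_inverse_le)
  qed
  have 1: "?f summable_on (range int)" and 2: "?f summable_on (range (\<lambda>n. - int n))"
    by (subst summable_on_reindex; use nat in \<open>simp add: inj_on_def o_def jap_sq\<close>)+
  have "(UNIV::int set) = range int \<union> range (\<lambda>n. - int n)"
  proof (rule set_eqI, simp)
    fix x :: int
    show "x \<in> range int \<or> x \<in> range (\<lambda>n. - int n)"
      by (cases x rule: int_cases) (auto simp: image_iff intro: exI[of _ "Suc _"])
  qed
  then show ?thesis using summable_on_union[OF 1 2] by simp
qed

section \<open>Elementary inequalities\<close>

text \<open>
  The fundamental theorem of calculus with lower limit \<open>-\<infinity>\<close>: up to a constant the integral is
  taken over a compact interval around \<open>t\<close>.
\<close>

lemma has_derivative_set_integral_atMost: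
  fixes f :: "real \<Rightarrow> real"
  assumes int: "integrable lborel f" and cont: "continuous_on UNIV f"
  shows "((\<lambda>s. LINT x:{..s}|lborel. f x) has_real_derivative f t) (at t)"
proof -
  define a where "a = t - 1"
  have si: "set_integrable lborel A f" if "A \<in> sets borel" for A
    using int that by (intro set_integrable_subset[of lborel UNIV f A]) (auto simp: set_integrable_def)
  have eq: "(LINT x:{..s}|lborel. f x) = (LINT x:{..a}|lborel. f x) + integral {a..s} f" if "a \<le> s" for s
  proof -
    have "{..s} = {..a} \<union> {a<..s}" using that by auto
    then have "(LINT x:{..s}|lborel. f x) = (LINT x:{..a}|lborel. f x) + (LINT x:{a<..s}|lborel. f x)"
      by (simp only:) (rule set_integral_Un, use that in \<open>auto intro!: si\<close>)
    also have "(LINT x:{a<..s}|lborel. f x) = (LINT x:{a..s}|lborel. f x)"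
      unfolding set_lebesgue_integral_def
      by (rule integral_cong_AE) (use int in \<open>auto intro!: AE_I'[of "{a}"] simp: indicator_def\<close>)
    also have "\<dots> = integral {a..s} f"
      by (rule set_borel_integral_eq_integral) (rule si, simp)
    finally show ?thesis .
  qed
  have "((\<lambda>s. integral {a..s} f) has_real_derivative f t) (at t within {a..t+1})"
    by (rule integral_has_real_derivative) (auto simp: a_def intro: continuous_on_subset[OF cont])
  then have "((\<lambda>s. integral {a..s} f) has_real_derivative f t) (at t)"
    by (subst (asm) at_within_interior) (auto simp: a_def)
  then have "((\<lambda>s. (LINT x:{..a}|lborel. f x) + integral {a..s} f) has_real_derivative f t) (at t)"
    by (auto intro!: derivative_eq_intros)
  moreover have "\<forall>\<^sub>F s in nhds t. (LINT x:{..s}|lborel. f x) = (LINT x:{..a}|lborel. f x) + integral {a..s} f"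
  proof -
    have "t \<in> {a<..}" by (simp add: a_def)
    then have "\<forall>\<^sub>F s in nhds t. s \<in> {a<..}" by (intro eventually_nhds_in_open) auto
    then show ?thesis by (rule eventually_mono) (rule eq, simp)
  qed
  ultimately show ?thesis by (subst DERIV_cong_ev) auto
qed

text \<open>
  Compare \<open>1 + u\<close> with \<open>exp (a u)\<close> for \<open>a\<close> so small that the \<open>n\<close>-th power stays below \<open>exp (c u)\<close>.
\<close>

lemma exp_absorb:
  assumes "0 < (c::real)"
  shows "\<exists>K>0. \<forall>u\<ge>0. (1 + u) ^ n * exp (- (c * u)) \<le> K"
proof -
  define a where "a = c / real (Suc n)"
  have a: "0 < a" using assms by (simp add: a_def)
  have "(1 + u) ^ n * exp (- (c * u)) \<le> (1 + 1 / a) ^ n" if u: "0 \<le> u" for u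
  proof -
    have "1 + u \<le> (1 + 1 / a) * (1 + a * u)" using a u by (simp add: field_simps)
    also have "\<dots> \<le> (1 + 1 / a) * exp (a * u)" using a by (intro mult_left_mono exp_ge_add_one_self) auto
    finally have "(1 + u) ^ n \<le> ((1 + 1 / a) * exp (a * u)) ^ n" using u by (intro power_mono) auto
    also have "\<dots> = (1 + 1 / a) ^ n * exp (real n * (a * u))"
      by (simp add: power_mult_distrib exp_of_nat_mult)
    also have "\<dots> \<le> (1 + 1 / a) ^ n * exp (c * u)"
    proof -
      have "real n * a \<le> c" unfolding a_def using assms by (simp add: field_simps)
      then have "real n * (a * u) \<le> c * u" using u by (simp add: mult.assoc[symmetric] mult_right_mono)
      then show ?thesis using a by (intro mult_left_mono) auto
    qed
    finally show ?thesis by (simp add: exp_minus field_simps)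
  qed
  then show ?thesis using a by (intro exI[of _ "(1 + 1 / a) ^ n"]) (auto intro!: zero_less_power add_pos_pos)
qed

text \<open>
  The first bound is good for \<open>d \<le> b\<close>, as in the transport region; the second grows only like the
  power \<open>p\<close> and is needed when \<open>d\<close> is the large quantity.
\<close>

lemma powr_ratio_le:
  fixes a b d p :: real
  assumes "0 < a" "0 < b" "0 \<le> p" "p \<le> 1" "\<bar>a - b\<bar> \<le> d"
  shows "\<bar>a powr p - b powr p\<bar> * b powr (- p) \<le> d / b"
    and "\<bar>a powr p - b powr p\<bar> * b powr (- p) \<le> 2 * (d / b) powr p"
proof -
  define y where "y = a / b"
  define x where "x = d / b"
  have y: "0 < y" using assms by (simp add: y_def)
  have d0: "0 \<le> d" using assms(5) by linarith
  have x0: "0 \<le> x" using assms d0 by (simp add: x_def)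
  have "\<bar>y - 1\<bar> = \<bar>a - b\<bar> / b"
  proof -
    have "y - 1 = (a - b) / b" using assms(2) by (simp add: y_def diff_divide_distrib)
    then show ?thesis using assms(2) by (simp add: abs_divide)
  qed
  also have "\<dots> \<le> x" unfolding x_def using assms by (intro divide_right_mono) auto
  finally have yx: "\<bar>y - 1\<bar> \<le> x" .
  have bp: "0 < b powr p" using assms by simp
  have "\<bar>a powr p - b powr p\<bar> * b powr (- p) = \<bar>a powr p - b powr p\<bar> / \<bar>b powr p\<bar>"
    by (simp add: powr_minus divide_inverse)
  also have "\<dots> = \<bar>a powr p / b powr p - 1\<bar>"
  proof -
    have "a powr p / b powr p - 1 = (a powr p - b powr p) / b powr p" using bp by (simp add: diff_divide_distrib)
    then show ?thesis by (simp add: abs_divide)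
  qed
  also have "\<dots> = \<bar>y powr p - 1\<bar>" using assms by (simp add: y_def powr_divide)
  finally have eq: "\<bar>a powr p - b powr p\<bar> * b powr (- p) = \<bar>y powr p - 1\<bar>" .
  have le: "\<bar>y powr p - 1\<bar> \<le> x"
  proof (cases "1 \<le> y")
    case True
    have "y powr p \<le> y powr 1" using True assms by (intro powr_mono) auto
    moreover have "1 \<le> y powr p" using True assms by (intro ge_one_powr_ge_zero) auto
    ultimately show ?thesis using yx y by simp
  next
    case False
    have "y powr 1 \<le> y powr p" using False assms y by (intro powr_mono') auto
    moreover have "y powr p \<le> 1" using False assms y powr_le1[of p y] by simp
    ultimately show ?thesis using yx y by simp
  qed
  show "\<bar>a powr p - b powr p\<bar> * b powr (- p) \<le> d / b" using eq le by (simp add: x_def)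
  have "\<bar>y powr p - 1\<bar> \<le> 2 * x powr p"
  proof (cases "x \<le> 1")
    case True
    have "x \<le> x powr p"
    proof (cases "x = 0")
      case False
      then have "x powr 1 \<le> x powr p" using True x0 assms by (intro powr_mono') auto
      then show ?thesis using x0 False by simp
    qed simp
    then show ?thesis using le powr_ge_zero[of x p] by linarith
  next
    case False
    have "y powr p \<le> (2 * x) powr p" using yx False y assms by (intro powr_mono2) auto
    also have "\<dots> = 2 powr p * x powr p" using x0 by (simp add: powr_mult)
    also have "\<dots> \<le> 2 powr 1 * x powr p" using assms by (intro mult_right_mono powr_mono) auto
    finally have "y powr p \<le> 2 * x powr p" by simp
    moreover have "1 \<le> x powr p" using False assms by (intro ge_one_powr_ge_zero) auto
    ultimately show ?thesis using powr_ge_zero[of y p] by linarith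
  qed
  then show "\<bar>a powr p - b powr p\<bar> * b powr (- p) \<le> 2 * (d / b) powr p" using eq by (simp add: x_def)
qed

lemma exp_diff_le:
  assumes "x \<le> B" "y \<le> (B::real)"
  shows "\<bar>exp x - exp y\<bar> \<le> exp B * \<bar>x - y\<bar>"
proof -
  have *: "exp x - exp y \<le> exp B * (x - y)" if "y \<le> x" "x \<le> B" for x y
  proof -
    have "1 + (y - x) \<le> exp (y - x)" by (rule exp_ge_add_one_self)
    then have "exp x * (1 - exp (y - x)) \<le> exp x * (x - y)" by (intro mult_left_mono; linarith?; simp)
    also have "\<dots> \<le> exp B * (x - y)" using that by (intro mult_right_mono) auto
    finally show ?thesis by (simp add: algebra_simps exp_add[symmetric])
  qed
  show ?thesis
    using *[of x y] *[of y x] assms by (cases "y \<le> x") (auto simp: abs_if)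
qed

lemma arctan_Lipschitz: "\<bar>arctan x - arctan y\<bar> \<le> \<bar>x - y\<bar>"
proof -
  have *: "arctan b - arctan a \<le> b - a" if "a < b" for a b
  proof -
    have "\<exists>z>a. z < b \<and> arctan b - arctan a = (b - a) * inverse (1 + z\<^sup>2)"
      by (rule MVT2[OF that]) (rule DERIV_arctan)
    then obtain z where z: "arctan b - arctan a = (b - a) * inverse (1 + z\<^sup>2)" by blast
    have "inverse (1 + z\<^sup>2) \<le> 1" by (simp add: inverse_le_1_iff)
    then have "(b - a) * inverse (1 + z\<^sup>2) \<le> (b - a) * 1" using that by (intro mult_left_mono) auto
    then show ?thesis using z by simp
  qed
  show ?thesis
  proof (cases x y rule: linorder_cases)
    case less
    then show ?thesis using *[of x y] arctan_monotone[of x y] by auto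
  next
    case greater
    then show ?thesis using *[of y x] arctan_monotone[of y x] by auto
  qed simp
qed

lemma powr_diff_le:
  fixes x y N :: real
  assumes "0 < y" "0 < x" "x \<le> 2 * y" "1 \<le> N"
  shows "\<bar>x powr N - y powr N\<bar> \<le> N * (2 * y) powr (N - 1) * \<bar>x - y\<bar>"
proof -
  have *: "b powr N - a powr N \<le> N * (2 * y) powr (N - 1) * (b - a)" if "0 < a" "a < b" "b \<le> 2 * y" for a b
  proof -
    have "\<exists>z>a. z < b \<and> b powr N - a powr N = (b - a) * (N * z powr (N - 1))"
      by (rule MVT2[OF that(2)]) (use that in \<open>auto intro!: has_real_derivative_powr\<close>)
    then obtain z where z: "a < z" "z < b" "b powr N - a powr N = (b - a) * (N * z powr (N - 1))" by blast
    have "z powr (N - 1) \<le> (2 * y) powr (N - 1)" using z that assms by (intro powr_mono2) auto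
    then have "(b - a) * (N * z powr (N - 1)) \<le> (b - a) * (N * (2 * y) powr (N - 1))"
      using that assms by (intro mult_left_mono) auto
    then show ?thesis using z by (simp add: mult_ac)
  qed
  show ?thesis
  proof (cases x y rule: linorder_cases)
    case less
    then have "x powr N \<le> y powr N" using assms by (intro powr_mono2) auto
    then show ?thesis using *[of x y] less assms by auto
  next
    case greater
    then have "y powr N \<le> x powr N" using assms by (intro powr_mono2) auto
    then show ?thesis using *[of y x] greater assms by auto
  qed simp
qed

text \<open>
  The weight \<open>A\<close> contains the inverse of a product of three bounded weights; its variation reduces to
  the variations of the single factors.
\<close>

lemma inverse_prod3_diff:
  fixes Q :: real
  assumes Q: "1 \<le> Q" and a: "inverse Q \<le> a" "a \<le> Q" and b: "inverse Q \<le> b" "b \<le> Q" and d: "inverse Q \<le> d" "d \<le> Q"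
    and a': "inverse Q \<le> a'" "a' \<le> Q" and b': "inverse Q \<le> b'" "b' \<le> Q" and d': "inverse Q \<le> d'" "d' \<le> Q"
  shows "\<bar>inverse (a * b * d) - inverse (a' * b' * d')\<bar> \<le> Q ^ 8 * (\<bar>a - a'\<bar> + \<bar>b - b'\<bar> + \<bar>d - d'\<bar>)"
    and "inverse (Q ^ 3) \<le> inverse (a * b * d)" and "inverse (a * b * d) \<le> Q ^ 3"
proof -
  have iQ: "0 < inverse Q" using Q by simp
  have pos: "0 < a" "0 < b" "0 < d" "0 < a'" "0 < b'" "0 < d'"
    using iQ a b d a' b' d' by linarith+
  have up: "inverse x \<le> Q" if "inverse Q \<le> x" for x
    using that le_imp_inverse_le[OF that] Q by simp
  have i3: "inverse (x * y * z) \<le> Q ^ 3" if "0 < x" "0 < y" "0 < z" "inverse Q \<le> x" "inverse Q \<le> y" "inverse Q \<le> z" for x y z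
  proof -
    have "inverse (x * y * z) = inverse x * inverse y * inverse z" by (simp add: mult.commute)
    also have "\<dots> \<le> Q * Q * Q" using that Q by (intro mult_mono up) auto
    finally show ?thesis by (simp add: power3_eq_cube)
  qed
  show "inverse (a * b * d) \<le> Q ^ 3" by (intro i3 pos a b d)
  have "a * b * d \<le> Q * Q * Q" using pos a b d Q by (intro mult_mono) auto
  then show "inverse (Q ^ 3) \<le> inverse (a * b * d)" using pos by (intro le_imp_inverse_le) (auto simp: power3_eq_cube)
  have "a' * b' * d' - a * b * d = (a' - a) * (b * d) + (b' - b) * (a' * d) + (d' - d) * (a' * b')"
    by (simp add: algebra_simps)
  then have "\<bar>a' * b' * d' - a * b * d\<bar> \<le> \<bar>(a' - a) * (b * d)\<bar> + \<bar>(b' - b) * (a' * d)\<bar> + \<bar>(d' - d) * (a' * b')\<bar>"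
    by linarith
  also have "\<dots> = \<bar>a - a'\<bar> * (b * d) + \<bar>b - b'\<bar> * (a' * d) + \<bar>d - d'\<bar> * (a' * b')"
    using pos by (simp add: abs_mult abs_minus_commute)
  also have "\<dots> \<le> \<bar>a - a'\<bar> * (Q * Q) + \<bar>b - b'\<bar> * (Q * Q) + \<bar>d - d'\<bar> * (Q * Q)"
    using pos a b d a' b' d' Q by (intro add_mono mult_left_mono mult_mono) auto
  finally have num: "\<bar>a' * b' * d' - a * b * d\<bar> \<le> Q\<^sup>2 * (\<bar>a - a'\<bar> + \<bar>b - b'\<bar> + \<bar>d - d'\<bar>)"
    by (simp add: algebra_simps power2_eq_square)
  have "inverse (a * b * d) - inverse (a' * b' * d') = (a' * b' * d' - a * b * d) * (inverse (a * b * d) * inverse (a' * b' * d'))"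
    using pos by (simp add: field_simps)
  then have "\<bar>inverse (a * b * d) - inverse (a' * b' * d')\<bar> = \<bar>a' * b' * d' - a * b * d\<bar> * (inverse (a * b * d) * inverse (a' * b' * d'))"
    using pos by (simp add: abs_mult)
  also have "\<dots> \<le> (Q\<^sup>2 * (\<bar>a - a'\<bar> + \<bar>b - b'\<bar> + \<bar>d - d'\<bar>)) * (Q ^ 3 * Q ^ 3)"
    using pos a b d a' b' d' Q num by (intro mult_mono i3) auto
  also have "\<dots> = Q ^ 8 * (\<bar>a - a'\<bar> + \<bar>b - b'\<bar> + \<bar>d - d'\<bar>)"
    by (simp add: eval_nat_numeral)
  finally show "\<bar>inverse (a * b * d) - inverse (a' * b' * d')\<bar> \<le> Q ^ 8 * (\<bar>a - a'\<bar> + \<bar>b - b'\<bar> + \<bar>d - d'\<bar>)" .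
qed

section \<open>Frequencies\<close>

lemma abs2_norm: "abs2 k \<eta> = norm (real_of_int k, \<eta>)"
  by (simp add: abs2_def norm_Pair)

lemma abs2_nonneg [simp]: "0 \<le> abs2 k \<eta>"
  by (simp add: abs2_norm)

lemma abs2_triangle: "abs2 k \<eta> \<le> abs2 l \<xi> + abs2 (k - l) (\<eta> - \<xi>)"
  unfolding abs2_norm using norm_triangle_ineq[of "(real_of_int l, \<xi>)" "(real_of_int (k - l), \<eta> - \<xi>)"] by simp

lemma abs2_minus: "abs2 (l - k) (\<xi> - \<eta>) = abs2 (k - l) (\<eta> - \<xi>)"
  unfolding abs2_def by (simp add: power2_commute)

lemma abs2_ge: "\<bar>of_int k\<bar> \<le> abs2 k \<eta>" "\<bar>\<eta>\<bar> \<le> abs2 k \<eta>"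
  unfolding abs2_def by (rule real_le_rsqrt; simp)+

lemma abs2_cross: "\<bar>\<zeta> * of_int l - of_int j * \<xi>\<bar> \<le> abs2 j \<zeta> * abs2 l \<xi>"
proof (rule power2_le_imp_le)
  have "(abs2 j \<zeta> * abs2 l \<xi>)\<^sup>2 = (\<zeta> * of_int l - of_int j * \<xi>)\<^sup>2 + (\<zeta> * \<xi> + of_int j * of_int l)\<^sup>2"
    unfolding power_mult_distrib abs2_def by (simp add: power2_eq_square algebra_simps)
  then show "\<bar>\<zeta> * of_int l - of_int j * \<xi>\<bar>\<^sup>2 \<le> (abs2 j \<zeta> * abs2 l \<xi>)\<^sup>2" by simp
qed simp

lemma jap2_sq: "(jap2 k \<eta>)\<^sup>2 = 1 + (abs2 k \<eta>)\<^sup>2"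
  by (simp add: jap2_def abs2_def)

lemma jap2_ge_1 [simp]: "1 \<le> jap2 k \<eta>"
  by (simp add: jap2_def)

lemma jap2_pos [simp]: "0 < jap2 k \<eta>"
  by (rule less_le_trans[OF zero_less_one jap2_ge_1])

lemma jap2_nonneg [simp]: "0 \<le> jap2 k \<eta>"
  by (rule less_imp_le) simp

lemma abs2_le_jap2: "abs2 k \<eta> \<le> jap2 k \<eta>"
  by (simp add: abs2_def jap2_def)

lemma jap2_le: "jap2 k \<eta> \<le> 1 + abs2 k \<eta>"
  by (rule power2_le_imp_le) (simp_all add: jap2_sq power2_sum)

lemma jap_le_jap2: "jap (of_int k) \<le> jap2 k \<eta>" "jap \<eta> \<le> jap2 k \<eta>"
  by (simp_all add: jap_def jap2_def)

lemma jap2_diff: "\<bar>jap2 k \<eta> - jap2 l \<xi>\<bar> \<le> abs2 (k - l) (\<eta> - \<xi>)"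
proof -
  have "jap2 k \<eta> = norm (1::real, (real_of_int k, \<eta>))" for k \<eta>
    by (simp add: jap2_def norm_Pair)
  then show ?thesis
    unfolding abs2_norm using norm_triangle_ineq3[of "(1::real, (real_of_int k, \<eta>))" "(1, (real_of_int l, \<xi>))"]
    by (simp add: norm_Pair)
qed

lemma power_le_jap2_10: "n \<le> 10 \<Longrightarrow> jap2 k \<eta> ^ n \<le> jap2 k \<eta> ^ 10"
  by (intro power_increasing) auto

lemma Lam_nonneg [simp]: "0 \<le> Lam t k \<eta>"
  by (simp add: Lam_def)

lemma Lam_triangle: "Lam t k \<eta> \<le> Lam t l \<xi> + Lam t (k - l) (\<eta> - \<xi>)"
  unfolding Lam_def using abs2_triangle[of k "\<eta> - of_int k * t" l "\<xi> - of_int l * t"]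
  by (simp add: algebra_simps)

lemma Lam_diff: "\<bar>Lam t k \<eta> - Lam t l \<xi>\<bar> \<le> Lam t (k - l) (\<eta> - \<xi>)"
proof -
  have "Lam t (l - k) (\<xi> - \<eta>) = Lam t (k - l) (\<eta> - \<xi>)"
    unfolding Lam_def using abs2_minus[of l k "\<xi> - of_int l * t" "\<eta> - of_int k * t"]
    by (simp add: algebra_simps)
  then show ?thesis
    using Lam_triangle[of t k \<eta> l \<xi>] Lam_triangle[of t l \<xi> k \<eta>] by linarith
qed

lemma Lam_ge: "\<bar>of_int k\<bar> \<le> Lam t k \<eta>" "\<bar>\<eta> - of_int k * t\<bar> \<le> Lam t k \<eta>"
  unfolding Lam_def by (rule abs2_ge)+

lemma Lam_ge_1: "k \<noteq> 0 \<Longrightarrow> 1 \<le> Lam t k \<eta>"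
proof -
  assume "k \<noteq> 0"
  then have "1 \<le> \<bar>real_of_int k\<bar>" by linarith
  then show ?thesis using Lam_ge(1)[of k t \<eta>] by linarith
qed

lemma Lam_zero_mode: "Lam t 0 \<eta> = \<bar>\<eta>\<bar>" "abs2 0 \<eta> = \<bar>\<eta>\<bar>"
  by (simp_all add: Lam_def abs2_def)

text \<open>
  For \<open>l \<noteq> 0\<close> the sheared frequency measures the distance of \<open>t\<close> to the critical time \<open>\<xi> / l\<close>.
\<close>

lemma Lam_jap:
  assumes "l \<noteq> 0"
  shows "Lam t l \<xi> = \<bar>of_int l\<bar> * jap (t - \<xi> / of_int l)"
proof -
  have "(Lam t l \<xi>)\<^sup>2 = (\<bar>of_int l\<bar> * jap (t - \<xi> / of_int l))\<^sup>2"
  proof -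
    have "(Lam t l \<xi>)\<^sup>2 = (of_int l)\<^sup>2 + (\<xi> - of_int l * t)\<^sup>2" by (simp add: Lam_def abs2_def)
    also have "\<dots> = (of_int l)\<^sup>2 * (1 + (t - \<xi> / of_int l)\<^sup>2)"
      using assms by (simp add: power2_eq_square field_simps)
    finally show ?thesis by (simp add: power_mult_distrib jap_sq)
  qed
  then show ?thesis by (rule power2_eq_imp_eq) auto
qed

text \<open>
  Inviscid damping: at time \<open>t\<close> a nonzero mode is sheared to a frequency of size \<open>t\<close>, unless
  \<open>|\<zeta>| \<ge> t / 2\<close> already.
\<close>

lemma Lam_lower:
  assumes "j \<noteq> 0" "0 \<le> t"
  shows "t \<le> 2 * (Lam t j \<zeta> * jap2 j \<zeta>)"
proof (cases "t \<le> 2 * \<bar>\<zeta>\<bar>")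
  case True
  have "1 * \<bar>\<zeta>\<bar> \<le> Lam t j \<zeta> * jap2 j \<zeta>"
    using Lam_ge_1[OF assms(1)] order_trans[OF abs2_ge(2) abs2_le_jap2, of \<zeta> j] by (intro mult_mono) auto
  then show ?thesis using True by linarith
next
  case False
  have "1 \<le> \<bar>real_of_int j\<bar>" using assms(1) by linarith
  then have "1 * t \<le> \<bar>of_int j\<bar> * t" using assms(2) by (intro mult_right_mono)
  also have "\<dots> = \<bar>of_int j * t\<bar>" using assms(2) by (simp add: abs_mult)
  finally have "t \<le> \<bar>of_int j * t\<bar>" by simp
  then have "t \<le> 2 * Lam t j \<zeta>" using False Lam_ge(2)[of \<zeta> j t] by linarith
  also have "\<dots> \<le> 2 * (Lam t j \<zeta> * jap2 j \<zeta>)"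
    using mult_left_mono[OF jap2_ge_1[of j \<zeta>] Lam_nonneg[of t j \<zeta>]] by simp
  finally show ?thesis .
qed

lemma abs2_le_Lam:
  assumes "0 \<le> t"
  shows "abs2 l \<xi> \<le> Lam t l \<xi> + \<bar>of_int l\<bar> * t"
proof -
  have "abs2 l \<xi> \<le> abs2 l (\<xi> - of_int l * t) + abs2 (l - l) (\<xi> - (\<xi> - of_int l * t))"
    by (rule abs2_triangle)
  then show ?thesis using assms by (simp add: Lam_zero_mode Lam_def abs_mult)
qed

text \<open>
  The exponential factor of \<open>A\<close>.
\<close>

definition en :: "real \<Rightarrow> real \<Rightarrow> real \<Rightarrow> int \<Rightarrow> real" where
  "en c \<mu> t k = exp (c * \<mu> powr (1/3) * t * (if k \<noteq> 0 then 1 else 0))"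

lemma en_pos [simp]: "0 < en c \<mu> t k"
  by (simp add: en_def)

lemma en_nonneg [simp]: "0 \<le> en c \<mu> t k"
  by (simp add: en_def)

section \<open>The resonance profile\<close>

locale resonance =
  fixes c r \<gamma> :: real
  assumes c_pos: "0 < c" and r_pos: "0 < r" and gam_nonneg: "0 \<le> \<gamma>" and gam_le_1: "\<gamma> \<le> 1"
begin

abbreviation g where "g \<equiv> g_res c r \<gamma>"
abbreviation \<l> where "\<l> \<equiv> ell r \<gamma>"

lemma g_pos [simp]: "0 < g s"
  unfolding g_res_eq using c_pos by simp

lemma g_nonneg [simp]: "0 \<le> g s"
  by (rule less_imp_le) simp

lemma continuous_on_g [continuous_intros]:
  "continuous_on S f \<Longrightarrow> continuous_on S (\<lambda>x. g (f x))"
  unfolding g_res_eq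
  by (intro continuous_intros) (auto simp: less_imp_neq[OF ell_pos, symmetric])

lemma borel_measurable_g [measurable (raw)]:
  "f \<in> borel_measurable M \<Longrightarrow> (\<lambda>x. g (f x)) \<in> borel_measurable M"
  by (rule borel_measurable_continuous_on) (auto intro: continuous_intros)

text \<open>
  The profile varies by at most a power of the ratio of the arguments, hence by at most a polynomial
  factor if the frequency is shifted.
\<close>

lemma g_shift: "\<exists>C>0. \<forall>x y w. 1 \<le> w \<longrightarrow> jap x \<le> 2 * jap y * w \<longrightarrow> g y \<le> C * w\<^sup>2 * g x"
proof -
  obtain C where C: "C \<ge> 1" "\<And>x y w. 1 \<le> w \<Longrightarrow> jap x \<le> 2 * jap y * w \<Longrightarrow> \<l> x \<le> C * \<l> y * w"
    using ell_submult[OF r_pos, of \<gamma>] by blast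
  have "g y \<le> 4 * C * w\<^sup>2 * g x" if w: "1 \<le> w" and xy: "jap x \<le> 2 * jap y * w" for x y w
  proof -
    have e: "jap x powr (1 + \<gamma>) * \<l> x \<le> 4 * C * w\<^sup>2 * (jap y powr (1 + \<gamma>) * \<l> y)"
    proof (cases "\<gamma> = 0")
      case True
      have "jap x * \<l> x \<le> (2 * jap y * w) * (C * \<l> y * w)"
        using xy C(2)[OF w xy] w by (intro mult_mono) auto
      also have "\<dots> \<le> (4 * jap y * w) * (C * \<l> y * w)"
        using w C(1) by (intro mult_right_mono) auto
      finally show ?thesis using True by (simp add: power2_eq_square mult_ac)
    next
      case False
      have "jap x powr (1 + \<gamma>) \<le> (2 * jap y * w) powr (1 + \<gamma>)"
        using xy gam_nonneg by (intro powr_mono2) auto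
      also have "\<dots> = (2 * w) powr (1 + \<gamma>) * jap y powr (1 + \<gamma>)"
        using w by (simp add: powr_mult)
      also have "(2 * w) powr (1 + \<gamma>) \<le> (2 * w) powr 2"
        using w gam_le_1 by (intro powr_mono) auto
      also have "(2 * w) powr 2 = 4 * w\<^sup>2" using w by (simp add: powr_numeral power_mult_distrib)
      also have "4 * w\<^sup>2 * jap y powr (1 + \<gamma>) \<le> 4 * C * w\<^sup>2 * jap y powr (1 + \<gamma>)"
        using C(1) by (intro mult_right_mono) auto
      finally show ?thesis using False by (simp add: ell_def mult_right_mono)
    qed
    show ?thesis
    proof -
      have p: "0 < jap x powr (1 + \<gamma>) * \<l> x" "0 < jap y powr (1 + \<gamma>) * \<l> y" by auto
      have "g s = c / (jap s powr (1 + \<gamma>) * \<l> s)" for s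
        unfolding g_res_eq powr_minus by (simp add: field_simps)
      then show ?thesis using e p c_pos by (simp add: field_simps)
    qed
  qed
  then show ?thesis using C(1) by (intro exI[of _ "4 * C"]) auto
qed

lemma g_bounded: "\<exists>B>0. \<forall>s. g s \<le> B"
proof -
  obtain C where C: "C > 0" "\<And>x y w. 1 \<le> w \<Longrightarrow> jap x \<le> 2 * jap y * w \<Longrightarrow> g y \<le> C * w\<^sup>2 * g x"
    using g_shift by blast
  have "g s \<le> C * g 0" for s
    using C(2)[of 1 0 s] jap_ge_1[of s] by (simp add: jap_def[of 0])
  then show ?thesis using C(1) by (intro exI[of _ "C * g 0"]) auto
qed

text \<open>
  Up to constants \<open>g\<close> is a function with an elementary antiderivative: a power of \<open>1 + |s|\<close> for
  \<open>\<gamma> > 0\<close>, and a power of \<open>ln (2 + |s|)\<close> for \<open>\<gamma> = 0\<close>.  The exponent \<open>1 + r > 1\<close> of the logarithm makes the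
  latter integrable.
\<close>

lemma nn_integral_g_finite: "(\<integral>\<^sup>+s. ennreal (g s) \<partial>lborel) < \<infinity>"
proof -
  define h where "h = (\<lambda>x::real. if \<gamma> = 0 then inverse (2 + x) * ln (2 + x) powr (- (1 + r)) else (1 + x) powr (- (1 + \<gamma>)))"
  define F where "F = (\<lambda>x::real. if \<gamma> = 0 then - (ln (2 + x) powr (- r)) / r else - ((1 + x) powr (- \<gamma>)) / \<gamma>)"
  have h_nn: "0 \<le> h x" if "0 \<le> x" for x using that by (simp add: h_def)
  have hm[measurable]: "h \<in> borel_measurable borel" unfolding h_def by measurable
  have "(\<integral>\<^sup>+x. ennreal (h x) * indicator {0..} x \<partial>lborel) = 0 - F 0"
  proof (rule nn_integral_FTC_atLeast)
    show "(F has_real_derivative h x) (at x)" if "0 \<le> x" for x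
    proof (cases "\<gamma> = 0")
      case True
      have "((\<lambda>x. ln (2 + x)) has_real_derivative inverse (2 + x)) (at x)"
        using that by (auto intro!: derivative_eq_intros simp: field_simps)
      then have "((\<lambda>x. ln (2 + x) powr (- r)) has_real_derivative
          (- r) * ln (2 + x) powr (- r - of_nat 1) * inverse (2 + x)) (at x)"
        using that by (intro DERIV_fun_powr) auto
      then have "((\<lambda>x. (- 1 / r) * ln (2 + x) powr (- r)) has_real_derivative
          (- 1 / r) * ((- r) * ln (2 + x) powr (- r - of_nat 1) * inverse (2 + x))) (at x)"
        by (rule DERIV_cmult)
      moreover have "(- 1 / r) * ((- r) * ln (2 + x) powr (- r - of_nat 1) * inverse (2 + x)) = h x"
      proof -
        have e: "- r - of_nat 1 = - (1 + r)" by simp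
        show ?thesis unfolding h_def e using True r_pos by (simp only: if_True) (simp add: field_simps)
      qed
      moreover have "F = (\<lambda>x. (- 1 / r) * ln (2 + x) powr (- r))"
        using True by (simp add: F_def)
      ultimately show ?thesis by simp
    next
      case False
      have e: "-(1 + \<gamma>) = -\<gamma> - 1" by simp
      show ?thesis unfolding F_def h_def e using that False
        by (auto intro!: derivative_eq_intros)
    qed
    show "(F \<longlongrightarrow> 0) at_top"
    proof (cases "\<gamma> = 0")
      case True
      have "((\<lambda>x::real. ln (2 + x) powr (- r)) \<longlongrightarrow> 0) at_top"
        by (rule tendsto_neg_powr) (use r_pos in \<open>auto intro!: filterlim_compose[OF ln_at_top] filterlim_tendsto_add_at_top[OF tendsto_const] filterlim_ident\<close>)
      then have "((\<lambda>x::real. - (ln (2 + x) powr (- r)) / r) \<longlongrightarrow> - 0 / r) at_top"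
        by (intro tendsto_intros) (use r_pos in auto)
      then show ?thesis using True unfolding F_def by simp
    next
      case False
      have "((\<lambda>x::real. (1 + x) powr (- \<gamma>)) \<longlongrightarrow> 0) at_top"
        by (rule tendsto_neg_powr) (use gam_nonneg False in \<open>auto intro!: filterlim_tendsto_add_at_top[OF tendsto_const] filterlim_ident\<close>)
      then have "((\<lambda>x::real. - ((1 + x) powr (- \<gamma>)) / \<gamma>) \<longlongrightarrow> - 0 / \<gamma>) at_top"
        by (intro tendsto_intros) (use False in auto)
      then show ?thesis using False unfolding F_def by simp
    qed
  qed (use h_nn in auto)
  then have fin: "(\<integral>\<^sup>+x. ennreal (h x) * indicator {0..} x \<partial>lborel) < \<infinity>" by simp
  have le: "\<exists>K>0. \<forall>s. g s \<le> K * h \<bar>s\<bar>"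
  proof (cases "\<gamma> = 0")
    case True
    have "g s \<le> c * 3 * 2 powr (1 + r) * h \<bar>s\<bar>" for s
    proof -
      define x where "x = \<bar>s\<bar>"
      have j: "1 \<le> jap s" "x \<le> jap s" unfolding x_def by (auto simp: abs_le_jap)
      have x0: "0 \<le> x" by (simp add: x_def)
      have "(1 + jap s)\<^sup>2 = 1 + 2 * jap s + jap s * jap s" by (simp add: power2_eq_square algebra_simps)
      then have "2 + x \<le> (1 + jap s)\<^sup>2" using j mult_mono[of 1 "jap s" 1 "jap s"] by linarith
      then have "ln (2 + x) \<le> ln ((1 + jap s)\<^sup>2)"
        using x0 by (subst ln_le_cancel_iff) (auto simp: add_pos_pos)
      then have "ln (2 + x) \<le> 2 * ln (1 + jap s)"
        by (simp add: ln_realpow add_pos_pos)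
      moreover have lp: "0 < ln (2 + x)" using x0 by simp
      ultimately have "(2 * ln (1 + jap s)) powr (- (1 + r)) \<le> ln (2 + x) powr (- (1 + r))"
        using r_pos by (intro powr_mono2') auto
      then have "2 powr (- (1 + r)) * ln (1 + jap s) powr (- (1 + r)) \<le> ln (2 + x) powr (- (1 + r))"
        by (simp add: powr_mult)
      then have 1: "ln (1 + jap s) powr (- (1 + r)) \<le> 2 powr (1 + r) * ln (2 + x) powr (- (1 + r))"
        unfolding powr_minus[of 2] by (simp add: field_simps)
      have 2: "inverse (jap s) \<le> 3 * inverse (2 + x)"
      proof -
        have "2 + x \<le> 3 * jap s" using j by linarith
        then show ?thesis using x0 by (simp add: field_simps)
      qed
      have "inverse (jap s) * ln (1 + jap s) powr (- (1 + r)) \<le> 3 * inverse (2 + x) * (2 powr (1 + r) * ln (2 + x) powr (- (1 + r)))"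
        using 1 2 x0 by (intro mult_mono) auto
      then have "c * (inverse (jap s) * ln (1 + jap s) powr (- (1 + r))) \<le> c * (3 * inverse (2 + x) * (2 powr (1 + r) * ln (2 + x) powr (- (1 + r))))"
        using c_pos by (intro mult_left_mono) auto
      then show ?thesis using ln_jap_pos[of s] True unfolding g_res_def h_def x_def by (simp add: mult_ac)
    qed
    then show ?thesis using c_pos by (intro exI[of _ "c * 3 * 2 powr (1 + r)"]) auto
  next
    case False
    have "g s \<le> c * 2 powr (1 + \<gamma>) * h \<bar>s\<bar>" for s
    proof -
      have "(1 + \<bar>s\<bar>) / 2 \<le> jap s" using add_mono[OF jap_ge_1[of s] abs_le_jap[of s]] by simp
      then have "jap s powr (- (1 + \<gamma>)) \<le> ((1 + \<bar>s\<bar>) / 2) powr (- (1 + \<gamma>))"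
        using gam_nonneg by (intro powr_mono2') auto
      also have "\<dots> = 2 powr (1 + \<gamma>) * (1 + \<bar>s\<bar>) powr (- (1 + \<gamma>))"
        by (simp only: powr_divide powr_minus) (simp add: field_simps)
      finally show ?thesis using False c_pos unfolding g_res_def h_def by simp
    qed
    then show ?thesis using c_pos by (intro exI[of _ "c * 2 powr (1 + \<gamma>)"]) auto
  qed
  then obtain K where K: "K > 0" "\<And>s. g s \<le> K * h \<bar>s\<bar>" by blast
  have "(\<integral>\<^sup>+s. ennreal (g s) \<partial>lborel) \<le> (\<integral>\<^sup>+s. ennreal K * (ennreal (h s) * indicator {0..} s + ennreal (h (-s)) * indicator {0..} (-s)) \<partial>lborel)"
  proof (intro nn_integral_mono)
    fix s :: real
    have "ennreal (g s) \<le> ennreal K * ennreal (h \<bar>s\<bar>)"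
      using K h_nn by (simp add: ennreal_mult[symmetric] ennreal_leI)
    also have "\<dots> \<le> ennreal K * (ennreal (h s) * indicator {0..} s + ennreal (h (-s)) * indicator {0..} (-s))"
      by (intro mult_left_mono) (auto simp: indicator_def abs_if)
    finally show "ennreal (g s) \<le> ennreal K * (ennreal (h s) * indicator {0..} s + ennreal (h (-s)) * indicator {0..} (-s))" .
  qed
  also have "\<dots> = ennreal K * ((\<integral>\<^sup>+x. ennreal (h x) * indicator {0..} x \<partial>lborel) + (\<integral>\<^sup>+x. ennreal (h (-x)) * indicator {0..} (-x) \<partial>lborel))"
    by (subst nn_integral_cmult; measurable; subst nn_integral_add; measurable)
  also have "(\<integral>\<^sup>+x. ennreal (h (-x)) * indicator {0..} (-x) \<partial>lborel) = (\<integral>\<^sup>+x. ennreal (h x) * indicator {0..} x \<partial>lborel)"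
    using nn_integral_real_affine[of "\<lambda>x. ennreal (h x) * indicator {0..} x" "-1" 0] by simp
  also have "ennreal K * ((\<integral>\<^sup>+x. ennreal (h x) * indicator {0..} x \<partial>lborel) + (\<integral>\<^sup>+x. ennreal (h x) * indicator {0..} x \<partial>lborel)) < \<infinity>"
    using fin by (simp add: ennreal_mult_less_top)
  finally show ?thesis .
qed

lemma integrable_g [simp]: "integrable lborel g"
  using nn_integral_g_finite by (intro integrableI_nonneg) auto

definition Phi :: "real \<Rightarrow> real" where
  "Phi s = (LINT x:{..s}|lborel. g x)"

lemma Phi_deriv: "(Phi has_real_derivative g s) (at s)"
  unfolding Phi_def[abs_def] by (rule has_derivative_set_integral_atMost) (auto intro: continuous_intros)

lemma Phi_nonneg: "0 \<le> Phi s"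
  unfolding Phi_def set_lebesgue_integral_def by (rule integral_nonneg_AE) simp

lemma Phi_le: "Phi s \<le> integral\<^sup>L lborel g"
  unfolding Phi_def set_lebesgue_integral_def
  by (rule integral_mono') (auto simp: indicator_def)

lemma continuous_on_Phi [continuous_intros]:
  "continuous_on S f \<Longrightarrow> continuous_on S (\<lambda>x. Phi (f x))"
  by (rule continuous_on_compose2[of UNIV Phi])
     (auto intro: DERIV_continuous_on[of UNIV Phi g] simp: Phi_deriv)

lemma Phi_MVT: "\<exists>z. \<bar>z - a\<bar> \<le> \<bar>b - a\<bar> \<and> \<bar>Phi a - Phi b\<bar> = g z * \<bar>a - b\<bar>"
proof (cases a b rule: linorder_cases)
  case less
  then obtain z where z: "a < z" "z < b" "Phi b - Phi a = (b - a) * g z"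
    using MVT2[of a b Phi g] Phi_deriv by blast
  then have "\<bar>Phi a - Phi b\<bar> = g z * \<bar>a - b\<bar>" using less by (simp add: abs_minus_commute[of "Phi a"] abs_mult)
  then show ?thesis using z by (intro exI[of _ z]) auto
next
  case greater
  then obtain z where z: "b < z" "z < a" "Phi a - Phi b = (a - b) * g z"
    using MVT2[of b a Phi g] Phi_deriv by blast
  then have "\<bar>Phi a - Phi b\<bar> = g z * \<bar>a - b\<bar>" using greater by (simp add: abs_mult)
  then show ?thesis using z by (intro exI[of _ z]) auto
qed simp

lemma ell_lower: "\<exists>e>0. \<forall>s. e \<le> \<l> s"
proof -
  obtain C where C: "C \<ge> 1" "\<And>x y w. 1 \<le> w \<Longrightarrow> jap x \<le> 2 * jap y * w \<Longrightarrow> \<l> x \<le> C * \<l> y * w"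
    using ell_submult[OF r_pos, of \<gamma>] by blast
  have "\<l> 0 / C \<le> \<l> s" for s
    using C(2)[of 1 0 s] C(1) jap_ge_1[of s] by (simp add: jap_def[of 0] field_simps)
  then show ?thesis using C(1) by (intro exI[of _ "\<l> 0 / C"]) auto
qed

text \<open>
  The increments of \<open>\<Phi>\<close> over a distance \<open>D\<close> are controlled by the value of \<open>g\<close> at either end.  For
  \<open>|a| \<ge> 2 D\<close> this is the mean value theorem, since \<open>g\<close> is then comparable on the whole interval.
  Otherwise \<open>g a\<close> is at least of order \<open>D\<^sup>-\<^sup>(\<^sup>1\<^sup>+\<^sup>\<gamma>\<^sup>) / \<ell>(D)\<close>, or of order 1 for \<open>D \<le> 1\<close>, and the bound
  says no more than that \<open>\<Phi>\<close> is bounded and Lipschitz.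
\<close>

lemma Phi_diff:
  "\<exists>C>0. \<forall>a b D. 0 < D \<longrightarrow> \<bar>a - b\<bar> \<le> D \<longrightarrow>
     \<bar>Phi a - Phi b\<bar> \<le> C * (D * (1 + D powr \<gamma>) * \<l> D * g a)"
proof -
  obtain Ce where Ce: "Ce \<ge> 1" "\<And>x y w. 1 \<le> w \<Longrightarrow> jap x \<le> 2 * jap y * w \<Longrightarrow> \<l> x \<le> Ce * \<l> y * w"
    using ell_submult[OF r_pos, of \<gamma>] by blast
  obtain Cg where Cg: "Cg > 0" "\<And>x y w. 1 \<le> w \<Longrightarrow> jap x \<le> 2 * jap y * w \<Longrightarrow> g y \<le> Cg * w\<^sup>2 * g x"
    using g_shift by blast
  obtain B where B: "B > 0" "\<And>s. g s \<le> B" using g_bounded by blast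
  obtain e where e: "e > 0" "\<And>s. e \<le> \<l> s" using ell_lower by blast
  define I where "I = integral\<^sup>L lborel g"
  have I: "0 \<le> I" "\<bar>Phi a - Phi b\<bar> \<le> I" for a b
    using Phi_nonneg[of a] Phi_nonneg[of b] Phi_le[of a] Phi_le[of b] unfolding I_def by auto
  (* q is the lower bound of \<ell>(D) g(a), up to the power of D, when a is at most of size 2 D. *)
  define q where "q = c / (16 * Ce)"
  have q: "q > 0" using c_pos Ce(1) by (simp add: q_def)
  define C where "C = Cg / e + (B + I) / q"
  have C: "Cg / e \<le> C" "B / q \<le> C" "I / q \<le> C" "C > 0"
    using Cg(1) e(1) q B(1) I(1) by (auto simp: C_def field_simps add_pos_nonneg)
  have "\<bar>Phi a - Phi b\<bar> \<le> C * (D * (1 + D powr \<gamma>) * \<l> D * g a)"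
    if D: "0 < D" and ab: "\<bar>a - b\<bar> \<le> D" for a b D
  proof (cases "2 * D \<le> \<bar>a\<bar>")
    case True
    obtain z where z: "\<bar>z - a\<bar> \<le> \<bar>b - a\<bar>" "\<bar>Phi a - Phi b\<bar> = g z * \<bar>a - b\<bar>" using Phi_MVT by blast
    have "\<bar>a\<bar> \<le> \<bar>2 * z\<bar>" using True z(1) ab by linarith
    then have "jap a \<le> 2 * jap z" using jap_mono[of a "2 * z"] jap_double[of z] by linarith
    then have "g z \<le> Cg * g a" using Cg(2)[of 1 a z] by simp
    then have "\<bar>Phi a - Phi b\<bar> \<le> (Cg * g a) * D" unfolding z(2) using ab Cg(1) by (intro mult_mono) auto
    also have "\<dots> = Cg / e * (D * 1 * e * g a)" using e(1) by simp
    also have "\<dots> \<le> C * (D * (1 + D powr \<gamma>) * \<l> D * g a)"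
      using C(1,4) D e by (intro mult_mono) auto
    finally show ?thesis .
  next
    case False
    then have "jap a \<le> jap (2 * D)" by (intro jap_mono) auto
    then have ja: "jap a \<le> 2 * jap D" using jap_double[of D] by linarith
    then have la: "\<l> a \<le> Ce * \<l> D" using Ce(2)[of 1 a D] by simp
    have "(4 * jap D powr (1 + \<gamma>)) \<ge> jap a powr (1 + \<gamma>)"
    proof -
      have "jap a powr (1 + \<gamma>) \<le> (2 * jap D) powr (1 + \<gamma>)" using ja gam_nonneg by (intro powr_mono2) auto
      also have "\<dots> = 2 powr (1 + \<gamma>) * jap D powr (1 + \<gamma>)" by (simp add: powr_mult)
      also have "2 powr (1 + \<gamma>) \<le> 2 powr 2" using gam_le_1 by (intro powr_mono) auto
      finally show ?thesis by (simp add: mult_right_mono)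
    qed
    then have "c / (4 * jap D powr (1 + \<gamma>) * (Ce * \<l> D)) \<le> c / (jap a powr (1 + \<gamma>) * \<l> a)"
      using la c_pos Ce(1) by (intro divide_left_mono mult_mono mult_pos_pos) auto
    also have "\<dots> = g a" unfolding g_res_eq powr_minus by (simp add: field_simps)
    finally have ga: "c / (4 * Ce) / jap D powr (1 + \<gamma>) \<le> \<l> D * g a"
      using Ce(1) less_imp_neq[OF ell_pos, of r \<gamma> D] by (simp add: field_simps)
    show ?thesis
    proof (cases "D \<le> 1")
      case True
      have "jap D \<le> 2" using jap_le[of D] True D by simp
      then have "jap D powr (1 + \<gamma>) \<le> 2 powr (1 + \<gamma>)" using gam_nonneg by (intro powr_mono2) auto
      also have "2 powr (1 + \<gamma>) \<le> 2 powr 2" using gam_le_1 by (intro powr_mono) auto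
      finally have j4: "jap D powr (1 + \<gamma>) \<le> 4" by simp
      have "q = c / (4 * Ce) / 4" by (simp add: q_def)
      also have "\<dots> \<le> c / (4 * Ce) / jap D powr (1 + \<gamma>)"
        using j4 c_pos Ce(1) by (intro divide_left_mono) auto
      finally have qq: "q \<le> \<l> D * g a" using ga by linarith
      obtain z where z: "\<bar>Phi a - Phi b\<bar> = g z * \<bar>a - b\<bar>" using Phi_MVT by blast
      have "\<bar>Phi a - Phi b\<bar> \<le> B * D" unfolding z using B ab by (intro mult_mono) auto
      also have "\<dots> = B / q * (D * 1 * q)" using q by simp
      also have "\<dots> \<le> C * (D * (1 + D powr \<gamma>) * (\<l> D * g a))"
        using C D q qq by (intro mult_mono) auto
      finally show ?thesis by (simp add: mult_ac)
    next
      case False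
      have "jap D \<le> 2 * D" using jap_le[of D] False D by simp
      then have "jap D powr (1 + \<gamma>) \<le> (2 * D) powr (1 + \<gamma>)" using gam_nonneg by (intro powr_mono2) auto
      also have "\<dots> = 2 powr (1 + \<gamma>) * D powr (1 + \<gamma>)" using D by (simp add: powr_mult)
      also have "2 powr (1 + \<gamma>) \<le> 2 powr 2" using gam_le_1 by (intro powr_mono) auto
      finally have j4: "jap D powr (1 + \<gamma>) \<le> 4 * (D * D powr \<gamma>)" using D by (simp add: powr_add mult_right_mono)
      have "q / (D * D powr \<gamma>) = c / (4 * Ce) / (4 * (D * D powr \<gamma>))" by (simp add: q_def)
      also have "\<dots> \<le> c / (4 * Ce) / jap D powr (1 + \<gamma>)"
        using j4 c_pos Ce(1) D by (intro divide_left_mono) auto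
      finally have qq: "q / (D * D powr \<gamma>) \<le> \<l> D * g a" using ga by linarith
      have "\<bar>Phi a - Phi b\<bar> \<le> I" by (rule I)
      also have "\<dots> = I / q * ((D * D powr \<gamma>) * (q / (D * D powr \<gamma>)))" using q D by simp
      also have "\<dots> \<le> C * (D * (1 + D powr \<gamma>) * (\<l> D * g a))"
        using C D q qq I(1) by (intro mult_mono mult_nonneg_nonneg) auto
      finally show ?thesis by (simp add: mult_ac)
    qed
  qed
  then show ?thesis using C(4) by blast
qed

section \<open>Sums over the resonant frequencies\<close>

text \<open>
  The coupling \<open>\<langle>n\<rangle>\<^sup>-\<^sup>3\<close> of the modes in the resonance weight.
\<close>

abbreviation b where "b n \<equiv> inverse (jap (real_of_int n) ^ 3)"

definition G :: "real \<Rightarrow> int \<Rightarrow> real \<Rightarrow> real" where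
  "G t k \<eta> = (\<Sum>\<^sub>\<infinity>n\<in>UNIV - {0::int}. g (t - \<eta> / of_int n) * b (k - n))"

text \<open>
  \<open>E\<close> is the exponent of \<open>m_res\<close> without the cutoff \<open>min 1 (t \<mu>\<^sup>1\<^sup>/\<^sup>3)\<close>, and \<open>G\<close> is its time derivative.
\<close>

definition E :: "real \<Rightarrow> int \<Rightarrow> real \<Rightarrow> real" where
  "E t k \<eta> = (LINT \<tau>:{..t}|lborel. G \<tau> k \<eta>)"

lemma m_res_eq: "m_res c r \<gamma> \<mu> t k \<eta> = exp (min 1 (t * \<mu> powr (1/3)) * E t k \<eta>)"
  by (simp add: m_res_def E_def G_def)

definition B2 :: real where "B2 = (\<Sum>\<^sub>\<infinity>n\<in>(UNIV::int set). inverse (jap (of_int n) ^ 2))"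

lemma shift_bij: "bij_betw (\<lambda>n::int. k - n) UNIV UNIV"
  by (rule bij_betw_byWitness[where f' = "\<lambda>n. k - n"]) auto

lemma sq_summable: "(\<lambda>n::int. inverse (jap (of_int (k - n)) ^ 2)) summable_on UNIV"
  using summable_on_reindex_bij_betw[OF shift_bij, of "\<lambda>n. inverse (jap (of_int n) ^ 2)" k] summable_jap_int
  by simp

lemma sq_sum: "(\<Sum>\<^sub>\<infinity>n\<in>UNIV. inverse (jap (of_int (k - n)) ^ 2)) = B2"
  using infsum_reindex_bij_betw[OF shift_bij, of "\<lambda>n. inverse (jap (of_int n) ^ 2)" k]
  by (simp add: B2_def)

lemma B2_pos: "0 < B2"
proof -
  have "inverse (jap (of_int 0) ^ 2) \<le> B2"
    unfolding B2_def using finite_sum_le_infsum[OF summable_jap_int, of "{0}"] by simp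
  moreover have "0 < inverse (jap (of_int 0) ^ 2)" by simp
  ultimately show ?thesis by linarith
qed

lemma b_le_sq: "b n \<le> inverse (jap (real_of_int n) ^ 2)"
  by (intro le_imp_inverse_le power_increasing) auto

text \<open>
  Sums over the modes are dominated by \<open>\<langle>k - n\<rangle>\<^sup>-\<^sup>2\<close>, whose sum does not depend on \<open>k\<close>.
\<close>

lemma summable_weight:
  assumes "\<And>n. \<bar>F n\<bar> \<le> K * inverse (jap (of_int (k - n)) ^ 2)"
  shows "F summable_on (A :: int set)"
proof -
  have "F summable_on UNIV"
  proof (rule abs_summable_summable)
    show "(\<lambda>n. norm (F n)) summable_on UNIV"
      by (rule summable_on_comparison_test[OF summable_on_cmult_right[OF sq_summable]])
         (use assms in auto)
  qed
  then show ?thesis by (rule summable_on_subset) auto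
qed

lemma infsum_weight:
  assumes "\<And>n. \<bar>F n\<bar> \<le> K * inverse (jap (of_int (k - n)) ^ 2)"
  shows "\<bar>infsum F (A :: int set)\<bar> \<le> K * B2"
proof -
  have s: "(\<lambda>n. \<bar>F n\<bar>) summable_on A"
    by (rule summable_weight[where K = K and k = k]) (use assms in auto)
  have K: "0 \<le> K" using order_trans[OF abs_ge_zero assms[of k]] by (simp add: jap_def)
  have "\<bar>infsum F A\<bar> \<le> infsum (\<lambda>n. \<bar>F n\<bar>) A"
    using norm_infsum_bound[of F A] s by simp
  also have "\<dots> \<le> infsum (\<lambda>n. K * inverse (jap (of_int (k - n)) ^ 2)) UNIV"
    by (rule infsum_mono_neutral) (use assms K s in \<open>auto intro!: summable_on_cmult_right sq_summable simp del: of_int_diff\<close>)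
  also have "\<dots> = K * B2" by (subst infsum_cmult_right') (simp add: sq_sum del: of_int_diff)
  finally show ?thesis .
qed

lemma G_term_bound: "\<exists>K>0. \<forall>t k \<eta> n. \<bar>g (t - \<eta> / of_int n) * b (k - n)\<bar> \<le> K * inverse (jap (of_int (k - n)) ^ 2)"
proof -
  obtain B where B: "B > 0" "\<And>s. g s \<le> B" using g_bounded by blast
  have "\<bar>g (t - \<eta> / of_int n) * b (k - n)\<bar> \<le> B * inverse (jap (of_int (k - n)) ^ 2)" for t k \<eta> n
    unfolding abs_mult using B b_le_sq[of "k - n"] by (intro mult_mono) auto
  then show ?thesis using B(1) by blast
qed

lemma G_summable: "(\<lambda>n. g (t - \<eta> / of_int n) * b (k - n)) summable_on A"
proof -
  obtain K where "\<forall>t k \<eta> n. \<bar>g (t - \<eta> / of_int n) * b (k - n)\<bar> \<le> K * inverse (jap (of_int (k - n)) ^ 2)"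
    using G_term_bound by blast
  then show ?thesis by (intro summable_weight[where K = K and k = k]) auto
qed

lemma G_nonneg [simp]: "0 \<le> G t k \<eta>"
  unfolding G_def by (rule infsum_nonneg) simp

lemma G_ge_term: "n \<noteq> 0 \<Longrightarrow> g (t - \<eta> / of_int n) * b (k - n) \<le> G t k \<eta>"
  unfolding G_def using finite_sum_le_infsum[OF G_summable, of "{n}" "UNIV - {0}" t \<eta> k] by simp

lemma b_shift: "b n \<le> 8 * jap (of_int j) ^ 3 * b (n + j)"
proof -
  have "jap (of_int (n + j)) ^ 3 \<le> (2 * jap (of_int n) * jap (of_int j)) ^ 3"
    using jap_add[of "of_int n" "of_int j"] by (intro power_mono) auto
  then show ?thesis by (simp add: field_simps power_mult_distrib)
qed

text \<open>
  Shifting the frequency by \<open>(j, \<zeta>)\<close> shifts each critical time \<open>\<eta> / n\<close> by at most \<open>|\<zeta>|\<close> and each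
  coupling by \<open>j\<close>.  The resonance sums at the input and the output frequency are therefore
  comparable, up to powers of the transporting frequency.
\<close>

lemma G_compare:
  "\<exists>C>0. \<forall>t k l \<eta> \<xi>. G t l \<xi> \<le> C * jap (of_int (k - l)) ^ 3 * (jap (\<eta> - \<xi>))\<^sup>2 * G t k \<eta>"
proof -
  obtain Cg where Cg: "Cg > 0" "\<And>x y w. 1 \<le> w \<Longrightarrow> jap x \<le> 2 * jap y * w \<Longrightarrow> g y \<le> Cg * w\<^sup>2 * g x"
    using g_shift by blast
  have "G t l \<xi> \<le> 8 * Cg * jap (of_int (k - l)) ^ 3 * (jap (\<eta> - \<xi>))\<^sup>2 * G t k \<eta>" for t k l \<eta> \<xi>
  proof -
    define K where "K = 8 * Cg * jap (of_int (k - l)) ^ 3 * (jap (\<eta> - \<xi>))\<^sup>2"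
    have "g (t - \<xi> / of_int n) * b (l - n) \<le> K * (g (t - \<eta> / of_int n) * b (k - n))" if "n \<noteq> 0" for n :: int
    proof -
      have e: "t - \<eta> / of_int n = (t - \<xi> / of_int n) + - ((\<eta> - \<xi>) / of_int n)"
        by (simp add: field_simps diff_divide_distrib)
      have "\<bar>(\<eta> - \<xi>) / of_int n\<bar> \<le> \<bar>\<eta> - \<xi>\<bar>"
      proof -
        have "1 \<le> \<bar>real_of_int n\<bar>" using that by linarith
        then have "\<bar>\<eta> - \<xi>\<bar> / \<bar>real_of_int n\<bar> \<le> \<bar>\<eta> - \<xi>\<bar> / 1" by (intro divide_left_mono) auto
        then show ?thesis by simp
      qed
      then have "jap ((\<eta> - \<xi>) / of_int n) \<le> jap (\<eta> - \<xi>)" by (rule jap_mono)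
      then have "jap (t - \<eta> / of_int n) \<le> 2 * jap (t - \<xi> / of_int n) * jap (\<eta> - \<xi>)"
        using jap_add[of "t - \<xi> / of_int n" "- ((\<eta> - \<xi>) / of_int n)"] unfolding e jap_minus
        by (meson order_trans mult_left_mono jap_nonneg zero_le_mult_iff zero_le_numeral)
      then have "g (t - \<xi> / of_int n) \<le> Cg * (jap (\<eta> - \<xi>))\<^sup>2 * g (t - \<eta> / of_int n)"
        by (intro Cg(2)) auto
      moreover have "b (l - n) \<le> 8 * jap (of_int (k - l)) ^ 3 * b (k - n)"
        using b_shift[of "l - n" "k - l"] by (simp add: algebra_simps)
      ultimately have "g (t - \<xi> / of_int n) * b (l - n) \<le>
         (Cg * (jap (\<eta> - \<xi>))\<^sup>2 * g (t - \<eta> / of_int n)) * (8 * jap (of_int (k - l)) ^ 3 * b (k - n))"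
        using Cg(1) by (intro mult_mono) auto
      then show ?thesis by (simp add: K_def mult_ac)
    qed
    then have "G t l \<xi> \<le> (\<Sum>\<^sub>\<infinity>n\<in>UNIV - {0::int}. K * (g (t - \<eta> / of_int n) * b (k - n)))"
      unfolding G_def by (intro infsum_mono G_summable summable_on_cmult_right) auto
    also have "\<dots> = K * G t k \<eta>" unfolding G_def by (rule infsum_cmult_right')
    finally show ?thesis by (simp add: K_def)
  qed
  then show ?thesis using Cg(1) by (intro exI[of _ "8 * Cg"]) auto
qed

lemma continuous_on_infsum_weight:
  fixes f :: "int \<Rightarrow> 'x::topological_space \<Rightarrow> real"
  assumes "\<And>n. continuous_on UNIV (f n)"
    and "\<And>n x. \<bar>f n x\<bar> \<le> K * inverse (jap (of_int (k - n)) ^ 2)"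
  shows "continuous_on UNIV (\<lambda>x. \<Sum>\<^sub>\<infinity>n\<in>A. f n x)"
proof (rule uniform_limit_theorem)
  show "uniform_limit UNIV (\<lambda>X x. \<Sum>n\<in>X. f n x) (\<lambda>x. \<Sum>\<^sub>\<infinity>n\<in>A. f n x) (finite_subsets_at_top A)"
    by (rule Weierstrass_m_test_general[where M = "\<lambda>n. K * inverse (jap (of_int (k - n)) ^ 2)"])
       (use assms(2) in \<open>auto intro!: summable_on_cmult_right summable_on_subset[OF sq_summable] simp del: of_int_diff\<close>)
  show "\<forall>\<^sub>F X in finite_subsets_at_top A. continuous_on UNIV (\<lambda>x. \<Sum>n\<in>X. f n x)"
    using assms(1) by (intro always_eventually allI continuous_on_sum)
qed auto

lemma continuous_G: "continuous_on UNIV (\<lambda>p. G (fst p) k (snd p))"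
proof -
  obtain K where "\<forall>t k \<eta> n. \<bar>g (t - \<eta> / of_int n) * b (k - n)\<bar> \<le> K * inverse (jap (of_int (k - n)) ^ 2)"
    using G_term_bound by blast
  then show ?thesis unfolding G_def
    by (intro continuous_on_infsum_weight[where K = K and k = k])
       (auto intro!: continuous_intros simp: divide_inverse)
qed

text \<open>
  Enumerates the modes, so that termwise integration of series applies.
\<close>

lemma sums_infsum_nonzero:
  fixes F :: "int \<Rightarrow> real"
  assumes "F summable_on (UNIV - {0})"
  defines "e \<equiv> from_nat_into (UNIV - {0::int})"
  shows "(\<lambda>i. F (e i)) sums (\<Sum>\<^sub>\<infinity>n\<in>UNIV - {0}. F n)"
proof -
  have "infinite (UNIV - {0::int})" by (simp add: infinite_UNIV_int)
  then have "bij_betw e UNIV (UNIV - {0})" unfolding e_def by (intro bij_betw_from_nat_into) auto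
  then have "((\<lambda>i. F (e i)) has_sum (\<Sum>\<^sub>\<infinity>n\<in>UNIV - {0}. F n)) UNIV"
    by (subst has_sum_reindex_bij_betw) (use assms in auto)
  then show ?thesis by (rule has_sum_imp_sums)
qed

lemma integral_g_shift:
  "integrable lborel (\<lambda>\<tau>. g (\<tau> - a))" "(LINT \<tau>|lborel. g (\<tau> - a)) = integral\<^sup>L lborel g"
  "(LINT \<tau>:{..t}|lborel. g (\<tau> - a)) = Phi (t - a)"
proof -
  show "integrable lborel (\<lambda>\<tau>. g (\<tau> - a))"
    using lborel_integrable_real_affine_iff[of 1 g "-a"] integrable_g by (simp add: add.commute)
  show "(LINT \<tau>|lborel. g (\<tau> - a)) = integral\<^sup>L lborel g"
    using lborel_integral_real_affine[of 1 g "-a"] by (simp add: add.commute)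
  have "indicat_real {..t - a} (x - a) = indicat_real {..t} x" for x by (auto simp: indicator_def)
  then show "(LINT \<tau>:{..t}|lborel. g (\<tau> - a)) = Phi (t - a)"
    unfolding Phi_def set_lebesgue_integral_def
    using lborel_integral_real_affine[of 1 "\<lambda>s. indicat_real {..t - a} s *\<^sub>R g s" "-a"]
    by (simp add: add.commute)
qed

lemma b_summable: "(\<lambda>n. b (k - n)) summable_on A"
  by (rule summable_weight[where K = 1 and k = k]) (use b_le_sq in \<open>auto simp del: of_int_diff\<close>)

lemma Phi_term_bound: "\<bar>Phi (t - \<eta> / of_int n) * b (k - n)\<bar> \<le> integral\<^sup>L lborel g * inverse (jap (of_int (k - n)) ^ 2)"
  unfolding abs_mult using Phi_nonneg Phi_le b_le_sq[of "k - n"]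
  by (intro mult_mono) (auto simp del: of_int_diff)

lemma G_integrable: "integrable lborel (\<lambda>\<tau>. G \<tau> k \<eta>)"
  and E_sum: "E t k \<eta> = (\<Sum>\<^sub>\<infinity>n\<in>UNIV - {0::int}. Phi (t - \<eta> / of_int n) * b (k - n))"
proof -
  define e where "e = from_nat_into (UNIV - {0::int})"
  define f where "f = (\<lambda>i \<tau>. g (\<tau> - \<eta> / of_int (e i)) * b (k - e i))"
  define I where "I = integral\<^sup>L lborel g"
  have Geq: "G \<tau> k \<eta> = (\<Sum>i. f i \<tau>)" for \<tau>
    unfolding G_def f_def e_def by (rule sums_unique, rule sums_infsum_nonzero, rule G_summable)
  have fsum: "summable (\<lambda>i. f i \<tau>)" for \<tau>
    unfolding f_def e_def by (rule sums_summable, rule sums_infsum_nonzero, rule G_summable)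
  have bsum: "summable (\<lambda>i. b (k - e i))"
    unfolding e_def by (rule sums_summable, rule sums_infsum_nonzero, rule b_summable)
  have f_nn: "0 \<le> f i \<tau>" for i \<tau> by (simp add: f_def)
  have f_int: "integrable lborel (f i)" for i
    unfolding f_def using integral_g_shift(1) by simp
  have f_I: "(LINT \<tau>|lborel. f i \<tau>) = I * b (k - e i)" for i
    unfolding f_def I_def using integral_g_shift(2) by simp
  have Isum: "summable (\<lambda>i. LINT \<tau>|lborel. norm (f i \<tau>))"
    using f_nn f_I bsum by (simp add: summable_mult)
  show "integrable lborel (\<lambda>\<tau>. G \<tau> k \<eta>)"
    unfolding Geq by (rule integrable_suminf[OF f_int]) (use f_nn fsum Isum in auto)
  have Phisum: "(\<lambda>n. Phi (t - \<eta> / of_int n) * b (k - n)) summable_on UNIV - {0}"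
    by (rule summable_weight[OF Phi_term_bound])
  have "E t k \<eta> = (LINT \<tau>|lborel. (\<Sum>i. indicator {..t} \<tau> * f i \<tau>))"
    unfolding E_def set_lebesgue_integral_def Geq using fsum by (simp add: suminf_mult)
  also have "\<dots> = (\<Sum>i. (LINT \<tau>|lborel. indicator {..t} \<tau> * f i \<tau>))"
  proof (rule integral_suminf)
    show int: "integrable lborel (\<lambda>\<tau>. indicator {..t} \<tau> * f i \<tau>)" for i
      using integrable_mult_indicator[OF _ f_int, of "{..t}" i] by simp
    show "AE \<tau> in lborel. summable (\<lambda>i. norm (indicat_real {..t} \<tau> * f i \<tau>))"
      using fsum f_nn by (auto simp: abs_mult intro: summable_mult)
    show "summable (\<lambda>i. LINT \<tau>|lborel. norm (indicat_real {..t} \<tau> * f i \<tau>))"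
    proof (rule summable_comparison_test'[OF Isum, of 0])
      fix i :: nat
      have "(LINT \<tau>|lborel. norm (indicat_real {..t} \<tau> * f i \<tau>)) \<le> (LINT \<tau>|lborel. norm (f i \<tau>))"
        by (rule integral_mono) (use int f_int in \<open>auto simp: indicator_def\<close>)
      then show "norm (LINT \<tau>|lborel. norm (indicat_real {..t} \<tau> * f i \<tau>)) \<le> (LINT \<tau>|lborel. norm (f i \<tau>))"
        by (simp add: integral_nonneg_AE)
    qed
  qed
  also have "\<dots> = (\<Sum>i. Phi (t - \<eta> / of_int (e i)) * b (k - e i))"
  proof (rule arg_cong[where f = suminf], rule ext)
    fix i
    have "(LINT \<tau>|lborel. indicator {..t} \<tau> * f i \<tau>) = (LINT \<tau>|lborel. (indicator {..t} \<tau> * g (\<tau> - \<eta> / of_int (e i))) * b (k - e i))"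
      by (simp add: f_def mult_ac)
    also have "\<dots> = Phi (t - \<eta> / of_int (e i)) * b (k - e i)"
      using integral_g_shift(3)[of t "\<eta> / of_int (e i)"] unfolding set_lebesgue_integral_def by simp
    finally show "(LINT \<tau>|lborel. indicator {..t} \<tau> * f i \<tau>) = Phi (t - \<eta> / of_int (e i)) * b (k - e i)" .
  qed
  also have "\<dots> = (\<Sum>\<^sub>\<infinity>n\<in>UNIV - {0::int}. Phi (t - \<eta> / of_int n) * b (k - n))"
    unfolding e_def by (rule sums_unique[symmetric], rule sums_infsum_nonzero, rule Phisum)
  finally show "E t k \<eta> = (\<Sum>\<^sub>\<infinity>n\<in>UNIV - {0::int}. Phi (t - \<eta> / of_int n) * b (k - n))" .
qed

lemma E_deriv: "((\<lambda>s. E s k \<eta>) has_real_derivative G t k \<eta>) (at t)"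
  unfolding E_def
  by (rule has_derivative_set_integral_atMost[OF G_integrable])
     (rule continuous_on_compose2[OF continuous_G, of UNIV "\<lambda>x. (x, \<eta>)", simplified], auto intro!: continuous_intros)

lemma E_nonneg: "0 \<le> E t k \<eta>"
  unfolding E_sum by (rule infsum_nonneg) (simp add: Phi_nonneg)

lemma E_summable: "(\<lambda>n. Phi (t - \<eta> / of_int n) * b (k - n)) summable_on A"
  by (rule summable_weight[OF Phi_term_bound])

lemma E_bounded: "E t k \<eta> \<le> integral\<^sup>L lborel g * B2"
proof -
  have "\<bar>E t k \<eta>\<bar> \<le> integral\<^sup>L lborel g * B2"
    unfolding E_sum by (rule infsum_weight, rule Phi_term_bound)
  then show ?thesis by simp
qed

lemma continuous_E: "continuous_on UNIV (\<lambda>p. E (fst p) k (snd p))"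
  unfolding E_sum
  by (rule continuous_on_infsum_weight[where K = "integral\<^sup>L lborel g" and k = k])
     (use Phi_term_bound in \<open>auto intro!: continuous_intros simp: divide_inverse\<close>)

lemma infsum_diff':
  fixes f h :: "'z \<Rightarrow> real"
  assumes "f summable_on A" "h summable_on A"
  shows "infsum f A - infsum h A = (\<Sum>\<^sub>\<infinity>x\<in>A. f x - h x)"
  using infsum_add[OF assms(1) summable_on_uminus[THEN iffD2, OF assms(2)]]
  by (simp add: infsum_uminus)

text \<open>
  For \<open>\<eta>\<close> varying in a fixed mode \<open>k\<close> the critical time \<open>\<eta> / n\<close> moves by \<open>|\<eta> - \<xi>| / |n|\<close>, and the coupling
  replaces \<open>1 / |n|\<close> by \<open>\<langle>k - n\<rangle> / |k|\<close>.
\<close>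

lemma E_Lipschitz: "\<exists>C>0. \<forall>t k \<eta> \<xi>. k \<noteq> 0 \<longrightarrow> \<bar>E t k \<eta> - E t k \<xi>\<bar> \<le> C * (\<bar>\<eta> - \<xi>\<bar> / \<bar>of_int k\<bar>)"
proof -
  obtain B where B: "B > 0" "\<And>s. g s \<le> B" using g_bounded by blast
  have "\<bar>E t k \<eta> - E t k \<xi>\<bar> \<le> (2 * B * B2) * (\<bar>\<eta> - \<xi>\<bar> / \<bar>of_int k\<bar>)" if k: "k \<noteq> 0" for t k \<eta> \<xi>
  proof -
    have "\<bar>(\<Sum>\<^sub>\<infinity>n\<in>UNIV - {0::int}. Phi (t - \<eta> / of_int n) * b (k - n) - Phi (t - \<xi> / of_int n) * b (k - n))\<bar>
        \<le> (2 * B * (\<bar>\<eta> - \<xi>\<bar> / \<bar>of_int k\<bar>)) * B2"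
    proof (rule infsum_weight)
      fix n :: int
      let ?j = "jap (of_int (k - n))"
      obtain z where z: "\<bar>Phi (t - \<eta> / of_int n) - Phi (t - \<xi> / of_int n)\<bar> = g z * \<bar>(t - \<eta> / of_int n) - (t - \<xi> / of_int n)\<bar>"
        using Phi_MVT by blast
      have "\<bar>(t - \<eta> / of_int n) - (t - \<xi> / of_int n)\<bar> = \<bar>\<eta> - \<xi>\<bar> / \<bar>of_int n\<bar>"
        by (simp add: abs_minus_commute[of \<eta>] diff_divide_distrib[symmetric] abs_divide)
      then have 1: "\<bar>Phi (t - \<eta> / of_int n) - Phi (t - \<xi> / of_int n)\<bar> \<le> B * (\<bar>\<eta> - \<xi>\<bar> / \<bar>of_int n\<bar>)"
        unfolding z using B by (intro mult_mono) auto
      have 2: "inverse \<bar>real_of_int n\<bar> \<le> 2 * ?j * inverse \<bar>of_int k\<bar>"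
      proof (cases "n = 0")
        case False
        have n1: "1 \<le> \<bar>real_of_int n\<bar>" using False by linarith
        have "\<bar>real_of_int k\<bar> \<le> \<bar>real_of_int n\<bar> + \<bar>real_of_int (k - n)\<bar>" by simp
        moreover have "\<bar>real_of_int (k - n)\<bar> \<le> \<bar>real_of_int n\<bar> * ?j"
          using mult_mono[OF n1 abs_le_jap[of "of_int (k - n)"]] by simp
        moreover have "\<bar>real_of_int n\<bar> \<le> \<bar>real_of_int n\<bar> * ?j" by (simp add: mult_le_cancel_left1)
        ultimately have "\<bar>real_of_int k\<bar> \<le> 2 * (\<bar>real_of_int n\<bar> * ?j)" by linarith
        then show ?thesis using n1 k by (simp add: field_simps)
      qed simp
      have "\<bar>Phi (t - \<eta> / of_int n) * b (k - n) - Phi (t - \<xi> / of_int n) * b (k - n)\<bar>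
          = \<bar>Phi (t - \<eta> / of_int n) - Phi (t - \<xi> / of_int n)\<bar> * b (k - n)"
        by (simp add: left_diff_distrib[symmetric] abs_mult)
      also have "\<dots> \<le> B * \<bar>\<eta> - \<xi>\<bar> * inverse \<bar>real_of_int n\<bar> * b (k - n)"
        using 1 by (intro mult_right_mono) (auto simp: divide_inverse mult_ac)
      also have "\<dots> \<le> B * \<bar>\<eta> - \<xi>\<bar> * (2 * ?j * inverse \<bar>of_int k\<bar>) * b (k - n)"
        using 2 B by (intro mult_right_mono mult_left_mono) auto
      also have "\<dots> = 2 * B * (\<bar>\<eta> - \<xi>\<bar> / \<bar>of_int k\<bar>) * inverse (?j ^ 2)"
        by (simp add: field_simps power2_eq_square power3_eq_cube)
      finally show "\<bar>Phi (t - \<eta> / of_int n) * b (k - n) - Phi (t - \<xi> / of_int n) * b (k - n)\<bar>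
         \<le> 2 * B * (\<bar>\<eta> - \<xi>\<bar> / \<bar>of_int k\<bar>) * inverse (?j ^ 2)" .
    qed
    then show ?thesis unfolding E_sum by (subst infsum_diff'[OF E_summable E_summable]) (simp add: mult_ac)
  qed
  then show ?thesis using B(1) B2_pos by (intro exI[of _ "2 * B * B2"]) auto
qed

text \<open>
  Value 0 at \<open>n = 0\<close>, so that the sum defining \<open>E\<close> extends over all integers and may be reindexed.
\<close>

definition Phi0 :: "real \<Rightarrow> real \<Rightarrow> int \<Rightarrow> real" where
  "Phi0 t \<xi> n = (if n = 0 then 0 else Phi (t - \<xi> / of_int n))"

lemma Phi0_bounds: "0 \<le> Phi0 t \<xi> n" "Phi0 t \<xi> n \<le> integral\<^sup>L lborel g"
  unfolding Phi0_def using Phi_nonneg Phi_le order_trans[OF Phi_nonneg Phi_le] by auto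

lemma Phi0_summable: "(\<lambda>n. b (k - n) * Phi0 t \<xi> (n + j)) summable_on A"
proof (rule summable_weight[where k = k and K = "integral\<^sup>L lborel g"])
  show "\<bar>b (k - n) * Phi0 t \<xi> (n + j)\<bar> \<le> integral\<^sup>L lborel g * inverse (jap (of_int (k - n)) ^ 2)" for n
    using mult_mono[OF Phi0_bounds(2)[of t \<xi> "n + j"] b_le_sq[of "k - n"]] Phi0_bounds[of t \<xi> "n + j"]
      order_trans[OF Phi_nonneg Phi_le]
    by (simp add: abs_mult mult_ac del: of_int_diff)
qed

lemma E_eq_Phi0: "E t k \<xi> = (\<Sum>\<^sub>\<infinity>n\<in>(UNIV::int set). b (k - j - n) * Phi0 t \<xi> (n + j))"
proof -
  have bij: "bij_betw (\<lambda>n::int. n + j) UNIV UNIV"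
    by (rule bij_betw_byWitness[where f' = "\<lambda>n. n - j"]) auto
  have "E t k \<xi> = (\<Sum>\<^sub>\<infinity>n\<in>(UNIV::int set). b (k - n) * Phi0 t \<xi> n)"
    unfolding E_sum by (rule infsum_cong_neutral) (auto simp: Phi0_def)
  also have "\<dots> = (\<Sum>\<^sub>\<infinity>n\<in>(UNIV::int set). b (k - (n + j)) * Phi0 t \<xi> (n + j))"
    by (rule infsum_reindex_bij_betw[OF bij, symmetric])
  finally show ?thesis by (simp add: algebra_simps)
qed

text \<open>
  The variation of \<open>E\<close> with the mode at a fixed \<open>\<xi>\<close>.  Reindexing the sum by \<open>j = k - l\<close> turns it into a
  variation of the critical times \<open>\<xi> / n\<close> and \<open>\<xi> / (n + j)\<close> with the same coupling to \<open>l\<close>.  Modes \<open>n\<close>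
  that are not comparable to \<open>l\<close> are weakly coupled and contribute a constant; for the others the
  two critical times differ by at most \<open>16 t \<langle>j\<rangle>\<^sup>2 / |l|\<close>, and \<open>Phi_diff\<close> produces one term of \<open>G\<close>.
\<close>

lemma E_shift:
  "\<exists>K>0. \<forall>t k l \<xi>. 1 \<le> t \<longrightarrow> k \<noteq> 0 \<longrightarrow> l \<noteq> 0 \<longrightarrow> \<bar>\<xi>\<bar> \<le> 2 * \<bar>of_int l\<bar> * t \<longrightarrow>
     \<bar>of_int l\<bar> * t powr (- \<gamma>) * \<bar>E t k \<xi> - E t l \<xi>\<bar>
       \<le> K * jap (of_int (k - l)) ^ 4 * (1 + t * \<l> t * G t l \<xi>)"
proof -
  obtain Ce where Ce: "Ce \<ge> 1" "\<And>x y w. 1 \<le> w \<Longrightarrow> jap x \<le> 2 * jap y * w \<Longrightarrow> \<l> x \<le> Ce * \<l> y * w"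
    using ell_submult[OF r_pos, of \<gamma>] by blast
  obtain Cp where Cp: "Cp > 0" "\<And>a b D. 0 < D \<Longrightarrow> \<bar>a - b\<bar> \<le> D \<Longrightarrow>
     \<bar>Phi a - Phi b\<bar> \<le> Cp * (D * (1 + D powr \<gamma>) * \<l> D * g a)"
    using Phi_diff by blast
  define I where "I = integral\<^sup>L lborel g"
  have I: "0 \<le> I" unfolding I_def using Phi_nonneg Phi_le by (rule order_trans)
  (* The first summand comes from the modes not comparable to l, the second from Phi_diff with D =
     16 t J^2 / |l|. *)
  define K where "K = 2 * I * B2 + 16 * Cp * 32 * Ce"
  have K: "2 * I * B2 \<le> K" "16 * Cp * 32 * Ce \<le> K" "K > 0"
    using Cp(1) Ce(1) I B2_pos by (auto simp: K_def add_nonneg_pos)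
  have "\<bar>of_int l\<bar> * t powr (- \<gamma>) * \<bar>E t k \<xi> - E t l \<xi>\<bar>
       \<le> K * jap (of_int (k - l)) ^ 4 * (1 + t * \<l> t * G t l \<xi>)"
    if t: "1 \<le> t" and k: "k \<noteq> 0" and l: "l \<noteq> 0" and xi: "\<bar>\<xi>\<bar> \<le> 2 * \<bar>of_int l\<bar> * t" for t k l \<xi>
  proof -
    define j where "j = k - l"
    define J where "J = jap (of_int j)"
    have J: "1 \<le> J" "\<bar>real_of_int j\<bar> \<le> J" unfolding J_def by (simp_all add: abs_le_jap)
    define P where "P = \<bar>of_int l\<bar> * t powr (- \<gamma>)"
    have tg: "t powr (- \<gamma>) \<le> 1" "0 < t powr (- \<gamma>)"
      using t gam_nonneg powr_mono[of "-\<gamma>" 0 t] by auto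
    have P0: "0 \<le> P" by (simp add: P_def)
    define X where "X = 16 * Cp * 32 * Ce * J ^ 4 * (t * \<l> t)"
    have X0: "0 \<le> X" using Cp(1) Ce(1) J(1) t by (simp add: X_def)
    (* u majorizes the weakly coupled modes, v the others. *)
    define u where "u = (\<lambda>n. (2 * I * J) * inverse (jap (of_int (l - n)) ^ 2))"
    define v where "v = (\<lambda>n::int. if n = 0 then 0 else X * (g (t - \<xi> / of_int n) * b (l - n)))"
    have vsum: "v summable_on UNIV" "infsum v UNIV = X * G t l \<xi>"
    proof -
      have s: "(\<lambda>n. X * (g (t - \<xi> / of_int n) * b (l - n))) summable_on UNIV - {0}"
        by (intro summable_on_cmult_right G_summable)
      show "v summable_on UNIV"
        using s by (rule summable_on_cong_neutral[THEN iffD1, rotated -1]) (auto simp: v_def)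
      have "infsum v UNIV = infsum (\<lambda>n. X * (g (t - \<xi> / of_int n) * b (l - n))) (UNIV - {0})"
        by (rule infsum_cong_neutral) (auto simp: v_def)
      then show "infsum v UNIV = X * G t l \<xi>" by (simp only: infsum_cmult_right' G_def)
    qed
    have usum: "u summable_on UNIV" "infsum u UNIV = 2 * I * J * B2"
      unfolding u_def by (intro summable_on_cmult_right sq_summable, subst infsum_cmult_right', simp add: sq_sum del: of_int_diff)
    have pointwise: "\<bar>P * (b (l - n) * Phi0 t \<xi> (n + j) - b (l - n) * Phi0 t \<xi> n)\<bar> \<le> u n + v n" for n
    proof -
      let ?L = "jap (of_int (l - n))"
      have e: "\<bar>P * (b (l - n) * Phi0 t \<xi> (n + j) - b (l - n) * Phi0 t \<xi> n)\<bar> = P * (b (l - n) * \<bar>Phi0 t \<xi> n - Phi0 t \<xi> (n + j)\<bar>)"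
        using P0 by (simp add: right_diff_distrib[symmetric] abs_mult abs_minus_commute del: of_int_diff)
      have v0: "0 \<le> v n" using X0 by (simp add: v_def)
      have u0: "0 \<le> u n" using I J(1) by (simp add: u_def)
      have ln: "\<bar>real_of_int l\<bar> \<le> \<bar>real_of_int n\<bar> + ?L"
        using abs_le_jap[of "of_int (l - n)"] by linarith
      show ?thesis
      proof (cases "n \<noteq> 0 \<and> n + j \<noteq> 0 \<and> \<bar>real_of_int l\<bar> \<le> 2 * \<bar>real_of_int n\<bar>")
        case False
        have "\<bar>real_of_int l\<bar> \<le> 2 * J * ?L"
        proof -
          have "\<bar>real_of_int l\<bar> \<le> 2 * ?L \<or> \<bar>real_of_int l\<bar> \<le> J + ?L"
            using False ln J by (cases "n = 0"; cases "n + j = 0") (auto simp: add_eq_0_iff)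
          moreover have "2 * 1 * ?L \<le> 2 * J * ?L" using J by (intro mult_mono) auto
          moreover have "J * 1 \<le> J * ?L" "1 * ?L \<le> J * ?L" using J by (intro mult_mono; auto)+
          ultimately show ?thesis by linarith
        qed
        then have "P * b (l - n) \<le> (2 * J * ?L) * 1 * b (l - n)"
          unfolding P_def using tg J by (intro mult_mono) auto
        also have "\<dots> = 2 * J * inverse (?L ^ 2)" by (simp add: field_simps power2_eq_square power3_eq_cube)
        finally have pb: "P * b (l - n) \<le> 2 * J * inverse (?L ^ 2)" .
        have "P * b (l - n) * \<bar>Phi0 t \<xi> n - Phi0 t \<xi> (n + j)\<bar> \<le> (2 * J * inverse (?L ^ 2)) * I"
          using Phi0_bounds[of t \<xi> n] Phi0_bounds[of t \<xi> "n + j"] J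
          by (intro mult_mono[OF pb]) (auto simp: I_def[symmetric] simp del: of_int_diff)
        then show ?thesis unfolding e using v0 by (simp add: u_def mult_ac del: of_int_diff)
      next
        case True
        then have n: "n \<noteq> 0" "n + j \<noteq> 0" "\<bar>real_of_int l\<bar> \<le> 2 * \<bar>real_of_int n\<bar>" by auto
        define D where "D = 16 * t * J\<^sup>2 / \<bar>of_int l\<bar>"
        have D0: "0 < D" using t J l by (simp add: D_def)
        have l1: "1 \<le> \<bar>real_of_int l\<bar>" using l by linarith
        have DleJ: "D \<le> 16 * J\<^sup>2 * t"
          unfolding D_def using l1 t by (simp add: divide_le_eq mult_le_cancel_left1)
        have nj1: "1 \<le> \<bar>real_of_int (n + j)\<bar>" using n(2) by linarith
        have nn: "\<bar>real_of_int n\<bar> \<le> 2 * J * \<bar>real_of_int (n + j)\<bar>"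
        proof -
          define m where "m = \<bar>real_of_int (n + j)\<bar>"
          have "\<bar>real_of_int n\<bar> \<le> m + J" unfolding m_def using J(2) by linarith
          moreover have "J * 1 \<le> J * m" "1 * m \<le> J * m"
            using J nj1 unfolding m_def by (intro mult_mono; auto)+
          ultimately have "\<bar>real_of_int n\<bar> \<le> 2 * J * m" by linarith
          then show ?thesis by (simp only: m_def)
        qed
        have dist: "\<bar>(t - \<xi> / of_int n) - (t - \<xi> / of_int (n + j))\<bar> \<le> D"
        proof -
          have "(t - \<xi> / of_int n) - (t - \<xi> / of_int (n + j)) = - (\<xi> * of_int j / (of_int n * of_int (n + j)))"
            using n by (simp add: field_simps)
          then have "\<bar>(t - \<xi> / of_int n) - (t - \<xi> / of_int (n + j))\<bar> = \<bar>\<xi>\<bar> * \<bar>of_int j\<bar> / (\<bar>of_int n\<bar> * \<bar>of_int (n + j)\<bar>)"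
            by (simp add: abs_mult abs_divide del: of_int_add)
          also have "\<dots> \<le> D"
          proof -
            have "\<bar>\<xi>\<bar> * \<bar>real_of_int j\<bar> * \<bar>of_int l\<bar> \<le> (2 * \<bar>of_int l\<bar> * t) * J * \<bar>of_int l\<bar>"
              using xi J t by (intro mult_mono) auto
            also have "\<dots> \<le> (2 * (2 * \<bar>of_int n\<bar>) * t) * J * (2 * \<bar>of_int n\<bar>)"
              using n(3) J t by (intro mult_mono) auto
            also have "\<dots> = 8 * t * J * \<bar>of_int n\<bar> * \<bar>of_int n\<bar>" by simp
            also have "\<dots> \<le> 8 * t * J * \<bar>of_int n\<bar> * (2 * J * \<bar>of_int (n + j)\<bar>)"
              using nn J t by (intro mult_left_mono) auto
            finally have "\<bar>\<xi>\<bar> * \<bar>real_of_int j\<bar> * \<bar>of_int l\<bar> \<le> 16 * t * J\<^sup>2 * (\<bar>of_int n\<bar> * \<bar>of_int (n + j)\<bar>)"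
              by (simp add: power2_eq_square mult_ac del: of_int_add)
            then show ?thesis unfolding D_def using l1 nj1 n(1) l
              by (simp add: divide_le_eq le_divide_eq mult_ac del: of_int_add)
          qed
          finally show ?thesis .
        qed
        have "P * \<bar>Phi0 t \<xi> n - Phi0 t \<xi> (n + j)\<bar> \<le> P * (Cp * (D * (1 + D powr \<gamma>) * \<l> D * g (t - \<xi> / of_int n)))"
          using Cp(2)[OF D0 dist] n P0 unfolding Phi0_def by (intro mult_left_mono) auto
        also have "\<dots> = Cp * (\<bar>of_int l\<bar> * D) * (t powr (- \<gamma>) * (1 + D powr \<gamma>)) * \<l> D * g (t - \<xi> / of_int n)"
          by (simp add: P_def mult_ac)
        also have "\<bar>of_int l\<bar> * D = 16 * t * J\<^sup>2" using l by (simp add: D_def)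
        also have "Cp * (16 * t * J\<^sup>2) * (t powr (- \<gamma>) * (1 + D powr \<gamma>)) * \<l> D * g (t - \<xi> / of_int n)
           \<le> Cp * (16 * t * J\<^sup>2) * (32 * Ce * J\<^sup>2 * \<l> t) * g (t - \<xi> / of_int n)"
        proof -
          have J2: "1 \<le> J\<^sup>2" using J by simp
          have "D powr \<gamma> \<le> (16 * J\<^sup>2 * t) powr \<gamma>" using DleJ D0 gam_nonneg by (intro powr_mono2) auto
          also have "\<dots> = (16 * J\<^sup>2) powr \<gamma> * t powr \<gamma>" using J t by (simp add: powr_mult)
          finally have "t powr (- \<gamma>) * D powr \<gamma> \<le> (16 * J\<^sup>2) powr \<gamma>"
            using tg t by (simp add: powr_minus field_simps)
          then have 1: "t powr (- \<gamma>) * (1 + D powr \<gamma>) \<le> 1 + (16 * J\<^sup>2) powr \<gamma>"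
            using tg(1) by (simp add: algebra_simps)
          have "(1 + (16 * J\<^sup>2) powr \<gamma>) * \<l> D \<le> 32 * Ce * J\<^sup>2 * \<l> t"
          proof (cases "\<gamma> = 0")
            case True
            have "jap D \<le> jap ((16 * J\<^sup>2) * t)" using DleJ D0 by (intro jap_mono) auto
            also have "\<dots> \<le> (16 * J\<^sup>2) * jap t" using J2 by (intro jap_scale) auto
            also have "\<dots> \<le> 2 * jap t * (16 * J\<^sup>2)" by simp
            finally have "\<l> D \<le> Ce * \<l> t * (16 * J\<^sup>2)" using J2 by (intro Ce(2)) auto
            then show ?thesis using True J by (simp add: mult_ac)
          next
            case False
            have "(16 * J\<^sup>2) powr \<gamma> \<le> (16 * J\<^sup>2) powr 1" using J2 gam_le_1 by (intro powr_mono) auto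
            then have "1 + (16 * J\<^sup>2) powr \<gamma> \<le> 32 * 1 * J\<^sup>2" using J2 by simp
            also have "\<dots> \<le> 32 * Ce * J\<^sup>2" using Ce(1) by (intro mult_mono) auto
            finally show ?thesis using False by (simp add: ell_def)
          qed
          then have "(t powr (- \<gamma>) * (1 + D powr \<gamma>)) * \<l> D \<le> 32 * Ce * J\<^sup>2 * \<l> t"
            using mult_right_mono[OF 1 ell_nonneg] by (rule order_trans[rotated])
          then have "Cp * (16 * t * J\<^sup>2) * ((t powr (- \<gamma>) * (1 + D powr \<gamma>)) * \<l> D) * g (t - \<xi> / of_int n)
             \<le> Cp * (16 * t * J\<^sup>2) * (32 * Ce * J\<^sup>2 * \<l> t) * g (t - \<xi> / of_int n)"
            using Cp(1) t by (intro mult_right_mono mult_left_mono) auto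
          then show ?thesis by (simp add: mult_ac)
        qed
        also have "\<dots> = X * g (t - \<xi> / of_int n)" by (simp add: X_def power2_eq_square power4_eq_xxxx mult_ac)
        finally have "P * \<bar>Phi0 t \<xi> n - Phi0 t \<xi> (n + j)\<bar> * b (l - n) \<le> X * g (t - \<xi> / of_int n) * b (l - n)"
          by (intro mult_right_mono) auto
        then have "P * (b (l - n) * \<bar>Phi0 t \<xi> n - Phi0 t \<xi> (n + j)\<bar>) \<le> v n"
          using n(1) unfolding v_def by (simp only: if_False mult_ac)
        then show ?thesis unfolding e using u0 by linarith
      qed
    qed
    have kj: "k - j = l" by (simp add: j_def)
    have "P * (E t k \<xi> - E t l \<xi>) = P * (\<Sum>\<^sub>\<infinity>n\<in>(UNIV::int set). b (l - n) * Phi0 t \<xi> (n + j) - b (l - n) * Phi0 t \<xi> n)"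
      using infsum_diff'[OF Phi0_summable[of l t \<xi> j UNIV] Phi0_summable[of l t \<xi> 0 UNIV]]
        E_eq_Phi0[of t k \<xi> j] E_eq_Phi0[of t l \<xi> 0] by (simp add: kj del: of_int_diff)
    also have "\<dots> = (\<Sum>\<^sub>\<infinity>n\<in>(UNIV::int set). P * (b (l - n) * Phi0 t \<xi> (n + j) - b (l - n) * Phi0 t \<xi> n))"
      by (rule infsum_cmult_right'[symmetric])
    also have "\<bar>\<dots>\<bar> \<le> (\<Sum>\<^sub>\<infinity>n\<in>(UNIV::int set). u n + v n)"
    proof -
      have s: "(\<lambda>n. u n + v n) summable_on UNIV" by (intro summable_on_add usum vsum)
      define F where "F = (\<lambda>n. P * (b (l - n) * Phi0 t \<xi> (n + j) - b (l - n) * Phi0 t \<xi> n))"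
      have Fp: "\<bar>F n\<bar> \<le> u n + v n" for n unfolding F_def by (rule pointwise)
      have Fs: "(\<lambda>n. \<bar>F n\<bar>) summable_on UNIV"
        by (rule summable_on_comparison_test[OF s]) (use Fp in auto)
      then have "\<bar>infsum F UNIV\<bar> \<le> infsum (\<lambda>n. \<bar>F n\<bar>) UNIV"
        using norm_infsum_bound[of F UNIV] by simp
      also have "\<dots> \<le> (\<Sum>\<^sub>\<infinity>n\<in>(UNIV::int set). u n + v n)"
        by (rule infsum_mono[OF Fs s]) (rule Fp)
      finally show ?thesis unfolding F_def .
    qed
    also have "\<dots> = 2 * I * J * B2 + X * G t l \<xi>"
      by (simp add: infsum_add usum vsum)
    also have "\<dots> \<le> K * J ^ 4 * (1 + t * \<l> t * G t l \<xi>)"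
    proof -
      have "J ^ 1 \<le> J ^ 4" using J by (intro power_increasing) auto
      then have "2 * I * B2 * J \<le> K * J ^ 4" using K J I B2_pos by (intro mult_mono) auto
      moreover have "X * G t l \<xi> \<le> K * J ^ 4 * (t * \<l> t * G t l \<xi>)"
        unfolding X_def using K(2) J t by (simp add: mult.assoc[symmetric]) (intro mult_right_mono; simp)
      ultimately show ?thesis by (simp add: algebra_simps)
    qed
    finally show ?thesis using P0 by (simp add: abs_mult P_def J_def j_def)
  qed
  then show ?thesis using K(3) by blast
qed

section \<open>The logarithmic derivative of the resonance weight\<close>

text \<open>
  The logarithmic time derivative of \<open>m_res\<close>, away from the kink of its cutoff; see \<open>dlog_m_res\<close>.
\<close>

definition dres :: "real \<Rightarrow> real \<Rightarrow> int \<Rightarrow> real \<Rightarrow> real" where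
  "dres \<mu> t k \<eta> = min 1 (t * \<mu> powr (1/3)) * G t k \<eta> + (if t * \<mu> powr (1/3) < 1 then \<mu> powr (1/3) * E t k \<eta> else 0)"

lemma dres_ge: "min 1 (t * \<mu> powr (1/3)) * G t k \<eta> \<le> dres \<mu> t k \<eta>"
  unfolding dres_def using E_nonneg by simp

lemma dres_nonneg: "0 \<le> t \<Longrightarrow> 0 \<le> dres \<mu> t k \<eta>"
  unfolding dres_def using E_nonneg by simp

lemma m_res_deriv:
  assumes "0 < \<mu>" "t * \<mu> powr (1/3) \<noteq> 1"
  shows "((\<lambda>s. m_res c r \<gamma> \<mu> s k \<eta>) has_real_derivative dres \<mu> t k \<eta> * m_res c r \<gamma> \<mu> t k \<eta>) (at t)"
proof -
  let ?b = "\<mu> powr (1/3)"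
  have b: "0 < ?b" using assms by simp
  define M where "M = (\<lambda>s::real. if t * ?b < 1 then s * ?b else 1)"
  have ev: "\<forall>\<^sub>F s in nhds t. min 1 (s * ?b) = M s"
  proof (cases "t * ?b < 1")
    case True
    then have "t \<in> {..<1 / ?b}" using b by (simp add: field_simps)
    then have "\<forall>\<^sub>F s in nhds t. s \<in> {..<1 / ?b}" by (intro eventually_nhds_in_open) auto
    then show ?thesis using True b by (elim eventually_mono) (simp add: M_def field_simps)
  next
    case False
    then have "t \<in> {1 / ?b<..}" using b assms(2) by (simp add: field_simps)
    then have "\<forall>\<^sub>F s in nhds t. s \<in> {1 / ?b<..}" by (intro eventually_nhds_in_open) auto
    then show ?thesis using False b by (elim eventually_mono) (simp add: M_def field_simps)
  qed
  have Mt: "M t = min 1 (t * ?b)" using eventually_nhds_x_imp_x[OF ev] by simp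
  have "(M has_real_derivative (if t * ?b < 1 then ?b else 0)) (at t)"
    unfolding M_def by (cases "t * ?b < 1") (auto intro!: derivative_eq_intros)
  then have "((\<lambda>s. M s * E s k \<eta>) has_real_derivative ((if t * ?b < 1 then ?b else 0) * E t k \<eta> + G t k \<eta> * M t)) (at t)"
    by (rule DERIV_mult) (rule E_deriv)
  then have "((\<lambda>s. exp (M s * E s k \<eta>)) has_real_derivative exp (M t * E t k \<eta>) * ((if t * ?b < 1 then ?b else 0) * E t k \<eta> + G t k \<eta> * M t)) (at t)"
    by (rule DERIV_chain2[OF DERIV_exp])
  moreover have "exp (M t * E t k \<eta>) * ((if t * ?b < 1 then ?b else 0) * E t k \<eta> + G t k \<eta> * M t) = dres \<mu> t k \<eta> * m_res c r \<gamma> \<mu> t k \<eta>"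
    unfolding m_res_eq dres_def Mt by (simp add: algebra_simps)
  moreover have "\<forall>\<^sub>F s in nhds t. m_res c r \<gamma> \<mu> s k \<eta> = exp (M s * E s k \<eta>)"
    using ev by (rule eventually_mono) (simp add: m_res_eq)
  ultimately show ?thesis by (subst DERIV_cong_ev) auto
qed

lemma m_res_pos: "0 < m_res c r \<gamma> \<mu> t k \<eta>" by (simp add: m_res_eq)

lemma dlog_m_res:
  assumes "0 < \<mu>" "t * \<mu> powr (1/3) \<noteq> 1"
  shows "dlog (m_res c r \<gamma> \<mu>) t k \<eta> = dres \<mu> t k \<eta>"
  unfolding dlog_def using DERIV_imp_deriv[OF m_res_deriv[OF assms]] m_res_pos[of \<mu> t k \<eta>] by simp

section \<open>Dissipated quantities\<close>

text \<open>
  The logarithmic loss, which occurs only for \<open>\<gamma> = 0\<close>.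
\<close>

definition Lf :: "real \<Rightarrow> real" where
  "Lf \<mu> = (if \<gamma> = 0 then \<bar>ln \<mu>\<bar> powr (1 + r) else 1)"

text \<open>
  The density of dissipation, as an amplitude: enhanced dissipation of nonzero modes, viscosity, and
  the decay produced by the resonance weight.
\<close>

definition w :: "real \<Rightarrow> real \<Rightarrow> int \<Rightarrow> real \<Rightarrow> real" where
  "w \<mu> t k \<eta> = (if k = 0 then 0 else \<mu> powr (1/6)) + \<mu> powr (1/2) * Lam t k \<eta> + sqrt (dres \<mu> t k \<eta>)"

text \<open>
  The bracket in the symbol bound.  Two of the three functions in the trilinear form carry a
  factor \<open>w\<close>, except in the term with \<open>h\<close>, whose integrability in time comes from the admissible weight.
\<close>

definition Br :: "real \<Rightarrow> real \<Rightarrow> real \<Rightarrow> int \<Rightarrow> int \<Rightarrow> real \<Rightarrow> real \<Rightarrow> real" where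
  "Br \<mu> h t k l \<eta> \<xi> = Lf \<mu> * \<mu> powr (- 1/3) *
     (h + w \<mu> t k \<eta> * w \<mu> t l \<xi> + w \<mu> t k \<eta> * w \<mu> t (k - l) (\<eta> - \<xi>) + w \<mu> t l \<xi> * w \<mu> t (k - l) (\<eta> - \<xi>))"

lemma w_nonneg: "0 \<le> t \<Longrightarrow> 0 \<le> w \<mu> t k \<eta>"
  by (simp add: w_def dres_nonneg)

lemma w_ge:
  assumes "0 \<le> t"
  shows "k \<noteq> 0 \<Longrightarrow> \<mu> powr (1/6) \<le> w \<mu> t k \<eta>" "\<mu> powr (1/2) * Lam t k \<eta> \<le> w \<mu> t k \<eta>"
    "sqrt (dres \<mu> t k \<eta>) \<le> w \<mu> t k \<eta>"
  using assms by (simp_all add: w_def dres_nonneg)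

lemma Lf_lower: "\<exists>K>0. \<forall>\<mu>. 0 < \<mu> \<longrightarrow> \<mu> \<le> 1/2 \<longrightarrow> 1 \<le> K * Lf \<mu>"
proof -
  define e where "e = min 1 (ln 2 powr (1 + r))"
  have e: "0 < e" by (simp add: e_def)
  have "e \<le> Lf \<mu>" if "0 < \<mu>" "\<mu> \<le> 1/2" for \<mu>
  proof (cases "\<gamma> = 0")
    case True
    have "ln \<mu> \<le> ln (1/2)" using that by (subst ln_le_cancel_iff) auto
    then have "ln 2 \<le> \<bar>ln \<mu>\<bar>" by (simp add: ln_div)
    then have "ln 2 powr (1 + r) \<le> \<bar>ln \<mu>\<bar> powr (1 + r)" using r_pos by (intro powr_mono2) auto
    then show ?thesis unfolding e_def Lf_def using True by simp
  qed (simp add: e_def Lf_def)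
  then show ?thesis using e by (intro exI[of _ "1 / e"]) (auto simp: field_simps)
qed

lemma Lf_nonneg [simp]: "0 \<le> Lf \<mu>"
  by (simp add: Lf_def)

lemma Br_nonneg: "0 \<le> t \<Longrightarrow> 0 \<le> h \<Longrightarrow> 0 \<le> Br \<mu> h t k l \<eta> \<xi>"
  unfolding Br_def by (intro mult_nonneg_nonneg add_nonneg_nonneg w_nonneg) auto

lemma Br_ge:
  assumes "0 \<le> t" "0 \<le> h"
  shows "Lf \<mu> * \<mu> powr (- 1/3) * h \<le> Br \<mu> h t k l \<eta> \<xi>"
    "Lf \<mu> * \<mu> powr (- 1/3) * (w \<mu> t k \<eta> * w \<mu> t l \<xi>) \<le> Br \<mu> h t k l \<eta> \<xi>"
    "Lf \<mu> * \<mu> powr (- 1/3) * (w \<mu> t k \<eta> * w \<mu> t (k - l) (\<eta> - \<xi>)) \<le> Br \<mu> h t k l \<eta> \<xi>"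
    "Lf \<mu> * \<mu> powr (- 1/3) * (w \<mu> t l \<xi> * w \<mu> t (k - l) (\<eta> - \<xi>)) \<le> Br \<mu> h t k l \<eta> \<xi>"
  unfolding Br_def using assms by (intro mult_left_mono; simp add: w_nonneg)+

text \<open>
  At most one of the three interacting modes is an average in \<open>x\<close>.  The other two are damped at the
  enhanced rate \<open>\<mu>\<^sup>1\<^sup>/\<^sup>6 \<cdot> \<mu>\<^sup>1\<^sup>/\<^sup>6 = \<mu>\<^sup>1\<^sup>/\<^sup>3\<close>, which compensates the prefactor: bounded symbols are harmless.
\<close>

lemma Br_one:
  assumes mu: "0 < \<mu>" and t: "0 \<le> t" and h: "0 \<le> h" and kl: "k \<noteq> 0 \<or> l \<noteq> 0"
  shows "Lf \<mu> \<le> Br \<mu> h t k l \<eta> \<xi>"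
proof -
  have m: "\<mu> powr (- 1/3) * (\<mu> powr (1/6) * \<mu> powr (1/6)) = 1"
    using mu by (simp add: powr_add[symmetric])
  have *: "Lf \<mu> \<le> Lf \<mu> * \<mu> powr (- 1/3) * (a * b)" if "\<mu> powr (1/6) \<le> a" "\<mu> powr (1/6) \<le> b" for a b
  proof -
    have "\<mu> powr (1/6) * \<mu> powr (1/6) \<le> a * b" using that by (intro mult_mono) (auto intro: order_trans[OF powr_ge_zero])
    then have "\<mu> powr (- 1/3) * (\<mu> powr (1/6) * \<mu> powr (1/6)) \<le> \<mu> powr (- 1/3) * (a * b)" by (intro mult_left_mono) auto
    then have "1 \<le> \<mu> powr (- 1/3) * (a * b)" using m by simp
    then have "Lf \<mu> * 1 \<le> Lf \<mu> * (\<mu> powr (- 1/3) * (a * b))" by (intro mult_left_mono) auto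
    then show ?thesis by (simp add: mult.assoc)
  qed
  consider "k \<noteq> 0" "l \<noteq> 0" | "k \<noteq> 0" "k - l \<noteq> 0" | "l \<noteq> 0" "k - l \<noteq> 0" using kl by fastforce
  then show ?thesis
  proof cases
    case 1
    show ?thesis by (rule order_trans[OF * Br_ge(2)]) (intro w_ge 1 t h)+
  next
    case 2
    show ?thesis by (rule order_trans[OF * Br_ge(3)]) (intro w_ge 2 t h)+
  next
    case 3
    show ?thesis by (rule order_trans[OF * Br_ge(4)]) (intro w_ge 3 t h)+
  qed
qed

text \<open>
  One of the other two modes is nonzero; pair its enhanced dissipation \<open>\<mu>\<^sup>1\<^sup>/\<^sup>6\<close> with the viscous term
  \<open>\<mu>\<^sup>1\<^sup>/\<^sup>2 \<Lambda>\<close>.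
\<close>

lemma Br_Lam:
  assumes mu: "0 < \<mu>" and t: "0 \<le> t" and h: "0 \<le> h" and kl: "k \<noteq> 0 \<or> l \<noteq> 0"
  shows "Lf \<mu> * (\<mu> powr (1/3) * (Lam t l \<xi> + Lam t k \<eta>)) \<le> 2 * Br \<mu> h t k l \<eta> \<xi>"
proof -
  have m: "\<mu> powr (1/3) = \<mu> powr (- 1/3) * (\<mu> powr (1/2) * \<mu> powr (1/6))"
    using mu by (simp add: powr_add[symmetric])
  have *: "Lf \<mu> * (\<mu> powr (1/3) * x) \<le> Lf \<mu> * \<mu> powr (- 1/3) * (a * b)"
    if "\<mu> powr (1/2) * x \<le> a" "\<mu> powr (1/6) \<le> b" "0 \<le> x" for a b x
  proof -
    have "(\<mu> powr (1/2) * x) * \<mu> powr (1/6) \<le> a * b"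
      using that by (intro mult_mono) (auto intro: order_trans[OF _ that(1)] order_trans[OF powr_ge_zero])
    then have "\<mu> powr (- 1/3) * ((\<mu> powr (1/2) * x) * \<mu> powr (1/6)) \<le> \<mu> powr (- 1/3) * (a * b)" by (intro mult_left_mono) auto
    then have "\<mu> powr (1/3) * x \<le> \<mu> powr (- 1/3) * (a * b)" using m by (simp add: mult_ac)
    then have "Lf \<mu> * (\<mu> powr (1/3) * x) \<le> Lf \<mu> * (\<mu> powr (- 1/3) * (a * b))" by (intro mult_left_mono) auto
    then show ?thesis by (simp add: mult.assoc)
  qed
  have l: "Lf \<mu> * (\<mu> powr (1/3) * Lam t l \<xi>) \<le> Br \<mu> h t k l \<eta> \<xi>"
  proof (cases "k = 0")
    case True
    then have "k - l \<noteq> 0" using kl by simp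
    then show ?thesis by (intro order_trans[OF * Br_ge(4)] w_ge t h Lam_nonneg)
  next
    case False
    then have "Lf \<mu> * (\<mu> powr (1/3) * Lam t l \<xi>) \<le> Lf \<mu> * \<mu> powr (- 1/3) * (w \<mu> t l \<xi> * w \<mu> t k \<eta>)" by (intro * w_ge t) auto
    also have "\<dots> \<le> Br \<mu> h t k l \<eta> \<xi>" unfolding mult.commute[of "w \<mu> t l \<xi>"] by (intro Br_ge t h)
    finally show ?thesis .
  qed
  have k: "Lf \<mu> * (\<mu> powr (1/3) * Lam t k \<eta>) \<le> Br \<mu> h t k l \<eta> \<xi>"
  proof (cases "l = 0")
    case True
    then have "k - l \<noteq> 0" using kl by simp
    then show ?thesis by (intro order_trans[OF * Br_ge(3)] w_ge t h Lam_nonneg)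
  next
    case False
    then show ?thesis by (intro order_trans[OF * Br_ge(2)] w_ge t h Lam_nonneg)
  qed
  show ?thesis using l k by (simp add: distrib_left)
qed

text \<open>
  In terms of \<open>u = t \<mu>\<^sup>1\<^sup>/\<^sup>3\<close> a factor \<open>t\<close> is \<open>\<mu>\<^sup>-\<^sup>1\<^sup>/\<^sup>3 u\<close>.  The exponential absorbs powers of \<open>1 + u\<close>, leaving
  the cutoff \<open>min 1 u\<close> with which \<open>m_res\<close> dissipates, and \<open>\<ell>(t)\<close> becomes \<open>\<ell>(\<mu>\<^sup>-\<^sup>1\<^sup>/\<^sup>3)\<close>, that is, the
  logarithmic loss.
\<close>

lemma time_gain:
  "\<exists>K>0. \<forall>\<mu> t. 0 < \<mu> \<longrightarrow> \<mu> \<le> 1/2 \<longrightarrow> 1 \<le> t \<longrightarrow>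
     exp (- (c * (t * \<mu> powr (1/3)))) * (t * \<l> t) \<le> K * Lf \<mu> * \<mu> powr (- 1/3) * min 1 (t * \<mu> powr (1/3))"
proof -
  obtain Ce where Ce: "Ce \<ge> 1" "\<And>x y w. 1 \<le> w \<Longrightarrow> jap x \<le> 2 * jap y * w \<Longrightarrow> \<l> x \<le> Ce * \<l> y * w"
    using ell_submult[OF r_pos, of \<gamma>] by blast
  obtain K0 where K0: "K0 > 0" "\<And>u. 0 \<le> u \<Longrightarrow> (1 + u) ^ 2 * exp (- (c * u)) \<le> K0"
    using exp_absorb[OF c_pos, of 2] by blast
  (* 7/3 = 1/3 + 2, from ln (4 x) with x = \<mu>^(-1/3) and ln 4 \<le> 2 |ln \<mu>|. *)
  define C1 where "C1 = (7/3::real) powr (1 + r)"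
  have C1: "1 \<le> C1" unfolding C1_def using r_pos by (intro ge_one_powr_ge_zero) auto
  have "exp (- (c * (t * \<mu> powr (1/3)))) * (t * \<l> t) \<le> (K0 * Ce * C1) * Lf \<mu> * \<mu> powr (- 1/3) * min 1 (t * \<mu> powr (1/3))"
    if mu: "0 < \<mu>" "\<mu> \<le> 1/2" and t: "1 \<le> t" for \<mu> t
  proof -
    define u where "u = t * \<mu> powr (1/3)"
    (* t = x u: here x carries the loss in \<mu> and u is absorbed by the exponential. *)
    define x where "x = \<mu> powr (- 1/3)"
    have u: "0 < u" using t mu by (simp add: u_def)
    have x1: "1 \<le> x" unfolding x_def using mu powr_mono_both'[of "1/3" "1/3" \<mu> 1]
      by (simp add: powr_minus[of _ "1/3", simplified] one_le_inverse_iff powr_le1)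
    have tx: "t = x * u" unfolding x_def u_def using mu by (simp add: powr_minus field_simps flip: powr_add)
    have "min 1 u * (1 + u) \<ge> u" using u by (simp add: min_def)
    then have t_le: "t \<le> x * (min 1 u * (1 + u))" unfolding tx using x1 by (intro mult_left_mono) auto
    have "jap t \<le> 2 * jap x * (1 + u)"
    proof (cases "1 \<le> u")
      case True
      then have "jap t \<le> u * jap x" unfolding tx using jap_scale[of u x] by (simp add: mult.commute)
      also have "\<dots> \<le> (2 * (1 + u)) * jap x" using True by (intro mult_right_mono) auto
      finally show ?thesis by (simp add: mult_ac)
    next
      case False
      then have "\<bar>t\<bar> \<le> \<bar>x\<bar>" unfolding tx using u x1 by (simp add: abs_mult mult_left_le)
      then have "jap t \<le> jap x" by (rule jap_mono)
      also have "\<dots> \<le> jap x * (2 * (1 + u))" using mult_left_mono[of 1 "2 * (1 + u)" "jap x"] u by simp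
      finally show ?thesis by (simp add: mult_ac)
    qed
    then have lt: "\<l> t \<le> Ce * \<l> x * (1 + u)" using u by (intro Ce(2)) auto
    have lx: "\<l> x \<le> C1 * Lf \<mu>"
    proof (cases "\<gamma> = 0")
      case True
      have "ln \<mu> < 0" using mu by (simp add: ln_less_zero)
      have "1 + jap x \<le> 2 + x" using jap_le[of x] x1 by simp
      also have "\<dots> \<le> 3 * x" using x1 by simp
      also have "\<dots> \<le> 4 * x" using x1 by simp
      finally have "ln (1 + jap x) \<le> ln (4 * x)" using x1 by (subst ln_le_cancel_iff) (auto simp: add_pos_pos)
      also have "\<dots> = ln 4 + (- 1/3) * ln \<mu>" using x1 mu unfolding x_def by (subst ln_mult) (auto simp: ln_powr)
      also have "ln 4 \<le> - 2 * ln \<mu>"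
      proof -
        have "ln 4 = 2 * ln (2::real)" using ln_realpow[of "2::real" 2] by simp
        moreover have "ln \<mu> \<le> ln (1/2)" using mu by (subst ln_le_cancel_iff) auto
        ultimately show ?thesis by (simp add: ln_div)
      qed
      finally have "ln (1 + jap x) \<le> 7/3 * \<bar>ln \<mu>\<bar>" using \<open>ln \<mu> < 0\<close> by simp
      then have "ln (1 + jap x) powr (1 + r) \<le> (7/3 * \<bar>ln \<mu>\<bar>) powr (1 + r)"
        using ln_jap_pos[of x] r_pos by (intro powr_mono2) auto
      then show ?thesis unfolding ell_def Lf_def C1_def using True by (simp add: powr_mult[symmetric])
    next
      case False
      then show ?thesis using C1 by (simp add: ell_def Lf_def)
    qed
    have "t * \<l> t \<le> (x * (min 1 u * (1 + u))) * (Ce * (C1 * Lf \<mu>) * (1 + u))"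
    proof (rule mult_mono[OF t_le])
      show "\<l> t \<le> Ce * (C1 * Lf \<mu>) * (1 + u)"
        using lt lx Ce(1) u by (meson mult_left_mono mult_right_mono order_trans add_nonneg_nonneg less_imp_le zero_le_one)
    qed (use x1 u in auto)
    then have "exp (- (c * u)) * (t * \<l> t) \<le> exp (- (c * u)) * ((x * (min 1 u * (1 + u))) * (Ce * (C1 * Lf \<mu>) * (1 + u)))"
      by (intro mult_left_mono) auto
    also have "\<dots> = ((1 + u)\<^sup>2 * exp (- (c * u))) * (Ce * C1 * Lf \<mu> * x * min 1 u)"
      by (simp add: power2_eq_square mult_ac)
    also have "\<dots> \<le> K0 * (Ce * C1 * Lf \<mu> * x * min 1 u)"
      using K0(2)[of u] u x1 Ce(1) C1 by (intro mult_right_mono) auto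
    finally show ?thesis unfolding u_def x_def by (simp add: mult_ac)
  qed
  then show ?thesis using K0(1) Ce(1) C1 by (intro exI[of _ "K0 * Ce * C1"]) auto
qed

text \<open>
  By \<open>G_compare\<close> the sum \<open>G\<close> at \<open>(l, \<xi>)\<close> is bounded by the geometric mean of its values at \<open>(l, \<xi>)\<close> and
  \<open>(k, \<eta>)\<close>, so that one half of the resonance is paid for by each of the two functions.
\<close>

lemma resonance_gain:
  "\<exists>K>0. \<forall>\<mu> t k l \<eta> \<xi>. 0 < \<mu> \<longrightarrow> \<mu> \<le> 1/2 \<longrightarrow> 1 \<le> t \<longrightarrow>
     exp (- (c * (t * \<mu> powr (1/3)))) * (t * \<l> t * G t l \<xi>)
       \<le> K * jap2 (k - l) (\<eta> - \<xi>) ^ 3 * (Lf \<mu> * \<mu> powr (- 1/3) * (w \<mu> t k \<eta> * w \<mu> t l \<xi>))"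
proof -
  obtain C where C: "C > 0" "\<And>t k l \<eta> \<xi>. G t l \<xi> \<le> C * jap (of_int (k - l)) ^ 3 * (jap (\<eta> - \<xi>))\<^sup>2 * G t k \<eta>"
    using G_compare by blast
  obtain K where K: "K > 0" "\<And>\<mu> t. 0 < \<mu> \<Longrightarrow> \<mu> \<le> 1/2 \<Longrightarrow> 1 \<le> t \<Longrightarrow>
     exp (- (c * (t * \<mu> powr (1/3)))) * (t * \<l> t) \<le> K * Lf \<mu> * \<mu> powr (- 1/3) * min 1 (t * \<mu> powr (1/3))"
    using time_gain by blast
  have "exp (- (c * (t * \<mu> powr (1/3)))) * (t * \<l> t * G t l \<xi>)
       \<le> (K * sqrt C) * jap2 (k - l) (\<eta> - \<xi>) ^ 3 * (Lf \<mu> * \<mu> powr (- 1/3) * (w \<mu> t k \<eta> * w \<mu> t l \<xi>))"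
    if mu: "0 < \<mu>" "\<mu> \<le> 1/2" and t: "1 \<le> t" for \<mu> t k l \<eta> \<xi>
  proof -
    define J where "J = jap2 (k - l) (\<eta> - \<xi>)"
    define mn where "mn = min 1 (t * \<mu> powr (1/3))"
    have J1: "1 \<le> J" by (simp add: J_def)
    have mn: "0 \<le> mn" using t by (simp add: mn_def)
    have "jap (of_int (k - l)) ^ 3 * (jap (\<eta> - \<xi>))\<^sup>2 \<le> J ^ 3 * J\<^sup>2"
      unfolding J_def by (intro mult_mono power_mono jap_le_jap2) auto
    also have "\<dots> \<le> J ^ 6" using J1 by (subst power_add[symmetric]) (intro power_increasing, auto)
    finally have "C * (jap (of_int (k - l)) ^ 3 * (jap (\<eta> - \<xi>))\<^sup>2) * G t k \<eta> \<le> C * J ^ 6 * G t k \<eta>"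
      using C(1) by (intro mult_right_mono mult_left_mono) auto
    then have G: "G t l \<xi> \<le> C * J ^ 6 * G t k \<eta>"
      using C(2)[of t l \<xi> k \<eta>] by (simp add: mult_ac del: of_int_diff)
    have "(mn * G t l \<xi>)\<^sup>2 \<le> (mn * (C * J ^ 6 * G t k \<eta>)) * (mn * G t l \<xi>)"
      unfolding power2_eq_square using G mn by (intro mult_right_mono mult_left_mono) auto
    also have "\<dots> = (C * J ^ 6) * ((mn * G t k \<eta>) * (mn * G t l \<xi>))" by simp
    also have "\<dots> \<le> (C * J ^ 6) * (dres \<mu> t k \<eta> * dres \<mu> t l \<xi>)"
      unfolding mn_def using t C(1) J1 by (intro mult_left_mono mult_mono dres_ge dres_nonneg) auto
    finally have "(mn * G t l \<xi>) \<le> sqrt ((C * J ^ 6) * (dres \<mu> t k \<eta> * dres \<mu> t l \<xi>))"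
      by (rule real_le_rsqrt)
    also have "\<dots> = sqrt C * J ^ 3 * (sqrt (dres \<mu> t k \<eta>) * sqrt (dres \<mu> t l \<xi>))"
    proof -
      have "sqrt (J ^ 6) = J ^ 3"
        by (rule real_sqrt_unique) (use J1 in \<open>simp_all add: power_mult[symmetric]\<close>)
      then show ?thesis by (simp add: real_sqrt_mult)
    qed
    also have "\<dots> \<le> sqrt C * J ^ 3 * (w \<mu> t k \<eta> * w \<mu> t l \<xi>)"
      using t J1 C(1) by (intro mult_left_mono mult_mono w_ge w_nonneg) (auto simp: dres_nonneg)
    finally have *: "mn * G t l \<xi> \<le> sqrt C * J ^ 3 * (w \<mu> t k \<eta> * w \<mu> t l \<xi>)" .
    have "exp (- (c * (t * \<mu> powr (1/3)))) * (t * \<l> t) * G t l \<xi> \<le> K * Lf \<mu> * \<mu> powr (- 1/3) * mn * G t l \<xi>"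
      unfolding mn_def by (intro mult_right_mono K mu t) auto
    also have "\<dots> = K * Lf \<mu> * \<mu> powr (- 1/3) * (mn * G t l \<xi>)" by simp
    also have "\<dots> \<le> K * Lf \<mu> * \<mu> powr (- 1/3) * (sqrt C * J ^ 3 * (w \<mu> t k \<eta> * w \<mu> t l \<xi>))"
      using K(1) * by (intro mult_left_mono) auto
    finally show ?thesis by (simp add: J_def mult_ac)
  qed
  then show ?thesis using K(1) C(1) by (intro exI[of _ "K * sqrt C"]) auto
qed

text \<open>
  It is the term \<open>n = l\<close> of the sum \<open>G\<close> at \<open>(l, \<xi>)\<close>.
\<close>

lemma resonant_factor:
  "\<exists>K>0. \<forall>t l \<xi>. 1 \<le> t \<longrightarrow> l \<noteq> 0 \<longrightarrow> jap (t - \<xi> / of_int l) \<le> 2 * t \<longrightarrow>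
     t * jap (t - \<xi> / of_int l) powr (- (1 + \<gamma>)) \<le> K * (t * \<l> t * G t l \<xi>)"
proof -
  obtain Ce where Ce: "Ce \<ge> 1" "\<And>x y w. 1 \<le> w \<Longrightarrow> jap x \<le> 2 * jap y * w \<Longrightarrow> \<l> x \<le> Ce * \<l> y * w"
    using ell_submult[OF r_pos, of \<gamma>] by blast
  have "t * jap (t - \<xi> / of_int l) powr (- (1 + \<gamma>)) \<le> (Ce / c) * (t * \<l> t * G t l \<xi>)"
    if t: "1 \<le> t" and l: "l \<noteq> 0" and s: "jap (t - \<xi> / of_int l) \<le> 2 * t" for t l \<xi>
  proof -
    define s where "s = t - \<xi> / of_int l"
    have "jap s \<le> 2 * jap t * 1" using s abs_le_jap[of t] t unfolding s_def by simp
    then have ls: "\<l> s \<le> Ce * \<l> t" using Ce(2)[of 1 s t] by simp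
    have "g s = g s * b (l - l)" by (simp add: jap_def[of 0])
    also have "\<dots> \<le> G t l \<xi>" unfolding s_def using l by (rule G_ge_term)
    finally have gG: "g s \<le> G t l \<xi>" .
    have "jap s powr (- (1 + \<gamma>)) = \<l> s * g s / c"
      unfolding g_res_eq using c_pos less_imp_neq[OF ell_pos, of r \<gamma> s] by simp
    also have "\<dots> \<le> (Ce * \<l> t) * G t l \<xi> / c"
      using ls gG c_pos Ce(1) by (intro divide_right_mono mult_mono) auto
    finally have "t * jap s powr (- (1 + \<gamma>)) \<le> t * ((Ce * \<l> t) * G t l \<xi> / c)"
      using t by (intro mult_left_mono) auto
    then show ?thesis by (simp add: s_def mult_ac)
  qed
  then show ?thesis using Ce(1) c_pos by (intro exI[of _ "Ce / c"]) auto
qed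

section \<open>The symbol of the transport term\<close>

text \<open>
  The symbol of \<open>\<nabla>\<^sup>\<bottom> \<Lambda>\<^sub>t\<^sup>-\<^sup>(\<^sup>1\<^sup>+\<^sup>\<gamma>\<^sup>) q \<cdot> \<nabla>\<close> for \<open>q\<close> at frequency \<open>(k - l, \<eta> - \<xi>)\<close>.  The determinant vanishes for
  parallel frequencies.
\<close>

definition V :: "real \<Rightarrow> int \<Rightarrow> int \<Rightarrow> real \<Rightarrow> real \<Rightarrow> real" where
  "V t k l \<eta> \<xi> = \<bar>(\<eta> - \<xi>) * of_int l - of_int (k - l) * \<xi>\<bar> * Lam t (k - l) (\<eta> - \<xi>) powr (- (1 + \<gamma>))"

lemma V_nonneg [simp]: "0 \<le> V t k l \<eta> \<xi>"
  by (simp add: V_def)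

lemma en_ge_1: "0 \<le> t \<Longrightarrow> 1 \<le> en c \<mu> t k"
  using c_pos by (simp add: en_def)

lemma en_triangle:
  assumes "0 \<le> t"
  shows "en c \<mu> t k \<le> en c \<mu> t (k - l) * en c \<mu> t l"
proof -
  have "0 \<le> c * \<mu> powr (1/3) * t" using c_pos assms by simp
  then show ?thesis unfolding en_def exp_add[symmetric] by (auto simp: mult_ac)
qed

text \<open>
  If the transporting mode is nonzero, its exponential weight is a gain.
\<close>

lemma en_gain:
  assumes "k \<noteq> l"
  shows "en c \<mu> t l = exp (- (c * (t * \<mu> powr (1/3)))) * (en c \<mu> t (k - l) * en c \<mu> t l)"
  using assms by (simp add: en_def exp_add[symmetric] mult_ac)

lemma en_gain_k:
  assumes "k \<noteq> l" "l \<noteq> 0" "0 \<le> t"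
  shows "en c \<mu> t k \<le> exp (- (c * (t * \<mu> powr (1/3)))) * (en c \<mu> t (k - l) * en c \<mu> t l)"
proof -
  have "0 \<le> c * (t * \<mu> powr (1/3))" using c_pos assms by simp
  then show ?thesis using assms by (auto simp: en_def exp_add[symmetric] mult_ac)
qed

lemma Lam_powr_le_1: "j \<noteq> 0 \<Longrightarrow> p \<le> 0 \<Longrightarrow> Lam t j \<zeta> powr p \<le> 1"
  using powr_mono[of p 0 "Lam t j \<zeta>"] Lam_ge_1[of j t \<zeta>] by simp

lemma V_le_high:
  assumes "k \<noteq> l"
  shows "V t k l \<eta> \<xi> \<le> jap2 (k - l) (\<eta> - \<xi>) * abs2 l \<xi>"
proof -
  have "V t k l \<eta> \<xi> \<le> (abs2 (k - l) (\<eta> - \<xi>) * abs2 l \<xi>) * 1"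
    unfolding V_def using assms gam_nonneg
    by (intro mult_mono abs2_cross Lam_powr_le_1) auto
  also have "\<dots> \<le> jap2 (k - l) (\<eta> - \<xi>) * abs2 l \<xi>" by (simp add: abs2_le_jap2 mult_right_mono)
  finally show ?thesis .
qed

lemma Lam_powr_upper:
  assumes "j \<noteq> 0" "1 \<le> t" "0 \<le> p"
  shows "Lam t j \<zeta> powr (- p) \<le> (2 * jap2 j \<zeta>) powr p * t powr (- p)"
proof -
  have "t / (2 * jap2 j \<zeta>) \<le> Lam t j \<zeta>"
    using Lam_lower[OF assms(1), of t \<zeta>] assms by (simp add: divide_le_eq mult_ac)
  then have "Lam t j \<zeta> powr (- p) \<le> (t / (2 * jap2 j \<zeta>)) powr (- p)"
    using assms by (intro powr_mono2') auto
  also have "\<dots> = (2 * jap2 j \<zeta>) powr p * t powr (- p)"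
    using assms by (simp add: powr_divide powr_minus field_simps)
  finally show ?thesis .
qed

lemma V_le_damped:
  assumes "k \<noteq> l" "1 \<le> t"
  shows "V t k l \<eta> \<xi> \<le> 4 * jap2 (k - l) (\<eta> - \<xi>) ^ 3 * (abs2 l \<xi> * t powr (- (1 + \<gamma>)))"
proof -
  define J where "J = jap2 (k - l) (\<eta> - \<xi>)"
  have J: "1 \<le> J" by (simp add: J_def)
  have "Lam t (k - l) (\<eta> - \<xi>) powr (- (1 + \<gamma>)) \<le> (2 * J) powr (1 + \<gamma>) * t powr (- (1 + \<gamma>))"
    unfolding J_def using assms gam_nonneg by (intro Lam_powr_upper) auto
  also have "\<dots> \<le> (2 * J) powr 2 * t powr (- (1 + \<gamma>))"
    using J gam_le_1 by (intro mult_right_mono powr_mono) auto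
  also have "(2 * J) powr 2 = 4 * J\<^sup>2" using J by (simp add: powr_numeral power_mult_distrib)
  finally have "Lam t (k - l) (\<eta> - \<xi>) powr (- (1 + \<gamma>)) \<le> 4 * J\<^sup>2 * t powr (- (1 + \<gamma>))" by simp
  then have "V t k l \<eta> \<xi> \<le> (J * abs2 l \<xi>) * (4 * J\<^sup>2 * t powr (- (1 + \<gamma>)))"
    unfolding V_def using J
    by (intro mult_mono order_trans[OF abs2_cross]) (auto simp: J_def abs2_le_jap2 mult_right_mono)
  then show ?thesis by (simp add: J_def power2_eq_square power3_eq_cube mult_ac)
qed

text \<open>
  For \<open>k = l\<close> the symbol is \<open>|l| |\<eta> - \<xi>|\<^sup>-\<^sup>\<gamma>\<close>, singular for \<open>\<gamma> > 0\<close> and without decay in time.  The Lipschitz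
  bounds of the weights supply the factor that removes the singularity.
\<close>

lemma V_diagonal: "V t l l \<eta> \<xi> * \<bar>\<eta> - \<xi>\<bar> \<le> \<bar>of_int l\<bar> * jap2 (l - l) (\<eta> - \<xi>)"
proof (cases "\<eta> = \<xi>")
  case False
  define z where "z = \<bar>\<eta> - \<xi>\<bar>"
  have z: "0 < z" using False by (simp add: z_def)
  have "V t l l \<eta> \<xi> * z = \<bar>of_int l\<bar> * (z powr 1 * z powr (- (1 + \<gamma>)) * z powr 1)"
    using z by (simp add: V_def Lam_zero_mode abs_mult z_def mult_ac)
  also have "z powr 1 * z powr (- (1 + \<gamma>)) * z powr 1 = z powr (1 - \<gamma>)"
    unfolding powr_add[symmetric] by simp
  also have "z powr (1 - \<gamma>) \<le> jap z powr (1 - \<gamma>)"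
    using z gam_le_1 abs_le_jap[of z] by (intro powr_mono2) auto
  also have "\<dots> \<le> jap z powr 1" using gam_nonneg by (intro powr_mono) auto
  also have "jap z powr 1 = jap2 (l - l) (\<eta> - \<xi>)" by (simp add: jap_def jap2_def z_def)
  finally show ?thesis by (simp add: z_def mult_left_mono)
qed simp

text \<open>
  If \<open>|l, \<xi>|\<close> exceeds \<open>2 \<Lambda>\<^sub>l\<close>, most of it is due to the shear \<open>l t\<close>.  For an average in \<open>x\<close> there is no
  shear, so only the first alternative remains.
\<close>

lemma transport_cases:
  assumes "8 * abs2 (k - l) (\<eta> - \<xi>) \<le> abs2 l \<xi>" "0 \<le> t"
  obtains (nonres) "abs2 l \<xi> \<le> 2 * (Lam t l \<xi> + Lam t k \<eta>)"
  | (res) "k \<noteq> 0" "l \<noteq> 0" "abs2 l \<xi> \<le> 2 * \<bar>of_int l\<bar> * t"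
proof -
  have "abs2 l \<xi> \<le> abs2 k \<eta> + abs2 (k - l) (\<eta> - \<xi>)"
    using abs2_triangle[of l \<xi> k \<eta>] by (simp add: abs2_minus)
  then have *: "abs2 l \<xi> \<le> 2 * abs2 k \<eta>" using assms(1) abs2_nonneg[of k \<eta>] by linarith
  show ?thesis
  proof (cases "k = 0 \<or> l = 0")
    case True
    have "abs2 l \<xi> \<le> 2 * (Lam t l \<xi> + Lam t k \<eta>)"
    proof (cases "l = 0")
      case True
      then have "abs2 l \<xi> = Lam t l \<xi>" by (simp add: Lam_zero_mode)
      then show ?thesis by simp
    next
      case False
      with True have "abs2 k \<eta> = Lam t k \<eta>" by (simp add: Lam_zero_mode)
      with * show ?thesis using Lam_nonneg[of t l \<xi>] by argo
    qed
    then show ?thesis by (rule that(1))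
  next
    case False
    show ?thesis
    proof (cases "abs2 l \<xi> \<le> 2 * Lam t l \<xi>")
      case True
      then have "abs2 l \<xi> \<le> 2 * (Lam t l \<xi> + Lam t k \<eta>)" using Lam_nonneg[of t k \<eta>] by argo
      then show ?thesis by (rule that(1))
    next
      case nn: False
      have "abs2 l \<xi> \<le> 2 * (\<bar>of_int l\<bar> * t)" using nn abs2_le_Lam[OF assms(2), of l \<xi>] by linarith
      then show ?thesis using False by (intro that(2)) auto
    qed
  qed
qed

section \<open>Absorption of resonant and nonresonant terms\<close>

text \<open>
  Standing conditions on the parameters; \<open>V = 0\<close> when \<open>k = l = 0\<close>.
\<close>

definition adm :: "real \<Rightarrow> real \<Rightarrow> real \<Rightarrow> int \<Rightarrow> int \<Rightarrow> bool" where
  "adm \<mu> h t k l \<longleftrightarrow> 0 < \<mu> \<and> \<mu> \<le> 1/2 \<and> 1 \<le> t \<and> 0 \<le> h \<and> (k \<noteq> 0 \<or> l \<noteq> 0)"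

lemma adm_Br: "adm \<mu> h t k l \<Longrightarrow> 0 \<le> Br \<mu> h t k l \<eta> \<xi>" "adm \<mu> h t k l \<Longrightarrow> Lf \<mu> \<le> Br \<mu> h t k l \<eta> \<xi>"
  unfolding adm_def by (auto intro: Br_nonneg Br_one)

lemma one_le_Br:
  "\<exists>K>0. \<forall>\<mu> h t k l \<eta> \<xi>. adm \<mu> h t k l \<longrightarrow> 1 \<le> K * Br \<mu> h t k l \<eta> \<xi>"
proof -
  obtain K where K: "K > 0" "\<And>\<mu>. 0 < \<mu> \<Longrightarrow> \<mu> \<le> 1/2 \<Longrightarrow> 1 \<le> K * Lf \<mu>" using Lf_lower by blast
  have "1 \<le> K * Br \<mu> h t k l \<eta> \<xi>" if "adm \<mu> h t k l" for \<mu> h t k l \<eta> \<xi>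
  proof -
    have "1 \<le> K * Lf \<mu>" using that by (intro K) (auto simp: adm_def)
    also have "\<dots> \<le> K * Br \<mu> h t k l \<eta> \<xi>" using K(1) adm_Br(2)[OF that] by (intro mult_left_mono) auto
    finally show ?thesis .
  qed
  then show ?thesis using K(1) by blast
qed

text \<open>
  By \<open>V_le_damped\<close> the symbol is of order \<open>|l, \<xi>| / t\<close>, the variation is at most \<open>t \<mu>\<^sup>1\<^sup>/\<^sup>3\<close>, and the product
  \<open>\<mu>\<^sup>1\<^sup>/\<^sup>3 (\<Lambda>\<^sub>l + \<Lambda>\<^sub>k)\<close> is dissipated by \<open>Br_Lam\<close>.
\<close>

lemma V_min:
  "\<exists>K>0. \<forall>\<mu> h t k l \<eta> \<xi>. adm \<mu> h t k l \<longrightarrow> k \<noteq> l \<longrightarrow> abs2 l \<xi> \<le> 2 * (Lam t l \<xi> + Lam t k \<eta>) \<longrightarrow>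
     V t k l \<eta> \<xi> * min 1 (t * \<mu> powr (1/3)) \<le> K * jap2 (k - l) (\<eta> - \<xi>) ^ 3 * Br \<mu> h t k l \<eta> \<xi>"
proof -
  obtain K where K: "K > 0" "\<And>\<mu>. 0 < \<mu> \<Longrightarrow> \<mu> \<le> 1/2 \<Longrightarrow> 1 \<le> K * Lf \<mu>" using Lf_lower by blast
  have "V t k l \<eta> \<xi> * min 1 (t * \<mu> powr (1/3)) \<le> (16 * K) * jap2 (k - l) (\<eta> - \<xi>) ^ 3 * Br \<mu> h t k l \<eta> \<xi>"
    if a: "adm \<mu> h t k l" and kl: "k \<noteq> l" and X: "abs2 l \<xi> \<le> 2 * (Lam t l \<xi> + Lam t k \<eta>)" for \<mu> h t k l \<eta> \<xi>
  proof -
    have a': "0 < \<mu>" "\<mu> \<le> 1/2" "1 \<le> t" "0 \<le> h" "k \<noteq> 0 \<or> l \<noteq> 0" using a by (auto simp: adm_def)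
    define Y where "Y = Lam t l \<xi> + Lam t k \<eta>"
    have Y: "0 \<le> Y" by (simp add: Y_def)
    define J3 where "J3 = jap2 (k - l) (\<eta> - \<xi>) ^ 3"
    have J3: "0 \<le> J3" by (simp add: J3_def)
    have tp: "t powr (- (1 + \<gamma>)) \<le> t powr (- 1)" using a'(3) gam_nonneg by (intro powr_mono) auto
    have "V t k l \<eta> \<xi> \<le> 4 * J3 * (abs2 l \<xi> * t powr (- (1 + \<gamma>)))"
      unfolding J3_def by (rule V_le_damped[OF kl a'(3)])
    also have "\<dots> \<le> 4 * J3 * ((2 * Y) * t powr (- 1))"
      using X tp J3 Y by (intro mult_left_mono mult_mono) (auto simp: Y_def)
    finally have "V t k l \<eta> \<xi> * min 1 (t * \<mu> powr (1/3)) \<le> (4 * J3 * ((2 * Y) * t powr (- 1))) * (t * \<mu> powr (1/3))"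
      using J3 Y a'(3) by (intro mult_mono) auto
    also have "\<dots> = 8 * J3 * (\<mu> powr (1/3) * Y)" using a'(3) by (simp add: powr_minus field_simps)
    also have "\<dots> = 8 * J3 * (1 * (\<mu> powr (1/3) * Y))" by simp
    also have "\<dots> \<le> 8 * J3 * ((K * Lf \<mu>) * (\<mu> powr (1/3) * Y))"
      using K(2)[OF a'(1,2)] J3 Y by (intro mult_left_mono mult_right_mono) auto
    also have "\<dots> = 8 * J3 * K * (Lf \<mu> * (\<mu> powr (1/3) * Y))" by simp
    also have "\<dots> \<le> 8 * J3 * K * (2 * Br \<mu> h t k l \<eta> \<xi>)"
      unfolding Y_def using a' J3 K(1) by (intro mult_left_mono Br_Lam) auto
    finally show ?thesis by (simp add: J3_def mult_ac)
  qed
  then show ?thesis using K(1) by (intro exI[of _ "16 * K"]) auto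
qed

text \<open>
  The size of a symbol near a critical time, \<open>s\<close> being the distance to it.  Further than \<open>2 t\<close> away,
  where \<open>\<ell>(s)\<close> is no longer controlled by \<open>\<ell>(t)\<close>, the second summand is dropped.
\<close>

definition res :: "real \<Rightarrow> real \<Rightarrow> real" where
  "res t s = 1 + (if jap s \<le> 2 * t then t * jap s powr (- (1 + \<gamma>)) else 0)"

lemma res_ge_1: "0 \<le> t \<Longrightarrow> 1 \<le> res t s"
  by (simp add: res_def)

text \<open>
  The resonance may sit at the transported or at the transporting frequency.  Both are inputs, and the
  bracket contains the product of \<open>w\<close> at the output with either of them.
\<close>

lemma res_gain:
  "\<exists>K>0. \<forall>\<mu> h t k l \<eta> \<xi>. adm \<mu> h t k l \<longrightarrow> l \<noteq> 0 \<longrightarrow>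
     exp (- (c * (t * \<mu> powr (1/3)))) * res t (t - \<xi> / of_int l) \<le> K * (jap2 (k - l) (\<eta> - \<xi>) ^ 3 * Br \<mu> h t k l \<eta> \<xi>)"
  "\<exists>K>0. \<forall>\<mu> h t k l \<eta> \<xi>. adm \<mu> h t k l \<longrightarrow> k \<noteq> l \<longrightarrow>
     exp (- (c * (t * \<mu> powr (1/3)))) * res t (t - (\<eta> - \<xi>) / of_int (k - l)) \<le> K * (jap2 l \<xi> ^ 3 * Br \<mu> h t k l \<eta> \<xi>)"
proof -
  obtain K1 where K1: "K1 > 0" "\<And>\<mu> h t k l \<eta> \<xi>. adm \<mu> h t k l \<Longrightarrow> 1 \<le> K1 * Br \<mu> h t k l \<eta> \<xi>" using one_le_Br by blast
  obtain K2 where K2: "K2 > 0" "\<And>t l \<xi>. 1 \<le> t \<Longrightarrow> l \<noteq> 0 \<Longrightarrow> jap (t - \<xi> / of_int l) \<le> 2 * t \<Longrightarrow>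
     t * jap (t - \<xi> / of_int l) powr (- (1 + \<gamma>)) \<le> K2 * (t * \<l> t * G t l \<xi>)" using resonant_factor by blast
  obtain K3 where K3: "K3 > 0" "\<And>\<mu> t k l \<eta> \<xi>. 0 < \<mu> \<Longrightarrow> \<mu> \<le> 1/2 \<Longrightarrow> 1 \<le> t \<Longrightarrow>
     exp (- (c * (t * \<mu> powr (1/3)))) * (t * \<l> t * G t l \<xi>)
       \<le> K3 * jap2 (k - l) (\<eta> - \<xi>) ^ 3 * (Lf \<mu> * \<mu> powr (- 1/3) * (w \<mu> t k \<eta> * w \<mu> t l \<xi>))" using resonance_gain by blast
  (* Both statements at once: (a, \<alpha>) is the resonant input frequency. *)
  have main: "exp (- (c * (t * \<mu> powr (1/3)))) * res t (t - \<alpha> / of_int a) \<le> (K1 + K2 * K3) * (J ^ 3 * Br \<mu> h t k l \<eta> \<xi>)"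
    if ad: "adm \<mu> h t k l" and a: "a \<noteq> 0" and J: "J = jap2 (k - a) (\<eta> - \<alpha>)"
      and le: "Lf \<mu> * \<mu> powr (- 1/3) * (w \<mu> t k \<eta> * w \<mu> t a \<alpha>) \<le> Br \<mu> h t k l \<eta> \<xi>"
    for \<mu> h t k l \<eta> \<xi> a \<alpha> J
  proof -
    define e where "e = exp (- (c * (t * \<mu> powr (1/3))))"
    have ad': "0 < \<mu>" "\<mu> \<le> 1/2" "1 \<le> t" using ad by (auto simp: adm_def)
    have J1: "1 \<le> J ^ 3" unfolding J by (simp add: one_le_power)
    have e: "0 \<le> e" "e \<le> 1" unfolding e_def using c_pos ad' by auto
    have B0: "0 \<le> Br \<mu> h t k l \<eta> \<xi>" by (rule adm_Br[OF ad])
    have "e * 1 \<le> 1 * (K1 * Br \<mu> h t k l \<eta> \<xi>)" using e K1(2)[OF ad] by (intro mult_mono) auto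
    also have "\<dots> \<le> K1 * (J ^ 3 * Br \<mu> h t k l \<eta> \<xi>)"
      using J1 B0 K1(1) mult_right_mono[OF J1 B0] by (simp add: mult_left_mono)
    finally have 1: "e * 1 \<le> K1 * (J ^ 3 * Br \<mu> h t k l \<eta> \<xi>)" .
    have 2: "e * (if jap (t - \<alpha> / of_int a) \<le> 2 * t then t * jap (t - \<alpha> / of_int a) powr (- (1 + \<gamma>)) else 0) \<le> K2 * K3 * (J ^ 3 * Br \<mu> h t k l \<eta> \<xi>)"
    proof (cases "jap (t - \<alpha> / of_int a) \<le> 2 * t")
      case True
      have "e * (t * jap (t - \<alpha> / of_int a) powr (- (1 + \<gamma>))) \<le> e * (K2 * (t * \<l> t * G t a \<alpha>))"
        using e by (intro mult_left_mono K2 ad' a True) auto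
      also have "\<dots> = K2 * (e * (t * \<l> t * G t a \<alpha>))" by simp
      also have "\<dots> \<le> K2 * (K3 * J ^ 3 * (Lf \<mu> * \<mu> powr (- 1/3) * (w \<mu> t k \<eta> * w \<mu> t a \<alpha>)))"
        unfolding e_def J using K2(1) by (intro mult_left_mono K3 ad') auto
      also have "\<dots> \<le> K2 * (K3 * J ^ 3 * Br \<mu> h t k l \<eta> \<xi>)"
        using K2(1) K3(1) order_trans[OF zero_le_one J1] by (intro mult_left_mono le mult_nonneg_nonneg) auto
      finally show ?thesis using True by (simp add: mult_ac)
    next
      case False
      have "0 \<le> K2 * K3 * (J ^ 3 * Br \<mu> h t k l \<eta> \<xi>)"
        using K2(1) K3(1) order_trans[OF zero_le_one J1] B0 by (intro mult_nonneg_nonneg) auto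
      then show ?thesis using False by simp
    qed
    show ?thesis using 1 2 unfolding res_def e_def by (simp add: algebra_simps)
  qed
  have Kp: "0 < K1 + K2 * K3" using K1(1) K2(1) K3(1) by (simp add: add_pos_pos)
  have "exp (- (c * (t * \<mu> powr (1/3)))) * res t (t - \<xi> / of_int l) \<le> (K1 + K2 * K3) * (jap2 (k - l) (\<eta> - \<xi>) ^ 3 * Br \<mu> h t k l \<eta> \<xi>)"
    if "adm \<mu> h t k l" "l \<noteq> 0" for \<mu> h t k l \<eta> \<xi>
    using that by (intro main Br_ge(2)) (auto simp: adm_def)
  then show "\<exists>K>0. \<forall>\<mu> h t k l \<eta> \<xi>. adm \<mu> h t k l \<longrightarrow> l \<noteq> 0 \<longrightarrow>
     exp (- (c * (t * \<mu> powr (1/3)))) * res t (t - \<xi> / of_int l) \<le> K * (jap2 (k - l) (\<eta> - \<xi>) ^ 3 * Br \<mu> h t k l \<eta> \<xi>)"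
    using Kp by blast
  have "exp (- (c * (t * \<mu> powr (1/3)))) * res t (t - (\<eta> - \<xi>) / of_int (k - l)) \<le> (K1 + K2 * K3) * (jap2 l \<xi> ^ 3 * Br \<mu> h t k l \<eta> \<xi>)"
    if "adm \<mu> h t k l" "k \<noteq> l" for \<mu> h t k l \<eta> \<xi>
    using that by (intro main Br_ge(3)) (auto simp: adm_def)
  then show "\<exists>K>0. \<forall>\<mu> h t k l \<eta> \<xi>. adm \<mu> h t k l \<longrightarrow> k \<noteq> l \<longrightarrow>
     exp (- (c * (t * \<mu> powr (1/3)))) * res t (t - (\<eta> - \<xi>) / of_int (k - l)) \<le> K * (jap2 l \<xi> ^ 3 * Br \<mu> h t k l \<eta> \<xi>)"
    using Kp by blast
qed

text \<open>
  The exponential weights of the two inputs.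
\<close>

abbreviation Ej where "Ej \<mu> t k l \<equiv> en c \<mu> t (k - l) * en c \<mu> t l"

lemma res_bound:
  assumes "1 \<le> t"
  shows "t powr (1 - \<gamma>) / jap s \<le> res t s"
proof (cases "jap s \<le> t")
  case True
  have "t powr (1 - \<gamma>) / jap s = t * jap s powr (- (1 + \<gamma>)) * (jap s / t) powr \<gamma>"
  proof -
    have "t powr (1 - \<gamma>) = t * t powr (- \<gamma>)" using assms by (simp add: powr_diff powr_minus divide_inverse)
    moreover have "jap s powr (- (1 + \<gamma>)) * jap s powr \<gamma> = inverse (jap s)"
      unfolding powr_add[symmetric] by (simp add: powr_minus)
    moreover have "(jap s / t) powr \<gamma> = jap s powr \<gamma> * t powr (- \<gamma>)"
      unfolding powr_minus by (subst powr_divide) (use assms in \<open>auto simp: divide_inverse\<close>)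
    ultimately show ?thesis by (simp only: divide_inverse mult_ac)
  qed
  also have "\<dots> \<le> t * jap s powr (- (1 + \<gamma>)) * 1"
    using True assms gam_nonneg by (intro mult_left_mono) (auto intro!: powr_le1)
  also have "\<dots> \<le> res t s" using True assms by (simp add: res_def)
  finally show ?thesis .
next
  case False
  have "t powr (1 - \<gamma>) \<le> t powr 1" using assms gam_nonneg by (intro powr_mono) auto
  also have "\<dots> \<le> jap s" using False assms by simp
  finally have "t powr (1 - \<gamma>) / jap s \<le> 1" by simp
  then show ?thesis using res_ge_1[of t s] assms by linarith
qed

text \<open>
  Here \<open>S\<close> is the part of the symbol and \<open>x\<close> the exponential weight that comes with it.  The power 10
  is what \<open>N \<ge> 12\<close> leaves after two powers are reserved for integrability in frequency.
\<close>

lemma bounded_term: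
  "\<exists>K>0. \<forall>\<mu> h t k l \<eta> \<xi> S n x. adm \<mu> h t k l \<longrightarrow> 0 \<le> S \<longrightarrow> S \<le> jap2 (k - l) (\<eta> - \<xi>) ^ n \<longrightarrow> n \<le> 10 \<longrightarrow> 0 \<le> x \<longrightarrow> x \<le> Ej \<mu> t k l \<longrightarrow>
     S * x \<le> K * jap2 (k - l) (\<eta> - \<xi>) ^ 10 * Ej \<mu> t k l * Br \<mu> h t k l \<eta> \<xi>"
proof -
  obtain K where K: "K > 0" "\<And>\<mu> h t k l \<eta> \<xi>. adm \<mu> h t k l \<Longrightarrow> 1 \<le> K * Br \<mu> h t k l \<eta> \<xi>" using one_le_Br by blast
  have "S * x \<le> K * jap2 (k - l) (\<eta> - \<xi>) ^ 10 * Ej \<mu> t k l * Br \<mu> h t k l \<eta> \<xi>"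
    if a: "adm \<mu> h t k l" and S: "0 \<le> S" "S \<le> jap2 (k - l) (\<eta> - \<xi>) ^ n" "n \<le> 10" and x: "0 \<le> x" "x \<le> Ej \<mu> t k l"
    for \<mu> h t k l \<eta> \<xi> S n x
  proof -
    have "S \<le> jap2 (k - l) (\<eta> - \<xi>) ^ 10" using S(2) power_le_jap2_10[OF S(3)] by (rule order_trans)
    then have "S * x * 1 \<le> (jap2 (k - l) (\<eta> - \<xi>) ^ 10 * Ej \<mu> t k l) * (K * Br \<mu> h t k l \<eta> \<xi>)"
      using x S(1) K(2)[OF a] by (intro mult_mono) auto
    then show ?thesis by (simp add: mult_ac)
  qed
  then show ?thesis using K(1) by blast
qed

text \<open>
  Resonances are absorbed if neither the transporting nor the transported mode is an average in \<open>x\<close>,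
  since then the output is spared a factor \<open>exp (c t \<mu>\<^sup>1\<^sup>/\<^sup>3)\<close>.
\<close>

lemma resonant_term:
  "\<exists>K>0. \<forall>\<mu> h t k l \<eta> \<xi> S n x. adm \<mu> h t k l \<longrightarrow> l \<noteq> 0 \<longrightarrow> 0 \<le> S \<longrightarrow>
     S \<le> jap2 (k - l) (\<eta> - \<xi>) ^ n * res t (t - \<xi> / of_int l) \<longrightarrow> n \<le> 7 \<longrightarrow>
     0 \<le> x \<longrightarrow> x \<le> exp (- (c * (t * \<mu> powr (1/3)))) * Ej \<mu> t k l \<longrightarrow>
     S * x \<le> K * jap2 (k - l) (\<eta> - \<xi>) ^ 10 * Ej \<mu> t k l * Br \<mu> h t k l \<eta> \<xi>"
proof -
  obtain K where K: "K > 0" "\<And>\<mu> h t k l \<eta> \<xi>. adm \<mu> h t k l \<Longrightarrow> l \<noteq> 0 \<Longrightarrow>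
     exp (- (c * (t * \<mu> powr (1/3)))) * res t (t - \<xi> / of_int l) \<le> K * (jap2 (k - l) (\<eta> - \<xi>) ^ 3 * Br \<mu> h t k l \<eta> \<xi>)"
    using res_gain(1) by blast
  have "S * x \<le> K * jap2 (k - l) (\<eta> - \<xi>) ^ 10 * Ej \<mu> t k l * Br \<mu> h t k l \<eta> \<xi>"
    if a: "adm \<mu> h t k l" "l \<noteq> 0" and S: "0 \<le> S" "S \<le> jap2 (k - l) (\<eta> - \<xi>) ^ n * res t (t - \<xi> / of_int l)" "n \<le> 7"
      and x: "0 \<le> x" "x \<le> exp (- (c * (t * \<mu> powr (1/3)))) * Ej \<mu> t k l"
    for \<mu> h t k l \<eta> \<xi> S n x
  proof -
    define J where "J = jap2 (k - l) (\<eta> - \<xi>)"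
    define e where "e = exp (- (c * (t * \<mu> powr (1/3))))"
    define R where "R = res t (t - \<xi> / of_int l)"
    have J: "1 \<le> J" by (simp add: J_def)
    have R: "0 \<le> R" unfolding R_def using res_ge_1[of t] a(1) by (smt (verit) adm_def)
    have B: "0 \<le> Br \<mu> h t k l \<eta> \<xi>" by (rule adm_Br[OF a(1)])
    have E: "0 \<le> Ej \<mu> t k l" by simp
    have "S * x \<le> (J ^ n * R) * (e * Ej \<mu> t k l)"
      using S x J R unfolding J_def R_def e_def by (intro mult_mono) auto
    also have "\<dots> = (J ^ n * Ej \<mu> t k l) * (e * R)" by simp
    also have "\<dots> \<le> (J ^ 7 * Ej \<mu> t k l) * (K * (J ^ 3 * Br \<mu> h t k l \<eta> \<xi>))"
    proof (rule mult_mono)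
      show "J ^ n * Ej \<mu> t k l \<le> J ^ 7 * Ej \<mu> t k l"
        using J S(3) by (intro mult_right_mono power_increasing) auto
      show "e * R \<le> K * (J ^ 3 * Br \<mu> h t k l \<eta> \<xi>)"
        unfolding e_def R_def J_def by (rule K(2)[OF a])
    qed (use J R in \<open>auto simp: e_def\<close>)
    also have "\<dots> = K * J ^ 10 * Ej \<mu> t k l * Br \<mu> h t k l \<eta> \<xi>"
    proof -
      have "J ^ 7 * J ^ 3 = J ^ 10" by (simp add: power_add[symmetric])
      then show ?thesis by (simp add: mult_ac)
    qed
    finally show ?thesis by (simp add: J_def)
  qed
  then show ?thesis using K(1) by blast
qed

lemma V_diag_div:
  assumes "l \<noteq> 0"
  shows "V t l l \<eta> \<xi> * (\<bar>\<eta> - \<xi>\<bar> / \<bar>of_int l\<bar>) \<le> jap2 (l - l) (\<eta> - \<xi>) ^ 1"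
  using V_diagonal[of t l \<eta> \<xi>] assms by (simp add: divide_le_eq mult_ac)

section \<open>Transport: variation of the weights\<close>

text \<open>
  The relative variation of \<open>\<Lambda>\<^sup>p\<close> is at most \<open>\<Lambda>\<^sub>j / \<Lambda>\<^sub>l\<close>.  Hence the product with \<open>V\<close> is at most
  \<open>\<langle>j, \<zeta>\<rangle> \<Lambda>\<^sub>j\<^sup>-\<^sup>\<gamma> |l, \<xi>| / \<Lambda>\<^sub>l\<close>, and \<open>|l, \<xi>| / \<Lambda>\<^sub>l \<le> 1 + t / \<langle>t - \<xi> / l\<rangle>\<close>: after the gain \<open>t\<^sup>-\<^sup>\<gamma>\<close> this is a resonant
  factor.
\<close>

lemma transport_Lam_diff:
  "\<exists>K>0. \<forall>\<mu> h t k l \<eta> \<xi> p. adm \<mu> h t k l \<longrightarrow> 0 \<le> p \<longrightarrow> p \<le> 1 \<longrightarrow> 0 < Lam t k \<eta> \<longrightarrow> 0 < Lam t l \<xi> \<longrightarrow>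
     V t k l \<eta> \<xi> * (\<bar>Lam t k \<eta> powr p - Lam t l \<xi> powr p\<bar> * Lam t l \<xi> powr (- p)) * en c \<mu> t k
       \<le> K * jap2 (k - l) (\<eta> - \<xi>) ^ 10 * Ej \<mu> t k l * Br \<mu> h t k l \<eta> \<xi>"
proof -
  obtain K1 where K1: "K1 > 0" "\<And>\<mu> h t k l \<eta> \<xi> S n x. adm \<mu> h t k l \<Longrightarrow> 0 \<le> S \<Longrightarrow> S \<le> jap2 (k - l) (\<eta> - \<xi>) ^ n \<Longrightarrow> n \<le> 10 \<Longrightarrow> 0 \<le> x \<Longrightarrow> x \<le> Ej \<mu> t k l \<Longrightarrow>
     S * x \<le> K1 * jap2 (k - l) (\<eta> - \<xi>) ^ 10 * Ej \<mu> t k l * Br \<mu> h t k l \<eta> \<xi>" using bounded_term by meson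
  obtain K2 where K2: "K2 > 0" "\<And>\<mu> h t k l \<eta> \<xi> S n x. adm \<mu> h t k l \<Longrightarrow> l \<noteq> 0 \<Longrightarrow> 0 \<le> S \<Longrightarrow>
     S \<le> jap2 (k - l) (\<eta> - \<xi>) ^ n * res t (t - \<xi> / of_int l) \<Longrightarrow> n \<le> 7 \<Longrightarrow>
     0 \<le> x \<Longrightarrow> x \<le> exp (- (c * (t * \<mu> powr (1/3)))) * Ej \<mu> t k l \<Longrightarrow>
     S * x \<le> K2 * jap2 (k - l) (\<eta> - \<xi>) ^ 10 * Ej \<mu> t k l * Br \<mu> h t k l \<eta> \<xi>" using resonant_term by meson
  have "V t k l \<eta> \<xi> * (\<bar>Lam t k \<eta> powr p - Lam t l \<xi> powr p\<bar> * Lam t l \<xi> powr (- p)) * en c \<mu> t k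
       \<le> (K1 + 4 * K2) * jap2 (k - l) (\<eta> - \<xi>) ^ 10 * Ej \<mu> t k l * Br \<mu> h t k l \<eta> \<xi>"
    if a: "adm \<mu> h t k l" and p: "0 \<le> p" "p \<le> 1" and L: "0 < Lam t k \<eta>" "0 < Lam t l \<xi>" for \<mu> h t k l \<eta> \<xi> p
  proof -
    define \<rho> where "\<rho> = \<bar>Lam t k \<eta> powr p - Lam t l \<xi> powr p\<bar> * Lam t l \<xi> powr (- p)"
    define J where "J = jap2 (k - l) (\<eta> - \<xi>)"
    define Q where "Q = Lam t (k - l) (\<eta> - \<xi>)"
    define B where "B = jap2 (k - l) (\<eta> - \<xi>) ^ 10 * Ej \<mu> t k l * Br \<mu> h t k l \<eta> \<xi>"
    have t: "1 \<le> t" "0 \<le> t" using a by (auto simp: adm_def)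
    have J: "1 \<le> J" by (simp add: J_def)
    have B: "0 \<le> B" unfolding B_def using adm_Br(1)[OF a] by simp
    have \<rho>: "0 \<le> \<rho>" "\<rho> \<le> Q / Lam t l \<xi>"
      unfolding \<rho>_def Q_def using powr_ratio_le(1)[OF L p Lam_diff] by auto
    have enk: "en c \<mu> t k \<le> Ej \<mu> t k l" by (rule en_triangle[OF t(2)])
    have "V t k l \<eta> \<xi> * \<rho> * en c \<mu> t k \<le> K1 * B \<or> V t k l \<eta> \<xi> * \<rho> * en c \<mu> t k \<le> 4 * (K2 * B)"
    proof (cases "k = l")
      case True
      then have l: "l \<noteq> 0" using a by (auto simp: adm_def)
      have "\<rho> \<le> \<bar>\<eta> - \<xi>\<bar> / \<bar>of_int l\<bar>"
        using \<rho>(2) Lam_ge(1)[of l t \<xi>] l True L(2)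
        by (auto simp: Q_def Lam_zero_mode intro!: order_trans[OF \<rho>(2)] divide_left_mono)
      then have "V t k l \<eta> \<xi> * \<rho> \<le> V t l l \<eta> \<xi> * (\<bar>\<eta> - \<xi>\<bar> / \<bar>of_int l\<bar>)"
        unfolding True by (rule mult_left_mono) simp
      also have "\<dots> \<le> jap2 (k - l) (\<eta> - \<xi>) ^ 1" using V_diag_div[OF l] True by simp
      finally have "V t k l \<eta> \<xi> * \<rho> * en c \<mu> t k \<le> K1 * B"
        unfolding B_def mult.assoc[of K1, symmetric] using \<rho> enk
        by (intro K1(2)[OF a, where n = 1]) auto
      then show ?thesis by simp
    next
      case False
      then have Q1: "1 \<le> Q" unfolding Q_def by (intro Lam_ge_1) auto
      have X0: "0 \<le> abs2 l \<xi>" by simp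
      have "V t k l \<eta> \<xi> * \<rho> \<le> (J * abs2 l \<xi> * Q powr (- (1 + \<gamma>))) * (Q / Lam t l \<xi>)"
      proof (rule mult_mono[OF _ \<rho>(2)])
        show "V t k l \<eta> \<xi> \<le> J * abs2 l \<xi> * Q powr (- (1 + \<gamma>))"
          unfolding V_def J_def Q_def
          by (intro mult_right_mono order_trans[OF abs2_cross] abs2_le_jap2) auto
      qed (use J \<rho> X0 in auto)
      also have "\<dots> = J * (Q powr 1 * Q powr (- (1 + \<gamma>))) * (abs2 l \<xi> / Lam t l \<xi>)" using Q1 by simp
      also have "Q powr 1 * Q powr (- (1 + \<gamma>)) = Q powr (- \<gamma>)" unfolding powr_add[symmetric] by simp
      finally have VR: "V t k l \<eta> \<xi> * \<rho> \<le> J * Q powr (- \<gamma>) * (abs2 l \<xi> / Lam t l \<xi>)" .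
      show ?thesis
      proof (cases "l = 0")
        case True
        have "Q powr (- \<gamma>) \<le> 1" unfolding Q_def using False gam_nonneg by (intro Lam_powr_le_1) auto
        then have "J * Q powr (- \<gamma>) * (abs2 l \<xi> / Lam t l \<xi>) \<le> J * 1 * 1"
          using J True L by (intro mult_mono) (auto simp: Lam_zero_mode)
        then have "V t k l \<eta> \<xi> * \<rho> \<le> jap2 (k - l) (\<eta> - \<xi>) ^ 1" using VR by (simp add: J_def)
        then have "V t k l \<eta> \<xi> * \<rho> * en c \<mu> t k \<le> K1 * B"
          unfolding B_def mult.assoc[of K1, symmetric] using \<rho> enk
          by (intro K1(2)[OF a, where n = 1]) auto
        then show ?thesis by simp
      next
        case l: False
        define s where "s = t - \<xi> / of_int l"
        have Ll: "Lam t l \<xi> = \<bar>of_int l\<bar> * jap s" unfolding s_def by (rule Lam_jap[OF l])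
        have "abs2 l \<xi> / Lam t l \<xi> \<le> (Lam t l \<xi> + \<bar>of_int l\<bar> * t) / Lam t l \<xi>"
          using L t by (intro divide_right_mono abs2_le_Lam) auto
        also have "\<dots> = 1 + t / jap s" using l unfolding Ll by (simp add: field_simps)
        finally have XL: "abs2 l \<xi> / Lam t l \<xi> \<le> 1 + t / jap s" .
        have "Q powr (- \<gamma>) \<le> (2 * J) powr \<gamma> * t powr (- \<gamma>)"
          unfolding Q_def J_def using False t gam_nonneg by (intro Lam_powr_upper) auto
        also have "\<dots> \<le> (2 * J) powr 1 * t powr (- \<gamma>)" using J gam_le_1 by (intro mult_right_mono powr_mono) auto
        finally have Qp: "Q powr (- \<gamma>) \<le> 2 * J * t powr (- \<gamma>)" using J by simp
        have "J * Q powr (- \<gamma>) * (abs2 l \<xi> / Lam t l \<xi>) \<le> J * (2 * J * t powr (- \<gamma>)) * (1 + t / jap s)"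
          using Qp XL J t L by (intro mult_mono) auto
        also have "\<dots> = 2 * J\<^sup>2 * (t powr (- \<gamma>) + t powr (1 - \<gamma>) / jap s)"
          using t by (simp add: powr_diff powr_minus power2_eq_square field_simps)
        also have "\<dots> \<le> 2 * J\<^sup>2 * (res t s + res t s)"
        proof -
          have "t powr (- \<gamma>) \<le> t powr 0" using t gam_nonneg by (intro powr_mono) auto
          then have "t powr (- \<gamma>) \<le> res t s" using t res_ge_1[of t s] by simp
          then show ?thesis using res_bound[OF t(1)] J by (intro mult_left_mono add_mono) auto
        qed
        finally have "V t k l \<eta> \<xi> * \<rho> / 4 \<le> J\<^sup>2 * res t s" using VR by simp
        then have "V t k l \<eta> \<xi> * \<rho> / 4 * en c \<mu> t k \<le> K2 * B"
          unfolding B_def mult.assoc[of K2, symmetric] using \<rho> False l t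
          by (intro K2(2)[OF a, where n = 2]) (auto simp: J_def s_def intro: en_gain_k)
        then show ?thesis by simp
      qed
    qed
    moreover have "K1 * B \<le> (K1 + 4 * K2) * B" "4 * (K2 * B) \<le> (K1 + 4 * K2) * B"
      using B K1(1) K2(1) by (simp_all add: distrib_right)
    ultimately show ?thesis unfolding \<rho>_def B_def by (simp add: mult.assoc) (meson order_trans)
  qed
  then show ?thesis using K1(1) K2(1) by (intro exI[of _ "K1 + 4 * K2"]) auto
qed

text \<open>
  The Sobolev weight gains the full factor \<open>|j, \<zeta>| / |l, \<xi>|\<close>, which compensates the derivative in \<open>V\<close>.
\<close>

lemma transport_jap2_diff:
  assumes N: "1 \<le> N"
  shows "\<exists>K>0. \<forall>\<mu> h t k l \<eta> \<xi>. adm \<mu> h t k l \<longrightarrow> 8 * abs2 (k - l) (\<eta> - \<xi>) \<le> abs2 l \<xi> \<longrightarrow>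
     V t k l \<eta> \<xi> * \<bar>jap2 k \<eta> powr N - jap2 l \<xi> powr N\<bar> * en c \<mu> t k
       \<le> K * jap2 (k - l) (\<eta> - \<xi>) ^ 10 * Ej \<mu> t k l * Br \<mu> h t k l \<eta> \<xi> * jap2 l \<xi> powr N"
proof -
  obtain K1 where K1: "K1 > 0" "\<And>\<mu> h t k l \<eta> \<xi> S n x. adm \<mu> h t k l \<Longrightarrow> 0 \<le> S \<Longrightarrow> S \<le> jap2 (k - l) (\<eta> - \<xi>) ^ n \<Longrightarrow> n \<le> 10 \<Longrightarrow> 0 \<le> x \<Longrightarrow> x \<le> Ej \<mu> t k l \<Longrightarrow>
     S * x \<le> K1 * jap2 (k - l) (\<eta> - \<xi>) ^ 10 * Ej \<mu> t k l * Br \<mu> h t k l \<eta> \<xi>" using bounded_term by meson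
  define D where "D = N * 2 powr (N - 1)"
  have D: "0 < D" using N by (simp add: D_def)
  have "V t k l \<eta> \<xi> * \<bar>jap2 k \<eta> powr N - jap2 l \<xi> powr N\<bar> * en c \<mu> t k
       \<le> (D * K1) * jap2 (k - l) (\<eta> - \<xi>) ^ 10 * Ej \<mu> t k l * Br \<mu> h t k l \<eta> \<xi> * jap2 l \<xi> powr N"
    if a: "adm \<mu> h t k l" and reg: "8 * abs2 (k - l) (\<eta> - \<xi>) \<le> abs2 l \<xi>" for \<mu> h t k l \<eta> \<xi>
  proof -
    define y where "y = jap2 l \<xi>"
    define d where "d = abs2 (k - l) (\<eta> - \<xi>)"
    have y: "0 < y" "1 \<le> y" by (simp_all add: y_def)
    have t: "0 \<le> t" using a by (simp add: adm_def)
    have d: "\<bar>jap2 k \<eta> - y\<bar> \<le> d" unfolding y_def d_def by (rule jap2_diff)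
    have "d \<le> y" using reg abs2_le_jap2[of l \<xi>] abs2_nonneg[of "k - l" "\<eta> - \<xi>"] unfolding d_def y_def by argo
    then have "jap2 k \<eta> \<le> 2 * y" using d by linarith
    then have "\<bar>jap2 k \<eta> powr N - y powr N\<bar> \<le> N * (2 * y) powr (N - 1) * \<bar>jap2 k \<eta> - y\<bar>"
      using y N by (intro powr_diff_le) auto
    also have "\<dots> \<le> N * (2 * y) powr (N - 1) * d" using d N by (intro mult_left_mono) auto
    also have "\<dots> = D * (y powr (N - 1) * d)" using y by (simp add: D_def powr_mult)
    finally have diff: "\<bar>jap2 k \<eta> powr N - y powr N\<bar> \<le> D * (y powr (N - 1) * d)" .
    have Vd: "V t k l \<eta> \<xi> * d \<le> jap2 (k - l) (\<eta> - \<xi>) ^ 2 * y"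
    proof (cases "k = l")
      case True
      have "V t k l \<eta> \<xi> * d \<le> \<bar>of_int l\<bar> * jap2 (k - l) (\<eta> - \<xi>)"
        using V_diagonal[of t l \<eta> \<xi>] True by (simp add: d_def Lam_zero_mode)
      also have "\<dots> \<le> y * jap2 (k - l) (\<eta> - \<xi>) ^ 2"
        using order_trans[OF abs2_ge(1) abs2_le_jap2, of l \<xi>] self_le_power[of "jap2 (k - l) (\<eta> - \<xi>)" 2]
        by (intro mult_mono) (auto simp: y_def)
      finally show ?thesis by (simp add: mult.commute)
    next
      case False
      have "V t k l \<eta> \<xi> * d \<le> (jap2 (k - l) (\<eta> - \<xi>) * y) * jap2 (k - l) (\<eta> - \<xi>)"
        using y by (intro mult_mono order_trans[OF V_le_high[OF False]] mult_left_mono)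
          (auto simp: d_def y_def abs2_le_jap2)
      then show ?thesis by (simp add: power2_eq_square mult_ac)
    qed
    have "V t k l \<eta> \<xi> * d / y * en c \<mu> t k \<le> K1 * jap2 (k - l) (\<eta> - \<xi>) ^ 10 * Ej \<mu> t k l * Br \<mu> h t k l \<eta> \<xi>"
      using Vd y t by (intro K1(2)[OF a, where n = 2] en_triangle) (auto simp: d_def divide_le_eq)
    then have "D * y powr N * (V t k l \<eta> \<xi> * d / y * en c \<mu> t k) \<le> D * y powr N * (K1 * jap2 (k - l) (\<eta> - \<xi>) ^ 10 * Ej \<mu> t k l * Br \<mu> h t k l \<eta> \<xi>)"
      using D by (intro mult_left_mono) auto
    moreover have "V t k l \<eta> \<xi> * \<bar>jap2 k \<eta> powr N - y powr N\<bar> * en c \<mu> t k \<le> V t k l \<eta> \<xi> * (D * (y powr (N - 1) * d)) * en c \<mu> t k"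
      using diff by (intro mult_right_mono mult_left_mono) auto
    moreover have "V t k l \<eta> \<xi> * (D * (y powr (N - 1) * d)) * en c \<mu> t k = D * y powr N * (V t k l \<eta> \<xi> * d / y * en c \<mu> t k)"
      using y by (simp add: powr_diff field_simps)
    ultimately have "V t k l \<eta> \<xi> * \<bar>jap2 k \<eta> powr N - y powr N\<bar> * en c \<mu> t k
        \<le> D * y powr N * (K1 * jap2 (k - l) (\<eta> - \<xi>) ^ 10 * Ej \<mu> t k l * Br \<mu> h t k l \<eta> \<xi>)" by linarith
    then show ?thesis by (simp only: y_def mult_ac)
  qed
  then show ?thesis using D K1(1) by (intro exI[of _ "D * K1"]) auto
qed

lemma min_nonres_term:
  "\<exists>K>0. \<forall>\<mu> h t k l \<eta> \<xi>. adm \<mu> h t k l \<longrightarrow> k \<noteq> l \<longrightarrow> abs2 l \<xi> \<le> 2 * (Lam t l \<xi> + Lam t k \<eta>) \<longrightarrow>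
     V t k l \<eta> \<xi> * min 1 (t * \<mu> powr (1/3)) \<le> K * jap2 (k - l) (\<eta> - \<xi>) ^ 10 * Br \<mu> h t k l \<eta> \<xi>"
proof -
  obtain K where K: "K > 0" "\<And>\<mu> h t k l \<eta> \<xi>. adm \<mu> h t k l \<Longrightarrow> k \<noteq> l \<Longrightarrow> abs2 l \<xi> \<le> 2 * (Lam t l \<xi> + Lam t k \<eta>) \<Longrightarrow>
     V t k l \<eta> \<xi> * min 1 (t * \<mu> powr (1/3)) \<le> K * jap2 (k - l) (\<eta> - \<xi>) ^ 3 * Br \<mu> h t k l \<eta> \<xi>" using V_min by blast
  have "V t k l \<eta> \<xi> * min 1 (t * \<mu> powr (1/3)) \<le> K * jap2 (k - l) (\<eta> - \<xi>) ^ 10 * Br \<mu> h t k l \<eta> \<xi>"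
    if "adm \<mu> h t k l" "k \<noteq> l" "abs2 l \<xi> \<le> 2 * (Lam t l \<xi> + Lam t k \<eta>)" for \<mu> h t k l \<eta> \<xi>
    using K(1) by (intro order_trans[OF K(2)[OF that]] mult_right_mono mult_left_mono power_le_jap2_10 adm_Br(1)[OF that(1)]) auto
  then show ?thesis using K(1) by blast
qed

text \<open>
  The weights differ only if exactly one of \<open>k\<close>, \<open>l\<close> vanishes.  Then \<open>transport_cases\<close> excludes resonance, and
  \<open>exp (c u) - 1\<close> is at most a multiple of \<open>exp (c u) min 1 u\<close> for \<open>u = t \<mu>\<^sup>1\<^sup>/\<^sup>3\<close>.
\<close>

lemma transport_en_diff:
  "\<exists>K>0. \<forall>\<mu> h t k l \<eta> \<xi>. adm \<mu> h t k l \<longrightarrow> 8 * abs2 (k - l) (\<eta> - \<xi>) \<le> abs2 l \<xi> \<longrightarrow>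
     V t k l \<eta> \<xi> * \<bar>en c \<mu> t k - en c \<mu> t l\<bar>
       \<le> K * jap2 (k - l) (\<eta> - \<xi>) ^ 10 * Ej \<mu> t k l * Br \<mu> h t k l \<eta> \<xi>"
proof -
  obtain K where K: "K > 0" "\<And>\<mu> h t k l \<eta> \<xi>. adm \<mu> h t k l \<Longrightarrow> k \<noteq> l \<Longrightarrow> abs2 l \<xi> \<le> 2 * (Lam t l \<xi> + Lam t k \<eta>) \<Longrightarrow>
     V t k l \<eta> \<xi> * min 1 (t * \<mu> powr (1/3)) \<le> K * jap2 (k - l) (\<eta> - \<xi>) ^ 10 * Br \<mu> h t k l \<eta> \<xi>" using min_nonres_term by blast
  have "V t k l \<eta> \<xi> * \<bar>en c \<mu> t k - en c \<mu> t l\<bar>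
       \<le> ((1 + c) * K) * jap2 (k - l) (\<eta> - \<xi>) ^ 10 * Ej \<mu> t k l * Br \<mu> h t k l \<eta> \<xi>"
    if a: "adm \<mu> h t k l" and reg: "8 * abs2 (k - l) (\<eta> - \<xi>) \<le> abs2 l \<xi>" for \<mu> h t k l \<eta> \<xi>
  proof (cases "(k = 0) = (l = 0)")
    case True
    then have "en c \<mu> t k = en c \<mu> t l" by (simp add: en_def)
    then show ?thesis using adm_Br(1)[OF a] K(1) c_pos by simp
  next
    case False
    define u where "u = t * \<mu> powr (1/3)"
    have t: "0 \<le> t" using a by (simp add: adm_def)
    have u: "0 \<le> u" using t by (simp add: u_def)
    have kl: "k \<noteq> l" using False by auto
    have X: "abs2 l \<xi> \<le> 2 * (Lam t l \<xi> + Lam t k \<eta>)"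
      by (rule transport_cases[OF reg t]) (use False in auto)
    have en: "c * \<mu> powr (1/3) * t = c * u" by (simp add: u_def)
    have "\<bar>en c \<mu> t k - en c \<mu> t l\<bar> = exp (c * u) - 1"
      using False c_pos u unfolding en_def en by auto
    also have "exp (c * u) - 1 \<le> exp (c * u) * ((1 + c) * min 1 u)"
    proof -
      have "exp (c * u) * (1 - c * u) \<le> exp (c * u) * exp (- (c * u))"
        using exp_ge_add_one_self[of "- (c * u)"] by (intro mult_left_mono) auto
      also have "\<dots> = 1" by (simp add: exp_minus)
      finally have 1: "exp (c * u) - 1 \<le> exp (c * u) * (c * u)" by (simp add: algebra_simps)
      have "c * u \<le> (1 + c) * min 1 u" if "u \<le> 1" using that u by (simp add: algebra_simps)
      moreover have "1 \<le> (1 + c) * min 1 u" if "\<not> u \<le> 1" using that c_pos by simp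
      ultimately show ?thesis using 1
        by (cases "u \<le> 1") (auto intro: order_trans[OF 1] mult_left_mono order_trans[of _ "exp (c * u) * 1"])
    qed
    also have "exp (c * u) * ((1 + c) * min 1 u) \<le> Ej \<mu> t k l * ((1 + c) * min 1 u)"
    proof -
      have "exp (c * u) \<le> Ej \<mu> t k l"
        using False u c_pos unfolding en_def en by (auto simp: exp_add[symmetric])
      then show ?thesis using u c_pos by (intro mult_right_mono) auto
    qed
    finally have "V t k l \<eta> \<xi> * \<bar>en c \<mu> t k - en c \<mu> t l\<bar> \<le> V t k l \<eta> \<xi> * (Ej \<mu> t k l * ((1 + c) * min 1 u))"
      by (intro mult_left_mono) auto
    also have "\<dots> = ((1 + c) * Ej \<mu> t k l) * (V t k l \<eta> \<xi> * min 1 u)" by simp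
    also have "\<dots> \<le> ((1 + c) * Ej \<mu> t k l) * (K * jap2 (k - l) (\<eta> - \<xi>) ^ 10 * Br \<mu> h t k l \<eta> \<xi>)"
      unfolding u_def using c_pos by (intro mult_left_mono K(2)[OF a kl X]) auto
    finally show ?thesis by (simp add: mult_ac)
  qed
  then show ?thesis using K(1) c_pos by (intro exI[of _ "(1 + c) * K"]) auto
qed

lemma en_l_le: "0 \<le> t \<Longrightarrow> en c \<mu> t l \<le> Ej \<mu> t k l"
  using en_ge_1[of t \<mu> "k - l"] mult_right_mono[of 1 "en c \<mu> t (k - l)" "en c \<mu> t l"] by simp

lemma G_term:
  "\<exists>K>0. \<forall>\<mu> h t k l \<eta> \<xi>. adm \<mu> h t k l \<longrightarrow> k \<noteq> l \<longrightarrow>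
     jap2 (k - l) (\<eta> - \<xi>) ^ 7 * (t * \<l> t * G t l \<xi>) * en c \<mu> t l
       \<le> K * jap2 (k - l) (\<eta> - \<xi>) ^ 10 * Ej \<mu> t k l * Br \<mu> h t k l \<eta> \<xi>"
proof -
  obtain K where K: "K > 0" "\<And>\<mu> t k l \<eta> \<xi>. 0 < \<mu> \<Longrightarrow> \<mu> \<le> 1/2 \<Longrightarrow> 1 \<le> t \<Longrightarrow>
     exp (- (c * (t * \<mu> powr (1/3)))) * (t * \<l> t * G t l \<xi>)
       \<le> K * jap2 (k - l) (\<eta> - \<xi>) ^ 3 * (Lf \<mu> * \<mu> powr (- 1/3) * (w \<mu> t k \<eta> * w \<mu> t l \<xi>))" using resonance_gain by blast
  have "jap2 (k - l) (\<eta> - \<xi>) ^ 7 * (t * \<l> t * G t l \<xi>) * en c \<mu> t l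
       \<le> K * jap2 (k - l) (\<eta> - \<xi>) ^ 10 * Ej \<mu> t k l * Br \<mu> h t k l \<eta> \<xi>"
    if a: "adm \<mu> h t k l" and kl: "k \<noteq> l" for \<mu> h t k l \<eta> \<xi>
  proof -
    define J where "J = jap2 (k - l) (\<eta> - \<xi>)"
    define e where "e = exp (- (c * (t * \<mu> powr (1/3))))"
    have J: "1 \<le> J" by (simp add: J_def)
    have a': "0 < \<mu>" "\<mu> \<le> 1/2" "1 \<le> t" "0 \<le> t" "0 \<le> h" using a by (auto simp: adm_def)
    have "e * (t * \<l> t * G t l \<xi>) \<le> K * J ^ 3 * (Lf \<mu> * \<mu> powr (- 1/3) * (w \<mu> t k \<eta> * w \<mu> t l \<xi>))"
      unfolding e_def J_def by (rule K(2)[OF a'(1-3)])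
    also have "\<dots> \<le> K * J ^ 3 * Br \<mu> h t k l \<eta> \<xi>"
      using K(1) J by (intro mult_left_mono Br_ge(2) a') auto
    finally have "(J ^ 7 * Ej \<mu> t k l) * (e * (t * \<l> t * G t l \<xi>)) \<le> (J ^ 7 * Ej \<mu> t k l) * (K * J ^ 3 * Br \<mu> h t k l \<eta> \<xi>)"
      using J by (intro mult_left_mono) auto
    also have "\<dots> = K * J ^ 10 * Ej \<mu> t k l * Br \<mu> h t k l \<eta> \<xi>"
      using power_add[of J 7 3] by simp
    finally have le: "(J ^ 7 * Ej \<mu> t k l) * (e * (t * \<l> t * G t l \<xi>)) \<le> K * J ^ 10 * Ej \<mu> t k l * Br \<mu> h t k l \<eta> \<xi>" .
    have "J ^ 7 * (t * \<l> t * G t l \<xi>) * en c \<mu> t l = J ^ 7 * (t * \<l> t * G t l \<xi>) * (e * Ej \<mu> t k l)"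
      unfolding e_def using en_gain[OF kl, of \<mu> t] by (rule arg_cong)
    also have "\<dots> = (J ^ 7 * Ej \<mu> t k l) * (e * (t * \<l> t * G t l \<xi>))" by (simp only: mult_ac)
    finally show ?thesis using le by (simp only: J_def)
  qed
  then show ?thesis using K(1) by blast
qed

text \<open>
  With \<open>|l, \<xi>|\<close> at most \<open>2 |l| t\<close>, one power of \<open>t\<close> is lost and the prefactor of \<open>E_shift\<close> appears.
\<close>

lemma V_le_resonant:
  assumes "k \<noteq> l" "1 \<le> t" "abs2 l \<xi> \<le> 2 * \<bar>of_int l\<bar> * t"
  shows "V t k l \<eta> \<xi> \<le> 8 * jap2 (k - l) (\<eta> - \<xi>) ^ 3 * (\<bar>of_int l\<bar> * t powr (- \<gamma>))"
proof -
  have "V t k l \<eta> \<xi> \<le> 4 * jap2 (k - l) (\<eta> - \<xi>) ^ 3 * (abs2 l \<xi> * t powr (- (1 + \<gamma>)))"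
    by (rule V_le_damped[OF assms(1,2)])
  also have "\<dots> \<le> 4 * jap2 (k - l) (\<eta> - \<xi>) ^ 3 * ((2 * \<bar>of_int l\<bar> * t) * t powr (- (1 + \<gamma>)))"
    using assms by (intro mult_left_mono mult_right_mono) auto
  also have "t * t powr (- (1 + \<gamma>)) = t powr (- \<gamma>)"
  proof -
    have "t * t powr (- (1 + \<gamma>)) = t powr 1 * t powr (- (1 + \<gamma>))" using assms by simp
    also have "\<dots> = t powr (- \<gamma>)" unfolding powr_add[symmetric] by simp
    finally show ?thesis .
  qed
  then have "4 * jap2 (k - l) (\<eta> - \<xi>) ^ 3 * ((2 * \<bar>of_int l\<bar> * t) * t powr (- (1 + \<gamma>))) = 8 * jap2 (k - l) (\<eta> - \<xi>) ^ 3 * (\<bar>of_int l\<bar> * t powr (- \<gamma>))"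
    by (simp only: mult.assoc)
  finally show ?thesis .
qed

lemma freq_ratio:
  assumes "k \<noteq> 0"
  shows "\<bar>of_int l\<bar> / \<bar>of_int k\<bar> \<le> 2 * jap2 (k - l) \<zeta>"
proof -
  define J where "J = jap2 (k - l) \<zeta>"
  define K where "K = \<bar>real_of_int k\<bar>"
  have k: "1 \<le> K" using assms unfolding K_def by linarith
  have J: "1 \<le> J" by (simp add: J_def)
  have "\<bar>of_int (k - l)\<bar> \<le> J" unfolding J_def by (rule order_trans[OF abs2_ge(1) abs2_le_jap2])
  then have "\<bar>of_int l\<bar> \<le> K + J" unfolding K_def by simp
  also have "\<dots> \<le> K * J + K * J" using k J mult_mono[of 1 K J J] mult_mono[of K K 1 J] by (intro add_mono) auto
  finally show ?thesis using k unfolding J_def[symmetric] K_def[symmetric] by (simp add: divide_le_eq mult_ac)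
qed

lemma min_bounds: "0 \<le> t \<Longrightarrow> 0 \<le> min 1 (t * \<mu> powr (1/3))" "min 1 (t * \<mu> powr (1/3)) \<le> 1"
  for t \<mu> :: real
  by auto

text \<open>
  A bound for \<open>E\<close>, and hence for the exponent of \<open>m_res\<close>.
\<close>

definition EB :: real where "EB = integral\<^sup>L lborel g * B2"

lemma EB_nonneg: "0 \<le> EB"
  using E_nonneg[of 0 0 0] E_bounded[of 0 0 0] unfolding EB_def by linarith

lemma m_res_diff_le:
  assumes "0 \<le> t"
  shows "\<bar>m_res c r \<gamma> \<mu> t k \<eta> - m_res c r \<gamma> \<mu> t l \<xi>\<bar> \<le> exp EB * (min 1 (t * \<mu> powr (1/3)) * \<bar>E t k \<eta> - E t l \<xi>\<bar>)"
proof -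
  define mn where "mn = min 1 (t * \<mu> powr (1/3))"
  have mn: "0 \<le> mn" "mn \<le> 1" unfolding mn_def using min_bounds assms by auto
  have *: "mn * E t k \<eta> \<le> EB" for k \<eta>
    using mult_mono[OF mn(2) E_bounded[of t k \<eta>]] mn E_nonneg[of t k \<eta>] by (simp add: EB_def)
  show ?thesis
    using exp_diff_le[OF *[of k \<eta>] *[of l \<xi>]] mn
    unfolding m_res_eq mn_def[symmetric] by (simp add: right_diff_distrib[symmetric] abs_mult)
qed

lemma m_res_bounds:
  assumes "0 \<le> t"
  shows "1 \<le> m_res c r \<gamma> \<mu> t k \<eta>" "m_res c r \<gamma> \<mu> t k \<eta> \<le> exp EB"
proof -
  define mn where "mn = min 1 (t * \<mu> powr (1/3))"
  have mn: "0 \<le> mn" "mn \<le> 1" unfolding mn_def using min_bounds assms by auto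
  have "mn * E t k \<eta> \<le> EB"
    using mult_mono[OF mn(2) E_bounded[of t k \<eta>]] mn E_nonneg[of t k \<eta>] by (simp add: EB_def)
  then show "1 \<le> m_res c r \<gamma> \<mu> t k \<eta>" "m_res c r \<gamma> \<mu> t k \<eta> \<le> exp EB"
    using mn E_nonneg[of t k \<eta>] unfolding m_res_eq mn_def[symmetric] by auto
qed

text \<open>
  Away from resonance the cutoff in the exponent of \<open>m_res\<close> is all that is needed.  In the resonant
  case, first \<open>\<eta>\<close> is moved to \<open>\<xi>\<close> in the mode \<open>k\<close> by \<open>E_Lipschitz\<close>, where \<open>|l| / |k|\<close> is harmless, and then \<open>k\<close>
  to \<open>l\<close> by \<open>E_shift\<close>.
\<close>

lemma transport_m_res_diff:
  "\<exists>K>0. \<forall>\<mu> h t k l \<eta> \<xi>. adm \<mu> h t k l \<longrightarrow> 8 * abs2 (k - l) (\<eta> - \<xi>) \<le> abs2 l \<xi> \<longrightarrow>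
     V t k l \<eta> \<xi> * \<bar>m_res c r \<gamma> \<mu> t k \<eta> - m_res c r \<gamma> \<mu> t l \<xi>\<bar> * en c \<mu> t l
       \<le> K * jap2 (k - l) (\<eta> - \<xi>) ^ 10 * Ej \<mu> t k l * Br \<mu> h t k l \<eta> \<xi>"
proof -
  obtain K1 where K1: "K1 > 0" "\<And>\<mu> h t k l \<eta> \<xi> S n x. adm \<mu> h t k l \<Longrightarrow> 0 \<le> S \<Longrightarrow> S \<le> jap2 (k - l) (\<eta> - \<xi>) ^ n \<Longrightarrow> n \<le> 10 \<Longrightarrow> 0 \<le> x \<Longrightarrow> x \<le> Ej \<mu> t k l \<Longrightarrow>
     S * x \<le> K1 * jap2 (k - l) (\<eta> - \<xi>) ^ 10 * Ej \<mu> t k l * Br \<mu> h t k l \<eta> \<xi>" using bounded_term by meson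
  obtain K2 where K2: "K2 > 0" "\<And>\<mu> h t k l \<eta> \<xi>. adm \<mu> h t k l \<Longrightarrow> k \<noteq> l \<Longrightarrow>
     jap2 (k - l) (\<eta> - \<xi>) ^ 7 * (t * \<l> t * G t l \<xi>) * en c \<mu> t l
       \<le> K2 * jap2 (k - l) (\<eta> - \<xi>) ^ 10 * Ej \<mu> t k l * Br \<mu> h t k l \<eta> \<xi>" using G_term by blast
  obtain K3 where K3: "K3 > 0" "\<And>\<mu> h t k l \<eta> \<xi>. adm \<mu> h t k l \<Longrightarrow> k \<noteq> l \<Longrightarrow> abs2 l \<xi> \<le> 2 * (Lam t l \<xi> + Lam t k \<eta>) \<Longrightarrow>
     V t k l \<eta> \<xi> * min 1 (t * \<mu> powr (1/3)) \<le> K3 * jap2 (k - l) (\<eta> - \<xi>) ^ 10 * Br \<mu> h t k l \<eta> \<xi>" using min_nonres_term by blast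
  obtain C where C: "C > 0" "\<And>t k \<eta> \<xi>. k \<noteq> 0 \<Longrightarrow> \<bar>E t k \<eta> - E t k \<xi>\<bar> \<le> C * (\<bar>\<eta> - \<xi>\<bar> / \<bar>of_int k\<bar>)" using E_Lipschitz by blast
  obtain K4 where K4: "K4 > 0" "\<And>t k l \<xi>. 1 \<le> t \<Longrightarrow> k \<noteq> 0 \<Longrightarrow> l \<noteq> 0 \<Longrightarrow> \<bar>\<xi>\<bar> \<le> 2 * \<bar>of_int l\<bar> * t \<Longrightarrow>
     \<bar>of_int l\<bar> * t powr (- \<gamma>) * \<bar>E t k \<xi> - E t l \<xi>\<bar>
       \<le> K4 * jap (of_int (k - l)) ^ 4 * (1 + t * \<l> t * G t l \<xi>)" using E_shift by blast
  define D where "D = exp EB"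
  have D: "0 < D" by (simp add: D_def)
  define K where "K = D * C * K1 + D * EB * K3 + 8 * D * (2 * C + K4) * K1 + 8 * D * K4 * K2"
  have K: "D * C * K1 \<le> K" "D * EB * K3 \<le> K" "8 * D * (2 * C + K4) * K1 + 8 * D * K4 * K2 \<le> K" "0 < K"
    using K1(1) K2(1) K3(1) K4(1) C(1) D EB_nonneg unfolding K_def by (simp_all add: add_pos_nonneg)
  have "V t k l \<eta> \<xi> * \<bar>m_res c r \<gamma> \<mu> t k \<eta> - m_res c r \<gamma> \<mu> t l \<xi>\<bar> * en c \<mu> t l
       \<le> K * (jap2 (k - l) (\<eta> - \<xi>) ^ 10 * Ej \<mu> t k l * Br \<mu> h t k l \<eta> \<xi>)"
    if a: "adm \<mu> h t k l" and reg: "8 * abs2 (k - l) (\<eta> - \<xi>) \<le> abs2 l \<xi>" for \<mu> h t k l \<eta> \<xi>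
  proof -
    define J where "J = jap2 (k - l) (\<eta> - \<xi>)"
    define B where "B = J ^ 10 * Ej \<mu> t k l * Br \<mu> h t k l \<eta> \<xi>"
    define v where "v = V t k l \<eta> \<xi>"
    define mn where "mn = min 1 (t * \<mu> powr (1/3))"
    define dE where "dE = \<bar>E t k \<eta> - E t l \<xi>\<bar>"
    define el where "el = en c \<mu> t l"
    have t: "1 \<le> t" "0 \<le> t" using a by (auto simp: adm_def)
    have J: "1 \<le> J" by (simp add: J_def)
    have B: "0 \<le> B" unfolding B_def using J adm_Br(1)[OF a] by simp
    have v: "0 \<le> v" by (simp add: v_def)
    have mn: "0 \<le> mn" "mn \<le> 1" unfolding mn_def using min_bounds t by auto
    have dE: "0 \<le> dE" "dE \<le> EB"
      using E_nonneg[of t k \<eta>] E_nonneg[of t l \<xi>] E_bounded[of t k \<eta>] E_bounded[of t l \<xi>] by (auto simp: dE_def EB_def)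
    have el: "0 < el" "el \<le> Ej \<mu> t k l" unfolding el_def using en_l_le[OF t(2)] by auto
    have "v * \<bar>m_res c r \<gamma> \<mu> t k \<eta> - m_res c r \<gamma> \<mu> t l \<xi>\<bar> * el \<le> v * (D * (mn * dE)) * el"
      unfolding D_def mn_def dE_def using v el t by (intro mult_right_mono mult_left_mono m_res_diff_le) auto
    also have "\<dots> \<le> K * B"
    proof (cases "k = l")
      case True
      then have l: "l \<noteq> 0" using a by (auto simp: adm_def)
      have "mn * dE \<le> 1 * (C * (\<bar>\<eta> - \<xi>\<bar> / \<bar>of_int l\<bar>))"
        unfolding dE_def True using mn C(2)[OF l] by (intro mult_mono) auto
      then have "v * (D * (mn * dE)) * el \<le> v * (D * (1 * (C * (\<bar>\<eta> - \<xi>\<bar> / \<bar>of_int l\<bar>)))) * el"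
        using v D el by (intro mult_right_mono mult_left_mono) auto
      also have "\<dots> = D * C * ((v * (\<bar>\<eta> - \<xi>\<bar> / \<bar>of_int l\<bar>)) * el)" by simp
      also have "\<dots> \<le> D * C * (K1 * J ^ 10 * Ej \<mu> t k l * Br \<mu> h t k l \<eta> \<xi>)"
        unfolding J_def using V_diag_div[OF l, of t \<eta> \<xi>] True D C(1) v el
        by (intro mult_left_mono K1(2)[OF a, where n = 1]) (auto simp: v_def)
      also have "\<dots> = (D * C * K1) * B" by (simp add: B_def)
      also have "\<dots> \<le> K * B" by (intro mult_right_mono K B)
      finally show ?thesis .
    next
      case kl: False
      show ?thesis
      proof (rule transport_cases[OF reg t(2)])
        assume X: "abs2 l \<xi> \<le> 2 * (Lam t l \<xi> + Lam t k \<eta>)"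
        have "v * (D * (mn * dE)) * el \<le> v * (D * (mn * EB)) * Ej \<mu> t k l"
          using v D mn dE el EB_nonneg by (intro mult_mono mult_left_mono) auto
        also have "\<dots> = D * EB * Ej \<mu> t k l * (v * mn)" by simp
        also have "\<dots> \<le> D * EB * Ej \<mu> t k l * (K3 * J ^ 10 * Br \<mu> h t k l \<eta> \<xi>)"
          unfolding v_def mn_def J_def using D EB_nonneg by (intro mult_left_mono K3(2)[OF a kl X]) auto
        also have "\<dots> = (D * EB * K3) * B" by (simp add: B_def)
        also have "\<dots> \<le> K * B" by (intro mult_right_mono K B)
        finally show ?thesis .
      next
        assume k: "k \<noteq> 0" and l: "l \<noteq> 0" and X: "abs2 l \<xi> \<le> 2 * \<bar>of_int l\<bar> * t"
        define P where "P = \<bar>of_int l\<bar> * t powr (- \<gamma>)"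
        define T where "T = t * \<l> t * G t l \<xi>"
        have T: "0 \<le> T" unfolding T_def using t by simp
        have tg: "t powr (- \<gamma>) \<le> 1" using t gam_nonneg powr_mono[of "-\<gamma>" 0 t] by auto
        have P: "0 \<le> P" "P \<le> \<bar>of_int l\<bar>" using tg by (simp_all add: P_def mult_left_le)
        have vP: "v \<le> 8 * J ^ 3 * P" unfolding v_def J_def P_def by (rule V_le_resonant[OF kl t(1) X])
        have z: "\<bar>\<eta> - \<xi>\<bar> \<le> J" unfolding J_def by (rule order_trans[OF abs2_ge(2) abs2_le_jap2])
        have 1: "P * \<bar>E t k \<eta> - E t k \<xi>\<bar> \<le> 2 * C * J ^ 2"
        proof -
          have "P * \<bar>E t k \<eta> - E t k \<xi>\<bar> \<le> \<bar>of_int l\<bar> * (C * (J / \<bar>of_int k\<bar>))"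
            using P C(1) z k by (intro mult_mono order_trans[OF C(2)] mult_left_mono divide_right_mono) auto
          also have "\<dots> = C * J * (\<bar>of_int l\<bar> / \<bar>of_int k\<bar>)" by simp
          also have "\<dots> \<le> C * J * (2 * J)"
            unfolding J_def using C(1) by (intro mult_left_mono freq_ratio k) auto
          finally show ?thesis by (simp add: power2_eq_square mult_ac)
        qed
        have 2: "P * \<bar>E t k \<xi> - E t l \<xi>\<bar> \<le> K4 * J ^ 4 * (1 + T)"
        proof -
          have "P * \<bar>E t k \<xi> - E t l \<xi>\<bar> \<le> K4 * jap (of_int (k - l)) ^ 4 * (1 + T)"
            unfolding P_def T_def using order_trans[OF abs2_ge(2) X] by (intro K4(2)[OF t(1) k l])
          also have "\<dots> \<le> K4 * J ^ 4 * (1 + T)"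
            unfolding J_def using K4(1) T by (intro mult_right_mono mult_left_mono power_mono jap_le_jap2) auto
          finally show ?thesis .
        qed
        have "mn * dE \<le> 1 * (\<bar>E t k \<eta> - E t k \<xi>\<bar> + \<bar>E t k \<xi> - E t l \<xi>\<bar>)"
          unfolding dE_def using mn by (intro mult_mono) auto
        then have "v * (D * (mn * dE)) * el \<le> (8 * J ^ 3 * P) * (D * (\<bar>E t k \<eta> - E t k \<xi>\<bar> + \<bar>E t k \<xi> - E t l \<xi>\<bar>)) * el"
          using vP v D el P J mn dE by (intro mult_right_mono mult_mono mult_left_mono mult_nonneg_nonneg) auto
        also have "\<dots> = 8 * D * J ^ 3 * (P * \<bar>E t k \<eta> - E t k \<xi>\<bar> + P * \<bar>E t k \<xi> - E t l \<xi>\<bar>) * el"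
          by (simp add: algebra_simps)
        also have "\<dots> \<le> 8 * D * J ^ 3 * (2 * C * J ^ 2 + K4 * J ^ 4 * (1 + T)) * el"
          using 1 2 D J el by (intro mult_right_mono mult_left_mono add_mono) auto
        also have "\<dots> \<le> 8 * D * J ^ 3 * (2 * C * J ^ 4 + K4 * J ^ 4 * (1 + T)) * el"
          using D J el C(1) T by (intro mult_right_mono mult_left_mono add_mono power_increasing) auto
        also have "\<dots> = (8 * D * (2 * C + K4)) * (J ^ 7 * el) + (8 * D * K4) * (J ^ 7 * T * el)"
        proof -
          have "J ^ 7 = J ^ 3 * J ^ 4" by (simp flip: power_add)
          then show ?thesis by (simp add: algebra_simps)
        qed
        also have "\<dots> \<le> (8 * D * (2 * C + K4)) * (K1 * B) + (8 * D * K4) * (K2 * B)"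
        proof (intro add_mono mult_left_mono)
          show "J ^ 7 * el \<le> K1 * B"
            unfolding B_def mult.assoc[of K1, symmetric] J_def using el by (intro K1(2)[OF a, where n = 7]) auto
          show "J ^ 7 * T * el \<le> K2 * B"
            unfolding B_def mult.assoc[of K2, symmetric] J_def T_def el_def by (rule K2(2)[OF a kl])
        qed (use D C(1) K4(1) in auto)
        also have "\<dots> = (8 * D * (2 * C + K4) * K1 + 8 * D * K4 * K2) * B" by (simp add: algebra_simps)
        also have "\<dots> \<le> K * B" by (intro mult_right_mono K B)
        finally show ?thesis .
      qed
    qed
    finally show ?thesis by (simp add: v_def el_def B_def J_def)
  qed
  then show ?thesis using K(4) by (intro exI[of _ K]) (auto simp: mult.assoc)
qed

text \<open>
  The exponent of \<open>M_diss\<close> up to the factor \<open>1 / c\<close>, as a function of the critical time \<open>a\<close>.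
\<close>

definition arctan_incr :: "real \<Rightarrow> real \<Rightarrow> real \<Rightarrow> real" where
  "arctan_incr bb t a = arctan (bb * (t - a)) - arctan (bb * (- a))"

lemma M_diss_eq: "M_diss c \<mu> t k \<eta> = exp (inverse c * arctan_incr (\<mu> powr (1/3)) t (\<eta> / (if k = 0 then 1 else of_int k)))"
  by (simp add: M_diss_def arctan_incr_def Let_def)

lemma arctan_incr_bounds:
  assumes "0 \<le> t" "0 \<le> bb"
  shows "\<bar>arctan_incr bb t a\<bar> \<le> pi" "\<bar>arctan_incr bb t a\<bar> \<le> bb * t" "\<bar>arctan_incr bb t a - arctan_incr bb t a'\<bar> \<le> 2 * bb * \<bar>a - a'\<bar>"
proof -
  show "\<bar>arctan_incr bb t a\<bar> \<le> pi"
    using arctan_bounded[of "bb * (t - a)"] arctan_bounded[of "bb * (- a)"] unfolding arctan_incr_def by linarith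
  have "\<bar>arctan_incr bb t a\<bar> \<le> \<bar>bb * (t - a) - bb * (- a)\<bar>" unfolding arctan_incr_def by (rule arctan_Lipschitz)
  also have "\<dots> = bb * t" using assms by (simp add: algebra_simps)
  finally show "\<bar>arctan_incr bb t a\<bar> \<le> bb * t" .
  have "\<bar>arctan (bb * (t - a)) - arctan (bb * (t - a'))\<bar> \<le> bb * \<bar>a - a'\<bar>"
    using arctan_Lipschitz[of "bb * (t - a)" "bb * (t - a')"] assms
    by (simp add: right_diff_distrib[symmetric] abs_mult abs_minus_commute del: right_diff_distrib_numeral)
  moreover have "\<bar>arctan (bb * (- a)) - arctan (bb * (- a'))\<bar> \<le> bb * \<bar>a - a'\<bar>"
  proof -
    have "bb * (- a) - bb * (- a') = bb * (a' - a)" by (simp add: algebra_simps)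
    then show ?thesis using arctan_Lipschitz[of "bb * (- a)" "bb * (- a')"] assms by (simp only: abs_mult abs_minus_commute[of a'] abs_of_nonneg)
  qed
  ultimately show "\<bar>arctan_incr bb t a - arctan_incr bb t a'\<bar> \<le> 2 * bb * \<bar>a - a'\<bar>" unfolding arctan_incr_def by linarith
qed

lemma M_diss_bounds:
  assumes "0 \<le> t"
  shows "exp (- (pi / c)) \<le> M_diss c \<mu> t k \<eta>" "M_diss c \<mu> t k \<eta> \<le> exp (pi / c)"
proof -
  have inverse_mult: "inverse c * x = x / c" for x by (simp add: divide_inverse)
  have *: "\<bar>arctan_incr (\<mu> powr (1/3)) t a / c\<bar> \<le> pi / c" for a
    using arctan_incr_bounds(1)[OF assms, of "\<mu> powr (1/3)" a] c_pos by (simp add: abs_divide divide_right_mono)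
  have "arctan_incr (\<mu> powr (1/3)) t a / c \<le> pi / c" "- (pi / c) \<le> arctan_incr (\<mu> powr (1/3)) t a / c" for a
    using abs_le_D1[OF *[of a]] abs_le_D2[OF *[of a]] by linarith+
  then show "exp (- (pi / c)) \<le> M_diss c \<mu> t k \<eta>" "M_diss c \<mu> t k \<eta> \<le> exp (pi / c)"
    unfolding M_diss_eq inverse_mult by (simp_all only: exp_le_cancel_iff)
qed

text \<open>
  \<open>M_diss\<close> depends on the frequency through the critical time only.  In the resonant case the critical
  times differ by \<open>|\<zeta> l - j \<xi>| / |k l|\<close>; the two powers of \<open>|l|\<close> cancel, and the factor \<open>t \<mu>\<^sup>1\<^sup>/\<^sup>3\<close> that
  remains is absorbed by the exponential gain.
\<close>

lemma transport_M_diss_diff: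
  "\<exists>K>0. \<forall>\<mu> h t k l \<eta> \<xi>. adm \<mu> h t k l \<longrightarrow> 8 * abs2 (k - l) (\<eta> - \<xi>) \<le> abs2 l \<xi> \<longrightarrow>
     V t k l \<eta> \<xi> * \<bar>M_diss c \<mu> t k \<eta> - M_diss c \<mu> t l \<xi>\<bar> * en c \<mu> t l
       \<le> K * jap2 (k - l) (\<eta> - \<xi>) ^ 10 * Ej \<mu> t k l * Br \<mu> h t k l \<eta> \<xi>"
proof -
  obtain K1 where K1: "K1 > 0" "\<And>\<mu> h t k l \<eta> \<xi> S n x. adm \<mu> h t k l \<Longrightarrow> 0 \<le> S \<Longrightarrow> S \<le> jap2 (k - l) (\<eta> - \<xi>) ^ n \<Longrightarrow> n \<le> 10 \<Longrightarrow> 0 \<le> x \<Longrightarrow> x \<le> Ej \<mu> t k l \<Longrightarrow>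
     S * x \<le> K1 * jap2 (k - l) (\<eta> - \<xi>) ^ 10 * Ej \<mu> t k l * Br \<mu> h t k l \<eta> \<xi>" using bounded_term by meson
  obtain K3 where K3: "K3 > 0" "\<And>\<mu> h t k l \<eta> \<xi>. adm \<mu> h t k l \<Longrightarrow> k \<noteq> l \<Longrightarrow> abs2 l \<xi> \<le> 2 * (Lam t l \<xi> + Lam t k \<eta>) \<Longrightarrow>
     V t k l \<eta> \<xi> * min 1 (t * \<mu> powr (1/3)) \<le> K3 * jap2 (k - l) (\<eta> - \<xi>) ^ 10 * Br \<mu> h t k l \<eta> \<xi>" using min_nonres_term by blast
  obtain K0 where K0: "K0 > 0" "\<And>u. 0 \<le> u \<Longrightarrow> (1 + u) ^ 1 * exp (- (c * u)) \<le> K0"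
    using exp_absorb[OF c_pos, of 1] by blast
  define D where "D = exp (pi / c) / c"
  have D: "0 < D" using c_pos by (simp add: D_def)
  define K where "K = 2 * D * K1 + 2 * D * pi * K3 + 64 * D * K0 * K1"
  have K: "2 * D * K1 \<le> K" "2 * D * pi * K3 \<le> K" "64 * D * K0 * K1 \<le> K" "0 < K"
    using K1(1) K3(1) K0(1) D unfolding K_def by (simp_all add: add_pos_nonneg)
  have "V t k l \<eta> \<xi> * \<bar>M_diss c \<mu> t k \<eta> - M_diss c \<mu> t l \<xi>\<bar> * en c \<mu> t l
       \<le> K * (jap2 (k - l) (\<eta> - \<xi>) ^ 10 * Ej \<mu> t k l * Br \<mu> h t k l \<eta> \<xi>)"
    if a: "adm \<mu> h t k l" and reg: "8 * abs2 (k - l) (\<eta> - \<xi>) \<le> abs2 l \<xi>" for \<mu> h t k l \<eta> \<xi>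
  proof -
    define J where "J = jap2 (k - l) (\<eta> - \<xi>)"
    define B where "B = J ^ 10 * Ej \<mu> t k l * Br \<mu> h t k l \<eta> \<xi>"
    define v where "v = V t k l \<eta> \<xi>"
    define bb where "bb = \<mu> powr (1/3)"
    define u where "u = t * bb"
    define x where "x = \<eta> / (if k = 0 then 1 else of_int k)"
    define y where "y = \<xi> / (if l = 0 then 1 else of_int l)"
    define df where "df = \<bar>arctan_incr bb t x - arctan_incr bb t y\<bar>"
    define el where "el = en c \<mu> t l"
    have t: "1 \<le> t" "0 \<le> t" "0 < \<mu>" "\<mu> \<le> 1/2" using a by (auto simp: adm_def)
    have bb: "0 \<le> bb" "bb \<le> 1" unfolding bb_def using t by (auto intro!: powr_le1)
    have J: "1 \<le> J" by (simp add: J_def)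
    have B: "0 \<le> B" unfolding B_def using J adm_Br(1)[OF a] by simp
    have v: "0 \<le> v" by (simp add: v_def)
    have u: "0 \<le> u" using t bb by (simp add: u_def)
    have el: "0 < el" "el \<le> Ej \<mu> t k l" unfolding el_def using en_l_le[OF t(2)] by auto
    have df0: "0 \<le> df" by (simp add: df_def)
    have "\<bar>M_diss c \<mu> t k \<eta> - M_diss c \<mu> t l \<xi>\<bar> \<le> exp (pi / c) * \<bar>inverse c * arctan_incr bb t x - inverse c * arctan_incr bb t y\<bar>"
      unfolding M_diss_eq x_def y_def bb_def
    proof (rule exp_diff_le)
      fix a
      have "inverse c * arctan_incr bb t a \<le> inverse c * pi" for a
        using arctan_incr_bounds(1)[OF t(2) bb(1), of a] c_pos by (intro mult_left_mono) auto
      then have "inverse c * arctan_incr bb t a \<le> pi / c" for a by (simp add: divide_inverse mult.commute)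
      then show "inverse c * arctan_incr (\<mu> powr (1 / 3)) t (\<eta> / (if k = 0 then 1 else real_of_int k)) \<le> pi / c"
        "inverse c * arctan_incr (\<mu> powr (1 / 3)) t (\<xi> / (if l = 0 then 1 else real_of_int l)) \<le> pi / c"
        unfolding bb_def by blast+
    qed
    also have "\<dots> = D * df" using c_pos
      by (simp add: df_def D_def right_diff_distrib[symmetric] abs_mult divide_inverse)
    finally have "v * \<bar>M_diss c \<mu> t k \<eta> - M_diss c \<mu> t l \<xi>\<bar> * el \<le> v * (D * df) * el"
      using v el by (intro mult_right_mono mult_left_mono) auto
    also have "\<dots> \<le> K * B"
    proof (cases "k = l")
      case True
      then have l: "l \<noteq> 0" using a by (auto simp: adm_def)
      have "\<bar>x - y\<bar> = \<bar>\<eta> - \<xi>\<bar> / \<bar>of_int l\<bar>"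
        using l True by (simp add: x_def y_def diff_divide_distrib[symmetric] abs_divide)
      then have "df \<le> 2 * bb * (\<bar>\<eta> - \<xi>\<bar> / \<bar>of_int l\<bar>)"
        unfolding df_def using arctan_incr_bounds(3)[OF t(2) bb(1), of x y] by simp
      also have "\<dots> \<le> 2 * 1 * (\<bar>\<eta> - \<xi>\<bar> / \<bar>of_int l\<bar>)" using bb by (intro mult_right_mono) auto
      finally have "v * (D * df) * el \<le> v * (D * (2 * 1 * (\<bar>\<eta> - \<xi>\<bar> / \<bar>of_int l\<bar>))) * el"
        using v D el by (intro mult_right_mono mult_left_mono) auto
      also have "\<dots> = 2 * D * ((v * (\<bar>\<eta> - \<xi>\<bar> / \<bar>of_int l\<bar>)) * el)" by simp
      also have "\<dots> \<le> 2 * D * (K1 * J ^ 10 * Ej \<mu> t k l * Br \<mu> h t k l \<eta> \<xi>)"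
        unfolding J_def using V_diag_div[OF l, of t \<eta> \<xi>] True D v el
        by (intro mult_left_mono K1(2)[OF a, where n = 1]) (auto simp: v_def)
      also have "\<dots> = (2 * D * K1) * B" by (simp add: B_def)
      also have "\<dots> \<le> K * B" by (intro mult_right_mono K B)
      finally show ?thesis .
    next
      case kl: False
      show ?thesis
      proof (rule transport_cases[OF reg t(2)])
        assume X: "abs2 l \<xi> \<le> 2 * (Lam t l \<xi> + Lam t k \<eta>)"
        have dfl: "df \<le> 2 * pi * min 1 u"
        proof (cases "u \<le> 1")
          case True
          have "df \<le> u + u" using arctan_incr_bounds(2)[OF t(2) bb(1), of x] arctan_incr_bounds(2)[OF t(2) bb(1), of y]
            unfolding df_def u_def by (simp add: mult.commute)
          also have "\<dots> \<le> 2 * pi * u" using u pi_ge_two mult_right_mono[of 2 "2 * pi" u] by simp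
          finally show ?thesis using True by simp
        next
          case False
          have "df \<le> pi + pi" using arctan_incr_bounds(1)[OF t(2) bb(1), of x] arctan_incr_bounds(1)[OF t(2) bb(1), of y]
            unfolding df_def by linarith
          then show ?thesis using False by simp
        qed
        have "v * (D * df) * el \<le> v * (D * (2 * pi * min 1 u)) * Ej \<mu> t k l"
          using v D dfl df0 el u by (intro mult_mono mult_left_mono) auto
        also have "\<dots> = 2 * D * pi * Ej \<mu> t k l * (v * min 1 u)" by simp
        also have "\<dots> \<le> 2 * D * pi * Ej \<mu> t k l * (K3 * J ^ 10 * Br \<mu> h t k l \<eta> \<xi>)"
          unfolding v_def u_def bb_def J_def using D by (intro mult_left_mono K3(2)[OF a kl X]) auto
        also have "\<dots> = (2 * D * pi * K3) * B" by (simp add: B_def)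
        also have "\<dots> \<le> K * B" by (intro mult_right_mono K B)
        finally show ?thesis .
      next
        assume k: "k \<noteq> 0" and l: "l \<noteq> 0" and X: "abs2 l \<xi> \<le> 2 * \<bar>of_int l\<bar> * t"
        have tg: "t powr (- \<gamma>) \<le> 1" using t gam_nonneg powr_mono[of "-\<gamma>" 0 t] by auto
        have l1: "0 < \<bar>real_of_int l\<bar>" "0 < \<bar>real_of_int k\<bar>" using l k by auto
        have "v \<le> 8 * J ^ 3 * (\<bar>of_int l\<bar> * t powr (- \<gamma>))" unfolding v_def J_def by (rule V_le_resonant[OF kl t(1) X])
        also have "\<dots> \<le> 8 * J ^ 3 * (\<bar>of_int l\<bar> * 1)" using tg J by (intro mult_left_mono) auto
        finally have vl: "v \<le> 8 * J ^ 3 * \<bar>of_int l\<bar>" by simp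
        have "x - y = ((\<eta> - \<xi>) * of_int l - of_int (k - l) * \<xi>) / (of_int k * of_int l)"
          unfolding x_def y_def using k l by (simp add: field_simps)
        then have "\<bar>x - y\<bar> = \<bar>(\<eta> - \<xi>) * of_int l - of_int (k - l) * \<xi>\<bar> / (\<bar>of_int k\<bar> * \<bar>of_int l\<bar>)"
          by (simp add: abs_divide abs_mult)
        also have "\<dots> \<le> (J * (2 * \<bar>of_int l\<bar> * t)) / (\<bar>of_int k\<bar> * \<bar>of_int l\<bar>)"
          using X J by (intro divide_right_mono order_trans[OF abs2_cross] mult_mono) (auto simp: J_def abs2_le_jap2)
        also have "\<dots> = 2 * J * t / \<bar>of_int k\<bar>" using l1 by simp
        finally have xy: "\<bar>x - y\<bar> \<le> 2 * J * t / \<bar>of_int k\<bar>" .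
        have "df \<le> 2 * bb * \<bar>x - y\<bar>" unfolding df_def by (rule arctan_incr_bounds(3)[OF t(2) bb(1)])
        also have "\<dots> \<le> 2 * bb * (2 * J * t / \<bar>of_int k\<bar>)" using xy bb by (intro mult_left_mono) auto
        also have "\<dots> = 4 * J * u / \<bar>of_int k\<bar>" by (simp add: u_def)
        finally have dfl: "df \<le> 4 * J * u / \<bar>of_int k\<bar>" .
        have "v * df \<le> (8 * J ^ 3 * \<bar>of_int l\<bar>) * (4 * J * u / \<bar>of_int k\<bar>)"
          using vl dfl v df0 J by (intro mult_mono) auto
        also have "\<dots> = 32 * J ^ 4 * u * (\<bar>of_int l\<bar> / \<bar>of_int k\<bar>)" by (simp add: power4_eq_xxxx power3_eq_cube)
        also have "\<dots> \<le> 32 * J ^ 4 * u * (2 * J)"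
          unfolding J_def using u by (intro mult_left_mono freq_ratio k) auto
        also have "\<dots> = 64 * J ^ 5 * u" by (simp add: eval_nat_numeral)
        finally have vdf: "v * df \<le> 64 * J ^ 5 * u" .
        have "v * (D * df) * el = D * (v * df) * el" by simp
        also have "\<dots> \<le> D * (64 * J ^ 5 * u) * el" using vdf D el by (intro mult_right_mono mult_left_mono) auto
        also have "\<dots> = 64 * D * K0 * (J ^ 5 * (u * el / K0))" using K0(1) by simp
        also have "\<dots> \<le> 64 * D * K0 * (K1 * J ^ 10 * Ej \<mu> t k l * Br \<mu> h t k l \<eta> \<xi>)"
        proof (intro mult_left_mono)
          have "u * el = (u * exp (- (c * u))) * Ej \<mu> t k l"
            unfolding el_def using en_gain[OF kl, of \<mu> t] by (simp add: u_def bb_def)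
          also have "u * exp (- (c * u)) \<le> K0"
            by (rule order_trans[OF _ K0(2)[OF u]]) (simp add: mult_right_mono)
          finally have "u * el \<le> K0 * Ej \<mu> t k l" by simp
          then show "J ^ 5 * (u * el / K0) \<le> K1 * J ^ 10 * Ej \<mu> t k l * Br \<mu> h t k l \<eta> \<xi>"
            unfolding J_def using K0(1) u el by (intro K1(2)[OF a, where n = 5]) (auto simp: divide_le_eq mult_ac)
        qed (use D K0(1) in auto)
        also have "\<dots> = (64 * D * K0 * K1) * B" by (simp add: B_def)
        also have "\<dots> \<le> K * B" by (intro mult_right_mono K B)
        finally show ?thesis .
      qed
    qed
    finally show ?thesis by (simp add: v_def el_def B_def J_def)
  qed
  then show ?thesis using K(4) by (intro exI[of _ K]) (auto simp: mult.assoc)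
qed

text \<open>
  Admissibility is designed for this term: the prefactor \<open>|l, \<xi>| t\<^sup>-\<^sup>(\<^sup>1\<^sup>+\<^sup>\<gamma>\<^sup>)\<close> is the bound for \<open>V\<close>, and each summand
  of \<open>R_adm\<close> is one of the quantities controlled by the bracket.  The powers of \<open>\<langle>t \<mu>\<^sup>1\<^sup>/\<^sup>3\<rangle>\<close> are absorbed by
  the exponential gain.  For \<open>k = l\<close> the Lipschitz condition takes over.
\<close>

lemma transport_M_diff:
  assumes CL: "0 < CL"
  shows "\<exists>K>0. \<forall>\<mu> h t k l \<eta> \<xi> M. adm \<mu> (h t) t k l \<longrightarrow> 8 * abs2 (k - l) (\<eta> - \<xi>) \<le> abs2 l \<xi> \<longrightarrow>
     t * \<mu> powr (1/3) \<noteq> 1 \<longrightarrow>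
     abs2 l \<xi> / t powr (1 + \<gamma>) * \<bar>M k \<eta> - M l \<xi>\<bar> \<le> R_adm c r \<gamma> N \<mu> CL n h t k l \<eta> \<xi> * Lf \<mu> \<longrightarrow>
     (k = l \<longrightarrow> \<bar>M k \<eta> - M l \<xi>\<bar> \<le> CL * (1 / \<bar>real_of_int k\<bar>) * \<bar>\<eta> - \<xi>\<bar> * jap (\<eta> - \<xi>) powr (N - 5)) \<longrightarrow>
     V t k l \<eta> \<xi> * \<bar>M k \<eta> - M l \<xi>\<bar> * en c \<mu> t l
       \<le> K * jap2 (k - l) (\<eta> - \<xi>) powr (N - 2) * Ej \<mu> t k l * Br \<mu> (h t) t k l \<eta> \<xi>"
proof -
  obtain K1 where K1: "K1 > 0" "\<And>\<mu> h t k l \<eta> \<xi>. adm \<mu> h t k l \<Longrightarrow> 1 \<le> K1 * Br \<mu> h t k l \<eta> \<xi>" using one_le_Br by blast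
  obtain K0 where K0: "K0 > 0" "\<And>u. 0 \<le> u \<Longrightarrow> (1 + u) ^ Suc n * exp (- (c * u)) \<le> K0"
    using exp_absorb[OF c_pos, of "Suc n"] by blast
  define K where "K = CL * K1 + 20 * CL * K0"
  have K: "CL * K1 \<le> K" "20 * CL * K0 \<le> K" "0 < K" using K1(1) K0(1) CL by (simp_all add: K_def add_pos_pos)
  have "V t k l \<eta> \<xi> * \<bar>M k \<eta> - M l \<xi>\<bar> * en c \<mu> t l
       \<le> K * (jap2 (k - l) (\<eta> - \<xi>) powr (N - 2) * Ej \<mu> t k l * Br \<mu> (h t) t k l \<eta> \<xi>)"
    if a: "adm \<mu> (h t) t k l" and reg: "8 * abs2 (k - l) (\<eta> - \<xi>) \<le> abs2 l \<xi>" and ne: "t * \<mu> powr (1/3) \<noteq> 1"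
      and M3: "abs2 l \<xi> / t powr (1 + \<gamma>) * \<bar>M k \<eta> - M l \<xi>\<bar> \<le> R_adm c r \<gamma> N \<mu> CL n h t k l \<eta> \<xi> * Lf \<mu>"
      and M4: "k = l \<Longrightarrow> \<bar>M k \<eta> - M l \<xi>\<bar> \<le> CL * (1 / \<bar>real_of_int k\<bar>) * \<bar>\<eta> - \<xi>\<bar> * jap (\<eta> - \<xi>) powr (N - 5)"
    for \<mu> h t k l \<eta> \<xi> and M :: "int \<Rightarrow> real \<Rightarrow> real"
  proof -
    define J where "J = jap2 (k - l) (\<eta> - \<xi>)"
    define Bb where "Bb = Br \<mu> (h t) t k l \<eta> \<xi>"
    define B where "B = J powr (N - 2) * Ej \<mu> t k l * Bb"
    define v where "v = V t k l \<eta> \<xi>"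
    define dM where "dM = \<bar>M k \<eta> - M l \<xi>\<bar>"
    define el where "el = en c \<mu> t l"
    define u where "u = t * \<mu> powr (1/3)"
    have a': "1 \<le> t" "0 \<le> t" "0 < \<mu>" "\<mu> \<le> 1/2" "0 \<le> h t" "k \<noteq> 0 \<or> l \<noteq> 0" using a by (auto simp: adm_def)
    have J: "1 \<le> J" by (simp add: J_def)
    have Bb: "0 \<le> Bb" unfolding Bb_def using adm_Br(1)[OF a] .
    have B: "0 \<le> B" unfolding B_def using Bb by simp
    have v: "0 \<le> v" by (simp add: v_def)
    have dM: "0 \<le> dM" by (simp add: dM_def)
    have u: "0 \<le> u" using a' by (simp add: u_def)
    have el: "0 < el" "el \<le> Ej \<mu> t k l" unfolding el_def using en_l_le[OF a'(2)] by auto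
    have "v * dM * el \<le> K * B"
    proof (cases "k = l")
      case True
      then have l: "l \<noteq> 0" using a' by auto
      have "v * dM \<le> v * (CL * (1 / \<bar>real_of_int k\<bar>) * \<bar>\<eta> - \<xi>\<bar> * jap (\<eta> - \<xi>) powr (N - 5))"
        using M4[OF True] v unfolding dM_def by (intro mult_left_mono)
      also have "\<dots> = CL * jap (\<eta> - \<xi>) powr (N - 5) * (v * (\<bar>\<eta> - \<xi>\<bar> / \<bar>of_int l\<bar>))" using True by simp
      also have "\<dots> \<le> CL * jap (\<eta> - \<xi>) powr (N - 5) * J"
        using V_diag_div[OF l, of t \<eta> \<xi>] True CL unfolding v_def J_def by (intro mult_left_mono) auto
      also have "jap (\<eta> - \<xi>) = J" using True by (simp add: J_def jap_def jap2_def)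
      also have "CL * J powr (N - 5) * J = CL * J powr (N - 4)"
      proof -
        have "J powr (N - 5) * J powr 1 = J powr (N - 4)" unfolding powr_add[symmetric] by simp
        then show ?thesis using J by simp
      qed
      also have "\<dots> \<le> CL * J powr (N - 2)" using CL J by (intro mult_left_mono powr_mono) auto
      finally have vdM: "v * dM \<le> CL * J powr (N - 2)" .
      have "v * dM * el * 1 \<le> (CL * J powr (N - 2)) * Ej \<mu> t k l * (K1 * Bb)"
        using el v dM CL K1(2)[OF a] unfolding Bb_def by (intro mult_mono[OF mult_mono[OF vdM]]) auto
      also have "\<dots> = (CL * K1) * B" by (simp add: B_def)
      also have "\<dots> \<le> K * B" by (intro mult_right_mono K B)
      finally show ?thesis by simp
    next
      case kl: False
      define Z where "Z = 1 + h t * \<mu> powr (- 1/3) + (t + \<mu> powr (- 1/3)) * sqrt (dlog (m_res c r \<gamma> \<mu>) t k \<eta>)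
         * sqrt (dlog (m_res c r \<gamma> \<mu>) t l \<xi>) + \<mu> powr (1/3) * (Lam t l \<xi> + Lam t k \<eta>)"
      have tu: "t = \<mu> powr (- 1/3) * u" unfolding u_def using a' by (simp add: mult.left_commute flip: powr_add)
      have ww: "sqrt (dres \<mu> t k \<eta>) * sqrt (dres \<mu> t l \<xi>) \<le> w \<mu> t k \<eta> * w \<mu> t l \<xi>"
        using a' by (intro mult_mono w_ge w_nonneg) (auto simp: dres_nonneg)
      have "Lf \<mu> * Z = Lf \<mu> + Lf \<mu> * \<mu> powr (- 1/3) * h t
        + (1 + u) * (Lf \<mu> * \<mu> powr (- 1/3) * (sqrt (dres \<mu> t k \<eta>) * sqrt (dres \<mu> t l \<xi>)))
        + Lf \<mu> * (\<mu> powr (1/3) * (Lam t l \<xi> + Lam t k \<eta>))"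
      proof -
        have t2: "t + \<mu> powr (- 1/3) = \<mu> powr (- 1/3) * (1 + u)" using tu by (simp add: algebra_simps)
        show ?thesis unfolding Z_def dlog_m_res[OF a'(3) ne] t2 by (simp add: algebra_simps)
      qed
      also have "\<dots> \<le> Bb + Bb + (1 + u) * Bb + 2 * Bb"
      proof (intro add_mono mult_left_mono)
        show "Lf \<mu> * \<mu> powr (- 1/3) * (sqrt (dres \<mu> t k \<eta>) * sqrt (dres \<mu> t l \<xi>)) \<le> Bb"
          unfolding Bb_def using ww by (intro order_trans[OF _ Br_ge(2)] mult_left_mono a') auto
        show "Lf \<mu> \<le> Bb" unfolding Bb_def by (intro Br_one a')
        show "Lf \<mu> * \<mu> powr (- 1/3) * h t \<le> Bb" unfolding Bb_def by (intro Br_ge(1) a')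
        show "Lf \<mu> * (\<mu> powr (1/3) * (Lam t l \<xi> + Lam t k \<eta>)) \<le> 2 * Bb" unfolding Bb_def by (intro Br_Lam a')
      qed (use u in auto)
      also have "\<dots> \<le> 5 * (1 + u) * Bb" using u Bb by (simp add: algebra_simps)
      finally have LZ: "Lf \<mu> * Z \<le> 5 * (1 + u) * Bb" .
      have "abs2 l \<xi> * t powr (- (1 + \<gamma>)) * dM \<le> R_adm c r \<gamma> N \<mu> CL n h t k l \<eta> \<xi> * Lf \<mu>"
        using M3 unfolding dM_def powr_minus by (simp add: divide_inverse)
      also have "\<dots> = CL * jap u ^ n * J powr (N - 5) * (Lf \<mu> * Z)"
        unfolding R_adm_def Z_def u_def J_def by (simp add: mult_ac)
      also have "\<dots> \<le> CL * (1 + u) ^ n * J powr (N - 5) * (5 * (1 + u) * Bb)"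
      proof (rule mult_mono[OF _ LZ])
        have "jap u ^ n \<le> (1 + u) ^ n" using jap_le[of u] u by (intro power_mono) auto
        then show "CL * jap u ^ n * J powr (N - 5) \<le> CL * (1 + u) ^ n * J powr (N - 5)"
          using CL by (intro mult_right_mono mult_left_mono) auto
        have "0 \<le> Z" unfolding Z_def dlog_m_res[OF a'(3) ne] using a' by (simp add: dres_nonneg)
        then show "0 \<le> Lf \<mu> * Z" by simp
      qed (use CL u in auto)
      finally have X: "abs2 l \<xi> * t powr (- (1 + \<gamma>)) * dM \<le> 5 * CL * (1 + u) ^ Suc n * J powr (N - 5) * Bb"
        by (simp only: power_Suc mult_ac)
      have "v * dM \<le> 4 * J ^ 3 * (abs2 l \<xi> * t powr (- (1 + \<gamma>))) * dM"
        unfolding v_def J_def using dM by (intro mult_right_mono V_le_damped[OF kl a'(1)])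
      also have "\<dots> = 4 * J ^ 3 * (abs2 l \<xi> * t powr (- (1 + \<gamma>)) * dM)" by simp
      also have "\<dots> \<le> 4 * J ^ 3 * (5 * CL * (1 + u) ^ Suc n * J powr (N - 5) * Bb)"
        using X J by (intro mult_left_mono) auto
      also have "\<dots> = 20 * CL * (J powr (N - 5) * J powr 3) * (1 + u) ^ Suc n * Bb"
        using J by (simp add: powr_numeral mult_ac)
      also have "J powr (N - 5) * J powr 3 = J powr (N - 2)" unfolding powr_add[symmetric] by simp
      finally have "v * dM * el \<le> 20 * CL * J powr (N - 2) * (1 + u) ^ Suc n * Bb * el"
        using el by (intro mult_right_mono) auto
      also have "\<dots> = (20 * CL * B) * ((1 + u) ^ Suc n * exp (- (c * u)))"
      proof -
        have "el = exp (- (c * u)) * Ej \<mu> t k l" unfolding el_def u_def by (rule en_gain[OF kl])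
        then show ?thesis by (simp only: B_def mult_ac)
      qed
      also have "\<dots> \<le> (20 * CL * B) * K0" using CL B by (intro mult_left_mono K0(2) u) auto
      also have "\<dots> = (20 * CL * K0) * B" by simp
      also have "\<dots> \<le> K * B" by (intro mult_right_mono K B)
      finally show ?thesis .
    qed
    then show ?thesis by (simp add: v_def dM_def el_def B_def J_def Bb_def)
  qed
  then show ?thesis using K(3) by (intro exI[of _ K]) (auto simp: mult.assoc)
qed

section \<open>Reaction and the symbol bound\<close>

text \<open>
  The transporting frequency is the high one.  With \<open>s = \<langle>t - \<zeta> / j\<rangle>\<close> one has \<open>\<Lambda>\<^sub>j = |j| s\<close> and
  \<open>|j, \<zeta>| \<le> |j| (s + t)\<close>, so that \<open>V\<close> is at most \<open>(s + t) s\<^sup>-\<^sup>(\<^sup>1\<^sup>+\<^sup>\<gamma>\<^sup>)\<close> up to powers of the low frequency.  The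
  relative variation \<open>\<rho>\<close> of \<open>\<Lambda>\<^sup>p\<close> is of order \<open>(|j| s / t)\<^sup>p\<close>, which \<open>p \<le> \<gamma>\<close> keeps harmless.  If one of the inputs
  is an average in \<open>x\<close>, there is no resonance.
\<close>

lemma reaction_V:
  assumes a: "k \<noteq> 0 \<or> l \<noteq> 0" and t: "1 \<le> t" and reg: "abs2 l \<xi> \<le> 8 * abs2 (k - l) (\<eta> - \<xi>)"
    and p: "0 \<le> p" "p \<le> \<gamma>" and L: "0 < Lam t k \<eta>" "0 < Lam t l \<xi>"
  defines "\<rho> \<equiv> \<bar>Lam t k \<eta> powr p - Lam t l \<xi> powr p\<bar> * Lam t l \<xi> powr (- p)"
  shows "k \<noteq> l \<Longrightarrow> l \<noteq> 0 \<Longrightarrow> V t k l \<eta> \<xi> * (1 + \<rho>) \<le> 10 * jap2 l \<xi> ^ 2 * res t (t - (\<eta> - \<xi>) / of_int (k - l))"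
    and "k = l \<or> l = 0 \<Longrightarrow> V t k l \<eta> \<xi> * (1 + \<rho>) \<le> 24 * jap2 l \<xi>"
proof -
  define Q where "Q = Lam t (k - l) (\<eta> - \<xi>)"
  define j where "j = \<bar>real_of_int (k - l)\<bar>"
  define v where "v = V t k l \<eta> \<xi>"
  define LL where "LL = jap2 l \<xi>"
  have LL: "1 \<le> LL" "abs2 l \<xi> \<le> LL" by (simp_all add: LL_def abs2_le_jap2)
  have p1: "p \<le> 1" using p gam_le_1 by linarith
  have \<rho>: "0 \<le> \<rho>" "\<rho> \<le> 2 * (Q / Lam t l \<xi>) powr p"
    unfolding \<rho>_def Q_def using powr_ratio_le(2)[OF L p(1) p1 Lam_diff] by auto
  have v0: "0 \<le> v" by (simp add: v_def)
  show "V t k l \<eta> \<xi> * (1 + \<rho>) \<le> 10 * jap2 l \<xi> ^ 2 * res t (t - (\<eta> - \<xi>) / of_int (k - l))"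
    if kl: "k \<noteq> l" and l: "l \<noteq> 0"
  proof -
    define s where "s = jap (t - (\<eta> - \<xi>) / of_int (k - l))"
    have s: "1 \<le> s" by (simp add: s_def)
    have j: "1 \<le> j" unfolding j_def using kl by linarith
    have Q: "Q = j * s" unfolding Q_def j_def s_def using kl by (intro Lam_jap) auto
    have Xj: "abs2 (k - l) (\<eta> - \<xi>) \<le> j * (s + t)"
      using abs2_le_Lam[of t "k - l" "\<eta> - \<xi>"] t Q unfolding Q_def j_def by (simp add: distrib_left)
    have v1: "v \<le> LL * (s + t) * s powr (- (1 + \<gamma>)) * j powr (- \<gamma>)"
    proof -
      have "v \<le> ((j * (s + t)) * LL) * (j * s) powr (- (1 + \<gamma>))"
        unfolding v_def V_def Q_def[symmetric] Q
        using Xj LL j s t by (intro mult_right_mono order_trans[OF abs2_cross] mult_mono mult_nonneg_nonneg) auto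
      also have "(j * s) powr (- (1 + \<gamma>)) = j powr (- (1 + \<gamma>)) * s powr (- (1 + \<gamma>))" using j s by (simp add: powr_mult)
      also have "((j * (s + t)) * LL) * (j powr (- (1 + \<gamma>)) * s powr (- (1 + \<gamma>))) = LL * (s + t) * s powr (- (1 + \<gamma>)) * (j powr 1 * j powr (- (1 + \<gamma>)))"
        using j by simp
      also have "j powr 1 * j powr (- (1 + \<gamma>)) = j powr (- \<gamma>)" unfolding powr_add[symmetric] by simp
      finally show ?thesis .
    qed
    have \<rho>1: "\<rho> \<le> 4 * LL * (j powr p * (s / t) powr p)"
    proof -
      have "Q / Lam t l \<xi> \<le> (2 * LL) * (j * (s / t))"
      proof -
        have "t \<le> 2 * (Lam t l \<xi> * LL)" unfolding LL_def using t by (intro Lam_lower[OF l]) auto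
        then have "Q * t \<le> Q * (2 * (Lam t l \<xi> * LL))" unfolding Q using j s by (intro mult_left_mono) auto
        then show ?thesis using L t unfolding Q by (simp add: field_simps)
      qed
      then have "(Q / Lam t l \<xi>) powr p \<le> ((2 * LL) * (j * (s / t))) powr p"
        using p L Q j s by (intro powr_mono2) auto
      also have "\<dots> = (2 * LL) powr p * (j powr p * (s / t) powr p)" by (simp only: powr_mult)
      also have "\<dots> \<le> (2 * LL) powr 1 * (j powr p * (s / t) powr p)" using LL p1 by (intro mult_right_mono powr_mono) auto
      finally show ?thesis using \<rho>(2) LL by simp
    qed
    have jp: "j powr (- \<gamma>) \<le> 1" "j powr (- \<gamma>) * j powr p \<le> 1"
      using j p gam_nonneg powr_mono[of "-\<gamma>" 0 j] powr_mono[of "p-\<gamma>" 0 j] by (auto simp: powr_add[symmetric])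
    define F where "F = (s + t) * s powr (- (1 + \<gamma>))"
    have F: "0 \<le> F" unfolding F_def using s t by simp
    have "v * (1 + \<rho>) = v + v * \<rho>" by (simp add: algebra_simps)
    moreover have "v \<le> LL\<^sup>2 * F"
    proof -
      have "v \<le> LL * F * j powr (- \<gamma>)" using v1 by (simp add: F_def mult_ac)
      also have "\<dots> \<le> (LL * F) * 1" using jp LL F by (intro mult_left_mono) auto
      also have "\<dots> \<le> LL * (LL * F)" using LL F mult_right_mono[of 1 LL "LL * F"] by simp
      finally show ?thesis by (simp add: power2_eq_square)
    qed
    moreover have "v * \<rho> \<le> 4 * LL\<^sup>2 * (F * (s / t) powr p)"
    proof -
      have "v * \<rho> \<le> (LL * (s + t) * s powr (- (1 + \<gamma>)) * j powr (- \<gamma>)) * (4 * LL * (j powr p * (s / t) powr p))"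
        using v1 \<rho>1 v0 \<rho>(1) LL s t by (intro mult_mono) auto
      also have "\<dots> = (4 * LL\<^sup>2 * (F * (s / t) powr p)) * (j powr (- \<gamma>) * j powr p)"
        by (simp add: F_def power2_eq_square mult_ac)
      also have "\<dots> \<le> (4 * LL\<^sup>2 * (F * (s / t) powr p)) * 1" using jp F by (intro mult_left_mono) auto
      finally show ?thesis by simp
    qed
    ultimately have 1: "v * (1 + \<rho>) \<le> LL\<^sup>2 * F + 4 * LL\<^sup>2 * (F * (s / t) powr p)" by linarith
    have F2: "F \<le> 2 * res t (t - (\<eta> - \<xi>) / of_int (k - l)) \<and> F * (s / t) powr p \<le> 2 * res t (t - (\<eta> - \<xi>) / of_int (k - l))"
    proof (cases "s \<le> t")
      case True
      have "F \<le> (2 * t) * s powr (- (1 + \<gamma>))" unfolding F_def using True by (intro mult_right_mono) auto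
      also have "\<dots> \<le> 2 * res t (t - (\<eta> - \<xi>) / of_int (k - l))"
        using True t unfolding res_def s_def[symmetric] by simp
      finally have f: "F \<le> 2 * res t (t - (\<eta> - \<xi>) / of_int (k - l))" .
      have "(s / t) powr p \<le> 1" using True s t p by (intro powr_le1) auto
      then have "F * (s / t) powr p \<le> F" using F by (simp add: mult_left_le)
      then show ?thesis using f by linarith
    next
      case False
      have st: "1 \<le> (s / t)" using False t by simp
      have e: "s * s powr (- (1 + \<gamma>)) = s powr (- \<gamma>)"
      proof -
        have "s * s powr (- (1 + \<gamma>)) = s powr 1 * s powr (- (1 + \<gamma>))" using s by simp
        also have "\<dots> = s powr (- \<gamma>)" unfolding powr_add[symmetric] by simp
        finally show ?thesis .
      qed
      have "F \<le> (2 * s) * s powr (- (1 + \<gamma>))" unfolding F_def using False by (intro mult_right_mono) auto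
      then have f: "F \<le> 2 * s powr (- \<gamma>)" using e by simp
      have sp: "(s / t) powr p \<le> s powr p" using s t p by (intro powr_mono2) (auto simp: divide_le_eq mult_le_cancel_left1)
      have one: "1 \<le> (s / t) powr p" using st p by (intro ge_one_powr_ge_zero) auto
      have "F * (s / t) powr p \<le> (2 * s powr (- \<gamma>)) * s powr p" using f sp F by (intro mult_mono) auto
      also have "\<dots> = 2 * s powr (p - \<gamma>)" by (simp add: powr_add[symmetric])
      also have "s powr (p - \<gamma>) \<le> s powr 0" using s p by (intro powr_mono) auto
      finally have 2: "F * (s / t) powr p \<le> 2" using s by simp
      have "F * 1 \<le> F * (s / t) powr p" using one F by (intro mult_left_mono)
      then show ?thesis using 2 res_ge_1[of t "t - (\<eta> - \<xi>) / of_int (k - l)"] t by linarith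
    qed
    define Rr where "Rr = res t (t - (\<eta> - \<xi>) / of_int (k - l))"
    have "LL\<^sup>2 * F \<le> LL\<^sup>2 * (2 * Rr)" "4 * LL\<^sup>2 * (F * (s / t) powr p) \<le> 4 * LL\<^sup>2 * (2 * Rr)"
      using F2 unfolding Rr_def by (intro mult_left_mono; simp)+
    then have "v * (1 + \<rho>) \<le> 10 * LL\<^sup>2 * Rr" using 1 by linarith
    then show ?thesis by (simp add: v_def LL_def Rr_def)
  qed
  show "V t k l \<eta> \<xi> * (1 + \<rho>) \<le> 24 * jap2 l \<xi>" if kl0: "k = l \<or> l = 0"
  proof (cases "k = l")
    case True
    then have l: "l \<noteq> 0" using a by auto
    define z where "z = \<bar>\<eta> - \<xi>\<bar>"
    have l1: "1 \<le> \<bar>real_of_int l\<bar>" using l by linarith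
    have z8: "\<bar>of_int l\<bar> \<le> 8 * z" using order_trans[OF abs2_ge(1) reg] True by (simp add: z_def Lam_zero_mode)
    have z: "1/8 \<le> z" "0 < z" using l1 z8 by linarith+
    have Qz: "Q = z" using True by (simp add: Q_def z_def Lam_zero_mode)
    have vz: "v = \<bar>of_int l\<bar> * z powr (- \<gamma>)"
    proof -
      have "v = \<bar>of_int l\<bar> * (z powr 1 * z powr (- (1 + \<gamma>)))"
        using True z by (simp add: v_def V_def Lam_zero_mode abs_mult z_def)
      also have "z powr 1 * z powr (- (1 + \<gamma>)) = z powr (- \<gamma>)" unfolding powr_add[symmetric] by simp
      finally show ?thesis .
    qed
    have z_pow: "z powr (- q) \<le> 8" if "0 \<le> q" "q \<le> 1" for q
    proof -
      have "z powr (- q) \<le> (1/8) powr (- q)" using z that by (intro powr_mono2') auto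
      also have "\<dots> = 8 powr q" by (simp add: powr_minus powr_divide)
      also have "\<dots> \<le> 8 powr 1" using that by (intro powr_mono) auto
      finally show ?thesis by simp
    qed
    have Ll1: "1 \<le> Lam t l \<xi>" by (rule Lam_ge_1[OF l])
    have "(Q / Lam t l \<xi>) powr p \<le> z powr p" unfolding Qz using z Ll1 p by (intro powr_mono2) (auto simp: divide_le_eq mult_le_cancel_left1)
    then have "\<rho> \<le> 2 * z powr p" using \<rho>(2) by linarith
    then have "v * (1 + \<rho>) \<le> v * (1 + 2 * z powr p)" using v0 by (intro mult_left_mono) auto
    also have "\<dots> = \<bar>of_int l\<bar> * (z powr (- \<gamma>) + 2 * (z powr (- \<gamma>) * z powr p))" unfolding vz by (simp add: algebra_simps)
    also have "z powr (- \<gamma>) * z powr p = z powr (- (\<gamma> - p))" by (simp add: powr_add[symmetric])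
    also have "\<bar>of_int l\<bar> * (z powr (- \<gamma>) + 2 * z powr (- (\<gamma> - p))) \<le> \<bar>of_int l\<bar> * (8 + 2 * 8)"
      using p gam_le_1 gam_nonneg by (intro mult_left_mono add_mono z_pow) auto
    also have "\<dots> \<le> LL * 24" using order_trans[OF abs2_ge(1) LL(2)] by simp
    finally show ?thesis by (simp add: v_def LL_def)
  next
    case kl: False
    then have l: "l = 0" using kl0 by simp
    have Q1: "1 \<le> Q" unfolding Q_def using kl by (intro Lam_ge_1) auto
    have jQ: "j \<le> Q" unfolding j_def Q_def by (rule Lam_ge(1))
    have j0: "0 \<le> j" by (simp add: j_def)
    have X: "Lam t l \<xi> = \<bar>\<xi>\<bar>" "\<bar>\<xi>\<bar> \<le> LL" using l LL by (simp_all add: Lam_zero_mode)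
    have xi: "0 < \<bar>\<xi>\<bar>" using L X by simp
    have vv: "v = j * \<bar>\<xi>\<bar> * Q powr (- (1 + \<gamma>))" using l by (simp add: v_def V_def Q_def j_def abs_mult)
    have "j * Q powr (- (1 + \<gamma>)) \<le> Q powr 1 * Q powr (- (1 + \<gamma>))" using jQ Q1 by (intro mult_right_mono) auto
    also have "\<dots> = Q powr (- \<gamma>)" unfolding powr_add[symmetric] by simp
    finally have jq: "j * Q powr (- (1 + \<gamma>)) \<le> Q powr (- \<gamma>)" .
    have v1: "v \<le> \<bar>\<xi>\<bar> * Q powr (- \<gamma>)" unfolding vv using mult_left_mono[OF jq, of "\<bar>\<xi>\<bar>"] by (simp add: mult_ac)
    have "v * \<rho> \<le> (\<bar>\<xi>\<bar> * Q powr (- \<gamma>)) * (2 * (Q / \<bar>\<xi>\<bar>) powr p)"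
      using v1 \<rho> X v0 by (intro mult_mono) auto
    also have "\<dots> = 2 * (\<bar>\<xi>\<bar> powr 1 * \<bar>\<xi>\<bar> powr (- p)) * (Q powr (- \<gamma>) * Q powr p)"
      using xi Q1 unfolding powr_divide by (simp add: powr_minus divide_inverse)
    also have "\<bar>\<xi>\<bar> powr 1 * \<bar>\<xi>\<bar> powr (- p) = \<bar>\<xi>\<bar> powr (1 - p)" unfolding powr_add[symmetric] by simp
    also have "Q powr (- \<gamma>) * Q powr p = Q powr (p - \<gamma>)" unfolding powr_add[symmetric] by simp
    also have "2 * \<bar>\<xi>\<bar> powr (1 - p) * Q powr (p - \<gamma>) \<le> 2 * LL * 1"
    proof (intro mult_mono)
      have "\<bar>\<xi>\<bar> powr (1 - p) \<le> LL powr (1 - p)" using X p1 by (intro powr_mono2) auto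
      also have "\<dots> \<le> LL powr 1" using LL p by (intro powr_mono) auto
      finally show "\<bar>\<xi>\<bar> powr (1 - p) \<le> LL" using LL by simp
      show "Q powr (p - \<gamma>) \<le> 1" using powr_mono[of "p - \<gamma>" 0 Q] Q1 p by simp
    qed (use LL in auto)
    finally have 2: "v * \<rho> \<le> 2 * LL" by simp
    have "Q powr (- \<gamma>) \<le> 1" using powr_mono[of "- \<gamma>" 0 Q] Q1 gam_nonneg by simp
    then have "v \<le> LL * 1" using v1 X by (intro order_trans[OF v1] mult_mono) auto
    then have "v * (1 + \<rho>) \<le> 24 * LL" using 2 LL by (simp add: algebra_simps)
    then show ?thesis by (simp add: v_def LL_def)
  qed
qed

lemma reaction_terms:
  "\<exists>K>0. \<forall>\<mu> h t k l \<eta> \<xi> p. adm \<mu> h t k l \<longrightarrow> abs2 l \<xi> \<le> 8 * abs2 (k - l) (\<eta> - \<xi>) \<longrightarrow> 0 \<le> p \<longrightarrow> p \<le> \<gamma> \<longrightarrow>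
     0 < Lam t k \<eta> \<longrightarrow> 0 < Lam t l \<xi> \<longrightarrow>
     V t k l \<eta> \<xi> * (1 + \<bar>Lam t k \<eta> powr p - Lam t l \<xi> powr p\<bar> * Lam t l \<xi> powr (- p)) * (en c \<mu> t k + en c \<mu> t l)
       \<le> K * jap2 l \<xi> ^ 10 * Ej \<mu> t k l * Br \<mu> h t k l \<eta> \<xi>"
proof -
  obtain K1 where K1: "K1 > 0" "\<And>\<mu> h t k l \<eta> \<xi>. adm \<mu> h t k l \<Longrightarrow> 1 \<le> K1 * Br \<mu> h t k l \<eta> \<xi>" using one_le_Br by blast
  obtain K2 where K2: "K2 > 0" "\<And>\<mu> h t k l \<eta> \<xi>. adm \<mu> h t k l \<Longrightarrow> k \<noteq> l \<Longrightarrow>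
     exp (- (c * (t * \<mu> powr (1/3)))) * res t (t - (\<eta> - \<xi>) / of_int (k - l)) \<le> K2 * (jap2 l \<xi> ^ 3 * Br \<mu> h t k l \<eta> \<xi>)"
    using res_gain(2) by blast
  define K where "K = 20 * K2 + 48 * K1"
  have K: "20 * K2 \<le> K" "48 * K1 \<le> K" "0 < K" using K1(1) K2(1) by (simp_all add: K_def)
  have "V t k l \<eta> \<xi> * (1 + \<bar>Lam t k \<eta> powr p - Lam t l \<xi> powr p\<bar> * Lam t l \<xi> powr (- p)) * (en c \<mu> t k + en c \<mu> t l)
       \<le> K * (jap2 l \<xi> ^ 10 * Ej \<mu> t k l * Br \<mu> h t k l \<eta> \<xi>)"
    if a: "adm \<mu> h t k l" and reg: "abs2 l \<xi> \<le> 8 * abs2 (k - l) (\<eta> - \<xi>)" and p: "0 \<le> p" "p \<le> \<gamma>"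
      and L: "0 < Lam t k \<eta>" "0 < Lam t l \<xi>" for \<mu> h t k l \<eta> \<xi> p
  proof -
    define LL where "LL = jap2 l \<xi>"
    define \<rho> where "\<rho> = \<bar>Lam t k \<eta> powr p - Lam t l \<xi> powr p\<bar> * Lam t l \<xi> powr (- p)"
    define B where "B = Br \<mu> h t k l \<eta> \<xi>"
    define v where "v = V t k l \<eta> \<xi>"
    define E2 where "E2 = en c \<mu> t k + en c \<mu> t l"
    have a': "k \<noteq> 0 \<or> l \<noteq> 0" "1 \<le> t" "0 \<le> t" using a by (auto simp: adm_def)
    have LL: "1 \<le> LL" by (simp add: LL_def)
    have B: "0 \<le> B" unfolding B_def by (rule adm_Br(1)[OF a])
    have \<rho>: "0 \<le> \<rho>" by (simp add: \<rho>_def)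
    have v: "0 \<le> v" by (simp add: v_def)
    have EE: "0 \<le> Ej \<mu> t k l" by simp
    have "v * (1 + \<rho>) * E2 \<le> K * (LL ^ 10 * Ej \<mu> t k l * B)"
    proof (cases "k \<noteq> l \<and> l \<noteq> 0")
      case True
      define e where "e = exp (- (c * (t * \<mu> powr (1/3))))"
      define R where "R = res t (t - (\<eta> - \<xi>) / of_int (k - l))"
      have R: "0 \<le> R" unfolding R_def using order_trans[OF zero_le_one res_ge_1[OF a'(3)]] .
      have "E2 \<le> 2 * (e * Ej \<mu> t k l)"
      proof -
        have "en c \<mu> t k \<le> e * Ej \<mu> t k l" unfolding e_def using True a' by (intro en_gain_k) auto
        moreover have "en c \<mu> t l \<le> e * Ej \<mu> t k l" unfolding e_def using True by (intro eq_refl en_gain) auto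
        ultimately show ?thesis unfolding E2_def by linarith
      qed
      then have "v * (1 + \<rho>) * E2 \<le> (10 * LL\<^sup>2 * R) * (2 * (e * Ej \<mu> t k l))"
        using reaction_V(1)[OF a'(1,2) reg p L] True R unfolding v_def \<rho>_def LL_def R_def
        by (intro mult_mono[of "V t k l \<eta> \<xi> * _"]) (auto simp: E2_def)
      also have "\<dots> = 20 * LL\<^sup>2 * Ej \<mu> t k l * (e * R)" by simp
      also have "\<dots> \<le> 20 * LL\<^sup>2 * Ej \<mu> t k l * (K2 * (LL ^ 3 * B))"
        unfolding e_def R_def LL_def B_def using True by (intro mult_left_mono K2(2)[OF a]) auto
      also have "\<dots> = (20 * K2) * (LL ^ 5 * (Ej \<mu> t k l * B))" by (simp add: eval_nat_numeral)
      also have "\<dots> \<le> K * (LL ^ 10 * (Ej \<mu> t k l * B))"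
        using K LL B EE by (intro mult_mono power_increasing mult_nonneg_nonneg) auto
      finally show ?thesis by (simp add: mult_ac)
    next
      case False
      have "E2 \<le> 2 * Ej \<mu> t k l" unfolding E2_def using en_triangle[OF a'(3), of \<mu> k l] en_l_le[OF a'(3), of \<mu> l k] by linarith
      then have "v * (1 + \<rho>) * E2 * 1 \<le> (24 * LL) * (2 * Ej \<mu> t k l) * (K1 * B)"
        using reaction_V(2)[OF a'(1,2) reg p L] False K1(2)[OF a] LL unfolding v_def \<rho>_def LL_def B_def
        by (intro mult_mono[of "_ * E2" _ 1] mult_mono[of "V t k l \<eta> \<xi> * _"]) (auto simp: E2_def)
      also have "\<dots> = (48 * K1) * (LL ^ 1 * (Ej \<mu> t k l * B))" by simp
      also have "\<dots> \<le> K * (LL ^ 10 * (Ej \<mu> t k l * B))"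
        using K LL B EE by (intro mult_mono power_increasing mult_nonneg_nonneg) auto
      finally show ?thesis by (simp add: mult_ac)
    qed
    then show ?thesis by (simp add: v_def \<rho>_def LL_def B_def E2_def)
  qed
  then show ?thesis using K(3) by (intro exI[of _ K]) (auto simp: mult.assoc)
qed

lemma A_weight_eq:
  "A_weight c r \<gamma> N \<mu> M t k \<eta> =
     jap2 k \<eta> powr N * en c \<mu> t k * inverse (m_res c r \<gamma> \<mu> t k \<eta> * M t k \<eta> * M_diss c \<mu> t k \<eta>)"
  by (simp add: A_weight_def en_def m_total_def)

text \<open>
  The pointwise bound behind the theorem.  In the transport region, \<open>A\<^sub>k - A\<^sub>l\<close> is telescoped over its
  factors, and the result decays in the low frequency \<open>(j, \<zeta>)\<close>: the Sobolev weight \<open>\<langle>j, \<zeta>\<rangle>\<^sup>N\<close> is needed only up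
  to \<open>N - 2\<close>.  In the reaction region the roles of the inputs are exchanged and \<open>A\<^sub>k\<close>, \<open>A\<^sub>l\<close> are bounded separately.
\<close>

lemma symbol_bound:
  assumes N: "12 \<le> N" and p: "0 \<le> p" "p \<le> \<gamma>" and CL: "0 < CL"
  shows "\<exists>K>0. \<forall>\<mu> M h t k l \<eta> \<xi>. 0 < \<mu> \<longrightarrow> \<mu> \<le> 1/2 \<longrightarrow> 1 \<le> t \<longrightarrow> 0 \<le> h t \<longrightarrow> t * \<mu> powr (1/3) \<noteq> 1 \<longrightarrow>
     (\<forall>k \<eta>. inverse CL \<le> M t k \<eta> \<and> M t k \<eta> \<le> CL) \<longrightarrow>
     (\<forall>k l \<eta> \<xi>. abs2 l \<xi> \<ge> 8 * abs2 (k - l) (\<eta> - \<xi>) \<longrightarrow>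
        abs2 l \<xi> / t powr (1 + \<gamma>) * \<bar>M t k \<eta> - M t l \<xi>\<bar> \<le> R_adm c r \<gamma> N \<mu> CL n h t k l \<eta> \<xi> * Lf \<mu>) \<longrightarrow>
     (\<forall>k \<eta> \<xi>. k \<noteq> 0 \<and> abs2 k \<xi> \<ge> 8 * \<bar>\<eta> - \<xi>\<bar> \<longrightarrow>
        \<bar>M t k \<eta> - M t k \<xi>\<bar> \<le> CL * (1 / \<bar>real_of_int k\<bar>) * \<bar>\<eta> - \<xi>\<bar> * jap (\<eta> - \<xi>) powr (N - 5)) \<longrightarrow>
     V t k l \<eta> \<xi> * \<bar>A_weight c r \<gamma> N \<mu> M t k \<eta> * Lam t k \<eta> powr p - A_weight c r \<gamma> N \<mu> M t l \<xi> * Lam t l \<xi> powr p\<bar> * Lam t l \<xi> powr (- p)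
       \<le> K * (A_weight c r \<gamma> N \<mu> M t (k - l) (\<eta> - \<xi>) * A_weight c r \<gamma> N \<mu> M t l \<xi>
             * (inverse (jap2 (k - l) (\<eta> - \<xi>) ^ 2) + inverse (jap2 l \<xi> ^ 2)) * Br \<mu> (h t) t k l \<eta> \<xi>)"
proof -
  have p1: "p \<le> 1" using p gam_le_1 by linarith
  have N1: "1 \<le> N" using N by simp
  obtain Ka where Ka: "Ka > 0" "\<And>\<mu> h t k l \<eta> \<xi> p. adm \<mu> h t k l \<Longrightarrow> 0 \<le> p \<Longrightarrow> p \<le> 1 \<Longrightarrow> 0 < Lam t k \<eta> \<Longrightarrow> 0 < Lam t l \<xi> \<Longrightarrow>
     V t k l \<eta> \<xi> * (\<bar>Lam t k \<eta> powr p - Lam t l \<xi> powr p\<bar> * Lam t l \<xi> powr (- p)) * en c \<mu> t k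
       \<le> Ka * jap2 (k - l) (\<eta> - \<xi>) ^ 10 * Ej \<mu> t k l * Br \<mu> h t k l \<eta> \<xi>" using transport_Lam_diff by blast
  obtain Kb where Kb: "Kb > 0" "\<And>\<mu> h t k l \<eta> \<xi>. adm \<mu> h t k l \<Longrightarrow> 8 * abs2 (k - l) (\<eta> - \<xi>) \<le> abs2 l \<xi> \<Longrightarrow>
     V t k l \<eta> \<xi> * \<bar>jap2 k \<eta> powr N - jap2 l \<xi> powr N\<bar> * en c \<mu> t k
       \<le> Kb * jap2 (k - l) (\<eta> - \<xi>) ^ 10 * Ej \<mu> t k l * Br \<mu> h t k l \<eta> \<xi> * jap2 l \<xi> powr N" using transport_jap2_diff[OF N1] by blast
  obtain Kc where Kc: "Kc > 0" "\<And>\<mu> h t k l \<eta> \<xi>. adm \<mu> h t k l \<Longrightarrow> 8 * abs2 (k - l) (\<eta> - \<xi>) \<le> abs2 l \<xi> \<Longrightarrow>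
     V t k l \<eta> \<xi> * \<bar>en c \<mu> t k - en c \<mu> t l\<bar>
       \<le> Kc * jap2 (k - l) (\<eta> - \<xi>) ^ 10 * Ej \<mu> t k l * Br \<mu> h t k l \<eta> \<xi>" using transport_en_diff by blast
  obtain Kd where Kd: "Kd > 0" "\<And>\<mu> h t k l \<eta> \<xi>. adm \<mu> h t k l \<Longrightarrow> 8 * abs2 (k - l) (\<eta> - \<xi>) \<le> abs2 l \<xi> \<Longrightarrow>
     V t k l \<eta> \<xi> * \<bar>m_res c r \<gamma> \<mu> t k \<eta> - m_res c r \<gamma> \<mu> t l \<xi>\<bar> * en c \<mu> t l
       \<le> Kd * jap2 (k - l) (\<eta> - \<xi>) ^ 10 * Ej \<mu> t k l * Br \<mu> h t k l \<eta> \<xi>" using transport_m_res_diff by blast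
  obtain Ke where Ke: "Ke > 0" "\<And>\<mu> h t k l \<eta> \<xi> M. adm \<mu> (h t) t k l \<Longrightarrow> 8 * abs2 (k - l) (\<eta> - \<xi>) \<le> abs2 l \<xi> \<Longrightarrow>
     t * \<mu> powr (1/3) \<noteq> 1 \<Longrightarrow>
     abs2 l \<xi> / t powr (1 + \<gamma>) * \<bar>M k \<eta> - M l \<xi>\<bar> \<le> R_adm c r \<gamma> N \<mu> CL n h t k l \<eta> \<xi> * Lf \<mu> \<Longrightarrow>
     (k = l \<Longrightarrow> \<bar>M k \<eta> - M l \<xi>\<bar> \<le> CL * (1 / \<bar>real_of_int k\<bar>) * \<bar>\<eta> - \<xi>\<bar> * jap (\<eta> - \<xi>) powr (N - 5)) \<Longrightarrow>
     V t k l \<eta> \<xi> * \<bar>M k \<eta> - M l \<xi>\<bar> * en c \<mu> t l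
       \<le> Ke * jap2 (k - l) (\<eta> - \<xi>) powr (N - 2) * Ej \<mu> t k l * Br \<mu> (h t) t k l \<eta> \<xi>"
    using transport_M_diff[OF CL, of N n] by blast
  obtain Kf where Kf: "Kf > 0" "\<And>\<mu> h t k l \<eta> \<xi>. adm \<mu> h t k l \<Longrightarrow> 8 * abs2 (k - l) (\<eta> - \<xi>) \<le> abs2 l \<xi> \<Longrightarrow>
     V t k l \<eta> \<xi> * \<bar>M_diss c \<mu> t k \<eta> - M_diss c \<mu> t l \<xi>\<bar> * en c \<mu> t l
       \<le> Kf * jap2 (k - l) (\<eta> - \<xi>) ^ 10 * Ej \<mu> t k l * Br \<mu> h t k l \<eta> \<xi>" using transport_M_diss_diff by blast
  obtain Kr where Kr: "Kr > 0" "\<And>\<mu> h t k l \<eta> \<xi> p. adm \<mu> h t k l \<Longrightarrow> abs2 l \<xi> \<le> 8 * abs2 (k - l) (\<eta> - \<xi>) \<Longrightarrow> 0 \<le> p \<Longrightarrow> p \<le> \<gamma> \<Longrightarrow>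
     0 < Lam t k \<eta> \<Longrightarrow> 0 < Lam t l \<xi> \<Longrightarrow>
     V t k l \<eta> \<xi> * (1 + \<bar>Lam t k \<eta> powr p - Lam t l \<xi> powr p\<bar> * Lam t l \<xi> powr (- p)) * (en c \<mu> t k + en c \<mu> t l)
       \<le> Kr * jap2 l \<xi> ^ 10 * Ej \<mu> t k l * Br \<mu> h t k l \<eta> \<xi>" using reaction_terms by blast
  (* Q bounds each of the three factors of m, and their inverses. *)
  define Q where "Q = exp EB + CL + inverse CL + exp (pi / c)"
  have Q: "1 \<le> Q" "exp EB \<le> Q" "CL \<le> Q" "inverse CL \<le> Q" "exp (pi / c) \<le> Q"
  proof -
    have "1 \<le> exp EB" using EB_nonneg by simp
    then show "1 \<le> Q" "exp EB \<le> Q" "CL \<le> Q" "inverse CL \<le> Q" "exp (pi / c) \<le> Q"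
      using CL exp_gt_zero[of "pi / c"] positive_imp_inverse_positive[OF CL] unfolding Q_def by linarith+
  qed
  define KT where "KT = Q ^ 3 * 2 powr N * Ka + Q ^ 3 * Kb + Q ^ 3 * Kc + Q ^ 8 * (Kd + Ke + Kf)"
  define KR where "KR = Q ^ 3 * 9 powr N * Kr"
  define K where "K = Q ^ 6 * (KT + KR)"
  have KTp: "0 < KT" "0 < KR" using Q(1) Ka(1) Kb(1) Kc(1) Kd(1) Ke(1) Kf(1) Kr(1)
    unfolding KT_def KR_def by (simp_all add: add_pos_pos)
  then have Kp: "0 < K" using Q(1) unfolding K_def by simp
  have "V t k l \<eta> \<xi> * \<bar>A_weight c r \<gamma> N \<mu> M t k \<eta> * Lam t k \<eta> powr p - A_weight c r \<gamma> N \<mu> M t l \<xi> * Lam t l \<xi> powr p\<bar> * Lam t l \<xi> powr (- p)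
       \<le> K * (A_weight c r \<gamma> N \<mu> M t (k - l) (\<eta> - \<xi>) * A_weight c r \<gamma> N \<mu> M t l \<xi>
             * (inverse (jap2 (k - l) (\<eta> - \<xi>) ^ 2) + inverse (jap2 l \<xi> ^ 2)) * Br \<mu> (h t) t k l \<eta> \<xi>)"
    if mu: "0 < \<mu>" "\<mu> \<le> 1/2" and t: "1 \<le> t" and h: "0 \<le> h t" and ne: "t * \<mu> powr (1/3) \<noteq> 1"
      and M2: "\<forall>k \<eta>. inverse CL \<le> M t k \<eta> \<and> M t k \<eta> \<le> CL"
      and M3: "\<forall>k l \<eta> \<xi>. abs2 l \<xi> \<ge> 8 * abs2 (k - l) (\<eta> - \<xi>) \<longrightarrow>
        abs2 l \<xi> / t powr (1 + \<gamma>) * \<bar>M t k \<eta> - M t l \<xi>\<bar> \<le> R_adm c r \<gamma> N \<mu> CL n h t k l \<eta> \<xi> * Lf \<mu>"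
      and M4: "\<forall>k \<eta> \<xi>. k \<noteq> 0 \<and> abs2 k \<xi> \<ge> 8 * \<bar>\<eta> - \<xi>\<bar> \<longrightarrow>
        \<bar>M t k \<eta> - M t k \<xi>\<bar> \<le> CL * (1 / \<bar>real_of_int k\<bar>) * \<bar>\<eta> - \<xi>\<bar> * jap (\<eta> - \<xi>) powr (N - 5)"
    for \<mu> M h t k l \<eta> \<xi>
  proof -
    (* A = H en i: Sobolev weight, exponential weight, and inverse of m. *)
    define H where "H = (\<lambda>k \<eta>. jap2 k \<eta> powr N)"
    define i where "i = (\<lambda>k \<eta>. inverse (m_res c r \<gamma> \<mu> t k \<eta> * M t k \<eta> * M_diss c \<mu> t k \<eta>))"
    define A where "A = A_weight c r \<gamma> N \<mu> M t"
    have A: "A k \<eta> = H k \<eta> * en c \<mu> t k * i k \<eta>" for k \<eta>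
      unfolding A_def H_def i_def by (rule A_weight_eq)
    have t0: "0 \<le> t" using t by simp
    have iQ: "inverse Q \<le> inverse x" if "0 < x" "x \<le> Q" for x using that by (intro le_imp_inverse_le)
    have b1: "inverse Q \<le> m_res c r \<gamma> \<mu> t k \<eta>" "m_res c r \<gamma> \<mu> t k \<eta> \<le> Q" for k \<eta>
      using m_res_bounds[OF t0, of \<mu> k \<eta>] Q(2) iQ[of 1] Q(1) by auto
    have b2: "inverse Q \<le> M t k \<eta>" "M t k \<eta> \<le> Q" for k \<eta>
      using order_trans[OF iQ[OF CL Q(3)]] M2 Q(3) order_trans by blast+
    have b3: "inverse Q \<le> M_diss c \<mu> t k \<eta>" "M_diss c \<mu> t k \<eta> \<le> Q" for k \<eta>
      using M_diss_bounds[OF t0, of \<mu> k \<eta>] Q(5) iQ[OF exp_gt_zero Q(5)] by (auto simp: exp_minus)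
    note idiff = inverse_prod3_diff[OF Q(1) b1 b2 b3 b1 b2 b3]
    have i: "inverse (Q ^ 3) \<le> i k \<eta>" "i k \<eta> \<le> Q ^ 3" for k \<eta>
      unfolding i_def by (rule idiff)+
    have i0: "0 \<le> i k \<eta>" for k \<eta>
      by (rule order_trans[OF _ i(1)]) (use Q(1) in simp)
    have H0: "0 \<le> H k \<eta>" for k \<eta> by (simp add: H_def)
    have A_le: "A k \<eta> \<le> Q ^ 3 * (H k \<eta> * en c \<mu> t k)" for k \<eta>
      unfolding A using mult_left_mono[OF i(2)[of k \<eta>], of "H k \<eta> * en c \<mu> t k"] H0[of k \<eta>] by (simp add: mult_ac)
    have A_ge: "H k \<eta> * en c \<mu> t k \<le> Q ^ 3 * A k \<eta>" for k \<eta>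
    proof -
      have "H k \<eta> * en c \<mu> t k * inverse (Q ^ 3) \<le> A k \<eta>"
        unfolding A by (intro mult_left_mono i) (use H0 in auto)
      then show ?thesis using Q(1) by (simp add: field_simps)
    qed
    have A0: "0 \<le> A k \<eta>" for k \<eta> unfolding A using H0 i0 by simp
    define B where "B = Br \<mu> (h t) t k l \<eta> \<xi>"
    have B0: "0 \<le> B" unfolding B_def using t0 h by (rule Br_nonneg)
    define J where "J = jap2 (k - l) (\<eta> - \<xi>)"
    define LL where "LL = jap2 l \<xi>"
    have J: "1 \<le> J" "0 < J" and LL: "1 \<le> LL" "0 < LL" by (simp_all add: J_def LL_def)
    define v where "v = V t k l \<eta> \<xi>"
    define Aj where "Aj = A (k - l) (\<eta> - \<xi>)"
    define Al where "Al = A l \<xi>"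
    define Ak where "Ak = A k \<eta>"
    have AAn: "0 \<le> Aj" "0 \<le> Al" "0 \<le> Ak" by (simp_all add: Aj_def Al_def Ak_def A0)
    have v0: "0 \<le> v" by (simp add: v_def)
    define S where "S = v * \<bar>Ak * Lam t k \<eta> powr p - Al * Lam t l \<xi> powr p\<bar> * Lam t l \<xi> powr (- p)"
    have "S \<le> K * (Aj * Al * (inverse (J ^ 2) + inverse (LL ^ 2)) * B)"
    proof (cases "v = 0")
      case True
      then show ?thesis using Kp AAn B0 J LL by (simp add: S_def)
    next
      case False
      (* Nonparallel frequencies are nonzero, so negative powers of \<Lambda> are genuine inverses. *)
      have vne: "(\<eta> - \<xi>) * of_int l - of_int (k - l) * \<xi> \<noteq> 0" using False by (auto simp: v_def V_def)
      have kl: "k \<noteq> 0 \<or> l \<noteq> 0" using vne by auto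
      have Lk: "0 < Lam t k \<eta>"
      proof (rule ccontr)
        assume "\<not> 0 < Lam t k \<eta>"
        then have "k = 0" "\<eta> = 0" unfolding Lam_def abs2_def by (auto simp: sum_power2_gt_zero_iff)
        then show False using vne by simp
      qed
      have Ll: "0 < Lam t l \<xi>"
      proof (rule ccontr)
        assume "\<not> 0 < Lam t l \<xi>"
        then have "l = 0" "\<xi> = 0" unfolding Lam_def abs2_def by (auto simp: sum_power2_gt_zero_iff)
        then show False using vne by simp
      qed
      have a: "adm \<mu> (h t) t k l" using mu t h kl by (simp add: adm_def)
      define \<rho> where "\<rho> = \<bar>Lam t k \<eta> powr p - Lam t l \<xi> powr p\<bar> * Lam t l \<xi> powr (- p)"
      have \<rho>0: "0 \<le> \<rho>" by (simp add: \<rho>_def)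
      have Lp: "Lam t l \<xi> powr p * Lam t l \<xi> powr (- p) = 1" using Ll by (simp add: powr_add[symmetric])
      have S1: "S \<le> v * (Ak * \<rho> + \<bar>Ak - Al\<bar>)"
      proof -
        have "\<bar>Ak * Lam t k \<eta> powr p - Al * Lam t l \<xi> powr p\<bar> \<le> Ak * \<bar>Lam t k \<eta> powr p - Lam t l \<xi> powr p\<bar> + \<bar>Ak - Al\<bar> * Lam t l \<xi> powr p"
        proof -
          have "Ak * Lam t k \<eta> powr p - Al * Lam t l \<xi> powr p = Ak * (Lam t k \<eta> powr p - Lam t l \<xi> powr p) + (Ak - Al) * Lam t l \<xi> powr p"
            by (simp add: algebra_simps)
          also have "\<bar>\<dots>\<bar> \<le> \<bar>Ak * (Lam t k \<eta> powr p - Lam t l \<xi> powr p)\<bar> + \<bar>(Ak - Al) * Lam t l \<xi> powr p\<bar>" by (rule abs_triangle_ineq)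
          finally show ?thesis using AAn by (simp add: abs_mult)
        qed
        then have "\<bar>Ak * Lam t k \<eta> powr p - Al * Lam t l \<xi> powr p\<bar> * Lam t l \<xi> powr (- p) \<le> (Ak * \<bar>Lam t k \<eta> powr p - Lam t l \<xi> powr p\<bar> + \<bar>Ak - Al\<bar> * Lam t l \<xi> powr p) * Lam t l \<xi> powr (- p)"
          by (intro mult_right_mono) auto
        also have "\<dots> = Ak * \<rho> + \<bar>Ak - Al\<bar>"
          unfolding \<rho>_def distrib_right mult.assoc Lp by simp
        finally show ?thesis unfolding S_def mult.assoc using v0 by (intro mult_left_mono)
      qed
      have Hj: "H (k - l) (\<eta> - \<xi>) = J powr N" and Hl: "H l \<xi> = LL powr N" by (simp_all add: H_def J_def LL_def)
      have AA: "J powr N * LL powr N * Ej \<mu> t k l \<le> Q ^ 6 * (Aj * Al)"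
      proof -
        have "(H (k - l) (\<eta> - \<xi>) * en c \<mu> t (k - l)) * (H l \<xi> * en c \<mu> t l) \<le> (Q ^ 3 * Aj) * (Q ^ 3 * Al)"
          unfolding Aj_def Al_def using H0 A0 Q(1) by (intro mult_mono A_ge) auto
        then show ?thesis unfolding Hj Hl by (simp add: mult_ac power_add[symmetric, of Q 3 3, simplified] flip: power_add)
      qed
      show ?thesis
      proof (cases "8 * abs2 (k - l) (\<eta> - \<xi>) \<le> abs2 l \<xi>")
        case reg: True
        define JJ where "JJ = J powr (N - 2)"
        have J10: "J ^ 10 \<le> JJ"
        proof -
          have "J ^ 10 = J powr 10" using J by (simp add: powr_numeral)
          also have "\<dots> \<le> JJ" unfolding JJ_def using J N by (intro powr_mono) auto
          finally show ?thesis .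
        qed
        define X where "X = JJ * Ej \<mu> t k l * B"
        have X0: "0 \<le> X" unfolding X_def JJ_def using B0 by simp
        have up: "Kx * J ^ 10 * Ej \<mu> t k l * B \<le> Kx * X" if "0 < Kx" for Kx
          unfolding X_def using that J10 B0 by (simp add: mult.assoc mult_left_mono mult_right_mono)
        have ta: "v * \<rho> * en c \<mu> t k \<le> Ka * X"
          unfolding v_def \<rho>_def by (rule order_trans[OF Ka(2)[OF a p(1) p1 Lk Ll] up[OF Ka(1), unfolded J_def B_def]])
        have tb: "v * \<bar>H k \<eta> - H l \<xi>\<bar> * en c \<mu> t k \<le> Kb * X * H l \<xi>"
          unfolding v_def H_def by (rule order_trans[OF Kb(2)[OF a reg] mult_right_mono[OF up[OF Kb(1), unfolded J_def B_def]]]) simp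
        have tc: "v * \<bar>en c \<mu> t k - en c \<mu> t l\<bar> \<le> Kc * X"
          unfolding v_def by (rule order_trans[OF Kc(2)[OF a reg] up[OF Kc(1), unfolded J_def B_def]])
        have td: "v * \<bar>m_res c r \<gamma> \<mu> t k \<eta> - m_res c r \<gamma> \<mu> t l \<xi>\<bar> * en c \<mu> t l \<le> Kd * X"
          unfolding v_def by (rule order_trans[OF Kd(2)[OF a reg] up[OF Kd(1), unfolded J_def B_def]])
        have tf: "v * \<bar>M_diss c \<mu> t k \<eta> - M_diss c \<mu> t l \<xi>\<bar> * en c \<mu> t l \<le> Kf * X"
          unfolding v_def by (rule order_trans[OF Kf(2)[OF a reg] up[OF Kf(1), unfolded J_def B_def]])
        have te: "v * \<bar>M t k \<eta> - M t l \<xi>\<bar> * en c \<mu> t l \<le> Ke * X"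
        proof -
          have "v * \<bar>M t k \<eta> - M t l \<xi>\<bar> * en c \<mu> t l \<le> Ke * jap2 (k - l) (\<eta> - \<xi>) powr (N - 2) * Ej \<mu> t k l * Br \<mu> (h t) t k l \<eta> \<xi>"
            unfolding v_def
          proof (rule Ke(2)[where M = "M t" and h = h and t = t, OF a reg ne])
            show "abs2 l \<xi> / t powr (1 + \<gamma>) * \<bar>M t k \<eta> - M t l \<xi>\<bar> \<le> R_adm c r \<gamma> N \<mu> CL n h t k l \<eta> \<xi> * Lf \<mu>"
              using M3 reg by blast
            assume "k = l"
            then show "\<bar>M t k \<eta> - M t l \<xi>\<bar> \<le> CL * (1 / \<bar>real_of_int k\<bar>) * \<bar>\<eta> - \<xi>\<bar> * jap (\<eta> - \<xi>) powr (N - 5)"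
              using M4 reg kl by (auto simp: Lam_zero_mode)
          qed
          then show ?thesis by (simp add: X_def JJ_def J_def B_def mult.assoc)
        qed
        have jk: "jap2 k \<eta> \<le> 2 * LL"
          using jap2_diff[of k \<eta> l \<xi>] reg abs2_le_jap2[of l \<xi>] abs2_nonneg[of "k - l" "\<eta> - \<xi>"] unfolding LL_def by argo
        have Hk: "H k \<eta> \<le> 2 powr N * H l \<xi>"
        proof -
          have "H k \<eta> \<le> (2 * LL) powr N" unfolding H_def using jk N by (intro powr_mono2) auto
          then show ?thesis unfolding Hl by (simp add: powr_mult)
        qed
        have 1: "v * (Ak * \<rho>) \<le> Q ^ 3 * 2 powr N * Ka * (H l \<xi> * X)"
        proof -
          have "Ak \<le> Q ^ 3 * ((2 powr N * H l \<xi>) * en c \<mu> t k)"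
            unfolding Ak_def using Hk Q(1) by (intro order_trans[OF A_le] mult_left_mono mult_right_mono) auto
          then have "v * (Ak * \<rho>) \<le> v * ((Q ^ 3 * ((2 powr N * H l \<xi>) * en c \<mu> t k)) * \<rho>)"
            using v0 \<rho>0 by (intro mult_left_mono mult_right_mono)
          also have "\<dots> = Q ^ 3 * 2 powr N * H l \<xi> * (v * \<rho> * en c \<mu> t k)" by simp
          also have "\<dots> \<le> Q ^ 3 * 2 powr N * H l \<xi> * (Ka * X)" using ta Q(1) H0 by (intro mult_left_mono) auto
          finally show ?thesis by (simp add: mult_ac)
        qed
        have 2: "v * \<bar>Ak - Al\<bar> \<le> (Q ^ 3 * Kb + Q ^ 3 * Kc + Q ^ 8 * (Kd + Ke + Kf)) * (H l \<xi> * X)"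
        proof -
          define D where "D = \<bar>m_res c r \<gamma> \<mu> t k \<eta> - m_res c r \<gamma> \<mu> t l \<xi>\<bar> + \<bar>M t k \<eta> - M t l \<xi>\<bar> + \<bar>M_diss c \<mu> t k \<eta> - M_diss c \<mu> t l \<xi>\<bar>"
          define ek where "ek = en c \<mu> t k"
          define el where "el = en c \<mu> t l"
          have e0: "0 \<le> ek" "0 \<le> el" by (simp_all add: ek_def el_def)
          have iD: "\<bar>i k \<eta> - i l \<xi>\<bar> \<le> Q ^ 8 * D" unfolding i_def D_def by (rule idiff(1))
          have "Ak - Al = (H k \<eta> - H l \<xi>) * ek * i k \<eta> + H l \<xi> * (ek - el) * i k \<eta> + H l \<xi> * el * (i k \<eta> - i l \<xi>)"
            unfolding Ak_def Al_def A ek_def el_def by (simp add: algebra_simps)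
          then have "\<bar>Ak - Al\<bar> \<le> \<bar>(H k \<eta> - H l \<xi>) * ek * i k \<eta>\<bar> + \<bar>H l \<xi> * (ek - el) * i k \<eta>\<bar> + \<bar>H l \<xi> * el * (i k \<eta> - i l \<xi>)\<bar>"
            by linarith
          also have "\<dots> = \<bar>H k \<eta> - H l \<xi>\<bar> * ek * i k \<eta> + H l \<xi> * \<bar>ek - el\<bar> * i k \<eta> + H l \<xi> * el * \<bar>i k \<eta> - i l \<xi>\<bar>"
            using e0 i0 H0 by (simp add: abs_mult)
          also have "\<dots> \<le> \<bar>H k \<eta> - H l \<xi>\<bar> * ek * Q ^ 3 + H l \<xi> * \<bar>ek - el\<bar> * Q ^ 3 + H l \<xi> * el * (Q ^ 8 * D)"
            using e0 H0 iD by (intro add_mono mult_left_mono i) auto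
          finally have "v * \<bar>Ak - Al\<bar> \<le> v * (\<bar>H k \<eta> - H l \<xi>\<bar> * ek * Q ^ 3 + H l \<xi> * \<bar>ek - el\<bar> * Q ^ 3 + H l \<xi> * el * (Q ^ 8 * D))"
            using v0 by (intro mult_left_mono)
          also have "\<dots> = Q ^ 3 * (v * \<bar>H k \<eta> - H l \<xi>\<bar> * ek) + Q ^ 3 * H l \<xi> * (v * \<bar>ek - el\<bar>) + Q ^ 8 * H l \<xi> * (v * D * el)"
            by (simp add: algebra_simps)
          also have "\<dots> \<le> Q ^ 3 * (Kb * X * H l \<xi>) + Q ^ 3 * H l \<xi> * (Kc * X) + Q ^ 8 * H l \<xi> * ((Kd + Ke + Kf) * X)"
          proof (intro add_mono mult_left_mono)
            show "v * \<bar>H k \<eta> - H l \<xi>\<bar> * ek \<le> Kb * X * H l \<xi>" unfolding ek_def by (rule tb)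
            show "v * \<bar>ek - el\<bar> \<le> Kc * X" unfolding ek_def el_def by (rule tc)
            show "v * D * el \<le> (Kd + Ke + Kf) * X"
              using td te tf unfolding D_def el_def by (simp add: algebra_simps)
          qed (use Q(1) H0 in auto)
          finally show ?thesis by (simp add: algebra_simps)
        qed
        have "S \<le> v * (Ak * \<rho>) + v * \<bar>Ak - Al\<bar>" using S1 by (simp add: distrib_left)
        also have "\<dots> \<le> KT * (H l \<xi> * X)" using 1 2 unfolding KT_def by (simp add: distrib_right)
        also have "H l \<xi> * X = (J powr N * LL powr N * Ej \<mu> t k l) * (inverse (J ^ 2) * B)"
        proof -
          have "JJ = J powr N * inverse (J ^ 2)"
            unfolding JJ_def using J by (simp add: powr_diff powr_numeral divide_inverse)
          then show ?thesis unfolding X_def Hl by simp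
        qed
        also have "KT * \<dots> \<le> KT * ((Q ^ 6 * (Aj * Al)) * (inverse (J ^ 2) * B))"
          using KTp AA B0 J by (intro mult_left_mono mult_right_mono) auto
        also have "\<dots> = (Q ^ 6 * KT) * (Aj * Al * inverse (J ^ 2) * B)" by simp
        also have "\<dots> \<le> K * (Aj * Al * (inverse (J ^ 2) + inverse (LL ^ 2)) * B)"
          using KTp Q(1) AAn B0 J LL unfolding K_def by (intro mult_mono) auto
        finally show ?thesis .
      next
        case False
        then have reg: "abs2 l \<xi> \<le> 8 * abs2 (k - l) (\<eta> - \<xi>)" by simp
        define X where "X = LL powr (N - 2) * Ej \<mu> t k l * B"
        have L10: "LL ^ 10 \<le> LL powr (N - 2)"
        proof -
          have "LL ^ 10 = LL powr 10" using LL by (simp add: powr_numeral)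
          also have "\<dots> \<le> LL powr (N - 2)" using LL N by (intro powr_mono) auto
          finally show ?thesis .
        qed
        define Es where "Es = en c \<mu> t k + en c \<mu> t l"
        have tr: "v * (1 + \<rho>) * Es \<le> Kr * X"
        proof -
          have "v * (1 + \<rho>) * Es \<le> Kr * LL ^ 10 * Ej \<mu> t k l * B"
            unfolding v_def \<rho>_def Es_def LL_def B_def by (rule Kr(2)[OF a reg p Lk Ll])
          also have "\<dots> \<le> Kr * X"
            unfolding X_def using Kr(1) L10 B0 by (simp add: mult.assoc mult_left_mono mult_right_mono)
          finally show ?thesis .
        qed
        (* 9 = 1 + 8: both other frequencies are at most of the size of the transporting one. *)
        have J9: "jap2 k \<eta> \<le> 9 * J" "LL \<le> 9 * J"
        proof -
          have 1: "abs2 l \<xi> \<le> 8 * J" using reg abs2_le_jap2[of "k - l" "\<eta> - \<xi>"] unfolding J_def by linarith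
          have "LL \<le> 1 + abs2 l \<xi>" unfolding LL_def by (rule jap2_le)
          then show "LL \<le> 9 * J" using 1 J by linarith
          have "abs2 (k - (k - l)) (\<eta> - (\<eta> - \<xi>)) = abs2 l \<xi>" by simp
          then have "jap2 k \<eta> \<le> J + abs2 l \<xi>" using jap2_diff[of k \<eta> "k - l" "\<eta> - \<xi>"] unfolding J_def by linarith
          then show "jap2 k \<eta> \<le> 9 * J" using 1 by linarith
        qed
        have H9: "H k \<eta> \<le> 9 powr N * J powr N" "H l \<xi> \<le> 9 powr N * J powr N"
          unfolding H_def powr_mult[symmetric] using J9 N by (auto intro!: powr_mono2 simp: LL_def)
        have Ab: "Ak \<le> Q ^ 3 * (9 powr N * J powr N * en c \<mu> t k)" "Al \<le> Q ^ 3 * (9 powr N * J powr N * en c \<mu> t l)"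
          unfolding Ak_def Al_def using H9 Q(1) by (intro order_trans[OF A_le] mult_left_mono mult_right_mono; simp)+
        define W where "W = Q ^ 3 * 9 powr N * J powr N"
        have W0: "0 \<le> W" unfolding W_def using Q(1) by simp
        have "Ak * \<rho> + \<bar>Ak - Al\<bar> \<le> (1 + \<rho>) * (Ak + Al)"
        proof -
          have "\<bar>Ak - Al\<bar> \<le> Ak + Al" "0 \<le> Al * \<rho>" using AAn \<rho>0 by auto
          then show ?thesis by (simp add: algebra_simps)
        qed
        also have "\<dots> \<le> (1 + \<rho>) * (W * Es)"
          using Ab \<rho>0 unfolding W_def Es_def by (intro mult_left_mono) (auto simp: algebra_simps)
        finally have "S \<le> v * ((1 + \<rho>) * (W * Es))" using S1 v0 by (meson mult_left_mono order_trans)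
        also have "\<dots> = W * (v * (1 + \<rho>) * Es)" by simp
        also have "\<dots> \<le> W * (Kr * X)" using tr W0 by (intro mult_left_mono)
        also have "\<dots> = KR * ((J powr N * LL powr N * Ej \<mu> t k l) * (inverse (LL ^ 2) * B))"
        proof -
          have "LL powr (N - 2) = LL powr N * inverse (LL ^ 2)"
            using LL by (simp add: powr_diff powr_numeral divide_inverse)
          then show ?thesis unfolding X_def W_def KR_def by simp
        qed
        also have "\<dots> \<le> KR * ((Q ^ 6 * (Aj * Al)) * (inverse (LL ^ 2) * B))"
          using KTp AA B0 LL by (intro mult_left_mono mult_right_mono) auto
        also have "\<dots> = (Q ^ 6 * KR) * (Aj * Al * inverse (LL ^ 2) * B)" by simp
        also have "\<dots> \<le> K * (Aj * Al * (inverse (J ^ 2) + inverse (LL ^ 2)) * B)"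
          using KTp Q(1) AAn B0 J LL unfolding K_def by (intro mult_mono) auto
        finally show ?thesis .
      qed
    qed
    then show ?thesis by (simp add: S_def v_def Ak_def Al_def Aj_def A_def J_def LL_def B_def)
  qed
  then show ?thesis using Kp by blast
qed

end

section \<open>Trilinear estimates\<close>

interpretation freq: sigma_finite_measure freq
proof -
  interpret pair_sigma_finite "count_space (UNIV :: int set)" "lborel :: real measure"
    by (intro pair_sigma_finite.intro sigma_finite_measure_count_space lborel.sigma_finite_measure_axioms)
  show "sigma_finite_measure freq" unfolding freq_def by unfold_locales
qed

interpretation freq2: pair_sigma_finite freq freq
  by unfold_locales

lemma space_freq [simp]: "space freq = UNIV"
  by (simp add: freq_def space_pair_measure)

lemma measurable_fst_freq [measurable]: "fst \<in> measurable freq (count_space UNIV)"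
  unfolding freq_def by measurable

lemma measurable_snd_freq [measurable]: "snd \<in> borel_measurable freq"
  unfolding freq_def by measurable

lemma measurable_freqI:
  assumes [measurable]: "f \<in> measurable M (count_space UNIV)" "g \<in> borel_measurable M"
  shows "(\<lambda>x. (f x, g x)) \<in> measurable M freq"
  unfolding freq_def by measurable

lemma measurable_minus_freq [measurable]: "(\<lambda>z. fst z - snd z) \<in> measurable (freq \<Otimes>\<^sub>M freq) freq"
proof -
  have "(\<lambda>z. (fst (fst z) - fst (snd z), snd (fst z) - snd (snd z))) \<in> measurable (freq \<Otimes>\<^sub>M freq) freq"
    by (intro measurable_freqI) measurable
  then show ?thesis by (simp add: minus_prod_def)
qed

lemma measurable_diff_freq [measurable (raw)]:
  assumes "f \<in> measurable M freq" "g \<in> measurable M freq"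
  shows "(\<lambda>x. f x - g x) \<in> measurable M freq"
  using measurable_compose[OF measurable_Pair[OF assms] measurable_minus_freq] by simp

lemma nn_integral_freq:
  "f \<in> borel_measurable freq \<Longrightarrow> (\<integral>\<^sup>+p. f p \<partial>freq) = (\<integral>\<^sup>+k. \<integral>\<^sup>+\<eta>. f (k, \<eta>) \<partial>lborel \<partial>count_space UNIV)"
  unfolding freq_def by (rule lborel.nn_integral_fst[symmetric])

text \<open>
  Translations and reflections of the frequency, coordinate by coordinate.
\<close>

lemma nn_integral_freq_affine:
  assumes f[measurable]: "f \<in> borel_measurable freq"
  shows "(\<integral>\<^sup>+p. f (p - a) \<partial>freq) = (\<integral>\<^sup>+p. f p \<partial>freq)" "(\<integral>\<^sup>+p. f (a - p) \<partial>freq) = (\<integral>\<^sup>+p. f p \<partial>freq)"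
proof -
  have pm: "(\<lambda>\<eta>. f (k, \<eta>)) \<in> borel_measurable borel" for k
    by (rule measurable_compose[OF measurable_freqI f]) auto
  have "(\<integral>\<^sup>+p. f (p - a) \<partial>freq) = (\<integral>\<^sup>+k. \<integral>\<^sup>+\<eta>. f ((k, \<eta>) - a) \<partial>lborel \<partial>count_space UNIV)"
    by (rule nn_integral_freq) measurable
  also have "\<dots> = (\<integral>\<^sup>+k. \<integral>\<^sup>+\<eta>. f (k - fst a, \<eta> - snd a) \<partial>lborel \<partial>count_space UNIV)"
    by (simp add: minus_prod_def)
  also have "\<dots> = (\<integral>\<^sup>+k. \<integral>\<^sup>+\<eta>. f (k - fst a, \<eta>) \<partial>lborel \<partial>count_space UNIV)"
    using nn_integral_real_affine[OF pm, of 1 _ "- snd a"] by (simp add: algebra_simps)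
  also have "\<dots> = (\<integral>\<^sup>+k. \<integral>\<^sup>+\<eta>. f (k, \<eta>) \<partial>lborel \<partial>count_space UNIV)"
    by (rule nn_integral_bij_count_space[of "\<lambda>k. k - fst a" UNIV UNIV "\<lambda>k. \<integral>\<^sup>+\<eta>. f (k, \<eta>) \<partial>lborel"])
       (rule bij_betw_byWitness[where f' = "\<lambda>k. k + fst a"], auto)
  also have "\<dots> = (\<integral>\<^sup>+p. f p \<partial>freq)" by (rule nn_integral_freq[symmetric]) measurable
  finally show "(\<integral>\<^sup>+p. f (p - a) \<partial>freq) = (\<integral>\<^sup>+p. f p \<partial>freq)" .
  have "(\<integral>\<^sup>+p. f (a - p) \<partial>freq) = (\<integral>\<^sup>+k. \<integral>\<^sup>+\<eta>. f (a - (k, \<eta>)) \<partial>lborel \<partial>count_space UNIV)"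
    by (rule nn_integral_freq) measurable
  also have "\<dots> = (\<integral>\<^sup>+k. \<integral>\<^sup>+\<eta>. f (fst a - k, snd a - \<eta>) \<partial>lborel \<partial>count_space UNIV)"
    by (simp add: minus_prod_def)
  also have "\<dots> = (\<integral>\<^sup>+k. \<integral>\<^sup>+\<eta>. f (fst a - k, \<eta>) \<partial>lborel \<partial>count_space UNIV)"
    using nn_integral_real_affine[OF pm, of "-1" _ "snd a"] by simp
  also have "\<dots> = (\<integral>\<^sup>+k. \<integral>\<^sup>+\<eta>. f (k, \<eta>) \<partial>lborel \<partial>count_space UNIV)"
    by (rule nn_integral_bij_count_space[of "\<lambda>k. fst a - k" UNIV UNIV "\<lambda>k. \<integral>\<^sup>+\<eta>. f (k, \<eta>) \<partial>lborel"])
       (rule bij_betw_byWitness[where f' = "\<lambda>k. fst a - k"], auto)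
  also have "\<dots> = (\<integral>\<^sup>+p. f p \<partial>freq)" by (rule nn_integral_freq[symmetric]) measurable
  finally show "(\<integral>\<^sup>+p. f (a - p) \<partial>freq) = (\<integral>\<^sup>+p. f p \<partial>freq)" .
qed

abbreviation sqn :: "(int \<times> real \<Rightarrow> ennreal) \<Rightarrow> ennreal" where
  "sqn a \<equiv> (\<integral>\<^sup>+p. (a p)\<^sup>2 \<partial>freq)"

text \<open>
  Cauchy-Schwarz in the output variable removes \<open>a\<close> and \<open>b\<close>; a second application in \<open>q\<close> uses that \<open>v\<close> is
  square integrable, so that \<open>d v\<close> is integrable.
\<close>

lemma convolution_bound_aux:
  fixes a b d v :: "int \<times> real \<Rightarrow> ennreal"
  assumes [measurable]: "a \<in> borel_measurable freq" "b \<in> borel_measurable freq" "d \<in> borel_measurable freq" "v \<in> borel_measurable freq"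
  shows "(\<integral>\<^sup>+p. \<integral>\<^sup>+q. a p * b (p - q) * d q * v q \<partial>freq \<partial>freq)\<^sup>2 \<le> sqn v * (sqn a * sqn b * sqn d)"
proof -
  define I where "I = (\<lambda>q. \<integral>\<^sup>+p. a p * b (p - q) \<partial>freq)"
  have Im[measurable]: "I \<in> borel_measurable freq" unfolding I_def by measurable
  have I2: "(I q)\<^sup>2 \<le> sqn a * sqn b" for q
  proof -
    have "(I q)\<^sup>2 \<le> sqn a * (\<integral>\<^sup>+p. (b (p - q))\<^sup>2 \<partial>freq)"
      unfolding I_def by (rule Cauchy_Schwarz_nn_integral) measurable
    also have "(\<integral>\<^sup>+p. (b (p - q))\<^sup>2 \<partial>freq) = sqn b"
      by (rule nn_integral_freq_affine(1)) measurable
    finally show ?thesis .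
  qed
  have "(\<integral>\<^sup>+p. \<integral>\<^sup>+q. a p * b (p - q) * d q * v q \<partial>freq \<partial>freq) = (\<integral>\<^sup>+q. \<integral>\<^sup>+p. a p * b (p - q) * d q * v q \<partial>freq \<partial>freq)"
    by (rule freq2.Fubini'[symmetric]) measurable
  also have "\<dots> = (\<integral>\<^sup>+q. d q * (v q * I q) \<partial>freq)"
  proof (rule nn_integral_cong)
    fix q
    have "(\<integral>\<^sup>+p. a p * b (p - q) * d q * v q \<partial>freq) = (\<integral>\<^sup>+p. (a p * b (p - q)) * (d q * v q) \<partial>freq)"
      by (simp add: mult.assoc)
    also have "\<dots> = I q * (d q * v q)" unfolding I_def by (rule nn_integral_multc) measurable
    finally show "(\<integral>\<^sup>+p. a p * b (p - q) * d q * v q \<partial>freq) = d q * (v q * I q)" by (simp add: mult_ac)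
  qed
  finally have 1: "(\<integral>\<^sup>+p. \<integral>\<^sup>+q. a p * b (p - q) * d q * v q \<partial>freq \<partial>freq)\<^sup>2 \<le> sqn d * (\<integral>\<^sup>+q. (v q * I q)\<^sup>2 \<partial>freq)"
    by (simp only:) (rule Cauchy_Schwarz_nn_integral, measurable)
  have "(\<integral>\<^sup>+q. (v q * I q)\<^sup>2 \<partial>freq) \<le> (\<integral>\<^sup>+q. (v q)\<^sup>2 * (sqn a * sqn b) \<partial>freq)"
    unfolding power_mult_distrib by (intro nn_integral_mono mult_left_mono I2) auto
  also have "\<dots> = sqn v * (sqn a * sqn b)" by (rule nn_integral_multc) measurable
  finally have "sqn d * (\<integral>\<^sup>+q. (v q * I q)\<^sup>2 \<partial>freq) \<le> sqn d * (sqn v * (sqn a * sqn b))"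
    by (rule mult_left_mono) simp
  with 1 have "(\<integral>\<^sup>+p. \<integral>\<^sup>+q. a p * b (p - q) * d q * v q \<partial>freq \<partial>freq)\<^sup>2 \<le> sqn d * (sqn v * (sqn a * sqn b))"
    by (rule order_trans)
  then show ?thesis by (simp only: mult_ac)
qed

text \<open>
  The trilinear form with the weight \<open>v\<close> on either input.
\<close>

definition Tri :: "(int \<times> real \<Rightarrow> ennreal) \<Rightarrow> (int \<times> real \<Rightarrow> ennreal) \<Rightarrow> (int \<times> real \<Rightarrow> ennreal) \<Rightarrow> (int \<times> real \<Rightarrow> ennreal) \<Rightarrow> ennreal" where
  "Tri v a b d = (\<integral>\<^sup>+p. \<integral>\<^sup>+q. a p * b (p - q) * d q * (v (p - q) + v q) \<partial>freq \<partial>freq)"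

text \<open>
  The reflection \<open>q \<mapsto> p - q\<close> exchanges the two inputs, so it suffices to treat the weight on one of them.
\<close>

lemma Tri_bound:
  fixes a b d v :: "int \<times> real \<Rightarrow> ennreal"
  assumes [measurable]: "a \<in> borel_measurable freq" "b \<in> borel_measurable freq" "d \<in> borel_measurable freq" "v \<in> borel_measurable freq"
  shows "(Tri v a b d)\<^sup>2 \<le> 4 * sqn v * (sqn a * sqn b * sqn d)"
proof -
  define M where "M = sqn v * (sqn a * sqn b * sqn d)"
  define T1 where "T1 = (\<integral>\<^sup>+p. \<integral>\<^sup>+q. a p * b (p - q) * d q * v q \<partial>freq \<partial>freq)"
  define T2 where "T2 = (\<integral>\<^sup>+p. \<integral>\<^sup>+q. a p * d (p - q) * b q * v q \<partial>freq \<partial>freq)"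
  have T: "T1\<^sup>2 \<le> M" "T2\<^sup>2 \<le> M"
    using convolution_bound_aux[of a b d v] convolution_bound_aux[of a d b v]
    unfolding T1_def T2_def M_def by (simp_all add: mult_ac)
  have "Tri v a b d = (\<integral>\<^sup>+p. (\<integral>\<^sup>+q. a p * d q * b (p - q) * v (p - q) \<partial>freq) + (\<integral>\<^sup>+q. a p * b (p - q) * d q * v q \<partial>freq) \<partial>freq)"
    unfolding Tri_def by (intro nn_integral_cong, subst nn_integral_add[symmetric]) (measurable, auto simp: algebra_simps)
  also have "\<dots> = (\<integral>\<^sup>+p. (\<integral>\<^sup>+q. a p * d q * b (p - q) * v (p - q) \<partial>freq) \<partial>freq) + T1"
    unfolding T1_def by (rule nn_integral_add) measurable
  also have "(\<integral>\<^sup>+p. (\<integral>\<^sup>+q. a p * d q * b (p - q) * v (p - q) \<partial>freq) \<partial>freq) = T2"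
    unfolding T2_def
  proof (rule nn_integral_cong)
    fix p
    show "(\<integral>\<^sup>+q. a p * d q * b (p - q) * v (p - q) \<partial>freq) = (\<integral>\<^sup>+q. a p * d (p - q) * b q * v q \<partial>freq)"
      using nn_integral_freq_affine(2)[of "\<lambda>q. a p * d (p - q) * b q * v q" p] by simp
  qed
  finally have TT: "Tri v a b d = T2 + T1" .
  have "(T2 + T1)\<^sup>2 \<le> 4 * M"
  proof (cases "T1 \<le> T2")
    case True
    then have "(T2 + T1)\<^sup>2 \<le> (2 * T2)\<^sup>2" by (intro power_mono) (auto simp: mult_2 add_left_mono)
    also have "\<dots> = 4 * T2\<^sup>2" by (simp add: power_mult_distrib)
    also have "\<dots> \<le> 4 * M" using T by (intro mult_left_mono) auto
    finally show ?thesis .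
  next
    case False
    then have "(T2 + T1)\<^sup>2 \<le> (2 * T1)\<^sup>2" by (intro power_mono) (auto simp: mult_2 add_right_mono)
    also have "\<dots> = 4 * T1\<^sup>2" by (simp add: power_mult_distrib)
    also have "\<dots> \<le> 4 * M" using T by (intro mult_left_mono) auto
    finally show ?thesis .
  qed
  then show ?thesis unfolding TT M_def by (simp add: mult.assoc)
qed

lemma ennreal_power2_le_imp_le:
  fixes x y :: ennreal
  assumes "x\<^sup>2 \<le> y\<^sup>2"
  shows "x \<le> y"
proof (cases y)
  case (real s)
  then show ?thesis
  proof (cases x)
    case (real u)
    then have "ennreal (u\<^sup>2) \<le> ennreal (s\<^sup>2)" using assms \<open>y = ennreal s\<close> \<open>0 \<le> s\<close> by (simp add: ennreal_power)
    then have "u\<^sup>2 \<le> s\<^sup>2" by (subst (asm) ennreal_le_iff) auto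
    then have "u \<le> s" using \<open>0 \<le> s\<close> by (rule power2_le_imp_le)
    then show ?thesis using real \<open>y = ennreal s\<close> by (simp add: ennreal_leI)
  next
    case top
    then have "x\<^sup>2 = top" by (simp add: power2_eq_square)
    moreover have "y\<^sup>2 = ennreal (s\<^sup>2)" using real by (simp add: ennreal_power)
    ultimately show ?thesis using assms by (simp add: top_unique)
  qed
qed simp

text \<open>
  Cauchy-Schwarz in time is replaced by the inequality of the means with a parameter \<open>\<theta>\<close>, which is
  fixed once at the end; this requires only integrals of nonnegative functions.
\<close>

lemma ennreal_amgm:
  fixes T X Y :: ennreal
  assumes "T\<^sup>2 \<le> ennreal (s\<^sup>2) * (X * Y)" "0 \<le> s" "0 < \<theta>"
  shows "T \<le> ennreal s * (ennreal \<theta> * X + ennreal (1 / \<theta>) * Y)"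
proof (rule ennreal_power2_le_imp_le)
  define X' where "X' = ennreal \<theta> * X"
  define Y' where "Y' = ennreal (1 / \<theta>) * Y"
  have "X' * Y' = (ennreal \<theta> * ennreal (1 / \<theta>)) * (X * Y)" by (simp add: X'_def Y'_def mult_ac)
  also have "ennreal \<theta> * ennreal (1 / \<theta>) = 1" using assms(3) by (simp add: ennreal_mult[symmetric])
  finally have XY: "X * Y = X' * Y'" by simp
  have "X' * Y' \<le> (X' + Y') * (X' + Y')" by (intro mult_mono) auto
  then have "T\<^sup>2 \<le> ennreal (s\<^sup>2) * (X' + Y')\<^sup>2"
    unfolding power2_eq_square[of "X' + Y'"]
    using assms(1) unfolding XY by (intro order_trans[OF assms(1)[unfolded XY]] mult_left_mono) auto
  then show "T\<^sup>2 \<le> (ennreal s * (ennreal \<theta> * X + ennreal (1 / \<theta>) * Y))\<^sup>2"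
    using assms(2) by (simp add: power_mult_distrib ennreal_power X'_def Y'_def)
qed

text \<open>
  The weight \<open>\<langle>k, \<eta>\<rangle>\<^sup>-\<^sup>2\<close>; its square decays like the power \<open>-4\<close>, enough for a space of dimension 2.
\<close>

definition vw :: "int \<times> real \<Rightarrow> real" where
  "vw p = inverse (jap2 (fst p) (snd p) ^ 2)"

lemma vw_nonneg [simp]: "0 \<le> vw p"
  by (simp add: vw_def)

lemma vw_measurable [measurable]: "vw \<in> borel_measurable freq"
  unfolding vw_def jap2_def by measurable

lemma vw_square_integrable: "sqn (\<lambda>p. ennreal (vw p)) < \<infinity>"
proof -
  have le: "(ennreal (vw (k, \<eta>)))\<^sup>2 \<le> ennreal (inverse (jap (of_int k) ^ 2)) * ennreal (inverse (1 + \<eta>\<^sup>2))" for k \<eta>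
  proof -
    have e: "jap2 k \<eta> ^ 2 = 1 + (of_int k)\<^sup>2 + \<eta>\<^sup>2" by (simp add: jap2_def)
    have "(1 + (of_int k)\<^sup>2) * (1 + \<eta>\<^sup>2) \<le> (1 + (of_int k)\<^sup>2 + \<eta>\<^sup>2)\<^sup>2"
    proof -
      have "1 + (of_int k)\<^sup>2 \<le> 1 + (of_int k)\<^sup>2 + \<eta>\<^sup>2" "1 + \<eta>\<^sup>2 \<le> 1 + (of_int k)\<^sup>2 + \<eta>\<^sup>2" by auto
      then show ?thesis unfolding power2_eq_square[of "1 + (of_int k)\<^sup>2 + \<eta>\<^sup>2"] by (intro mult_mono) auto
    qed
    then have "inverse ((jap2 k \<eta> ^ 2)\<^sup>2) \<le> inverse ((1 + (of_int k)\<^sup>2) * (1 + \<eta>\<^sup>2))"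
      unfolding e by (intro le_imp_inverse_le) (auto simp: add_pos_nonneg)
    then have "(vw (k, \<eta>))\<^sup>2 \<le> inverse (jap (of_int k) ^ 2) * inverse (1 + \<eta>\<^sup>2)"
      by (simp add: vw_def jap_sq power_inverse)
    then show ?thesis by (simp add: ennreal_power ennreal_mult[symmetric] ennreal_leI)
  qed
  have fin: "(\<integral>\<^sup>+\<eta>. ennreal (inverse (1 + \<eta>\<^sup>2)) \<partial>lborel) < \<infinity>"
  proof -
    have A: "(\<integral>\<^sup>+x. ennreal (inverse (1 + x\<^sup>2)) * indicator {0..} x \<partial>lborel) = ennreal (pi / 2 - arctan 0)"
      by (rule nn_integral_FTC_atLeast) (auto simp: DERIV_arctan tendsto_arctan_at_top)
    have "(\<integral>\<^sup>+x. ennreal (inverse (1 + x\<^sup>2)) \<partial>lborel) \<le> (\<integral>\<^sup>+x. ennreal (inverse (1 + x\<^sup>2)) * indicator {0..} x + ennreal (inverse (1 + (-x)\<^sup>2)) * indicator {0..} (-x) \<partial>lborel)"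
      by (intro nn_integral_mono) (auto simp: indicator_def)
    also have "\<dots> = (\<integral>\<^sup>+x. ennreal (inverse (1 + x\<^sup>2)) * indicator {0..} x \<partial>lborel) + (\<integral>\<^sup>+x. ennreal (inverse (1 + (-x)\<^sup>2)) * indicator {0..} (-x) \<partial>lborel)"
      by (rule nn_integral_add) measurable
    also have "(\<integral>\<^sup>+x. ennreal (inverse (1 + (-x)\<^sup>2)) * indicator {0..} (-x) \<partial>lborel) = (\<integral>\<^sup>+x. ennreal (inverse (1 + x\<^sup>2)) * indicator {0..} x \<partial>lborel)"
      using nn_integral_real_affine[of "\<lambda>x. ennreal (inverse (1 + x\<^sup>2)) * indicator {0..} x" "-1" 0] by simp
    finally show ?thesis unfolding A using le_less_trans by fastforce
  qed
  have finZ: "(\<integral>\<^sup>+k. ennreal (inverse (jap (real_of_int k) ^ 2)) \<partial>count_space UNIV) < \<infinity>"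
  proof -
    have "integrable (count_space UNIV) (\<lambda>k::int. inverse (jap (real_of_int k) ^ 2))"
      using summable_jap_int abs_summable_equivalent[of "\<lambda>k::int. inverse (jap (real_of_int k) ^ 2)" UNIV]
      by (simp add: abs_summable_on_def)
    then show ?thesis by (subst nn_integral_eq_integral) auto
  qed
  have "sqn (\<lambda>p. ennreal (vw p)) = (\<integral>\<^sup>+k. \<integral>\<^sup>+\<eta>. (ennreal (vw (k, \<eta>)))\<^sup>2 \<partial>lborel \<partial>count_space UNIV)"
    by (rule nn_integral_freq) measurable
  also have "\<dots> \<le> (\<integral>\<^sup>+k. \<integral>\<^sup>+\<eta>. ennreal (inverse (jap (of_int k) ^ 2)) * ennreal (inverse (1 + \<eta>\<^sup>2)) \<partial>lborel \<partial>count_space UNIV)"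
    by (intro nn_integral_mono le)
  also have "\<dots> = (\<integral>\<^sup>+k. ennreal (inverse (jap (of_int k) ^ 2)) * (\<integral>\<^sup>+\<eta>. ennreal (inverse (1 + \<eta>\<^sup>2)) \<partial>lborel) \<partial>count_space UNIV)"
    by (intro nn_integral_cong nn_integral_cmult) measurable
  also have "\<dots> = (\<integral>\<^sup>+k. ennreal (inverse (jap (real_of_int k) ^ 2)) \<partial>count_space UNIV) * (\<integral>\<^sup>+\<eta>. ennreal (inverse (1 + \<eta>\<^sup>2)) \<partial>lborel)"
    by (rule nn_integral_multc) simp
  also have "\<dots> < \<infinity>" using fin finZ by (simp add: ennreal_mult_less_top)
  finally show ?thesis .
qed

section \<open>Measurability and Fourier norms\<close>

lemma sigma_finite_cyl: "sigma_finite_measure cyl"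
  unfolding cyl_def by (rule sigma_finite_measure_restrict_space) (auto intro: lborel.sigma_finite_measure_axioms borel_Times)

text \<open>
  The transform is a pointwise limit of integrals that depend measurably on time and frequency.
\<close>

lemma fourier_measurable:
  assumes "L2_function t f"
  shows "(\<lambda>p. fourier (f (fst p)) k (snd p)) \<in> borel_measurable (borel \<Otimes>\<^sub>M borel)"
proof -
  interpret cyl: sigma_finite_measure cyl by (rule sigma_finite_cyl)
  have "(\<lambda>p. f (fst p) (snd p)) \<in> borel_measurable borel" using assms by (simp add: L2_function_def)
  then have fm: "(\<lambda>p. f (fst p) (snd p)) \<in> borel_measurable (borel \<Otimes>\<^sub>M borel)" by (simp add: borel_prod)
  have cm: "id \<in> measurable cyl borel" unfolding cyl_def by (rule measurable_restrict_space1) simp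
  have c2: "(\<lambda>x. snd x) \<in> measurable ((borel \<Otimes>\<^sub>M borel) \<Otimes>\<^sub>M cyl) (borel :: (real \<times> real) measure)"
    using measurable_compose[OF measurable_snd cm] by simp
  have f2: "(\<lambda>x. f (fst (fst x)) (snd x)) \<in> borel_measurable ((borel \<Otimes>\<^sub>M borel) \<Otimes>\<^sub>M cyl)"
    using measurable_compose[OF measurable_Pair[OF measurable_compose[OF measurable_fst measurable_fst] c2] fm] by simp
  have s1: "(\<lambda>x. fst (snd x)) \<in> borel_measurable ((borel \<Otimes>\<^sub>M borel) \<Otimes>\<^sub>M cyl)"
    and s2: "(\<lambda>x. snd (snd x)) \<in> borel_measurable ((borel \<Otimes>\<^sub>M borel) \<Otimes>\<^sub>M cyl)"
    by (rule measurable_compose[OF c2], simp add: borel_measurable_continuous_onI continuous_on_fst continuous_on_snd continuous_on_id)+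
  have e1: "(\<lambda>x. snd (fst x)) \<in> borel_measurable ((borel \<Otimes>\<^sub>M borel) \<Otimes>\<^sub>M cyl)" by measurable
  have cis: "cis \<in> borel_measurable borel" by (rule borel_measurable_continuous_onI) (intro continuous_intros)
  show ?thesis
    unfolding fourier_def
  proof (rule borel_measurable_lim_metric)
    fix i :: nat
    have "(\<lambda>x. \<integral>z. complex_of_real (exp (- (snd z / real (Suc i))\<^sup>2) * f (fst x) z)
            * cis (- (real_of_int k * fst z + snd x * snd z)) \<partial>cyl) \<in> borel_measurable (borel \<Otimes>\<^sub>M borel)"
    proof (rule cyl.borel_measurable_lebesgue_integral, unfold case_prod_beta')
      have cf: "(\<lambda>x. cis (- (real_of_int k * fst (snd x) + snd (fst x) * snd (snd x)))) \<in> borel_measurable ((borel \<Otimes>\<^sub>M borel) \<Otimes>\<^sub>M cyl)"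
        by (rule measurable_compose[OF _ cis]) (use s1 s2 e1 in measurable)
      have ef: "(\<lambda>x. exp (- (snd (snd x) / real (Suc i))\<^sup>2) * f (fst (fst x)) (snd x)) \<in> borel_measurable ((borel \<Otimes>\<^sub>M borel) \<Otimes>\<^sub>M cyl)"
        using f2 s2 by measurable
      show "(\<lambda>x. complex_of_real (exp (- (snd (snd x) / real (Suc i))\<^sup>2) * f (fst (fst x)) (snd x)) *
            cis (- (real_of_int k * fst (snd x) + snd (fst x) * snd (snd x)))) \<in> borel_measurable ((borel \<Otimes>\<^sub>M borel) \<Otimes>\<^sub>M cyl)"
        by (rule borel_measurable_times[OF measurable_compose[OF ef borel_measurable_of_real] cf])
    qed
    then show "(\<lambda>x. complex_of_real (1 / (2 * pi)) * (\<integral>z. complex_of_real (exp (- (snd z / real (Suc i))\<^sup>2) * f (fst x) z)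
            * cis (- (real_of_int k * fst z + snd x * snd z)) \<partial>cyl)) \<in> borel_measurable (borel \<Otimes>\<^sub>M borel)"
      by measurable
  qed
qed

lemma measurable_time_freq:
  assumes "\<And>k. (\<lambda>p. F (fst p) k (snd p)) \<in> borel_measurable (borel \<Otimes>\<^sub>M borel)"
  shows "(\<lambda>z. F (fst z) (fst (snd z)) (snd (snd z))) \<in> borel_measurable (lborel \<Otimes>\<^sub>M freq)"
proof -
  have k: "(\<lambda>z. fst (snd z)) \<in> measurable (lborel \<Otimes>\<^sub>M freq) (count_space UNIV)"
    by (rule measurable_compose[OF measurable_snd measurable_fst_freq])
  have m: "(\<lambda>z. F (fst z) k (snd (snd z))) \<in> borel_measurable (lborel \<Otimes>\<^sub>M freq)" for k
  proof -
    have "(\<lambda>z. (fst z, snd (snd z))) \<in> measurable (lborel \<Otimes>\<^sub>M freq) (borel \<Otimes>\<^sub>M borel)" by measurable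
    from measurable_compose[OF this assms[of k]] show ?thesis by simp
  qed
  show ?thesis by (rule measurable_compose_countable[OF m k])
qed

text \<open>
  The wave numbers are countable.
\<close>

lemma AE_freqI:
  assumes "\<And>k. AE \<eta> in lborel. P (k, \<eta>)"
  shows "AE p in freq. P p"
proof -
  have "\<forall>k. \<exists>N. N \<in> null_sets lborel \<and> {\<eta>. \<not> P (k, \<eta>)} \<subseteq> N"
    using assms unfolding eventually_ae_filter by auto
  then obtain N where N: "\<And>k. N k \<in> null_sets lborel" "\<And>k. {\<eta>. \<not> P (k, \<eta>)} \<subseteq> N k" by metis
  have "{k} \<times> N k \<in> null_sets freq" for k
  proof (rule null_setsI)
    have Nk: "N k \<in> sets lborel" "emeasure lborel (N k) = 0" using N(1)[of k] by auto
    show "{k} \<times> N k \<in> sets freq" unfolding freq_def using Nk by (intro pair_measureI) auto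
    show "emeasure freq ({k} \<times> N k) = 0"
      unfolding freq_def using Nk by (subst lborel.emeasure_pair_measure_Times) auto
  qed
  then have "(\<Union>k. {k} \<times> N k) \<in> null_sets freq" by (rule null_sets_UN)
  moreover have "{p \<in> space freq. \<not> P p} \<subseteq> (\<Union>k. {k} \<times> N k)" using N(2) by fastforce
  ultimately show ?thesis by (rule AE_I')
qed

definition fnorm :: "nat \<Rightarrow> (real \<times> real \<Rightarrow> nat \<Rightarrow> real) \<Rightarrow> int \<times> real \<Rightarrow> real" where
  "fnorm d f p = L2_set (\<lambda>i. cmod (fourier (\<lambda>z. f z i) (fst p) (snd p))) {..<d}"

lemma fnorm_nonneg [simp]: "0 \<le> fnorm d f p"
  by (simp add: fnorm_def)

text \<open>
  The symbol \<open>\<sigma>\<close> need not be measurable: it may be the square root of a time derivative that is known only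
  almost everywhere.  A measurable minorant \<open>s\<close> of \<open>|\<sigma>|\<^sup>2\<close> takes its place.
\<close>

lemma L2_sq_ge:
  assumes [measurable]: "\<And>i. i < d \<Longrightarrow> (\<lambda>p. fourier (\<lambda>z. f z i) (fst p) (snd p)) \<in> borel_measurable freq"
    "s \<in> borel_measurable freq"
    and s0: "\<And>p. 0 \<le> s p" and s: "AE p in freq. s p \<le> (cmod (\<sigma> (fst p) (snd p)))\<^sup>2"
  shows "(\<integral>\<^sup>+p. ennreal (s p * (fnorm d f p)\<^sup>2) \<partial>freq) \<le> L2_sq d \<sigma> f"
proof -
  have "(\<integral>\<^sup>+p. ennreal (s p * (fnorm d f p)\<^sup>2) \<partial>freq)
      = (\<integral>\<^sup>+p. (\<Sum>i<d. ennreal (s p * (cmod (fourier (\<lambda>z. f z i) (fst p) (snd p)))\<^sup>2)) \<partial>freq)"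
  proof (rule nn_integral_cong)
    fix p
    have "s p * (fnorm d f p)\<^sup>2 = (\<Sum>i<d. s p * (cmod (fourier (\<lambda>z. f z i) (fst p) (snd p)))\<^sup>2)"
      by (simp add: fnorm_def L2_set_def sum_nonneg sum_distrib_left)
    then show "ennreal (s p * (fnorm d f p)\<^sup>2) = (\<Sum>i<d. ennreal (s p * (cmod (fourier (\<lambda>z. f z i) (fst p) (snd p)))\<^sup>2))"
      using s0[of p] by (simp add: sum_ennreal)
  qed
  also have "\<dots> = (\<Sum>i<d. \<integral>\<^sup>+p. ennreal (s p * (cmod (fourier (\<lambda>z. f z i) (fst p) (snd p)))\<^sup>2) \<partial>freq)"
    by (rule nn_integral_sum) auto
  also have "\<dots> \<le> L2_sq d \<sigma> f"
    unfolding L2_sq_def case_prod_unfold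
  proof (intro sum_mono nn_integral_mono_AE)
    fix i
    show "AE p in freq. ennreal (s p * (cmod (fourier (\<lambda>z. f z i) (fst p) (snd p)))\<^sup>2)
       \<le> ennreal ((cmod (\<sigma> (fst p) (snd p) * fourier (\<lambda>z. f z i) (fst p) (snd p)))\<^sup>2)"
      using s by (rule eventually_mono) (auto simp: norm_mult power_mult_distrib intro!: ennreal_leI mult_right_mono)
  qed
  finally show ?thesis .
qed

lemma ennreal_norm_integral_le:
  fixes f :: "'a \<Rightarrow> complex"
  shows "ennreal (cmod (\<integral>x. f x \<partial>M)) \<le> (\<integral>\<^sup>+x. ennreal (cmod (f x)) \<partial>M)"
proof (cases "integrable M f")
  case True
  then show ?thesis by (rule integral_norm_bound_ennreal)
qed (simp add: not_integrable_integral_eq)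

lemma fourier_time_freq:
  assumes "L2_function t f"
  shows "(\<lambda>z. fourier (f (fst z)) (fst (snd z)) (snd (snd z))) \<in> borel_measurable (lborel \<Otimes>\<^sub>M freq)"
  using measurable_time_freq[of "\<lambda>\<tau>. fourier (f \<tau>)", OF fourier_measurable[OF assms]] .

lemma time_slice:
  assumes "(\<lambda>z. F (fst z) (snd z)) \<in> borel_measurable (lborel \<Otimes>\<^sub>M freq)"
  shows "(\<lambda>p. F \<tau> p) \<in> borel_measurable freq"
proof -
  have "(\<lambda>p. (\<tau>, p)) \<in> measurable freq (lborel \<Otimes>\<^sub>M freq)" by simp
  from measurable_compose[OF this assms] show ?thesis by simp
qed

lemma fnorm_time_freq:
  assumes "\<forall>i<d. L2_function t (\<lambda>\<tau> z. f \<tau> z i)"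
  shows "(\<lambda>z. fnorm d (f (fst z)) (snd z)) \<in> borel_measurable (lborel \<Otimes>\<^sub>M freq)"
proof -
  have [measurable]: "(\<lambda>z. fourier (\<lambda>y. f (fst z) y i) (fst (snd z)) (snd (snd z))) \<in> borel_measurable (lborel \<Otimes>\<^sub>M freq)"
    if "i < d" for i
    using fourier_time_freq[of t "\<lambda>\<tau> z. f \<tau> z i"] assms that by simp
  show ?thesis unfolding fnorm_def L2_set_def by measurable
qed

lemma borel_pairI: "f \<in> borel_measurable borel \<Longrightarrow> f \<in> borel_measurable (borel \<Otimes>\<^sub>M borel)"
  for f :: "real \<times> real \<Rightarrow> real"
  by (simp add: borel_prod)

context resonance
begin

section \<open>Energy\<close>

lemma m_res_measurable: "(\<lambda>p. m_res c r \<gamma> \<mu> (fst p) k (snd p)) \<in> borel_measurable (borel \<Otimes>\<^sub>M borel)"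
  unfolding m_res_eq
  by (rule borel_pairI, rule borel_measurable_continuous_onI) (intro continuous_intros continuous_E)

lemma E_measurable: "(\<lambda>p. E (fst p) k (snd p)) \<in> borel_measurable (borel \<Otimes>\<^sub>M borel)"
  by (rule borel_pairI, rule borel_measurable_continuous_onI) (rule continuous_E)

lemma G_measurable: "(\<lambda>p. G (fst p) k (snd p)) \<in> borel_measurable (borel \<Otimes>\<^sub>M borel)"
  by (rule borel_pairI, rule borel_measurable_continuous_onI) (rule continuous_G)

lemma dres_measurable: "(\<lambda>p. dres \<mu> (fst p) k (snd p)) \<in> borel_measurable (borel \<Otimes>\<^sub>M borel)"
  unfolding dres_def using E_measurable[of k] G_measurable[of k] by measurable

lemma Lam_measurable: "(\<lambda>p. Lam (fst p) k (snd p)) \<in> borel_measurable (borel \<Otimes>\<^sub>M borel)"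
  unfolding Lam_def abs2_def by measurable

lemma w_time_freq: "(\<lambda>z. w \<mu> (fst z) (fst (snd z)) (snd (snd z))) \<in> borel_measurable (lborel \<Otimes>\<^sub>M freq)"
proof (rule measurable_time_freq)
  show "(\<lambda>p. w \<mu> (fst p) k (snd p)) \<in> borel_measurable (borel \<Otimes>\<^sub>M borel)" for k
    unfolding w_def using dres_measurable[of \<mu> k] Lam_measurable[of k] by measurable
qed

lemma A_time_freq:
  assumes "\<forall>k. (\<lambda>p. M (fst p) k (snd p)) \<in> borel_measurable borel"
  shows "(\<lambda>z. A_weight c r \<gamma> N \<mu> M (fst z) (fst (snd z)) (snd (snd z))) \<in> borel_measurable (lborel \<Otimes>\<^sub>M freq)"
proof (rule measurable_time_freq)
  fix k
  have M: "(\<lambda>p. M (fst p) k (snd p)) \<in> borel_measurable (borel \<Otimes>\<^sub>M borel)"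
    using assms by (simp add: borel_pairI)
  have D: "(\<lambda>p. M_diss c \<mu> (fst p) k (snd p)) \<in> borel_measurable (borel \<Otimes>\<^sub>M borel)"
    unfolding M_diss_def Let_def by measurable
  show "(\<lambda>p. A_weight c r \<gamma> N \<mu> M (fst p) k (snd p)) \<in> borel_measurable (borel \<Otimes>\<^sub>M borel)"
    unfolding A_weight_def m_total_def jap2_def using M D m_res_measurable[of \<mu> k] by measurable
qed

text \<open>
  The logarithmic time derivative of \<open>M_diss\<close>.  The mode \<open>k = 0\<close> inherits it from \<open>k = 1\<close>.
\<close>

definition ddiss :: "real \<Rightarrow> real \<Rightarrow> int \<Rightarrow> real \<Rightarrow> real" where
  "ddiss \<mu> t k \<eta> = inverse c * (\<mu> powr (1/3) / (1 + \<mu> powr (2/3) * \<bar>t - \<eta> / of_int (if k = 0 then 1 else k)\<bar>\<^sup>2))"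

lemma ddiss_nonneg: "0 \<le> ddiss \<mu> t k \<eta>"
  unfolding ddiss_def using c_pos by (intro mult_nonneg_nonneg divide_nonneg_nonneg add_nonneg_nonneg) auto

lemma ddiss_measurable: "(\<lambda>p. ddiss \<mu> (fst p) k (snd p)) \<in> borel_measurable (borel \<Otimes>\<^sub>M borel)"
  unfolding ddiss_def by measurable

text \<open>
  Logarithmic derivatives add up, and the one of the admissible weight is nonnegative.
\<close>

lemma dlog_m_total_ge:
  assumes "0 < \<mu>" "t * \<mu> powr (1/3) \<noteq> 1" "(\<lambda>s. M s k \<eta>) differentiable (at t)" "0 \<le> deriv (\<lambda>s. M s k \<eta>) t" "0 < M t k \<eta>"
  shows "dres \<mu> t k \<eta> + ddiss \<mu> t k \<eta> \<le> dlog (m_total c r \<gamma> \<mu> M) t k \<eta>"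
proof -
  define a where "a = m_res c r \<gamma> \<mu> t k \<eta>"
  define e where "e = M_diss c \<mu> t k \<eta>"
  define M' where "M' = deriv (\<lambda>s. M s k \<eta>) t"
  have pos: "0 < a" "0 < e" "0 < M t k \<eta>" using assms by (simp_all add: a_def m_res_pos e_def M_diss_eq)
  have d1: "((\<lambda>s. m_res c r \<gamma> \<mu> s k \<eta>) has_real_derivative dres \<mu> t k \<eta> * a) (at t)"
    unfolding a_def by (rule m_res_deriv[OF assms(1,2)])
  have d2: "((\<lambda>s. M s k \<eta>) has_real_derivative M') (at t)"
    unfolding M'_def using assms(3) by (simp add: DERIV_deriv_iff_real_differentiable)
  have d3: "((\<lambda>s. M_diss c \<mu> s k \<eta>) has_real_derivative ddiss \<mu> t k \<eta> * e) (at t)"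
  proof (cases "k = 0")
    case True
    then show ?thesis using M_diss_deriv[OF assms(1), of 1 c \<eta> t] by (simp add: M_diss_zero_mode ddiss_def e_def)
  next
    case False
    then show ?thesis using M_diss_deriv[OF assms(1), of k c \<eta> t] by (simp add: ddiss_def e_def)
  qed
  have "((\<lambda>s. m_res c r \<gamma> \<mu> s k \<eta> * M s k \<eta> * M_diss c \<mu> s k \<eta>) has_real_derivative
      (dres \<mu> t k \<eta> * a * M t k \<eta> + M' * a) * e + (ddiss \<mu> t k \<eta> * e) * (a * M t k \<eta>)) (at t)"
    unfolding a_def e_def by (rule DERIV_mult[OF DERIV_mult[OF d1[unfolded a_def] d2] d3[unfolded e_def]])
  then have "dlog (m_total c r \<gamma> \<mu> M) t k \<eta> = ((dres \<mu> t k \<eta> * a * M t k \<eta> + M' * a) * e + (ddiss \<mu> t k \<eta> * e) * (a * M t k \<eta>)) / (a * M t k \<eta> * e)"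
    unfolding dlog_def m_total_def by (simp add: DERIV_imp_deriv a_def e_def)
  also have "\<dots> = dres \<mu> t k \<eta> + ddiss \<mu> t k \<eta> + M' / M t k \<eta>"
    using pos by (simp add: field_simps)
  finally show ?thesis using assms(4) pos unfolding M'_def by simp
qed

text \<open>
  The term \<open>\<mu>\<^sup>1\<^sup>/\<^sup>3\<close> for \<open>k \<noteq> 0\<close> is the enhanced dissipation: within \<open>\<mu>\<^sup>-\<^sup>1\<^sup>/\<^sup>3\<close> of the critical time it is supplied
  by \<open>M_diss\<close>, and outside by viscosity, because \<open>\<mu> (\<eta> - k t)\<^sup>2\<close> exceeds it there.
\<close>

lemma w_square_le:
  assumes "0 < \<mu>" "0 \<le> t"
  shows "(w \<mu> t k \<eta>)\<^sup>2 \<le> (6 * c + 6) * (\<mu> * (of_int k)\<^sup>2 + \<mu> * (\<eta> - of_int k * t)\<^sup>2 + (dres \<mu> t k \<eta> + ddiss \<mu> t k \<eta>))"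
proof -
  define L where "L = \<mu> * (of_int k)\<^sup>2 + \<mu> * (\<eta> - of_int k * t)\<^sup>2"
  have L0: "0 \<le> L" using assms by (simp add: L_def)
  define a where "a = (if k = 0 then 0 else \<mu> powr (1/6))"
  define b' where "b' = \<mu> powr (1/2) * Lam t k \<eta>"
  define e where "e = sqrt (dres \<mu> t k \<eta>)"
  have b2: "b'\<^sup>2 = L"
    unfolding b'_def L_def Lam_def abs2_def using assms
    by (simp add: power_mult_distrib power2_eq_square[of "\<mu> powr (1/2)"] powr_add[symmetric] distrib_left)
  have e2: "e\<^sup>2 = dres \<mu> t k \<eta>" unfolding e_def using dres_nonneg[OF assms(2)] by simp
  have a2: "a\<^sup>2 \<le> 2 * c * ddiss \<mu> t k \<eta> + L"
  proof (cases "k = 0")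
    case True
    then show ?thesis using ddiss_nonneg[of \<mu> t k \<eta>] c_pos L0 by (simp add: a_def)
  next
    case k: False
    define s where "s = t - \<eta> / of_int k"
    have m: "\<mu> powr (2/3) * \<mu> powr (1/3) = \<mu>" using assms by (simp add: powr_add[symmetric])
    have a2: "a\<^sup>2 = \<mu> powr (1/3)" unfolding a_def using k assms by (simp add: power2_eq_square powr_add[symmetric])
    have ddk: "c * ddiss \<mu> t k \<eta> = \<mu> powr (1/3) / (1 + \<mu> powr (2/3) * s\<^sup>2)" using k c_pos by (simp add: ddiss_def s_def)
    show ?thesis
    proof (cases "\<mu> powr (2/3) * s\<^sup>2 \<le> 1")
      case True
      have "\<mu> powr (1/3) / 2 \<le> \<mu> powr (1/3) / (1 + \<mu> powr (2/3) * s\<^sup>2)"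
        using True by (intro divide_left_mono) (auto intro: add_pos_nonneg)
      then show ?thesis using a2 ddk L0 by linarith
    next
      case False
      have "1 \<le> (real_of_int k)\<^sup>2" using k by (metis of_int_1_le_iff of_int_power zero_less_power2 int_one_le_iff_zero_less)
      then have "s\<^sup>2 \<le> (of_int k)\<^sup>2 * s\<^sup>2" using mult_right_mono[of 1 "(real_of_int k)\<^sup>2" "s\<^sup>2"] by simp
      also have "\<dots> = (\<eta> - of_int k * t)\<^sup>2" unfolding power_mult_distrib[symmetric] s_def
        using k by (simp add: right_diff_distrib power2_commute mult.commute)
      finally have s2: "s\<^sup>2 \<le> (\<eta> - of_int k * t)\<^sup>2" .
      have "\<mu> powr (1/3) * 1 \<le> \<mu> powr (1/3) * (\<mu> powr (2/3) * s\<^sup>2)" using False by (intro mult_left_mono) auto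
      also have "\<dots> = (\<mu> powr (2/3) * \<mu> powr (1/3)) * s\<^sup>2" by (simp only: mult_ac)
      also have "\<dots> = \<mu> * s\<^sup>2" by (simp only: m)
      also have "\<dots> \<le> \<mu> * (\<eta> - of_int k * t)\<^sup>2" using s2 assms by (intro mult_left_mono) auto
      also have "\<dots> \<le> L" using assms by (simp add: L_def)
      finally show ?thesis using a2 ddiss_nonneg[of \<mu> t k \<eta>] c_pos by (simp add: add_increasing)
    qed
  qed
  have "(a + b' + e)\<^sup>2 \<le> 3 * (a\<^sup>2 + b'\<^sup>2 + e\<^sup>2)"
    using zero_le_power2[of "a - b'"] zero_le_power2[of "a - e"] zero_le_power2[of "b' - e"]
    by (simp add: power2_eq_square algebra_simps)
  also have "\<dots> \<le> 3 * (2 * c * ddiss \<mu> t k \<eta> + L + L + dres \<mu> t k \<eta>)" using a2 b2 e2 by simp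
  also have "\<dots> \<le> (6 * c + 6) * (L + (dres \<mu> t k \<eta> + ddiss \<mu> t k \<eta>))"
    using ddiss_nonneg[of \<mu> t k \<eta>] dres_nonneg[OF assms(2), of \<mu> k \<eta>] L0 c_pos
    by (simp add: algebra_simps add_increasing mult_nonneg_nonneg)
  finally show ?thesis unfolding w_def a_def b'_def e_def L_def by (simp add: add.assoc)
qed

text \<open>
  The modulus of the transform of \<open>A f\<close>.
\<close>

definition Anorm :: "real \<Rightarrow> real \<Rightarrow> (real \<Rightarrow> int \<Rightarrow> real \<Rightarrow> real) \<Rightarrow> nat \<Rightarrow> (real \<Rightarrow> real \<times> real \<Rightarrow> nat \<Rightarrow> real) \<Rightarrow> real \<Rightarrow> int \<times> real \<Rightarrow> real" where
  "Anorm N \<mu> M d f \<tau> p = A_weight c r \<gamma> N \<mu> M \<tau> (fst p) (snd p) * fnorm d (f \<tau>) p"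

lemma Anorm_time_freq:
  assumes "\<forall>k. (\<lambda>p. M (fst p) k (snd p)) \<in> borel_measurable borel" "\<forall>i<d. L2_function t (\<lambda>\<tau> z. f \<tau> z i)"
  shows "(\<lambda>z. Anorm N \<mu> M d f (fst z) (snd z)) \<in> borel_measurable (lborel \<Otimes>\<^sub>M freq)"
  unfolding Anorm_def using A_time_freq[OF assms(1)] fnorm_time_freq[OF assms(2)] by measurable

lemma energy_sup:
  assumes en: "energy_bound c1 C \<mu> m (A_weight c r \<gamma> N \<mu> M) t d f \<epsilon>" and \<tau>: "\<tau> \<in> {1..t}"
    and M: "\<forall>k. (\<lambda>p. M (fst p) k (snd p)) \<in> borel_measurable borel" and f: "\<forall>i<d. L2_function t (\<lambda>\<tau> z. f \<tau> z i)"
  shows "(\<integral>\<^sup>+p. ennreal ((Anorm N \<mu> M d f \<tau> p)\<^sup>2) \<partial>freq) \<le> ennreal (C * \<epsilon>\<^sup>2)"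
proof -
  let ?A = "A_weight c r \<gamma> N \<mu> M"
  have fm: "(\<lambda>p. fourier (\<lambda>z. f \<tau> z i) (fst p) (snd p)) \<in> borel_measurable freq" if "i < d" for i
    using time_slice[OF fourier_time_freq[of t "\<lambda>\<tau> z. f \<tau> z i"]] f that by simp
  have Am[measurable]: "(\<lambda>p. ?A \<tau> (fst p) (snd p)) \<in> borel_measurable freq"
    by (rule time_slice[OF A_time_freq[OF M]])
  have "(\<integral>\<^sup>+p. ennreal ((?A \<tau> (fst p) (snd p))\<^sup>2 * (fnorm d (f \<tau>) p)\<^sup>2) \<partial>freq) \<le> L2_sq d (\<lambda>k \<eta>. of_real (?A \<tau> k \<eta>)) (f \<tau>)"
    by (rule L2_sq_ge[OF fm]) (auto simp: norm_of_real)
  also have "\<dots> \<le> (SUP \<tau>\<in>{1..t}. L2_sq d (\<lambda>k \<eta>. of_real (?A \<tau> k \<eta>)) (f \<tau>))"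
    using \<tau> by (intro SUP_upper)
  also have "\<dots> \<le> ennreal (C * \<epsilon>\<^sup>2)"
    using en unfolding energy_bound_def by (rule order_trans[rotated]) simp
  finally show ?thesis by (simp add: Anorm_def power_mult_distrib)
qed

lemma W_measurable:
  assumes M: "\<forall>k. (\<lambda>p. M (fst p) k (snd p)) \<in> borel_measurable borel" and f: "\<forall>i<d. L2_function t (\<lambda>\<tau> z. f \<tau> z i)"
  shows "(\<lambda>\<tau>. \<integral>\<^sup>+p. ennreal ((w \<mu> \<tau> (fst p) (snd p) * Anorm N \<mu> M d f \<tau> p)\<^sup>2) \<partial>freq) \<in> borel_measurable lborel"
proof -
  have "(\<lambda>z. ennreal ((w \<mu> (fst z) (fst (snd z)) (snd (snd z)) * Anorm N \<mu> M d f (fst z) (snd z))\<^sup>2)) \<in> borel_measurable (lborel \<Otimes>\<^sub>M freq)"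
    using w_time_freq[of \<mu>] Anorm_time_freq[OF M f, of N \<mu>] by measurable
  then show ?thesis
    by (intro freq.borel_measurable_nn_integral) (simp add: case_prod_unfold)
qed

text \<open>
  For almost every time the integrand is bounded by the dissipation in the energy inequality: the
  admissible weight is differentiable for almost every \<open>\<eta>\<close>, in all of the countably many modes.
\<close>

lemma energy_diss:
  assumes en: "energy_bound c1 C \<mu> (m_total c r \<gamma> \<mu> M) (A_weight c r \<gamma> N \<mu> M) t d f \<epsilon>" and c1: "0 < c1" and mu: "0 < \<mu>"
    and M: "\<forall>k. (\<lambda>p. M (fst p) k (snd p)) \<in> borel_measurable borel" and f: "\<forall>i<d. L2_function t (\<lambda>\<tau> z. f \<tau> z i)"
    and Md: "\<forall>k. AE p in lborel. 0 < fst p \<longrightarrow> (\<lambda>s. M s k (snd p)) differentiable (at (fst p)) \<and> 0 \<le> deriv (\<lambda>s. M s k (snd p)) (fst p)"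
    and Mp: "\<forall>t>0. \<forall>k \<eta>. 0 < M t k \<eta>" and C0: "0 \<le> C"
  shows "(\<integral>\<^sup>+\<tau>\<in>{1..t}. (\<integral>\<^sup>+p. ennreal ((w \<mu> \<tau> (fst p) (snd p) * Anorm N \<mu> M d f \<tau> p)\<^sup>2) \<partial>freq) \<partial>lborel) \<le> ennreal ((6 * c + 6) / c1 * C * \<epsilon>\<^sup>2)"
proof -
  let ?A = "A_weight c r \<gamma> N \<mu> M"
  let ?m = "m_total c r \<gamma> \<mu> M"
  define W where "W = (\<lambda>\<tau>. \<integral>\<^sup>+p. ennreal ((w \<mu> \<tau> (fst p) (snd p) * Anorm N \<mu> M d f \<tau> p)\<^sup>2) \<partial>freq)"
  define D where "D = (\<lambda>\<tau>. ennreal \<mu> *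
            (L2_sq d (\<lambda>k \<eta>. \<i> * of_int k * of_real (?A \<tau> k \<eta>)) (f \<tau>)
             + L2_sq d (\<lambda>k \<eta>. \<i> * of_real (\<eta> - of_int k * \<tau>) * of_real (?A \<tau> k \<eta>)) (f \<tau>))
          + L2_sq d (\<lambda>k \<eta>. of_real (sqrt (dlog ?m \<tau> k \<eta>) * ?A \<tau> k \<eta>)) (f \<tau>))"
  define K where "K = 6 * c + 6"
  have K: "0 < K" using c_pos by (simp add: K_def)
  have Wm: "W \<in> borel_measurable lborel" unfolding W_def by (rule W_measurable[OF M f])
  have "AE z in lborel \<Otimes>\<^sub>M lborel. 0 < fst z \<longrightarrow> (\<lambda>s. M s k (snd z)) differentiable (at (fst z)) \<and> 0 \<le> deriv (\<lambda>s. M s k (snd z)) (fst z)" for k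
    unfolding lborel_prod using Md by blast
  from lborel_pair.AE_pair[OF this]
  have "AE \<tau> in lborel. AE \<eta> in lborel. 0 < \<tau> \<longrightarrow> (\<lambda>s. M s k \<eta>) differentiable (at \<tau>) \<and> 0 \<le> deriv (\<lambda>s. M s k \<eta>) \<tau>" for k
    by simp
  then have "AE \<tau> in lborel. \<forall>k. AE \<eta> in lborel. 0 < \<tau> \<longrightarrow> (\<lambda>s. M s k \<eta>) differentiable (at \<tau>) \<and> 0 \<le> deriv (\<lambda>s. M s k \<eta>) \<tau>"
    unfolding AE_all_countable by blast
  moreover have "AE \<tau> in lborel. \<tau> \<noteq> 1 / \<mu> powr (1/3)" by (rule AE_lborel_singleton)
  ultimately have "AE \<tau> in lborel. ennreal (1 / K) * (W \<tau> * indicator {1..t} \<tau>) \<le> D \<tau> * indicator {1..t} \<tau>"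
  proof eventually_elim
    case (elim \<tau>)
    show ?case
    proof (cases "\<tau> \<in> {1..t}")
      case True
      then have \<tau>: "0 < \<tau>" "0 \<le> \<tau>" by auto
      have ne: "\<tau> * \<mu> powr (1/3) \<noteq> 1" using elim(2) mu by (simp add: field_simps)
      have fm[measurable]: "(\<lambda>p. fourier (\<lambda>z. f \<tau> z i) (fst p) (snd p)) \<in> borel_measurable freq" if "i < d" for i
        using time_slice[OF fourier_time_freq[of t "\<lambda>\<tau> z. f \<tau> z i"]] f that by simp
      have Am[measurable]: "(\<lambda>p. ?A \<tau> (fst p) (snd p)) \<in> borel_measurable freq"
        by (rule time_slice[OF A_time_freq[OF M]])
      have Fm[measurable]: "(\<lambda>p. fnorm d (f \<tau>) p) \<in> borel_measurable freq"
        by (rule time_slice[OF fnorm_time_freq[OF f]])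
      have dm[measurable]: "(\<lambda>p. dres \<mu> \<tau> (fst p) (snd p)) \<in> borel_measurable freq"
        by (rule time_slice[OF measurable_time_freq[OF dres_measurable]])
      have ddm[measurable]: "(\<lambda>p. ddiss \<mu> \<tau> (fst p) (snd p)) \<in> borel_measurable freq"
        by (rule time_slice[OF measurable_time_freq[OF ddiss_measurable]])
      define A where "A = (\<lambda>p. ?A \<tau> (fst p) (snd p))"
      have [measurable]: "A \<in> borel_measurable freq" unfolding A_def by measurable
      define F where "F = (\<lambda>p. (fnorm d (f \<tau>) p)\<^sup>2)"
      have [measurable]: "F \<in> borel_measurable freq" unfolding F_def by measurable
      have F0: "0 \<le> F p" for p by (simp add: F_def)
      define s1 where "s1 = (\<lambda>p::int \<times> real. (of_int (fst p))\<^sup>2 * (A p)\<^sup>2)"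
      define s2 where "s2 = (\<lambda>p::int \<times> real. (snd p - of_int (fst p) * \<tau>)\<^sup>2 * (A p)\<^sup>2)"
      define s3 where "s3 = (\<lambda>p::int \<times> real. (dres \<mu> \<tau> (fst p) (snd p) + ddiss \<mu> \<tau> (fst p) (snd p)) * (A p)\<^sup>2)"
      have sm[measurable]: "s1 \<in> borel_measurable freq" "s2 \<in> borel_measurable freq" "s3 \<in> borel_measurable freq"
        unfolding s1_def s2_def s3_def by measurable
      have s0: "0 \<le> s1 p" "0 \<le> s2 p" "0 \<le> s3 p" for p
        unfolding s1_def s2_def s3_def using dres_nonneg[OF \<tau>(2)] ddiss_nonneg by simp_all
      have 1: "(\<integral>\<^sup>+p. ennreal (s1 p * F p) \<partial>freq) \<le> L2_sq d (\<lambda>k \<eta>. \<i> * of_int k * of_real (?A \<tau> k \<eta>)) (f \<tau>)"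
        unfolding F_def by (rule L2_sq_ge[OF fm sm(1) s0(1)]) (auto simp: s1_def A_def norm_mult power_mult_distrib)
      have 2: "(\<integral>\<^sup>+p. ennreal (s2 p * F p) \<partial>freq) \<le> L2_sq d (\<lambda>k \<eta>. \<i> * of_real (\<eta> - of_int k * \<tau>) * of_real (?A \<tau> k \<eta>)) (f \<tau>)"
        unfolding F_def by (rule L2_sq_ge[OF fm sm(2) s0(2)]) (auto simp: s2_def A_def norm_mult power_mult_distrib simp del: of_real_diff)
      have 3: "(\<integral>\<^sup>+p. ennreal (s3 p * F p) \<partial>freq) \<le> L2_sq d (\<lambda>k \<eta>. of_real (sqrt (dlog ?m \<tau> k \<eta>) * ?A \<tau> k \<eta>)) (f \<tau>)"
        unfolding F_def
      proof (rule L2_sq_ge[OF fm sm(3) s0(3)])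
        have "AE p in freq. dres \<mu> \<tau> (fst p) (snd p) + ddiss \<mu> \<tau> (fst p) (snd p) \<le> dlog ?m \<tau> (fst p) (snd p)"
        proof (rule AE_freqI)
          fix k
          have "AE \<eta> in lborel. 0 < \<tau> \<longrightarrow> (\<lambda>s. M s k \<eta>) differentiable (at \<tau>) \<and> 0 \<le> deriv (\<lambda>s. M s k \<eta>) \<tau>"
            using elim(1) by blast
          then show "AE \<eta> in lborel. dres \<mu> \<tau> (fst (k, \<eta>)) (snd (k, \<eta>)) + ddiss \<mu> \<tau> (fst (k, \<eta>)) (snd (k, \<eta>)) \<le> dlog ?m \<tau> (fst (k, \<eta>)) (snd (k, \<eta>))"
            by (rule eventually_mono) (use \<tau> ne mu Mp in \<open>auto intro!: dlog_m_total_ge\<close>)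
        qed
        then show "AE p in freq. s3 p \<le> (cmod (complex_of_real (sqrt (dlog ?m \<tau> (fst p) (snd p)) * ?A \<tau> (fst p) (snd p))))\<^sup>2"
        proof (rule eventually_mono)
          fix p
          assume le: "dres \<mu> \<tau> (fst p) (snd p) + ddiss \<mu> \<tau> (fst p) (snd p) \<le> dlog ?m \<tau> (fst p) (snd p)"
          have "0 \<le> dlog ?m \<tau> (fst p) (snd p)"
            by (rule order_trans[OF add_nonneg_nonneg[OF dres_nonneg[OF \<tau>(2)] ddiss_nonneg] le])
          then show "s3 p \<le> (cmod (complex_of_real (sqrt (dlog ?m \<tau> (fst p) (snd p)) * ?A \<tau> (fst p) (snd p))))\<^sup>2"
            unfolding s3_def A_def using mult_right_mono[OF le, of "(?A \<tau> (fst p) (snd p))\<^sup>2"]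
            by (simp only: norm_of_real power2_abs power_mult_distrib real_sqrt_pow2) simp
        qed
      qed
      have "ennreal (1 / K) * W \<tau> = (\<integral>\<^sup>+p. ennreal (1 / K) * ennreal ((w \<mu> \<tau> (fst p) (snd p) * Anorm N \<mu> M d f \<tau> p)\<^sup>2) \<partial>freq)"
      proof -
        have [measurable]: "(\<lambda>p. w \<mu> \<tau> (fst p) (snd p)) \<in> borel_measurable freq" by (rule time_slice[OF w_time_freq])
        have [measurable]: "(\<lambda>p. Anorm N \<mu> M d f \<tau> p) \<in> borel_measurable freq" by (rule time_slice[OF Anorm_time_freq[OF M f]])
        show ?thesis unfolding W_def by (rule nn_integral_cmult[symmetric]) measurable
      qed
      also have "\<dots> \<le> (\<integral>\<^sup>+p. ennreal \<mu> * (ennreal (s1 p * F p) + ennreal (s2 p * F p)) + ennreal (s3 p * F p) \<partial>freq)"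
      proof (rule nn_integral_mono)
        fix p :: "int \<times> real"
        have "(1 / K) * (w \<mu> \<tau> (fst p) (snd p) * Anorm N \<mu> M d f \<tau> p)\<^sup>2 = (1 / K) * (w \<mu> \<tau> (fst p) (snd p))\<^sup>2 * ((A p)\<^sup>2 * F p)"
          by (simp add: Anorm_def A_def F_def power_mult_distrib)
        also have "\<dots> \<le> (\<mu> * (of_int (fst p))\<^sup>2 + \<mu> * (snd p - of_int (fst p) * \<tau>)\<^sup>2 + (dres \<mu> \<tau> (fst p) (snd p) + ddiss \<mu> \<tau> (fst p) (snd p))) * ((A p)\<^sup>2 * F p)"
          using w_square_le[OF mu \<tau>(2), of "fst p" "snd p", folded K_def] K F0[of p]
          by (intro mult_right_mono) (auto simp: divide_le_eq mult.commute)
        also have "\<dots> = \<mu> * (s1 p * F p + s2 p * F p) + s3 p * F p" by (simp add: s1_def s2_def s3_def algebra_simps)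
        finally have "ennreal ((1 / K) * (w \<mu> \<tau> (fst p) (snd p) * Anorm N \<mu> M d f \<tau> p)\<^sup>2) \<le> ennreal (\<mu> * (s1 p * F p + s2 p * F p) + s3 p * F p)"
          by (rule ennreal_leI)
        also have "\<dots> = ennreal \<mu> * (ennreal (s1 p * F p) + ennreal (s2 p * F p)) + ennreal (s3 p * F p)"
          using mu s0 F0 by (simp add: ennreal_plus ennreal_mult)
        finally show "ennreal (1 / K) * ennreal ((w \<mu> \<tau> (fst p) (snd p) * Anorm N \<mu> M d f \<tau> p)\<^sup>2) \<le> ennreal \<mu> * (ennreal (s1 p * F p) + ennreal (s2 p * F p)) + ennreal (s3 p * F p)"
          by (subst ennreal_mult[symmetric]) (use K in auto)
      qed
      also have "\<dots> = ennreal \<mu> * ((\<integral>\<^sup>+p. ennreal (s1 p * F p) \<partial>freq) + (\<integral>\<^sup>+p. ennreal (s2 p * F p) \<partial>freq)) + (\<integral>\<^sup>+p. ennreal (s3 p * F p) \<partial>freq)"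
        by (simp add: nn_integral_add nn_integral_cmult)
      also have "\<dots> \<le> D \<tau>" unfolding D_def by (intro add_mono mult_left_mono 1 2 3) auto
      finally show ?thesis using True by simp
    qed simp
  qed
  then have "(\<integral>\<^sup>+\<tau>. ennreal (1 / K) * (W \<tau> * indicator {1..t} \<tau>) \<partial>lborel) \<le> (\<integral>\<^sup>+\<tau>\<in>{1..t}. D \<tau> \<partial>lborel)"
    by (rule nn_integral_mono_AE)
  moreover have "(\<integral>\<^sup>+\<tau>. ennreal (1 / K) * (W \<tau> * indicator {1..t} \<tau>) \<partial>lborel) = ennreal (1 / K) * (\<integral>\<^sup>+\<tau>\<in>{1..t}. W \<tau> \<partial>lborel)"
    using Wm by (intro nn_integral_cmult) auto
  ultimately have 1: "ennreal (1 / K) * (\<integral>\<^sup>+\<tau>\<in>{1..t}. W \<tau> \<partial>lborel) \<le> (\<integral>\<^sup>+\<tau>\<in>{1..t}. D \<tau> \<partial>lborel)" by simp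
  have 2: "ennreal c1 * (\<integral>\<^sup>+\<tau>\<in>{1..t}. D \<tau> \<partial>lborel) \<le> ennreal (C * \<epsilon>\<^sup>2)"
    using en unfolding energy_bound_def D_def by (rule order_trans[rotated]) simp
  have "(\<integral>\<^sup>+\<tau>\<in>{1..t}. W \<tau> \<partial>lborel) = ennreal (K / c1) * (ennreal c1 * (ennreal (1 / K) * (\<integral>\<^sup>+\<tau>\<in>{1..t}. W \<tau> \<partial>lborel)))"
    using K c1 by (simp add: mult.assoc[symmetric] ennreal_mult[symmetric])
  also have "\<dots> \<le> ennreal (K / c1) * ennreal (C * \<epsilon>\<^sup>2)"
    using 1 2 by (intro mult_left_mono order_trans[OF mult_left_mono 2]) auto
  also have "\<dots> = ennreal ((6 * c + 6) / c1 * C * \<epsilon>\<^sup>2)"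
    using K c1 C0 by (simp add: ennreal_mult[symmetric] K_def mult.assoc)
  finally show ?thesis unfolding W_def .
qed

section \<open>The time integral\<close>

text \<open>
  Moduli are taken inside the integrals and the symbol bound is inserted; the sum over components is
  handled by Cauchy-Schwarz in \<open>\<real>\<^sup>d\<close> at fixed frequencies.  Multiplying out the bracket gives four trilinear forms.
\<close>

lemma NL_le:
  assumes M: "\<forall>k. (\<lambda>p. M (fst p) k (snd p)) \<in> borel_measurable borel"
    and f1: "\<forall>i<d. L2_function t (\<lambda>\<tau> z. f1 \<tau> z i)" and f2: "\<forall>i<d. L2_function t (\<lambda>\<tau> z. f2 \<tau> z i)"
    and q: "L2_function t q"
    and K0: "0 \<le> K" and \<tau>: "0 \<le> \<tau>" and h: "0 \<le> h" and A0: "\<And>k \<eta>. 0 \<le> A_weight c r \<gamma> N \<mu> M \<tau> k \<eta>"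
    and SB: "\<And>k l \<eta> \<xi>. V \<tau> k l \<eta> \<xi> * \<bar>A_weight c r \<gamma> N \<mu> M \<tau> k \<eta> * Lam \<tau> k \<eta> powr p - A_weight c r \<gamma> N \<mu> M \<tau> l \<xi> * Lam \<tau> l \<xi> powr p\<bar> * Lam \<tau> l \<xi> powr (- p)
       \<le> K * (A_weight c r \<gamma> N \<mu> M \<tau> (k - l) (\<eta> - \<xi>) * A_weight c r \<gamma> N \<mu> M \<tau> l \<xi>
             * (inverse (jap2 (k - l) (\<eta> - \<xi>) ^ 2) + inverse (jap2 l \<xi> ^ 2)) * Br \<mu> h \<tau> k l \<eta> \<xi>)"
  defines "X \<equiv> \<lambda>p. ennreal (Anorm N \<mu> M d f1 \<tau> p)" and "Y \<equiv> \<lambda>p. ennreal (Anorm N \<mu> M 1 (\<lambda>\<tau> z i. q \<tau> z) \<tau> p)"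
    and "Z \<equiv> \<lambda>p. ennreal (Anorm N \<mu> M d f2 \<tau> p)" and "v \<equiv> \<lambda>p. ennreal (vw p)"
    and "wX \<equiv> \<lambda>p. ennreal (w \<mu> \<tau> (fst p) (snd p) * Anorm N \<mu> M d f1 \<tau> p)"
    and "wY \<equiv> \<lambda>p. ennreal (w \<mu> \<tau> (fst p) (snd p) * Anorm N \<mu> M 1 (\<lambda>\<tau> z i. q \<tau> z) \<tau> p)"
    and "wZ \<equiv> \<lambda>p. ennreal (w \<mu> \<tau> (fst p) (snd p) * Anorm N \<mu> M d f2 \<tau> p)"
  shows "ennreal (NL \<gamma> p (A_weight c r \<gamma> N \<mu> M) d f1 f2 q \<tau>)
     \<le> ennreal (K * (Lf \<mu> * \<mu> powr (- 1/3))) * (ennreal h * Tri v X Y Z + Tri v wX Y wZ + Tri v wX wY Z + Tri v X wY wZ)"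
proof -
  define A where "A = A_weight c r \<gamma> N \<mu> M \<tau>"
  define W where "W = (\<lambda>p. w \<mu> \<tau> (fst p) (snd p))"
  define x where "x = (\<lambda>i p. A (fst p) (snd p) * cmod (fourier (\<lambda>z. f1 \<tau> z i) (fst p) (snd p)))"
  define z where "z = (\<lambda>i p. A (fst p) (snd p) * cmod (fourier (\<lambda>z. f2 \<tau> z i) (fst p) (snd p)))"
  define y where "y = (\<lambda>p. A (fst p) (snd p) * cmod (fourier (q \<tau>) (fst p) (snd p)))"
  define PX where "PX = Anorm N \<mu> M d f1 \<tau>"
  define PY where "PY = Anorm N \<mu> M 1 (\<lambda>\<tau> z i. q \<tau> z) \<tau>"
  define PZ where "PZ = Anorm N \<mu> M d f2 \<tau>"
  define kern where "kern = (\<lambda>p p'. (vw (p - p') + vw p') * (Lf \<mu> * \<mu> powr (- 1/3) * (h + W p * W p' + W p * W (p - p') + W p' * W (p - p'))))"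
  have q1: "\<forall>i<1. L2_function t (\<lambda>\<tau> z. q \<tau> z)" using q by simp
  have A0': "0 \<le> A k \<eta>" for k \<eta> unfolding A_def by (rule A0)
  have Am[measurable]: "(\<lambda>p. A (fst p) (snd p)) \<in> borel_measurable freq"
    unfolding A_def by (rule time_slice[OF A_time_freq[OF M]])
  have f1m[measurable]: "(\<lambda>p. fourier (\<lambda>z. f1 \<tau> z i) (fst p) (snd p)) \<in> borel_measurable freq" if "i < d" for i
    using time_slice[OF fourier_time_freq[of t "\<lambda>\<tau> z. f1 \<tau> z i"]] f1 that by simp
  have f2m[measurable]: "(\<lambda>p. fourier (\<lambda>z. f2 \<tau> z i) (fst p) (snd p)) \<in> borel_measurable freq" if "i < d" for i
    using time_slice[OF fourier_time_freq[of t "\<lambda>\<tau> z. f2 \<tau> z i"]] f2 that by simp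
  have qm[measurable]: "(\<lambda>p. fourier (q \<tau>) (fst p) (snd p)) \<in> borel_measurable freq"
    by (rule time_slice[OF fourier_time_freq[OF q]])
  have xm[measurable]: "x i \<in> borel_measurable freq" if "i < d" for i unfolding x_def using that by measurable
  have zm[measurable]: "z i \<in> borel_measurable freq" if "i < d" for i unfolding z_def using that by measurable
  have ym[measurable]: "y \<in> borel_measurable freq" unfolding y_def by measurable
  have Wm[measurable]: "W \<in> borel_measurable freq" unfolding W_def by (rule time_slice[OF w_time_freq])
  have PXm[measurable]: "PX \<in> borel_measurable freq" unfolding PX_def by (rule time_slice[OF Anorm_time_freq[OF M f1]])
  have PYm[measurable]: "PY \<in> borel_measurable freq" unfolding PY_def by (rule time_slice[OF Anorm_time_freq[OF M q1]])
  have PZm[measurable]: "PZ \<in> borel_measurable freq" unfolding PZ_def by (rule time_slice[OF Anorm_time_freq[OF M f2]])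
  have W0: "0 \<le> W p" for p unfolding W_def by (rule w_nonneg[OF \<tau>])
  have km[measurable]: "(\<lambda>u. kern (fst u) (snd u)) \<in> borel_measurable (freq \<Otimes>\<^sub>M freq)" unfolding kern_def by measurable
  have kern0: "0 \<le> kern p p'" for p p' unfolding kern_def using h W0 by (intro mult_nonneg_nonneg add_nonneg_nonneg) auto
  have x0: "0 \<le> x i p" and y0: "0 \<le> y p" and z0: "0 \<le> z i p" for i p unfolding x_def y_def z_def using A0' by simp_all
  have PX: "PX u = L2_set (\<lambda>i. x i u) {..<d}" and PZ: "PZ u = L2_set (\<lambda>i. z i u) {..<d}" for u
    unfolding PX_def PZ_def Anorm_def fnorm_def x_def z_def A_def using A0 by (simp_all add: L2_set_right_distrib)
  have PY: "PY u = y u" for u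
    unfolding PY_def Anorm_def fnorm_def y_def A_def by (simp add: L2_set_def)
  have pt: "cmod ((of_real (A (fst u) (snd u) * Lam \<tau> (fst u) (snd u) powr p) - of_real (A (fst u') (snd u') * Lam \<tau> (fst u') (snd u') powr p)) *
      ((\<i> * of_real (snd u - snd u') * of_real (Lam \<tau> (fst u - fst u') (snd u - snd u') powr (- (1 + \<gamma>))) * fourier (q \<tau>) (fst u - fst u') (snd u - snd u') * (\<i> * of_int (fst u'))
       + - (\<i> * of_int (fst u - fst u')) * of_real (Lam \<tau> (fst u - fst u') (snd u - snd u') powr (- (1 + \<gamma>))) * fourier (q \<tau>) (fst u - fst u') (snd u - snd u') * (\<i> * of_real (snd u')))
       * (of_real (Lam \<tau> (fst u') (snd u') powr (- p)) * fourier (\<lambda>z. f2 \<tau> z i) (fst u') (snd u'))))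
    \<le> K * (y (u - u') * z i u' * kern u u')" (is "cmod ?lhs \<le> _") for u u' :: "int \<times> real" and i
  proof -
    obtain k \<eta> where u: "u = (k, \<eta>)" by (cases u)
    obtain l \<xi> where u': "u' = (l, \<xi>)" by (cases u')
    let ?L = "Lam \<tau> (k - l) (\<eta> - \<xi>) powr (- (1 + \<gamma>))"
    let ?Q = "fourier (q \<tau>) (k - l) (\<eta> - \<xi>)"
    let ?F = "fourier (\<lambda>z. f2 \<tau> z i) l \<xi>"
    have "?lhs = of_real (A k \<eta> * Lam \<tau> k \<eta> powr p - A l \<xi> * Lam \<tau> l \<xi> powr p) * (- of_real ((\<eta> - \<xi>) * of_int l - of_int (k - l) * \<xi>))
        * of_real ?L * ?Q * (of_real (Lam \<tau> l \<xi> powr (- p)) * ?F)"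
      unfolding u u' by (simp add: algebra_simps)
    then have "cmod ?lhs = V \<tau> k l \<eta> \<xi> * \<bar>A k \<eta> * Lam \<tau> k \<eta> powr p - A l \<xi> * Lam \<tau> l \<xi> powr p\<bar> * Lam \<tau> l \<xi> powr (- p) * (cmod ?Q * cmod ?F)"
      unfolding V_def by (simp only: norm_mult norm_minus_cancel norm_of_real abs_of_nonneg powr_ge_zero mult_ac)
    also have "\<dots> \<le> K * (A (k - l) (\<eta> - \<xi>) * A l \<xi> * (inverse (jap2 (k - l) (\<eta> - \<xi>) ^ 2) + inverse (jap2 l \<xi> ^ 2)) * Br \<mu> h \<tau> k l \<eta> \<xi>) * (cmod ?Q * cmod ?F)"
      unfolding A_def by (intro mult_right_mono SB) auto
    also have "\<dots> = K * (y (u - u') * z i u' * kern u u')"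
      unfolding y_def z_def kern_def u u' vw_def W_def Br_def by (simp add: mult_ac)
    finally show ?thesis .
  qed
  define Gh where "Gh = (\<lambda>i. commutator_hat
          (\<lambda>k \<eta>. of_real (A k \<eta> * Lam \<tau> k \<eta> powr p))
          (\<lambda>k \<eta>. (\<i> * of_real \<eta> * of_real (Lam \<tau> k \<eta> powr (- (1 + \<gamma>))) * fourier (q \<tau>) k \<eta>,
                  - (\<i> * of_int k) * of_real (Lam \<tau> k \<eta> powr (- (1 + \<gamma>))) * fourier (q \<tau>) k \<eta>))
          (\<lambda>k \<eta>. of_real (Lam \<tau> k \<eta> powr (- p)) * fourier (\<lambda>z. f2 \<tau> z i) k \<eta>))"
  have G: "ennreal (cmod (Gh i (fst u) (snd u))) \<le> (\<integral>\<^sup>+u'. ennreal (K * (y (u - u') * z i u' * kern u u')) \<partial>freq)" for i u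
  proof -
    define int where "int = (\<lambda>u'. (of_real (A (fst u) (snd u) * Lam \<tau> (fst u) (snd u) powr p) - of_real (A (fst u') (snd u') * Lam \<tau> (fst u') (snd u') powr p)) *
      ((\<i> * of_real (snd u - snd u') * of_real (Lam \<tau> (fst u - fst u') (snd u - snd u') powr (- (1 + \<gamma>))) * fourier (q \<tau>) (fst u - fst u') (snd u - snd u') * (\<i> * of_int (fst u'))
       + - (\<i> * of_int (fst u - fst u')) * of_real (Lam \<tau> (fst u - fst u') (snd u - snd u') powr (- (1 + \<gamma>))) * fourier (q \<tau>) (fst u - fst u') (snd u - snd u') * (\<i> * of_real (snd u')))
       * (of_real (Lam \<tau> (fst u') (snd u') powr (- p)) * fourier (\<lambda>z. f2 \<tau> z i) (fst u') (snd u'))))"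
    have "Gh i (fst u) (snd u) = 1 / (2 * pi) * (\<integral>u'. int u' \<partial>freq)"
      unfolding Gh_def commutator_hat_def int_def case_prod_unfold fst_conv snd_conv ..
    then have "cmod (Gh i (fst u) (snd u)) = 1 / (2 * pi) * cmod (\<integral>u'. int u' \<partial>freq)"
      by (simp add: norm_mult norm_divide)
    also have "\<dots> \<le> 1 * cmod (\<integral>u'. int u' \<partial>freq)"
      using pi_ge_two by (intro mult_right_mono) (auto simp: divide_le_eq)
    finally have "ennreal (cmod (Gh i (fst u) (snd u))) \<le> ennreal (cmod (\<integral>u'. int u' \<partial>freq))" by (simp add: ennreal_leI)
    also have "\<dots> \<le> (\<integral>\<^sup>+u'. ennreal (cmod (int u')) \<partial>freq)" by (rule ennreal_norm_integral_le)
    also have "\<dots> \<le> (\<integral>\<^sup>+u'. ennreal (K * (y (u - u') * z i u' * kern u u')) \<partial>freq)"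
      unfolding int_def by (intro nn_integral_mono ennreal_leI pt)
    finally show ?thesis .
  qed
  define Fh where "Fh = (\<lambda>i k \<eta>. complex_of_real (A k \<eta>) * fourier (\<lambda>z. f1 \<tau> z i) k \<eta>)"
  have NL_eq: "NL \<gamma> p (A_weight c r \<gamma> N \<mu> M) d f1 f2 q \<tau> = cmod (\<Sum>i<d. inner_hat (Fh i) (Gh i))"
    unfolding NL_def Fh_def Gh_def A_def ..
  have I: "ennreal (cmod (inner_hat (Fh i) (Gh i))) \<le> (\<integral>\<^sup>+u. \<integral>\<^sup>+u'. ennreal (K * (x i u * y (u - u') * z i u' * kern u u')) \<partial>freq \<partial>freq)" if i: "i < d" for i
  proof -
    have "ennreal (cmod (inner_hat (Fh i) (Gh i))) \<le> (\<integral>\<^sup>+u. ennreal (cmod (Fh i (fst u) (snd u) * cnj (Gh i (fst u) (snd u)))) \<partial>freq)"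
      unfolding inner_hat_def case_prod_unfold by (rule ennreal_norm_integral_le)
    also have "\<dots> \<le> (\<integral>\<^sup>+u. \<integral>\<^sup>+u'. ennreal (K * (x i u * y (u - u') * z i u' * kern u u')) \<partial>freq \<partial>freq)"
    proof (rule nn_integral_mono)
      fix u :: "int \<times> real"
      have "cmod (Fh i (fst u) (snd u)) = x i u" unfolding Fh_def x_def using A0' by (simp add: norm_mult)
      then have "ennreal (cmod (Fh i (fst u) (snd u) * cnj (Gh i (fst u) (snd u)))) = ennreal (x i u) * ennreal (cmod (Gh i (fst u) (snd u)))"
        using x0 by (simp add: norm_mult ennreal_mult)
      also have "\<dots> \<le> ennreal (x i u) * (\<integral>\<^sup>+u'. ennreal (K * (y (u - u') * z i u' * kern u u')) \<partial>freq)"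
        by (intro mult_left_mono G) auto
      also have "\<dots> = (\<integral>\<^sup>+u'. ennreal (x i u) * ennreal (K * (y (u - u') * z i u' * kern u u')) \<partial>freq)"
      proof (rule nn_integral_cmult[symmetric])
        have "(\<lambda>u'. kern u u') \<in> borel_measurable freq" unfolding kern_def by measurable
        then show "(\<lambda>u'. ennreal (K * (y (u - u') * z i u' * kern u u'))) \<in> borel_measurable freq"
          using zm[OF i] by measurable
      qed
      also have "\<dots> = (\<integral>\<^sup>+u'. ennreal (K * (x i u * y (u - u') * z i u' * kern u u')) \<partial>freq)"
        using x0 by (intro nn_integral_cong) (simp add: ennreal_mult'[symmetric] mult_ac)
      finally show "ennreal (cmod (Fh i (fst u) (snd u) * cnj (Gh i (fst u) (snd u)))) \<le> (\<integral>\<^sup>+u'. ennreal (K * (x i u * y (u - u') * z i u' * kern u u')) \<partial>freq)" .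
    qed
    finally show ?thesis .
  qed
  have "ennreal (NL \<gamma> p (A_weight c r \<gamma> N \<mu> M) d f1 f2 q \<tau>) \<le> ennreal (\<Sum>i<d. cmod (inner_hat (Fh i) (Gh i)))"
    unfolding NL_eq by (intro ennreal_leI norm_sum)
  also have "\<dots> = (\<Sum>i<d. ennreal (cmod (inner_hat (Fh i) (Gh i))))" by (simp add: sum_ennreal)
  also have "\<dots> \<le> (\<Sum>i<d. \<integral>\<^sup>+u. \<integral>\<^sup>+u'. ennreal (K * (x i u * y (u - u') * z i u' * kern u u')) \<partial>freq \<partial>freq)"
    by (intro sum_mono I) auto
  also have "\<dots> = (\<integral>\<^sup>+u. (\<Sum>i<d. \<integral>\<^sup>+u'. ennreal (K * (x i u * y (u - u') * z i u' * kern u u')) \<partial>freq) \<partial>freq)"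
  proof (rule nn_integral_sum[symmetric])
    fix i assume "i \<in> {..<d}"
    then have i: "i < d" by simp
    show "(\<lambda>u. \<integral>\<^sup>+u'. ennreal (K * (x i u * y (u - u') * z i u' * kern u u')) \<partial>freq) \<in> borel_measurable freq"
      using xm[OF i] zm[OF i] km by (intro freq.borel_measurable_nn_integral) (simp add: case_prod_unfold)
  qed
  also have "\<dots> = (\<integral>\<^sup>+u. \<integral>\<^sup>+u'. (\<Sum>i<d. ennreal (K * (x i u * y (u - u') * z i u' * kern u u'))) \<partial>freq \<partial>freq)"
  proof (intro nn_integral_cong nn_integral_sum[symmetric])
    fix u i assume "i \<in> {..<d}"
    then have i: "i < d" by simp
    have "(\<lambda>u'. kern u u') \<in> borel_measurable freq" unfolding kern_def by measurable
    then show "(\<lambda>u'. ennreal (K * (x i u * y (u - u') * z i u' * kern u u'))) \<in> borel_measurable freq"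
      using zm[OF i] by measurable
  qed
  also have "\<dots> \<le> (\<integral>\<^sup>+u. \<integral>\<^sup>+u'. ennreal (K * (PX u * PY (u - u') * PZ u' * kern u u')) \<partial>freq \<partial>freq)"
  proof (intro nn_integral_mono)
    fix u u' :: "int \<times> real"
    have "(\<Sum>i<d. ennreal (K * (x i u * y (u - u') * z i u' * kern u u'))) = ennreal (\<Sum>i<d. K * (x i u * y (u - u') * z i u' * kern u u'))"
      using K0 x0 y0 z0 kern0 by (intro sum_ennreal) (auto intro!: mult_nonneg_nonneg)
    also have "(\<Sum>i<d. K * (x i u * y (u - u') * z i u' * kern u u')) = K * y (u - u') * kern u u' * (\<Sum>i<d. \<bar>x i u\<bar> * \<bar>z i u'\<bar>)"
      using x0 z0 by (simp add: sum_distrib_left mult_ac)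
    also have "ennreal \<dots> \<le> ennreal (K * y (u - u') * kern u u' * (PX u * PZ u'))"
      unfolding PX PZ using K0 y0 kern0 by (intro ennreal_leI mult_left_mono L2_set_mult_ineq) (auto intro!: mult_nonneg_nonneg)
    finally show "(\<Sum>i<d. ennreal (K * (x i u * y (u - u') * z i u' * kern u u'))) \<le> ennreal (K * (PX u * PY (u - u') * PZ u' * kern u u'))"
      by (simp add: PY mult_ac)
  qed
  also have "\<dots> = (\<integral>\<^sup>+u. \<integral>\<^sup>+u'. ennreal (K * (Lf \<mu> * \<mu> powr (- 1/3))) *
       (ennreal h * (X u * Y (u - u') * Z u' * (v (u - u') + v u')) + wX u * Y (u - u') * wZ u' * (v (u - u') + v u')
        + wX u * wY (u - u') * Z u' * (v (u - u') + v u') + X u * wY (u - u') * wZ u' * (v (u - u') + v u')) \<partial>freq \<partial>freq)"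
  proof (intro nn_integral_cong)
    fix u u' :: "int \<times> real"
    have P0: "0 \<le> PX u" "0 \<le> PY (u - u')" "0 \<le> PZ u'" by (simp_all add: PX PZ PY y0 L2_set_nonneg)
    define a1 where "a1 = PX u" define a2 where "a2 = PY (u - u')" define a3 where "a3 = PZ u'"
    define w1 where "w1 = W u" define w2 where "w2 = W (u - u')" define w3 where "w3 = W u'"
    define v1 where "v1 = vw (u - u') + vw u'"
    define KK where "KK = K * (Lf \<mu> * \<mu> powr (- 1/3))"
    have nn: "0 \<le> a1" "0 \<le> a2" "0 \<le> a3" "0 \<le> w1" "0 \<le> w2" "0 \<le> w3" "0 \<le> v1" "0 \<le> KK"
      using P0 W0 K0 by (simp_all add: a1_def a2_def a3_def w1_def w2_def w3_def v1_def KK_def)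
    have vv: "v (u - u') + v u' = ennreal v1" by (simp add: v_def v1_def)
    have e: "X u = ennreal a1" "Y (u - u') = ennreal a2" "Z u' = ennreal a3"
      "wX u = ennreal (w1 * a1)" "wY (u - u') = ennreal (w2 * a2)" "wZ u' = ennreal (w3 * a3)"
      by (simp_all add: X_def Y_def Z_def wX_def wY_def wZ_def a1_def a2_def a3_def w1_def w2_def w3_def W_def PX_def PY_def PZ_def)
    have "K * (PX u * PY (u - u') * PZ u' * kern u u') = KK * (h * (a1 * a2 * a3 * v1) + (w1 * a1) * a2 * (w3 * a3) * v1 + (w1 * a1) * (w2 * a2) * a3 * v1 + a1 * (w2 * a2) * (w3 * a3) * v1)"
      unfolding kern_def a1_def[symmetric] a2_def[symmetric] a3_def[symmetric] w1_def[symmetric] w2_def[symmetric] w3_def[symmetric] v1_def[symmetric] KK_def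
      by (simp add: algebra_simps)
    then show "ennreal (K * (PX u * PY (u - u') * PZ u' * kern u u')) = ennreal (K * (Lf \<mu> * \<mu> powr (- 1/3))) *
       (ennreal h * (X u * Y (u - u') * Z u' * (v (u - u') + v u')) + wX u * Y (u - u') * wZ u' * (v (u - u') + v u')
        + wX u * wY (u - u') * Z u' * (v (u - u') + v u') + X u * wY (u - u') * wZ u' * (v (u - u') + v u'))"
      unfolding vv e KK_def[symmetric] using nn h
      by (simp add: ennreal_mult[symmetric] ennreal_plus[symmetric] del: ennreal_plus)
  qed
  also have "\<dots> = ennreal (K * (Lf \<mu> * \<mu> powr (- 1/3))) * (ennreal h * Tri v X Y Z + Tri v wX Y wZ + Tri v wX wY Z + Tri v X wY wZ)"
  proof -
    have [measurable]: "X \<in> borel_measurable freq" "Y \<in> borel_measurable freq" "Z \<in> borel_measurable freq" "v \<in> borel_measurable freq"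
      "wX \<in> borel_measurable freq" "wY \<in> borel_measurable freq" "wZ \<in> borel_measurable freq"
      unfolding X_def Y_def Z_def v_def wX_def wY_def wZ_def PX_def[symmetric] PY_def[symmetric] PZ_def[symmetric] W_def[symmetric]
      using PXm PYm PZm Wm unfolding W_def by measurable
    show ?thesis unfolding Tri_def by (simp add: nn_integral_add nn_integral_cmult)
  qed
  finally show ?thesis .
qed

text \<open>
  Each of the four trilinear forms has two factors that are square integrable in time, or the
  integrable factor \<open>h\<close>.  The two constants \<open>\<epsilon>\<^sub>f\<close>, \<open>\<epsilon>\<^sub>q\<close> enter with the right homogeneity if the means are
  weighted by \<open>\<theta> = \<epsilon>\<^sub>q / \<epsilon>\<^sub>f\<close>.
\<close>

lemma time_integrated_bound:
  assumes N: "12 \<le> N" and p: "0 \<le> p" "p \<le> \<gamma>" and c1: "0 < c1" and C: "0 < C" and CL: "0 < CL"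
  shows "\<exists>K>0. \<forall>\<mu> M t d f1 f2 q \<epsilon>f \<epsilon>q.
    0 < \<mu> \<longrightarrow> \<mu> \<le> 1/2 \<longrightarrow> admissible c r \<gamma> N \<mu> CL n M \<longrightarrow> 1 < t \<longrightarrow> 0 < \<epsilon>f \<longrightarrow> 0 < \<epsilon>q \<longrightarrow>
    (\<forall>i<d. L2_function t (\<lambda>\<tau> z. f1 \<tau> z i)) \<longrightarrow> (\<forall>i<d. L2_function t (\<lambda>\<tau> z. f2 \<tau> z i)) \<longrightarrow> L2_function t q \<longrightarrow>
    energy_bound c1 C \<mu> (m_total c r \<gamma> \<mu> M) (A_weight c r \<gamma> N \<mu> M) t d f1 \<epsilon>f \<longrightarrow>
    energy_bound c1 C \<mu> (m_total c r \<gamma> \<mu> M) (A_weight c r \<gamma> N \<mu> M) t d f2 \<epsilon>f \<longrightarrow>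
    energy_bound c1 C \<mu> (m_total c r \<gamma> \<mu> M) (A_weight c r \<gamma> N \<mu> M) t 1 (\<lambda>\<tau> z i. q \<tau> z) \<epsilon>q \<longrightarrow>
    (\<integral>\<^sup>+\<tau>\<in>{1..t}. ennreal (NL \<gamma> p (A_weight c r \<gamma> N \<mu> M) d f1 f2 q \<tau>) \<partial>lborel)
      \<le> ennreal (K * Lf \<mu> * \<mu> powr (- 1/3) * \<epsilon>f\<^sup>2 * \<epsilon>q)"
proof -
  obtain Ks where Ks: "Ks > 0" and SB: "\<And>\<mu> M h t k l \<eta> \<xi>. 0 < \<mu> \<Longrightarrow> \<mu> \<le> 1/2 \<Longrightarrow> 1 \<le> t \<Longrightarrow> 0 \<le> h t \<Longrightarrow> t * \<mu> powr (1/3) \<noteq> 1 \<Longrightarrow>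
     (\<forall>k \<eta>. inverse CL \<le> M t k \<eta> \<and> M t k \<eta> \<le> CL) \<Longrightarrow>
     (\<forall>k l \<eta> \<xi>. abs2 l \<xi> \<ge> 8 * abs2 (k - l) (\<eta> - \<xi>) \<longrightarrow>
        abs2 l \<xi> / t powr (1 + \<gamma>) * \<bar>M t k \<eta> - M t l \<xi>\<bar> \<le> R_adm c r \<gamma> N \<mu> CL n h t k l \<eta> \<xi> * Lf \<mu>) \<Longrightarrow>
     (\<forall>k \<eta> \<xi>. k \<noteq> 0 \<and> abs2 k \<xi> \<ge> 8 * \<bar>\<eta> - \<xi>\<bar> \<longrightarrow>
        \<bar>M t k \<eta> - M t k \<xi>\<bar> \<le> CL * (1 / \<bar>real_of_int k\<bar>) * \<bar>\<eta> - \<xi>\<bar> * jap (\<eta> - \<xi>) powr (N - 5)) \<Longrightarrow>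
     V t k l \<eta> \<xi> * \<bar>A_weight c r \<gamma> N \<mu> M t k \<eta> * Lam t k \<eta> powr p - A_weight c r \<gamma> N \<mu> M t l \<xi> * Lam t l \<xi> powr p\<bar> * Lam t l \<xi> powr (- p)
       \<le> Ks * (A_weight c r \<gamma> N \<mu> M t (k - l) (\<eta> - \<xi>) * A_weight c r \<gamma> N \<mu> M t l \<xi>
             * (inverse (jap2 (k - l) (\<eta> - \<xi>) ^ 2) + inverse (jap2 l \<xi> ^ 2)) * Br \<mu> (h t) t k l \<eta> \<xi>)"
    using symbol_bound[OF N p CL, of n] by (elim exE conjE) (rule that, assumption, blast)
  define nu where "nu = enn2real (sqn (\<lambda>p. ennreal (vw p)))"
  have nu: "sqn (\<lambda>p. ennreal (vw p)) = ennreal nu" "0 \<le> nu"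
    unfolding nu_def using vw_square_integrable by auto
  define s0 where "s0 = 2 * sqrt nu * (C * sqrt C)"
  define s where "s = 2 * sqrt nu * sqrt C"
  define K2 where "K2 = (6 * c + 6) / c1 * C"
  have nn: "0 \<le> s0" "0 \<le> s" "0 < K2" unfolding s0_def s_def K2_def using nu C c1 c_pos by simp_all
  define Kt where "Kt = CL * s0 + 6 * s * K2 + 1"
  have Kt: "0 < Kt" "CL * s0 + 6 * s * K2 \<le> Kt" unfolding Kt_def using nn CL by (simp_all add: add_nonneg_pos)
  have "(\<integral>\<^sup>+\<tau>\<in>{1..t}. ennreal (NL \<gamma> p (A_weight c r \<gamma> N \<mu> M) d f1 f2 q \<tau>) \<partial>lborel)
      \<le> ennreal ((Ks * Kt) * Lf \<mu> * \<mu> powr (- 1/3) * \<epsilon>f\<^sup>2 * \<epsilon>q)"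
    if mu: "0 < \<mu>" "\<mu> \<le> 1/2" and ad: "admissible c r \<gamma> N \<mu> CL n M" and t: "1 < t" and ef: "0 < \<epsilon>f" and eq: "0 < \<epsilon>q"
      and f1: "\<forall>i<d. L2_function t (\<lambda>\<tau> z. f1 \<tau> z i)" and f2: "\<forall>i<d. L2_function t (\<lambda>\<tau> z. f2 \<tau> z i)" and q: "L2_function t q"
      and e1: "energy_bound c1 C \<mu> (m_total c r \<gamma> \<mu> M) (A_weight c r \<gamma> N \<mu> M) t d f1 \<epsilon>f"
      and e2: "energy_bound c1 C \<mu> (m_total c r \<gamma> \<mu> M) (A_weight c r \<gamma> N \<mu> M) t d f2 \<epsilon>f"
      and e3: "energy_bound c1 C \<mu> (m_total c r \<gamma> \<mu> M) (A_weight c r \<gamma> N \<mu> M) t 1 (\<lambda>\<tau> z i. q \<tau> z) \<epsilon>q"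
    for \<mu> M t d f1 f2 q \<epsilon>f \<epsilon>q
  proof -
    have Mm: "\<forall>k. (\<lambda>p. M (fst p) k (snd p)) \<in> borel_measurable borel" using ad by (simp add: admissible_def)
    have Md: "\<forall>k. AE p in lborel. 0 < fst p \<longrightarrow> (\<lambda>s. M s k (snd p)) differentiable (at (fst p)) \<and> 0 \<le> deriv (\<lambda>s. M s k (snd p)) (fst p)"
      using ad unfolding admissible_def by (elim conjE)
    have M2: "\<forall>t>0. \<forall>k \<eta>. inverse CL \<le> M t k \<eta> \<and> M t k \<eta> \<le> CL" using ad unfolding admissible_def by (elim conjE)
    have Mp: "\<forall>t>0. \<forall>k \<eta>. 0 < M t k \<eta>"
      by (intro allI impI) (rule less_le_trans[OF positive_imp_inverse_positive[OF CL]], use M2 in simp)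
    have Lf_eq: "(if \<gamma> > 0 then 1 else \<bar>ln \<mu>\<bar> powr (1 + r)) = Lf \<mu>"
      using gam_nonneg by (auto simp: Lf_def)
    obtain h where h: "h \<in> borel_measurable borel" "\<forall>t. 0 \<le> h t" "(\<integral>\<^sup>+t. ennreal (h t) \<partial>lborel) \<le> ennreal CL"
      and M3: "\<forall>t\<ge>1. t * \<mu> powr (1/3) \<noteq> 1 \<longrightarrow>
          (\<forall>k l \<eta> \<xi>. abs2 l \<xi> \<ge> 8 * abs2 (k - l) (\<eta> - \<xi>) \<longrightarrow>
            abs2 l \<xi> / t powr (1 + \<gamma>) * \<bar>M t k \<eta> - M t l \<xi>\<bar> \<le> R_adm c r \<gamma> N \<mu> CL n h t k l \<eta> \<xi> * Lf \<mu>)"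
      using ad unfolding admissible_def Lf_eq by (elim conjE exE) (rule that)
    have M4: "\<forall>t\<ge>1. \<forall>k \<eta> \<xi>. k \<noteq> 0 \<and> abs2 k \<xi> \<ge> 8 * \<bar>\<eta> - \<xi>\<bar> \<longrightarrow>
        \<bar>M t k \<eta> - M t k \<xi>\<bar> \<le> CL * (1 / \<bar>real_of_int k\<bar>) * \<bar>\<eta> - \<xi>\<bar> * jap (\<eta> - \<xi>) powr (N - 5)"
      using ad unfolding admissible_def by (elim conjE)
    have q1: "\<forall>i<1. L2_function t (\<lambda>\<tau> z. q \<tau> z)" using q by simp
    define X where "X = Anorm N \<mu> M d f1"
    define Y where "Y = Anorm N \<mu> M 1 (\<lambda>\<tau> z i. q \<tau> z)"
    define Z where "Z = Anorm N \<mu> M d f2"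
    define W where "W = (\<lambda>P :: real \<Rightarrow> int \<times> real \<Rightarrow> real. \<lambda>\<tau> p. w \<mu> \<tau> (fst p) (snd p) * P \<tau> p)"
    define D where "D = (\<lambda>P :: real \<Rightarrow> int \<times> real \<Rightarrow> real. \<lambda>\<tau>. \<integral>\<^sup>+p. ennreal ((W P \<tau> p)\<^sup>2) \<partial>freq)"
    have Dm: "D X \<in> borel_measurable lborel" "D Y \<in> borel_measurable lborel" "D Z \<in> borel_measurable lborel"
      unfolding D_def W_def X_def Y_def Z_def by (rule W_measurable[OF Mm f1] W_measurable[OF Mm q1] W_measurable[OF Mm f2])+
    have DI: "(\<integral>\<^sup>+\<tau>\<in>{1..t}. D X \<tau> \<partial>lborel) \<le> ennreal (K2 * \<epsilon>f\<^sup>2)" "(\<integral>\<^sup>+\<tau>\<in>{1..t}. D Y \<tau> \<partial>lborel) \<le> ennreal (K2 * \<epsilon>q\<^sup>2)"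
      "(\<integral>\<^sup>+\<tau>\<in>{1..t}. D Z \<tau> \<partial>lborel) \<le> ennreal (K2 * \<epsilon>f\<^sup>2)"
      unfolding D_def W_def X_def Y_def Z_def K2_def using C
      by (intro energy_diss[OF e1 c1 mu(1) Mm f1 Md Mp] energy_diss[OF e2 c1 mu(1) Mm f2 Md Mp] energy_diss[OF e3 c1 mu(1) Mm q1 Md Mp]; simp)+
    (* Balances the energies \<epsilon>f^2 and \<epsilon>q^2 in the inequality of the means. *)
    define \<theta> where "\<theta> = \<epsilon>q / \<epsilon>f"
    have \<theta>: "0 < \<theta>" using ef eq by (simp add: \<theta>_def)
    define Bd where "Bd = (\<lambda>\<tau>. ennreal (s0 * \<epsilon>f\<^sup>2 * \<epsilon>q) * ennreal (h \<tau>)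
        + ennreal (s * \<epsilon>q) * (D X \<tau> + D Z \<tau>)
        + ennreal (s * \<epsilon>f) * (ennreal \<theta> * D X \<tau> + ennreal (1 / \<theta>) * D Y \<tau>)
        + ennreal (s * \<epsilon>f) * (ennreal \<theta> * D Z \<tau> + ennreal (1 / \<theta>) * D Y \<tau>))"
    define KL where "KL = Ks * (Lf \<mu> * \<mu> powr (- 1/3))"
    have KL: "0 \<le> KL" unfolding KL_def using Ks by simp
    have pointwise: "ennreal (NL \<gamma> p (A_weight c r \<gamma> N \<mu> M) d f1 f2 q \<tau>) \<le> ennreal KL * Bd \<tau>"
      if \<tau>: "\<tau> \<in> {1..t}" and ne: "\<tau> * \<mu> powr (1/3) \<noteq> 1" for \<tau>
    proof -
      have \<tau>0: "1 \<le> \<tau>" "0 \<le> \<tau>" "0 < \<tau>" using \<tau> by auto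
      have A0: "0 \<le> A_weight c r \<gamma> N \<mu> M \<tau> k \<eta>" for k \<eta>
        unfolding A_weight_eq M_diss_eq using less_imp_le[OF m_res_pos] less_imp_le[OF Mp[rule_format, OF \<tau>0(3)]]
        by (intro mult_nonneg_nonneg) auto
      have P0: "0 \<le> X \<tau> u" "0 \<le> Y \<tau> u" "0 \<le> Z \<tau> u" for u
        unfolding X_def Y_def Z_def Anorm_def using A0 by simp_all
      have W0: "0 \<le> W X \<tau> u" "0 \<le> W Y \<tau> u" "0 \<le> W Z \<tau> u" for u
        unfolding W_def using P0 w_nonneg[OF \<tau>0(2)] by simp_all
      have [measurable]: "X \<tau> \<in> borel_measurable freq" "Y \<tau> \<in> borel_measurable freq" "Z \<tau> \<in> borel_measurable freq"
        unfolding X_def Y_def Z_def by (rule time_slice[OF Anorm_time_freq[OF Mm f1]] time_slice[OF Anorm_time_freq[OF Mm q1]] time_slice[OF Anorm_time_freq[OF Mm f2]])+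
      have [measurable]: "(\<lambda>p. w \<mu> \<tau> (fst p) (snd p)) \<in> borel_measurable freq" by (rule time_slice[OF w_time_freq])
      have Wm[measurable]: "W X \<tau> \<in> borel_measurable freq" "W Y \<tau> \<in> borel_measurable freq" "W Z \<tau> \<in> borel_measurable freq"
        unfolding W_def by measurable
      have sX: "sqn (\<lambda>u. ennreal (X \<tau> u)) \<le> ennreal (C * \<epsilon>f\<^sup>2)" and sY: "sqn (\<lambda>u. ennreal (Y \<tau> u)) \<le> ennreal (C * \<epsilon>q\<^sup>2)"
        and sZ: "sqn (\<lambda>u. ennreal (Z \<tau> u)) \<le> ennreal (C * \<epsilon>f\<^sup>2)"
        using energy_sup[OF e1 \<tau> Mm f1] energy_sup[OF e3 \<tau> Mm q1] energy_sup[OF e2 \<tau> Mm f2] P0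
        by (simp_all add: X_def Y_def Z_def ennreal_power)
      have sW: "sqn (\<lambda>u. ennreal (W X \<tau> u)) = D X \<tau>" "sqn (\<lambda>u. ennreal (W Y \<tau> u)) = D Y \<tau>" "sqn (\<lambda>u. ennreal (W Z \<tau> u)) = D Z \<tau>"
        unfolding D_def using W0 by (simp_all add: ennreal_power)
      let ?v = "\<lambda>u. ennreal (vw u)"
      have T0: "Tri ?v (\<lambda>u. ennreal (X \<tau> u)) (\<lambda>u. ennreal (Y \<tau> u)) (\<lambda>u. ennreal (Z \<tau> u)) \<le> ennreal (s0 * \<epsilon>f\<^sup>2 * \<epsilon>q)" (is "?T \<le> _")
      proof (rule ennreal_power2_le_imp_le)
        have "?T\<^sup>2 \<le> 4 * ennreal nu * (sqn (\<lambda>u. ennreal (X \<tau> u)) * sqn (\<lambda>u. ennreal (Y \<tau> u)) * sqn (\<lambda>u. ennreal (Z \<tau> u)))"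
          unfolding nu(1)[symmetric] by (rule Tri_bound) measurable
        also have "\<dots> \<le> 4 * ennreal nu * (ennreal (C * \<epsilon>f\<^sup>2) * ennreal (C * \<epsilon>q\<^sup>2) * ennreal (C * \<epsilon>f\<^sup>2))"
          by (intro mult_left_mono mult_mono sX sY sZ) auto
        also have "\<dots> = ennreal (4 * nu * (C * \<epsilon>f\<^sup>2 * (C * \<epsilon>q\<^sup>2) * (C * \<epsilon>f\<^sup>2)))"
          using nu(2) C by (simp add: ennreal_mult)
        also have "4 * nu * (C * \<epsilon>f\<^sup>2 * (C * \<epsilon>q\<^sup>2) * (C * \<epsilon>f\<^sup>2)) = (s0 * \<epsilon>f\<^sup>2 * \<epsilon>q)\<^sup>2"
        proof -
          have "s0\<^sup>2 = 4 * nu * (C\<^sup>2 * C)" unfolding s0_def power_mult_distrib using nu(2) C by simp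
          then show ?thesis unfolding power_mult_distrib by (simp add: power2_eq_square)
        qed
        finally show "?T\<^sup>2 \<le> (ennreal (s0 * \<epsilon>f\<^sup>2 * \<epsilon>q))\<^sup>2"
          using nn ef eq by (simp add: ennreal_power)
      qed
      have sq: "4 * ennreal nu * ennreal (C * e\<^sup>2) = ennreal ((s * e)\<^sup>2)" if "0 < e" for e
      proof -
        have "4 * ennreal nu * ennreal (C * e\<^sup>2) = ennreal (4 * nu * (C * e\<^sup>2))" using nu(2) C by (simp add: ennreal_mult)
        also have "4 * nu * (C * e\<^sup>2) = (s * e)\<^sup>2" unfolding s_def power_mult_distrib using nu(2) C by simp
        finally show ?thesis .
      qed
      have T1: "Tri ?v (\<lambda>u. ennreal (W X \<tau> u)) (\<lambda>u. ennreal (Y \<tau> u)) (\<lambda>u. ennreal (W Z \<tau> u)) \<le> ennreal (s * \<epsilon>q) * (ennreal 1 * D X \<tau> + ennreal (1 / 1) * D Z \<tau>)" (is "?T \<le> _")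
      proof (rule ennreal_amgm)
        have "?T\<^sup>2 \<le> 4 * ennreal nu * (D X \<tau> * sqn (\<lambda>u. ennreal (Y \<tau> u)) * D Z \<tau>)"
          unfolding nu(1)[symmetric] sW[symmetric] by (rule Tri_bound) measurable
        also have "\<dots> \<le> 4 * ennreal nu * (D X \<tau> * ennreal (C * \<epsilon>q\<^sup>2) * D Z \<tau>)"
          by (intro mult_left_mono mult_mono sY) auto
        also have "\<dots> = 4 * ennreal nu * ennreal (C * \<epsilon>q\<^sup>2) * (D X \<tau> * D Z \<tau>)" by (simp only: mult_ac)
        finally show "?T\<^sup>2 \<le> ennreal ((s * \<epsilon>q)\<^sup>2) * (D X \<tau> * D Z \<tau>)" unfolding sq[OF eq] .
      qed (use nn eq in auto)
      have T2: "Tri ?v (\<lambda>u. ennreal (W X \<tau> u)) (\<lambda>u. ennreal (W Y \<tau> u)) (\<lambda>u. ennreal (Z \<tau> u)) \<le> ennreal (s * \<epsilon>f) * (ennreal \<theta> * D X \<tau> + ennreal (1 / \<theta>) * D Y \<tau>)" (is "?T \<le> _")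
      proof (rule ennreal_amgm)
        have "?T\<^sup>2 \<le> 4 * ennreal nu * (D X \<tau> * D Y \<tau> * sqn (\<lambda>u. ennreal (Z \<tau> u)))"
          unfolding nu(1)[symmetric] sW[symmetric] by (rule Tri_bound) measurable
        also have "\<dots> \<le> 4 * ennreal nu * (D X \<tau> * D Y \<tau> * ennreal (C * \<epsilon>f\<^sup>2))"
          by (intro mult_left_mono sZ) auto
        also have "\<dots> = 4 * ennreal nu * ennreal (C * \<epsilon>f\<^sup>2) * (D X \<tau> * D Y \<tau>)" by (simp only: mult_ac)
        finally show "?T\<^sup>2 \<le> ennreal ((s * \<epsilon>f)\<^sup>2) * (D X \<tau> * D Y \<tau>)" unfolding sq[OF ef] .
      qed (use nn ef \<theta> in auto)
      have T3: "Tri ?v (\<lambda>u. ennreal (X \<tau> u)) (\<lambda>u. ennreal (W Y \<tau> u)) (\<lambda>u. ennreal (W Z \<tau> u)) \<le> ennreal (s * \<epsilon>f) * (ennreal \<theta> * D Z \<tau> + ennreal (1 / \<theta>) * D Y \<tau>)" (is "?T \<le> _")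
      proof (rule ennreal_amgm)
        have "?T\<^sup>2 \<le> 4 * ennreal nu * (sqn (\<lambda>u. ennreal (X \<tau> u)) * D Y \<tau> * D Z \<tau>)"
          unfolding nu(1)[symmetric] sW[symmetric] by (rule Tri_bound) measurable
        also have "\<dots> \<le> 4 * ennreal nu * (ennreal (C * \<epsilon>f\<^sup>2) * D Y \<tau> * D Z \<tau>)"
          by (intro mult_left_mono mult_right_mono sX) auto
        also have "\<dots> = 4 * ennreal nu * ennreal (C * \<epsilon>f\<^sup>2) * (D Z \<tau> * D Y \<tau>)" by (simp only: mult_ac)
        finally show "?T\<^sup>2 \<le> ennreal ((s * \<epsilon>f)\<^sup>2) * (D Z \<tau> * D Y \<tau>)" unfolding sq[OF ef] .
      qed (use nn ef \<theta> in auto)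
      have "ennreal (NL \<gamma> p (A_weight c r \<gamma> N \<mu> M) d f1 f2 q \<tau>)
        \<le> ennreal (Ks * (Lf \<mu> * \<mu> powr (- 1/3))) * (ennreal (h \<tau>) * Tri ?v (\<lambda>u. ennreal (X \<tau> u)) (\<lambda>u. ennreal (Y \<tau> u)) (\<lambda>u. ennreal (Z \<tau> u))
           + Tri ?v (\<lambda>u. ennreal (W X \<tau> u)) (\<lambda>u. ennreal (Y \<tau> u)) (\<lambda>u. ennreal (W Z \<tau> u))
           + Tri ?v (\<lambda>u. ennreal (W X \<tau> u)) (\<lambda>u. ennreal (W Y \<tau> u)) (\<lambda>u. ennreal (Z \<tau> u))
           + Tri ?v (\<lambda>u. ennreal (X \<tau> u)) (\<lambda>u. ennreal (W Y \<tau> u)) (\<lambda>u. ennreal (W Z \<tau> u)))"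
        unfolding X_def Y_def Z_def W_def
      proof (rule NL_le[OF Mm f1 f2 q less_imp_le[OF Ks] \<tau>0(2) h(2)[rule_format] A0])
        show "V \<tau> k l \<eta> \<xi> * \<bar>A_weight c r \<gamma> N \<mu> M \<tau> k \<eta> * Lam \<tau> k \<eta> powr p - A_weight c r \<gamma> N \<mu> M \<tau> l \<xi> * Lam \<tau> l \<xi> powr p\<bar> * Lam \<tau> l \<xi> powr (- p)
          \<le> Ks * (A_weight c r \<gamma> N \<mu> M \<tau> (k - l) (\<eta> - \<xi>) * A_weight c r \<gamma> N \<mu> M \<tau> l \<xi>
             * (inverse (jap2 (k - l) (\<eta> - \<xi>) ^ 2) + inverse (jap2 l \<xi> ^ 2)) * Br \<mu> (h \<tau>) \<tau> k l \<eta> \<xi>)" for k l \<eta> \<xi>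
        proof (rule SB[OF mu \<tau>0(1) h(2)[rule_format] ne])
          show "\<forall>k \<eta>. inverse CL \<le> M \<tau> k \<eta> \<and> M \<tau> k \<eta> \<le> CL" using M2 \<tau>0(3) by simp
        qed (use M3 M4 \<tau>0(1) ne in simp_all)
      qed
      also have "\<dots> \<le> ennreal KL * (ennreal (h \<tau>) * ennreal (s0 * \<epsilon>f\<^sup>2 * \<epsilon>q)
           + ennreal (s * \<epsilon>q) * (ennreal 1 * D X \<tau> + ennreal (1 / 1) * D Z \<tau>)
           + ennreal (s * \<epsilon>f) * (ennreal \<theta> * D X \<tau> + ennreal (1 / \<theta>) * D Y \<tau>)
           + ennreal (s * \<epsilon>f) * (ennreal \<theta> * D Z \<tau> + ennreal (1 / \<theta>) * D Y \<tau>))"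
        unfolding KL_def by (intro mult_left_mono add_mono T0 T1 T2 T3) auto
      also have "\<dots> = ennreal KL * Bd \<tau>" unfolding Bd_def by (simp add: mult.commute)
      finally show ?thesis .
    qed
    have Bdm: "Bd \<in> borel_measurable lborel" unfolding Bd_def using Dm h(1) by measurable
    have "AE \<tau> in lborel. \<tau> \<noteq> 1 / \<mu> powr (1/3)" by (rule AE_lborel_singleton)
    then have "(\<integral>\<^sup>+\<tau>\<in>{1..t}. ennreal (NL \<gamma> p (A_weight c r \<gamma> N \<mu> M) d f1 f2 q \<tau>) \<partial>lborel) \<le> (\<integral>\<^sup>+\<tau>. ennreal KL * (Bd \<tau> * indicator {1..t} \<tau>) \<partial>lborel)"
    proof (intro nn_integral_mono_AE, elim eventually_mono)
      fix \<tau> :: real assume "\<tau> \<noteq> 1 / \<mu> powr (1/3)"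
      then have "\<tau> * \<mu> powr (1/3) \<noteq> 1" using mu by (simp add: field_simps)
      then show "ennreal (NL \<gamma> p (A_weight c r \<gamma> N \<mu> M) d f1 f2 q \<tau>) * indicator {1..t} \<tau> \<le> ennreal KL * (Bd \<tau> * indicator {1..t} \<tau>)"
        using pointwise[of \<tau>] by (cases "\<tau> \<in> {1..t}") auto
    qed
    also have "\<dots> = ennreal KL * (\<integral>\<^sup>+\<tau>\<in>{1..t}. Bd \<tau> \<partial>lborel)"
      using Bdm by (intro nn_integral_cmult) auto
    also have "(\<integral>\<^sup>+\<tau>\<in>{1..t}. Bd \<tau> \<partial>lborel) = (\<integral>\<^sup>+\<tau>. ennreal (s0 * \<epsilon>f\<^sup>2 * \<epsilon>q) * (ennreal (h \<tau>) * indicator {1..t} \<tau>)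
        + ennreal (s * \<epsilon>q) * (D X \<tau> * indicator {1..t} \<tau> + D Z \<tau> * indicator {1..t} \<tau>)
        + ennreal (s * \<epsilon>f) * (ennreal \<theta> * (D X \<tau> * indicator {1..t} \<tau>) + ennreal (1 / \<theta>) * (D Y \<tau> * indicator {1..t} \<tau>))
        + ennreal (s * \<epsilon>f) * (ennreal \<theta> * (D Z \<tau> * indicator {1..t} \<tau>) + ennreal (1 / \<theta>) * (D Y \<tau> * indicator {1..t} \<tau>)) \<partial>lborel)"
      unfolding Bd_def by (intro nn_integral_cong) (auto simp: indicator_def)
    also have "\<dots> = ennreal (s0 * \<epsilon>f\<^sup>2 * \<epsilon>q) * (\<integral>\<^sup>+\<tau>\<in>{1..t}. ennreal (h \<tau>) \<partial>lborel)
        + ennreal (s * \<epsilon>q) * ((\<integral>\<^sup>+\<tau>\<in>{1..t}. D X \<tau> \<partial>lborel) + (\<integral>\<^sup>+\<tau>\<in>{1..t}. D Z \<tau> \<partial>lborel))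
        + ennreal (s * \<epsilon>f) * (ennreal \<theta> * (\<integral>\<^sup>+\<tau>\<in>{1..t}. D X \<tau> \<partial>lborel) + ennreal (1 / \<theta>) * (\<integral>\<^sup>+\<tau>\<in>{1..t}. D Y \<tau> \<partial>lborel))
        + ennreal (s * \<epsilon>f) * (ennreal \<theta> * (\<integral>\<^sup>+\<tau>\<in>{1..t}. D Z \<tau> \<partial>lborel) + ennreal (1 / \<theta>) * (\<integral>\<^sup>+\<tau>\<in>{1..t}. D Y \<tau> \<partial>lborel))"
      using Dm h(1) by (simp add: nn_integral_add nn_integral_cmult)
    also have "\<dots> \<le> ennreal (s0 * \<epsilon>f\<^sup>2 * \<epsilon>q) * ennreal CL
        + ennreal (s * \<epsilon>q) * (ennreal (K2 * \<epsilon>f\<^sup>2) + ennreal (K2 * \<epsilon>f\<^sup>2))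
        + ennreal (s * \<epsilon>f) * (ennreal \<theta> * ennreal (K2 * \<epsilon>f\<^sup>2) + ennreal (1 / \<theta>) * ennreal (K2 * \<epsilon>q\<^sup>2))
        + ennreal (s * \<epsilon>f) * (ennreal \<theta> * ennreal (K2 * \<epsilon>f\<^sup>2) + ennreal (1 / \<theta>) * ennreal (K2 * \<epsilon>q\<^sup>2))"
    proof (intro add_mono mult_left_mono DI)
      have "(\<integral>\<^sup>+\<tau>\<in>{1..t}. ennreal (h \<tau>) \<partial>lborel) \<le> (\<integral>\<^sup>+\<tau>. ennreal (h \<tau>) \<partial>lborel)"
        by (intro nn_integral_mono) (auto simp: indicator_def)
      then show "(\<integral>\<^sup>+\<tau>\<in>{1..t}. ennreal (h \<tau>) \<partial>lborel) \<le> ennreal CL" using h(3) by (rule order_trans)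
    qed auto
    also have "\<dots> = ennreal (s0 * \<epsilon>f\<^sup>2 * \<epsilon>q * CL + s * \<epsilon>q * (K2 * \<epsilon>f\<^sup>2 + K2 * \<epsilon>f\<^sup>2)
        + s * \<epsilon>f * (\<theta> * (K2 * \<epsilon>f\<^sup>2) + 1 / \<theta> * (K2 * \<epsilon>q\<^sup>2)) + s * \<epsilon>f * (\<theta> * (K2 * \<epsilon>f\<^sup>2) + 1 / \<theta> * (K2 * \<epsilon>q\<^sup>2)))"
      using nn \<theta> ef eq CL by (simp add: ennreal_mult[symmetric] ennreal_plus[symmetric] del: ennreal_plus)
    also have "s0 * \<epsilon>f\<^sup>2 * \<epsilon>q * CL + s * \<epsilon>q * (K2 * \<epsilon>f\<^sup>2 + K2 * \<epsilon>f\<^sup>2)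
        + s * \<epsilon>f * (\<theta> * (K2 * \<epsilon>f\<^sup>2) + 1 / \<theta> * (K2 * \<epsilon>q\<^sup>2)) + s * \<epsilon>f * (\<theta> * (K2 * \<epsilon>f\<^sup>2) + 1 / \<theta> * (K2 * \<epsilon>q\<^sup>2))
        = (CL * s0 + 6 * s * K2) * (\<epsilon>f\<^sup>2 * \<epsilon>q)"
      using ef eq by (simp add: \<theta>_def power2_eq_square field_simps)
    also have "ennreal KL * ennreal ((CL * s0 + 6 * s * K2) * (\<epsilon>f\<^sup>2 * \<epsilon>q)) \<le> ennreal KL * ennreal (Kt * (\<epsilon>f\<^sup>2 * \<epsilon>q))"
      using Kt(2) eq by (intro mult_left_mono ennreal_leI mult_right_mono) auto
    also have "\<dots> = ennreal ((Ks * Kt) * Lf \<mu> * \<mu> powr (- 1/3) * \<epsilon>f\<^sup>2 * \<epsilon>q)"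
      using KL Kt(1) eq by (subst ennreal_mult[symmetric]) (auto simp: KL_def mult_ac)
    finally show ?thesis by (simp add: mult_left_mono)
  qed
  then show ?thesis using Ks Kt(1) by (intro exI[of _ "Ks * Kt"]) auto
qed

end

theorem theorem2:
  fixes \<gamma> \<gamma>' r N c c1 C CL :: real and n :: nat
  assumes "N \<ge> 12" "0 \<le> \<gamma>'" "\<gamma>' \<le> \<gamma>" "\<gamma> \<le> 1" "r > 0"
    and "c > 0" "c1 > 0" "C > 0" "CL > 0"
  shows "\<exists>K>0. \<forall>(\<mu>::real) (M :: real \<Rightarrow> int \<Rightarrow> real \<Rightarrow> real) (t::real) (d::nat)
      (f1 :: real \<Rightarrow> real \<times> real \<Rightarrow> nat \<Rightarrow> real) (f2 :: real \<Rightarrow> real \<times> real \<Rightarrow> nat \<Rightarrow> real)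
      (q :: real \<Rightarrow> real \<times> real \<Rightarrow> real) (\<epsilon>f::real) (\<epsilon>q::real).
    let m = m_total c r \<gamma> \<mu> M; A = A_weight c r \<gamma> N \<mu> M in
    0 < \<mu> \<and> \<mu> \<le> 1/2 \<and> admissible c r \<gamma> N \<mu> CL n M \<and> t > 1 \<and> \<epsilon>f > 0 \<and> \<epsilon>q > 0 \<and>
    (\<forall>i<d. L2_function t (\<lambda>\<tau> z. f1 \<tau> z i)) \<and>
    (\<forall>i<d. L2_function t (\<lambda>\<tau> z. f2 \<tau> z i)) \<and>
    L2_function t q \<and>
    energy_bound c1 C \<mu> m A t d f1 \<epsilon>f \<and>
    energy_bound c1 C \<mu> m A t d f2 \<epsilon>f \<and>
    energy_bound c1 C \<mu> m A t 1 (\<lambda>\<tau> z i. q \<tau> z) \<epsilon>q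
    \<longrightarrow>
    (\<gamma> > 0 \<longrightarrow>
       (\<integral>\<^sup>+\<tau>\<in>{1..t}. ennreal (NL \<gamma> \<gamma>' A d f1 f2 q \<tau>) \<partial>lborel)
         \<le> ennreal (K * \<mu> powr (- 1/3) * \<epsilon>f\<^sup>2 * \<epsilon>q)) \<and>
    (\<gamma> = 0 \<longrightarrow>
       (\<integral>\<^sup>+\<tau>\<in>{1..t}. ennreal (NL \<gamma> \<gamma>' A d f1 f2 q \<tau>) \<partial>lborel)
         \<le> ennreal (K * \<bar>ln \<mu>\<bar> powr (1 + r) * \<mu> powr (- 1/3) * \<epsilon>f\<^sup>2 * \<epsilon>q))"
proof -
  interpret resonance c r \<gamma>
    by unfold_locales (use assms in auto)
  obtain K where "K > 0" and K: "\<And>\<mu> M t d f1 f2 q \<epsilon>f \<epsilon>q.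
    0 < \<mu> \<Longrightarrow> \<mu> \<le> 1/2 \<Longrightarrow> admissible c r \<gamma> N \<mu> CL n M \<Longrightarrow> 1 < t \<Longrightarrow> 0 < \<epsilon>f \<Longrightarrow> 0 < \<epsilon>q \<Longrightarrow>
    (\<forall>i<d. L2_function t (\<lambda>\<tau> z. f1 \<tau> z i)) \<Longrightarrow> (\<forall>i<d. L2_function t (\<lambda>\<tau> z. f2 \<tau> z i)) \<Longrightarrow> L2_function t q \<Longrightarrow>
    energy_bound c1 C \<mu> (m_total c r \<gamma> \<mu> M) (A_weight c r \<gamma> N \<mu> M) t d f1 \<epsilon>f \<Longrightarrow>
    energy_bound c1 C \<mu> (m_total c r \<gamma> \<mu> M) (A_weight c r \<gamma> N \<mu> M) t d f2 \<epsilon>f \<Longrightarrow>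
    energy_bound c1 C \<mu> (m_total c r \<gamma> \<mu> M) (A_weight c r \<gamma> N \<mu> M) t 1 (\<lambda>\<tau> z i. q \<tau> z) \<epsilon>q \<Longrightarrow>
    (\<integral>\<^sup>+\<tau>\<in>{1..t}. ennreal (NL \<gamma> \<gamma>' (A_weight c r \<gamma> N \<mu> M) d f1 f2 q \<tau>) \<partial>lborel)
      \<le> ennreal (K * Lf \<mu> * \<mu> powr (- 1/3) * \<epsilon>f\<^sup>2 * \<epsilon>q)"
    using time_integrated_bound[OF assms(1-3,7-9), of n] by (elim exE conjE) (rule that, assumption, blast)
  have Lf: "0 < \<gamma> \<Longrightarrow> Lf \<mu> = 1" "\<gamma> = 0 \<Longrightarrow> Lf \<mu> = \<bar>ln \<mu>\<bar> powr (1 + r)" for \<mu>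
    unfolding Lf_def by simp_all
  show ?thesis
  proof (intro exI[of _ K] conjI allI, rule \<open>K > 0\<close>, unfold Let_def, intro impI)
    fix \<mu> :: real and M :: "real \<Rightarrow> int \<Rightarrow> real \<Rightarrow> real" and t :: real and d :: nat
      and f1 f2 :: "real \<Rightarrow> real \<times> real \<Rightarrow> nat \<Rightarrow> real" and q :: "real \<Rightarrow> real \<times> real \<Rightarrow> real" and \<epsilon>f \<epsilon>q :: real
    assume hyps: "0 < \<mu> \<and> \<mu> \<le> 1/2 \<and> admissible c r \<gamma> N \<mu> CL n M \<and> t > 1 \<and> \<epsilon>f > 0 \<and> \<epsilon>q > 0 \<and>
      (\<forall>i<d. L2_function t (\<lambda>\<tau> z. f1 \<tau> z i)) \<and> (\<forall>i<d. L2_function t (\<lambda>\<tau> z. f2 \<tau> z i)) \<and> L2_function t q \<and>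
      energy_bound c1 C \<mu> (m_total c r \<gamma> \<mu> M) (A_weight c r \<gamma> N \<mu> M) t d f1 \<epsilon>f \<and>
      energy_bound c1 C \<mu> (m_total c r \<gamma> \<mu> M) (A_weight c r \<gamma> N \<mu> M) t d f2 \<epsilon>f \<and>
      energy_bound c1 C \<mu> (m_total c r \<gamma> \<mu> M) (A_weight c r \<gamma> N \<mu> M) t 1 (\<lambda>\<tau> z i. q \<tau> z) \<epsilon>q"
    then have "(\<integral>\<^sup>+\<tau>\<in>{1..t}. ennreal (NL \<gamma> \<gamma>' (A_weight c r \<gamma> N \<mu> M) d f1 f2 q \<tau>) \<partial>lborel)
      \<le> ennreal (K * Lf \<mu> * \<mu> powr (- 1/3) * \<epsilon>f\<^sup>2 * \<epsilon>q)"
      by (elim conjE) (rule K)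
    then show "(0 < \<gamma> \<longrightarrow> (\<integral>\<^sup>+\<tau>\<in>{1..t}. ennreal (NL \<gamma> \<gamma>' (A_weight c r \<gamma> N \<mu> M) d f1 f2 q \<tau>) \<partial>lborel)
         \<le> ennreal (K * \<mu> powr (- 1/3) * \<epsilon>f\<^sup>2 * \<epsilon>q)) \<and>
      (\<gamma> = 0 \<longrightarrow> (\<integral>\<^sup>+\<tau>\<in>{1..t}. ennreal (NL \<gamma> \<gamma>' (A_weight c r \<gamma> N \<mu> M) d f1 f2 q \<tau>) \<partial>lborel)
         \<le> ennreal (K * \<bar>ln \<mu>\<bar> powr (1 + r) * \<mu> powr (- 1/3) * \<epsilon>f\<^sup>2 * \<epsilon>q))"
      using Lf[of \<mu>] by (intro conjI impI) (simp_all only: mult_1_right)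
  qed
qed

end
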